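(* Let $(\mathcal{G}_1,\mathcal{G}_2,\theta)$ be a triple in which $\mathcal{G}_1,\mathcal{G}_2$ are finite, connected, bidirected graphs without multiple edges or loops, with commuting vertex matrices on the same vertex set $V$. Let $n\ge 1$ and let $(\mathcal{G}_1^{(n)},\mathcal{G}_2^{(n)},\theta^{(n)})$ be the disjoint union of $n$ copies of the triple $(\mathcal{G}_1,\mathcal{G}_2,\theta)$. Then $${\rm Aut}^{+}(\mathcal{G}_1^{(n)},\mathcal{G}_2^{(n)},\theta^{(n)})={\rm Aut}^{+}(\mathcal{G}_1,\mathcal{G}_2,\theta)\wr_{\ast}S_n^{+},$$ where $\wr_\ast$ denotes the free wreath product and equality means isomorphism of compact quantum groups.
   Context: **Triples.** A $1$-graph is a finite directed graph $(V,E)$ with source and target maps $s,t$; its vertex matrix is its adjacency matrix. A triple $(\mathcal{G}_1,\mathcal{G}_2,\theta)$ consists of two $1$-graphs $\mathcal{G}_l=(V,E_l)$, $l=1,2$, on the same finite vertex set $V$, bidirected (every edge $v\to w$ has a reverse edge $w\to v$) and without multiple edges, loops or isolated vertices, whose vertex matrices $\varepsilon_1,\varepsilon_2$ commute, and a bijection $\theta:E_1\star E_2\to E_2\star E_1$, where $E_1\star E_2=\{(a,b)\in E_1\times E_2:s(a)=t(b)\}$ and $E_2\star E_1=\{(c,d)\in E_2\times E_1:s(c)=t(d)\}$, such that $\theta(a,b)=(c,d)$ implies $t(a)=t(c)$, $s(b)=s(d)$. **$n$ copies.** $\mathcal{G}_l^{(n)}$ is the disjoint union of $n$ copies of $\mathcal{G}_l$,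 on the vertex set $V\sqcup\cdots\sqcup V$ ($n$ times), for $l=1,2$. Its composable pairs are the disjoint union of $n$ copies of $E_1\star E_2$, and $\theta^{(n)}$ is defined to be $\theta$ on each copy. **Magic unitary and $S_n^+$.** A matrix with entries in a unital $C^*$-algebra is a magic unitary if its entries are projections and every row and every column sums to $1$. $S_n^+$ is the compact quantum group (CQG) whose $C^*$-algebra is the universal unital $C^*$-algebra generated by the entries of an $n\times n$ magic unitary $((x_{kl}))$, with $\Delta(x_{kl})=\sum_rx_{kr}\otimes x_{rl}$. **Quantum automorphism group of a triple.** ${\rm Aut}^{+}(\mathcal{G}_1,\mathcal{G}_2,\theta)$ is the universal CQG acting faithfully on the triple. Concretely, its $C^*$-algebra is the universal unital $C^*$-algebra generated by $q_{ij}$, $i,j\in V$, such that $A=((q_{ij}))$ is a magic unitary, $A\varepsilon_l=\varepsilon_lA$ for $l=1,2$, and for all $(a,b),(a',b')\in E_1\star E_2$ with $\theta(a,b)=(c,d)$, $\theta(a',b')=(c',d')$, $$q_{t(c')t(c)}q_{s(c')s(c)}q_{s(d')s(d)}=q_{t(a')t(a)}q_{s(a')s(a)}q_{s(b')s(b)};$$ the coproduct is $\Delta(q_{ij})=\sum_kq_{ik}\otimes q_{kj}$. **Free wreath product (Bichon).** For a CQG $\mathbb{G}$, $\mathbb{G}\wr_\ast S_n^+$ is the CQG whose $C^*$-algebra is the quotient of the unital free product $C(\mathbb{G})^{\ast n}\ast C(S_n^+)$ by the relations $\nu_k(a)x_{kl}=x_{kl}\nu_k(a)$ for $a\in C(\mathbb{G})$,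 $1\le k,l\le n$, where $\nu_k$ is the embedding of the $k$-th copy of $C(\mathbb{G})$; the coproduct is determined by $\Delta(x_{kl})=\sum_rx_{kr}\otimes x_{rl}$ and $\Delta(\nu_k(a))=\sum_{l}(\nu_k\otimes\nu_l)(\Delta_{\mathbb{G}}(a))\,(x_{kl}\otimes1)$. *)

theory Defs
  imports
    "HOL-Analysis.Analysis"
    "HOL-Algebra.QuotRing"
    "HOL-Algebra.Module"
    "HOL-Library.Poly_Mapping"
    "Graph_Theory.Digraph_Component"
begin

section \<open>C*-algebras and *-homomorphisms\<close>

record 'a cstar = "(complex, 'a) module" +
  adj :: "'a \<Rightarrow> 'a"
  cnorm :: "'a \<Rightarrow> real"

text \<open>Unital *-homomorphisms, as functions that are \<^const>\<open>undefined\<close> off the carrier, so that a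
  homomorphism is determined by its values on the carrier.  Between C*-algebras every unital
  *-homomorphism is norm-decreasing; the last clause records this instead of requiring it to be
  rederived from spectral theory.\<close>

definition star_hom :: "('a, 'm) cstar_scheme \<Rightarrow> ('b, 'n) cstar_scheme \<Rightarrow> ('a \<Rightarrow> 'b) set" where
  "star_hom A B = {f \<in> ring_hom A B \<inter> extensional (carrier A).
     \<forall>a\<in>carrier A. (\<forall>c. f (c \<odot>\<^bsub>A\<^esub> a) = c \<odot>\<^bsub>B\<^esub> f a) \<and> f (adj A a) = adj B (f a)
       \<and> cnorm B (f a) \<le> cnorm A a}"

section \<open>Universal unital C*-algebras\<close>

text \<open>Words over letters \<open>(g, False)\<close>, standing for the generator \<open>g\<close>, and \<open>(g, True)\<close>, standing
  for its adjoint.  The monoid operation is written additively because that is what the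
  convolution product of \<^type>\<open>poly_mapping\<close> expects of its exponents.\<close>

datatype 'g star_word = Word (letters: "('g \<times> bool) list")

instantiation star_word :: (type) monoid_add
begin

definition zero_star_word :: "'a star_word" where
  "0 = Word []"

definition plus_star_word :: "'a star_word \<Rightarrow> 'a star_word \<Rightarrow> 'a star_word" where
  "v + w = Word (letters v @ letters w)"

instance
  by standard (auto simp: zero_star_word_def plus_star_word_def)

end

text \<open>The free unital complex *-algebra (noncommutative *-polynomials).\<close>

type_synonym 'g free_star = "'g star_word \<Rightarrow>\<^sub>0 complex"

definition free_gen :: "'g \<Rightarrow> 'g free_star" where
  "free_gen g = Poly_Mapping.single (Word [(g, False)]) 1"

definition free_scale :: "complex \<Rightarrow> 'g free_star \<Rightarrow> 'g free_star" where
  "free_scale c p = Poly_Mapping.single 0 c * p"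

definition word_adj :: "'g star_word \<Rightarrow> 'g star_word" where
  "word_adj w = Word (rev (map (\<lambda>(g, b). (g, \<not> b)) (letters w)))"

definition free_adj :: "'g free_star \<Rightarrow> 'g free_star" where
  "free_adj p = (\<Sum>w\<in>Poly_Mapping.keys p.
     Poly_Mapping.single (word_adj w) (cnj (Poly_Mapping.lookup p w)))"

definition free_on :: "'g set \<Rightarrow> 'g free_star set" where
  "free_on X = {p. \<forall>w\<in>Poly_Mapping.keys p. fst ` set (letters w) \<subseteq> X}"

definition cstar_seminorm :: "'g set \<Rightarrow> ('g free_star \<Rightarrow> real) \<Rightarrow> bool" where
  "cstar_seminorm X N \<longleftrightarrow> (\<forall>p\<in>free_on X.
     (\<forall>q\<in>free_on X. N (p + q) \<le> N p + N q \<and> N (p * q) \<le> N p * N q)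
     \<and> (\<forall>c. N (free_scale c p) = cmod c * N p)
     \<and> 0 \<le> N p
     \<and> N (free_adj p * p) = (N p)\<^sup>2)"

text \<open>Relations are of the form \<open>\<parallel>p\<parallel> \<le> \<eta>\<close>, given as a pair \<open>(p, \<eta>)\<close>; an algebraic relation
  \<open>p = 0\<close> is the pair \<open>(p, 0)\<close>.\<close>

type_synonym 'g relations = "('g free_star \<times> real) set"

definition algebraic :: "'g free_star set \<Rightarrow> 'g relations" where
  "algebraic P = (\<lambda>p. (p, 0)) ` P"

text \<open>The largest C*-seminorm compatible with the relations.  The supremum is finite as soon as
  the relations bound the norm of every generator.\<close>

definition universal_seminorm :: "'g set \<Rightarrow> 'g relations \<Rightarrow> 'g free_star \<Rightarrow> real" where
  "universal_seminorm X R p =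
     Sup {N p | N. cstar_seminorm X N \<and> (\<forall>(r, \<eta>)\<in>R. N r \<le> \<eta>)}"

text \<open>The universal unital C*-algebra generated by \<open>X\<close> subject to \<open>R\<close> is the Hausdorff completion
  of the free *-algebra on \<open>X\<close> for this seminorm: the ring of Cauchy sequences modulo the ideal of
  null sequences.\<close>

definition cauchy_ring :: "'g set \<Rightarrow> ('g free_star \<Rightarrow> real) \<Rightarrow> (nat \<Rightarrow> 'g free_star) ring" where
  "cauchy_ring X N =
     \<lparr>carrier = {s. (\<forall>n. s n \<in> free_on X) \<and>
                    (\<forall>e>0. \<exists>M. \<forall>m\<ge>M. \<forall>n\<ge>M. N (s m - s n) < e)},
      mult = (\<lambda>s t n. s n * t n), one = (\<lambda>_. 1), zero = (\<lambda>_. 0), add = (\<lambda>s t n. s n + t n)\<rparr>"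

definition null_ideal :: "'g set \<Rightarrow> ('g free_star \<Rightarrow> real) \<Rightarrow> (nat \<Rightarrow> 'g free_star) set" where
  "null_ideal X N = {s \<in> carrier (cauchy_ring X N). (\<lambda>n. N (s n)) \<longlonglongrightarrow> 0}"

type_synonym 'g univ_elem = "(nat \<Rightarrow> 'g free_star) set"

definition univ_cstar :: "'g set \<Rightarrow> 'g relations \<Rightarrow> 'g univ_elem cstar" where
  "univ_cstar X R =
     (let N = universal_seminorm X R; C = cauchy_ring X N; I = null_ideal X N; Q = C Quot I in
      \<lparr>carrier = carrier Q, mult = mult Q, one = one Q, zero = zero Q, add = add Q,
       smult = (\<lambda>c S. \<Union>s\<in>S. I +>\<^bsub>C\<^esub> (\<lambda>n. free_scale c (s n))),
       adj = (\<lambda>S. (\<lambda>s n. free_adj (s n)) ` S),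
       cnorm = (\<lambda>S. THE r. \<exists>s\<in>S. (\<lambda>n. N (s n)) \<longlonglongrightarrow> r)\<rparr>)"

definition univ_gen :: "'g set \<Rightarrow> 'g relations \<Rightarrow> 'g \<Rightarrow> 'g univ_elem" where
  "univ_gen X R g =
     (let N = universal_seminorm X R in
      null_ideal X N +>\<^bsub>cauchy_ring X N\<^esub> (\<lambda>_. free_gen g))"

section \<open>The minimal tensor product\<close>

definition ell2 :: "('i \<Rightarrow> complex) set" where
  "ell2 = {x. (\<lambda>i. (cmod (x i))\<^sup>2) summable_on UNIV}"

definition ell2_norm :: "('i \<Rightarrow> complex) \<Rightarrow> real" where
  "ell2_norm x = sqrt (\<Sum>\<^sub>\<infinity>i. (cmod (x i))\<^sup>2)"

definition ell2_inner :: "('i \<Rightarrow> complex) \<Rightarrow> ('i \<Rightarrow> complex) \<Rightarrow> complex" where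
  "ell2_inner x y = (\<Sum>\<^sub>\<infinity>i. cnj (x i) * y i)"

type_synonym 'i operator = "('i \<Rightarrow> complex) \<Rightarrow> ('i \<Rightarrow> complex)"

definition bounded_ops :: "'i operator set" where
  "bounded_ops = {T \<in> ell2 \<rightarrow>\<^sub>E ell2.
     (\<forall>x\<in>ell2. \<forall>y\<in>ell2. T (\<lambda>i. x i + y i) = (\<lambda>i. T x i + T y i))
     \<and> (\<forall>c. \<forall>x\<in>ell2. T (\<lambda>i. c * x i) = (\<lambda>i. c * T x i))
     \<and> (\<exists>K. \<forall>x\<in>ell2. ell2_norm (T x) \<le> K * ell2_norm x)}"

definition B_ell2 :: "'i operator cstar" where
  "B_ell2 =
     \<lparr>carrier = bounded_ops, mult = compose ell2, one = (\<lambda>x\<in>ell2. x),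
      zero = (\<lambda>x\<in>ell2. \<lambda>_. 0), add = (\<lambda>S T. \<lambda>x\<in>ell2. \<lambda>i. S x i + T x i),
      smult = (\<lambda>c T. \<lambda>x\<in>ell2. \<lambda>i. c * T x i),
      adj = (\<lambda>T. THE S. S \<in> bounded_ops \<and>
              (\<forall>x\<in>ell2. \<forall>y\<in>ell2. ell2_inner (S x) y = ell2_inner x (T y))),
      cnorm = (\<lambda>T. Sup {ell2_norm (T x) | x. x \<in> ell2 \<and> ell2_norm x \<le> 1})\<rparr>"

text \<open>\<open>S \<otimes> T\<close> on \<open>\<ell>\<^sup>2(I \<times> J)\<close>: apply \<open>T\<close> in the second coordinate, then \<open>S\<close> in the first.\<close>

definition op_tensor :: "'i operator \<Rightarrow> 'j operator \<Rightarrow> ('i \<times> 'j) operator" where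
  "op_tensor S T = (\<lambda>z\<in>ell2. \<lambda>(i, j). S (\<lambda>k. T (\<lambda>l. z (k, l)) j) i)"

text \<open>Bounded families in a C*-algebra, with pointwise operations and the supremum norm.\<close>

definition bounded_families :: "'i set \<Rightarrow> 'a cstar \<Rightarrow> ('i \<Rightarrow> 'a) cstar" where
  "bounded_families I B =
     \<lparr>carrier = {T \<in> I \<rightarrow>\<^sub>E carrier B. \<exists>K. \<forall>i\<in>I. cnorm B (T i) \<le> K},
      mult = (\<lambda>S T. \<lambda>i\<in>I. S i \<otimes>\<^bsub>B\<^esub> T i), one = (\<lambda>i\<in>I. \<one>\<^bsub>B\<^esub>),
      zero = (\<lambda>i\<in>I. \<zero>\<^bsub>B\<^esub>), add = (\<lambda>S T. \<lambda>i\<in>I. S i \<oplus>\<^bsub>B\<^esub> T i),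
      smult = (\<lambda>c T. \<lambda>i\<in>I. c \<odot>\<^bsub>B\<^esub> T i),
      adj = (\<lambda>T. \<lambda>i\<in>I. adj B (T i)),
      cnorm = (\<lambda>T. Sup (insert 0 ((\<lambda>i. cnorm B (T i)) ` I)))\<rparr>"

text \<open>\<open>A \<otimes>\<^sub>m\<^sub>i\<^sub>n B\<close> is the closed linear span of the operators \<open>\<pi>(a) \<otimes> \<rho>(b)\<close> when \<open>\<pi>\<close> and \<open>\<rho>\<close> run
  simultaneously through all representations of \<open>A\<close> and \<open>B\<close>.  Representations on
  \<open>\<ell>\<^sup>2(\<nat>)\<close> are enough when \<open>A\<close> and \<open>B\<close> are separable, as are all algebras below: a nonzero
  separable C*-algebra has a faithful unital representation on \<open>\<ell>\<^sup>2(\<nat>)\<close>.\<close>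

definition reps :: "('a, 'm) cstar_scheme \<Rightarrow> ('a \<Rightarrow> nat operator) set" where
  "reps A = star_hom A B_ell2"

type_synonym ('a, 'b) tensor_elem =
  "('a \<Rightarrow> nat operator) \<times> ('b \<Rightarrow> nat operator) \<Rightarrow> (nat \<times> nat) operator"

definition tensor ::
  "('a, 'm) cstar_scheme \<Rightarrow> ('b, 'n) cstar_scheme \<Rightarrow> 'a \<Rightarrow> 'b \<Rightarrow> ('a, 'b) tensor_elem" where
  "tensor A B a b = (\<lambda>(\<pi>, \<rho>)\<in>reps A \<times> reps B. op_tensor (\<pi> a) (\<rho> b))"

definition min_tensor ::
  "('a, 'm) cstar_scheme \<Rightarrow> ('b, 'n) cstar_scheme \<Rightarrow> ('a, 'b) tensor_elem cstar" where
  "min_tensor A B =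
     (let P = bounded_families (reps A \<times> reps B) B_ell2 in
      P\<lparr>carrier := {T \<in> carrier P. \<forall>e>0. \<exists>(m::nat) a b.
          a \<in> {..<m} \<rightarrow> carrier A \<and> b \<in> {..<m} \<rightarrow> carrier B \<and>
          cnorm P (T \<ominus>\<^bsub>P\<^esub> (\<Oplus>\<^bsub>P\<^esub>i\<in>{..<m}. tensor A B (a i) (b i))) < e}\<rparr>)"

text \<open>For \<open>\<phi> : A \<rightarrow> C\<close> and \<open>\<psi> : B \<rightarrow> D\<close>, the *-homomorphism \<open>\<phi> \<otimes> \<psi>\<close> from \<open>A \<otimes>\<^sub>m\<^sub>i\<^sub>n B\<close> to
  \<open>C \<otimes>\<^sub>m\<^sub>i\<^sub>n D\<close>: since \<open>(\<pi> \<otimes> \<rho>) \<circ> (\<phi> \<otimes> \<psi>) = (\<pi> \<circ> \<phi>) \<otimes> (\<rho> \<circ> \<psi>)\<close>, it reindexes families by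
  restriction of representations along \<open>\<phi>\<close> and \<open>\<psi>\<close>.\<close>

definition tensor_map ::
  "('a, 'm) cstar_scheme \<Rightarrow> ('b, 'n) cstar_scheme \<Rightarrow> ('c, 'k) cstar_scheme \<Rightarrow> ('d, 'l) cstar_scheme
    \<Rightarrow> ('a \<Rightarrow> 'c) \<Rightarrow> ('b \<Rightarrow> 'd) \<Rightarrow> ('a, 'b) tensor_elem \<Rightarrow> ('c, 'd) tensor_elem" where
  "tensor_map A B C D \<phi> \<psi> T =
     (\<lambda>(\<pi>, \<rho>)\<in>reps C \<times> reps D. T (compose (carrier A) \<pi> \<phi>, compose (carrier B) \<rho> \<psi>))"

section \<open>Compact quantum groups\<close>

text \<open>A quantum group is given by its (full) C*-algebra and its comultiplication, which takes values
  in the minimal tensor product.  An isomorphism is a *-isomorphism intertwining the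
  comultiplications; it is automatically isometric.\<close>

record 'a cqg =
  cqg_alg :: "'a cstar"
  comult :: "'a \<Rightarrow> ('a, 'a) tensor_elem"

definition cqg_isomorphic :: "'a cqg \<Rightarrow> 'b cqg \<Rightarrow> bool" where
  "cqg_isomorphic G H \<longleftrightarrow>
     (let A = cqg_alg G; B = cqg_alg H in
      \<exists>\<phi>\<in>star_hom A B. bij_betw \<phi> (carrier A) (carrier B) \<and>
        (\<forall>a\<in>carrier A. comult H (\<phi> a) = tensor_map A A B B \<phi> \<phi> (comult G a)))"

text \<open>The quantum group of a universal \<open>V \<times> V\<close> magic unitary subject to further relations \<open>R\<close>.
  By density of the *-algebra generated by the \<open>q\<^sub>i\<^sub>j\<close>, there is at most one comultiplication with
  the prescribed values.\<close>

definition magic_relations :: "'v set \<Rightarrow> ('v \<times> 'v) free_star set" where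
  "magic_relations V =
     (\<Union>i\<in>V. \<Union>j\<in>V. {free_adj (free_gen (i, j)) - free_gen (i, j),
                     free_gen (i, j) * free_gen (i, j) - free_gen (i, j)})
     \<union> {(\<Sum>j\<in>V. free_gen (i, j)) - 1 | i. i \<in> V}
     \<union> {(\<Sum>i\<in>V. free_gen (i, j)) - 1 | j. j \<in> V}"

definition magic_gen :: "'v set \<Rightarrow> ('v \<times> 'v) free_star set \<Rightarrow> 'v \<Rightarrow> 'v \<Rightarrow> ('v \<times> 'v) univ_elem" where
  "magic_gen V R i j = univ_gen (V \<times> V) (algebraic (magic_relations V \<union> R)) (i, j)"

definition magic_cqg :: "'v set \<Rightarrow> ('v \<times> 'v) free_star set \<Rightarrow> ('v \<times> 'v) univ_elem cqg" where
  "magic_cqg V R =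
     (let A = univ_cstar (V \<times> V) (algebraic (magic_relations V \<union> R)); q = magic_gen V R in
      \<lparr>cqg_alg = A,
       comult = (THE \<Delta>. \<Delta> \<in> star_hom A (min_tensor A A) \<and>
         (\<forall>i\<in>V. \<forall>j\<in>V. \<Delta> (q i j) = (\<Oplus>\<^bsub>min_tensor A A\<^esub>k\<in>V. tensor A A (q i k) (q k j))))\<rparr>)"

definition quantum_perm :: "nat \<Rightarrow> (nat \<times> nat) univ_elem cqg" where
  "quantum_perm n = magic_cqg {..<n} {}"

section \<open>The free wreath product\<close>

text \<open>Relations making \<open>\<iota>\<close> a unital *-homomorphism on the C*-algebra \<open>A\<close>; as in \<^const>\<open>star_hom\<close>,
  the norm relations are automatic.\<close>

definition hom_relations :: "('a, 'm) cstar_scheme \<Rightarrow> ('a \<Rightarrow> 'g) \<Rightarrow> 'g relations" where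
  "hom_relations A \<iota> =
     (let h = (\<lambda>a. free_gen (\<iota> a)) in
      algebraic
        (\<Union>a\<in>carrier A. \<Union>b\<in>carrier A. {h (a \<oplus>\<^bsub>A\<^esub> b) - (h a + h b), h (a \<otimes>\<^bsub>A\<^esub> b) - h a * h b})
      \<union> algebraic {h (c \<odot>\<^bsub>A\<^esub> a) - free_scale c (h a) | c a. a \<in> carrier A}
      \<union> algebraic {h (adj A a) - free_adj (h a) | a. a \<in> carrier A}
      \<union> algebraic {h \<one>\<^bsub>A\<^esub> - 1}
      \<union> {(h a, cnorm A a) | a. a \<in> carrier A})"

text \<open>Generators and relations of \<open>A\<^bsup>*n\<^esup> * B\<close>: \<open>Inl (k, a)\<close> is the element \<open>a\<close> of the \<open>k\<close>-th copy
  of \<open>A\<close>, and \<open>Inr b\<close> is the element \<open>b\<close> of \<open>B\<close>.\<close>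

definition free_product_gens :: "nat \<Rightarrow> 'a cstar \<Rightarrow> 'b cstar \<Rightarrow> (nat \<times> 'a + 'b) set" where
  "free_product_gens n A B = ({..<n} \<times> carrier A) <+> carrier B"

definition free_product_relations :: "nat \<Rightarrow> 'a cstar \<Rightarrow> 'b cstar \<Rightarrow> (nat \<times> 'a + 'b) relations" where
  "free_product_relations n A B =
     (\<Union>k\<in>{..<n}. hom_relations A (\<lambda>a. Inl (k, a))) \<union> hom_relations B Inr"

text \<open>Adding the commutation relations presents the quotient of the free product by them.\<close>

definition free_wreath :: "'a cqg \<Rightarrow> nat \<Rightarrow> (nat \<times> 'a + (nat \<times> nat) univ_elem) univ_elem cqg" where
  "free_wreath G n =
     (let A = cqg_alg G; B = cqg_alg (quantum_perm n); s = magic_gen {..<n} {};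
          X = free_product_gens n A B;
          R = free_product_relations n A B \<union> algebraic
                {free_gen (Inl (k, a)) * free_gen (Inr (s k l))
                   - free_gen (Inr (s k l)) * free_gen (Inl (k, a)) | a k l.
                 a \<in> carrier A \<and> k < n \<and> l < n};
          W = univ_cstar X R;
          \<nu> = (\<lambda>k. \<lambda>a\<in>carrier A. univ_gen X R (Inl (k, a)));
          x = (\<lambda>k l. univ_gen X R (Inr (s k l)));
          T = min_tensor W W
      in
      \<lparr>cqg_alg = W,
       comult = (THE \<Delta>. \<Delta> \<in> star_hom W T \<and>
         (\<forall>k<n. \<forall>l<n. \<Delta> (x k l) = (\<Oplus>\<^bsub>T\<^esub>r\<in>{..<n}. tensor W W (x k r) (x r l))) \<and>
         (\<forall>k<n. \<forall>a\<in>carrier A. \<Delta> (\<nu> k a) =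
            (\<Oplus>\<^bsub>T\<^esub>l\<in>{..<n}. tensor_map A A W W (\<nu> k) (\<nu> l) (comult G a)
                             \<otimes>\<^bsub>T\<^esub> tensor W W (x k l) \<one>\<^bsub>W\<^esub>)))\<rparr>)"

section \<open>Triples and their quantum automorphism groups\<close>

text \<open>Source and target of an edge are \<^const>\<open>tail\<close> and \<^const>\<open>head\<close>.\<close>

definition star_pairs :: "('v, 'e) pre_digraph \<Rightarrow> ('v, 'f) pre_digraph \<Rightarrow> ('e \<times> 'f) set" where
  "star_pairs G H = {(a, b). a \<in> arcs G \<and> b \<in> arcs H \<and> tail G a = head H b}"

definition vertex_matrix :: "('v, 'e) pre_digraph \<Rightarrow> 'v \<Rightarrow> 'v \<Rightarrow> nat" where
  "vertex_matrix G v w = card {e \<in> arcs G. tail G e = v \<and> head G e = w}"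

locale graph_triple =
  G1: graph G1 + G2: graph G2
  for G1 :: "('v, 'e) pre_digraph" and G2 :: "('v, 'f) pre_digraph" +
  fixes \<theta> :: "'e \<times> 'f \<Rightarrow> 'f \<times> 'e"
  assumes same_verts: "verts G1 = verts G2"
    and no_isolated1: "v \<in> verts G1 \<Longrightarrow> \<exists>e\<in>arcs G1. tail G1 e = v"
    and no_isolated2: "v \<in> verts G2 \<Longrightarrow> \<exists>e\<in>arcs G2. tail G2 e = v"
    and commute: "\<lbrakk>u \<in> verts G1; w \<in> verts G1\<rbrakk> \<Longrightarrow>
      (\<Sum>v\<in>verts G1. vertex_matrix G1 u v * vertex_matrix G2 v w)
      = (\<Sum>v\<in>verts G1. vertex_matrix G2 u v * vertex_matrix G1 v w)"
    and theta_bij: "bij_betw \<theta> (star_pairs G1 G2) (star_pairs G2 G1)"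
    and theta_ends: "\<lbrakk>(a, b) \<in> star_pairs G1 G2; \<theta> (a, b) = (c, d)\<rbrakk> \<Longrightarrow>
      head G1 a = head G2 c \<and> tail G2 b = tail G1 d"

definition intertwining_relations :: "('v, 'e) pre_digraph \<Rightarrow> ('v \<times> 'v) free_star set" where
  "intertwining_relations G =
     {(\<Sum>k\<in>verts G. free_scale (of_nat (vertex_matrix G k j)) (free_gen (i, k)))
        - (\<Sum>k\<in>verts G. free_scale (of_nat (vertex_matrix G i k)) (free_gen (k, j)))
      | i j. i \<in> verts G \<and> j \<in> verts G}"

definition theta_relations ::
  "('v, 'e) pre_digraph \<Rightarrow> ('v, 'f) pre_digraph \<Rightarrow> ('e \<times> 'f \<Rightarrow> 'f \<times> 'e) \<Rightarrow> ('v \<times> 'v) free_star set"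
  where
  "theta_relations G1 G2 \<theta> =
     {free_gen (head G2 c', head G2 c) * free_gen (tail G2 c', tail G2 c)
          * free_gen (tail G1 d', tail G1 d)
        - free_gen (head G1 a', head G1 a) * free_gen (tail G1 a', tail G1 a)
          * free_gen (tail G2 b', tail G2 b)
      | a b c d a' b' c' d'.
        (a, b) \<in> star_pairs G1 G2 \<and> (a', b') \<in> star_pairs G1 G2
        \<and> \<theta> (a, b) = (c, d) \<and> \<theta> (a', b') = (c', d')}"

definition quantum_aut ::
  "('v, 'e) pre_digraph \<Rightarrow> ('v, 'f) pre_digraph \<Rightarrow> ('e \<times> 'f \<Rightarrow> 'f \<times> 'e) \<Rightarrow> ('v \<times> 'v) univ_elem cqg"
  where
  "quantum_aut G1 G2 \<theta> = magic_cqg (verts G1)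
     (intertwining_relations G1 \<union> intertwining_relations G2 \<union> theta_relations G1 G2 \<theta>)"

definition copies :: "nat \<Rightarrow> ('v, 'e) pre_digraph \<Rightarrow> (nat \<times> 'v, nat \<times> 'e) pre_digraph" where
  "copies n G = \<lparr>verts = {..<n} \<times> verts G, arcs = {..<n} \<times> arcs G,
     tail = (\<lambda>(k, e). (k, tail G e)), head = (\<lambda>(k, e). (k, head G e))\<rparr>"

text \<open>The two edges of a composable pair in the disjoint union lie in the same copy.\<close>

definition theta_copies ::
  "('e \<times> 'f \<Rightarrow> 'f \<times> 'e) \<Rightarrow> (nat \<times> 'e) \<times> (nat \<times> 'f) \<Rightarrow> (nat \<times> 'f) \<times> (nat \<times> 'e)" where
  "theta_copies \<theta> = (\<lambda>((k, a), (_, b)). case \<theta> (a, b) of (c, d) \<Rightarrow> ((k, c), (k, d)))"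

end

theory Submission
  imports Defs
begin

text \<open>Let \<open>u\<close> be the universal magic unitary of the disjoint union.  Commutation with the vertex
  matrices makes entries belonging to an edge and a non-edge orthogonal, so the sums
  \<open>\<Sum>\<^sub>j u\<^sub>(\<^sub>k\<^sub>,\<^sub>i\<^sub>)\<^sub>(\<^sub>l\<^sub>,\<^sub>j\<^sub>)\<close> do not change when \<open>i\<close> moves along an edge of
  \<open>G1\<close>; by connectedness they depend only on \<open>k\<close> and \<open>l\<close>, and they form a magic unitary \<open>x\<close>.  The
  sums \<open>\<nu>\<^sub>k(q\<^sub>i\<^sub>j) = \<Sum>\<^sub>l u\<^sub>(\<^sub>k\<^sub>,\<^sub>i\<^sub>)\<^sub>(\<^sub>l\<^sub>,\<^sub>j\<^sub>)\<close> satisfy the relations of the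
  triple and commute with \<open>x\<^sub>k\<^sub>l\<close>, and \<open>u\<close> is recovered as \<open>\<nu>\<^sub>k(q\<^sub>i\<^sub>j) x\<^sub>k\<^sub>l\<close>.  The universal
  properties turn these formulas into mutually inverse *-homomorphisms.  The transported
  comultiplication has the prescribed values on \<open>x\<^sub>k\<^sub>l\<close> and \<open>\<nu>\<^sub>k(q\<^sub>i\<^sub>j)\<close>; the formula on all of
  \<open>\<nu>\<^sub>k(A)\<close> follows by compressing with the projections \<open>x\<^sub>k\<^sub>r \<otimes> 1\<close>, which sum to \<open>1\<close> and commute
  with the range of \<open>(\<nu>\<^sub>k \<otimes> \<nu>\<^sub>r) \<circ> \<Delta>\<close>.\<close>

text \<open>The analytic obstacle is orthogonality. A magic unitary is given only by projections
  with row and column sums 1, and everything rests on the vanishing of products of distinct entries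
  of a row or column. This has to be extracted from the bare C*-axioms, without order or functional
  calculus; an extreme-point estimate takes the place of positivity. The second obstacle is that
  universal algebras and comultiplications are given by suprema and definite descriptions. The
  supremum is shown to be attained, so the relations hold in the completion, and any solution in a
  C*-algebra bounds its norm from below. A description of a comultiplication must be shown to
  denote: for a triple this requires that the convolved matrix \<Sum>_k q_ik \<otimes> q_kj again
  satisfies the \<theta>-relations, which are cubic. For the wreath product the candidate is
  transported from the disjoint union; Bichon's formula on a whole copy of the algebra is not
  visibly multiplicative, so it cannot be extended from generators in one stroke.\<close>

section \<open>Abstract unital C*-algebras\<close>

text \<open>Completeness is phrased with \<open>(-1) \<odot> s n\<close> rather than
  \<open>\<ominus>\<close>: the record has no field for the additive inverse, and the scalar form
  can be evaluated directly in every concrete algebra. The unit is not forced to have norm 1, so the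
  zero algebra is an instance; a presentation may a priori collapse to it.\<close>

locale cstar_algebra = ring A for A :: "('a, 'm) cstar_scheme" (structure) +
  assumes smult_closed [simp, intro]: "a \<in> carrier A \<Longrightarrow> c \<odot> a \<in> carrier A"
    and smult_add_left: "a \<in> carrier A \<Longrightarrow> (c + d) \<odot> a = c \<odot> a \<oplus> d \<odot> a"
    and smult_add_right: "\<lbrakk>a \<in> carrier A; b \<in> carrier A\<rbrakk> \<Longrightarrow> c \<odot> (a \<oplus> b) = c \<odot> a \<oplus> c \<odot> b"
    and smult_smult [simp]: "a \<in> carrier A \<Longrightarrow> c \<odot> (d \<odot> a) = (c * d) \<odot> a"
    and smult_one [simp]: "a \<in> carrier A \<Longrightarrow> 1 \<odot> a = a"
    and smult_mult_left [simp]: "\<lbrakk>a \<in> carrier A; b \<in> carrier A\<rbrakk> \<Longrightarrow> (c \<odot> a) \<otimes> b = c \<odot> (a \<otimes> b)"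
    and smult_mult_right [simp]: "\<lbrakk>a \<in> carrier A; b \<in> carrier A\<rbrakk> \<Longrightarrow> a \<otimes> (c \<odot> b) = c \<odot> (a \<otimes> b)"
    and adj_closed [simp, intro]: "a \<in> carrier A \<Longrightarrow> adj A a \<in> carrier A"
    and adj_add [simp]: "\<lbrakk>a \<in> carrier A; b \<in> carrier A\<rbrakk> \<Longrightarrow> adj A (a \<oplus> b) = adj A a \<oplus> adj A b"
    and adj_mult [simp]: "\<lbrakk>a \<in> carrier A; b \<in> carrier A\<rbrakk> \<Longrightarrow> adj A (a \<otimes> b) = adj A b \<otimes> adj A a"
    and adj_smult [simp]: "a \<in> carrier A \<Longrightarrow> adj A (c \<odot> a) = cnj c \<odot> adj A a"
    and adj_adj [simp]: "a \<in> carrier A \<Longrightarrow> adj A (adj A a) = a"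
    and norm_add: "\<lbrakk>a \<in> carrier A; b \<in> carrier A\<rbrakk> \<Longrightarrow> cnorm A (a \<oplus> b) \<le> cnorm A a + cnorm A b"
    and norm_mult: "\<lbrakk>a \<in> carrier A; b \<in> carrier A\<rbrakk> \<Longrightarrow> cnorm A (a \<otimes> b) \<le> cnorm A a * cnorm A b"
    and norm_smult [simp]: "a \<in> carrier A \<Longrightarrow> cnorm A (c \<odot> a) = cmod c * cnorm A a"
    and norm_eq_zero: "\<lbrakk>a \<in> carrier A; cnorm A a = 0\<rbrakk> \<Longrightarrow> a = \<zero>"
    and norm_cstar: "a \<in> carrier A \<Longrightarrow> cnorm A (adj A a \<otimes> a) = (cnorm A a)\<^sup>2"
    and complete: "\<lbrakk>\<And>n. s n \<in> carrier A;
        \<forall>e>0. \<exists>M. \<forall>m\<ge>M. \<forall>n\<ge>M. cnorm A (s m \<oplus> (-1) \<odot> s n) < e\<rbrakk>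
      \<Longrightarrow> \<exists>a\<in>carrier A. (\<lambda>n. cnorm A (s n \<oplus> (-1) \<odot> a)) \<longlonglongrightarrow> 0"

text \<open>Here \<open>0 \<odot> a = \<zero>\<close> is a separate hypothesis: it makes
  \<open>(-1) \<odot> a\<close> an additive inverse, and it follows from the other laws only once
  cancellation is available.\<close>

lemma cstar_algebraI:
  fixes A :: "('a, 'm) cstar_scheme" (structure)
  assumes "\<zero> \<in> carrier A" "\<one> \<in> carrier A"
    "\<And>a b. \<lbrakk>a \<in> carrier A; b \<in> carrier A\<rbrakk> \<Longrightarrow> a \<oplus> b \<in> carrier A"
    "\<And>a b. \<lbrakk>a \<in> carrier A; b \<in> carrier A\<rbrakk> \<Longrightarrow> a \<otimes> b \<in> carrier A"
    "\<And>a b c. \<lbrakk>a \<in> carrier A; b \<in> carrier A; c \<in> carrier A\<rbrakk> \<Longrightarrow> (a \<oplus> b) \<oplus> c = a \<oplus> (b \<oplus> c)"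
    "\<And>a b. \<lbrakk>a \<in> carrier A; b \<in> carrier A\<rbrakk> \<Longrightarrow> a \<oplus> b = b \<oplus> a"
    "\<And>a. a \<in> carrier A \<Longrightarrow> \<zero> \<oplus> a = a"
    "\<And>a b c. \<lbrakk>a \<in> carrier A; b \<in> carrier A; c \<in> carrier A\<rbrakk> \<Longrightarrow> (a \<otimes> b) \<otimes> c = a \<otimes> (b \<otimes> c)"
    "\<And>a. a \<in> carrier A \<Longrightarrow> \<one> \<otimes> a = a"
    "\<And>a. a \<in> carrier A \<Longrightarrow> a \<otimes> \<one> = a"
    "\<And>a b c. \<lbrakk>a \<in> carrier A; b \<in> carrier A; c \<in> carrier A\<rbrakk> \<Longrightarrow> (a \<oplus> b) \<otimes> c = a \<otimes> c \<oplus> b \<otimes> c"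
    "\<And>a b c. \<lbrakk>a \<in> carrier A; b \<in> carrier A; c \<in> carrier A\<rbrakk> \<Longrightarrow> c \<otimes> (a \<oplus> b) = c \<otimes> a \<oplus> c \<otimes> b"
    "\<And>a c. a \<in> carrier A \<Longrightarrow> c \<odot> a \<in> carrier A"
    "\<And>a c d. a \<in> carrier A \<Longrightarrow> (c + d) \<odot> a = c \<odot> a \<oplus> d \<odot> a"
    "\<And>a. a \<in> carrier A \<Longrightarrow> 0 \<odot> a = \<zero>"
    "\<And>a b c. \<lbrakk>a \<in> carrier A; b \<in> carrier A\<rbrakk> \<Longrightarrow> c \<odot> (a \<oplus> b) = c \<odot> a \<oplus> c \<odot> b"
    "\<And>a c d. a \<in> carrier A \<Longrightarrow> c \<odot> (d \<odot> a) = (c * d) \<odot> a"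
    "\<And>a. a \<in> carrier A \<Longrightarrow> 1 \<odot> a = a"
    "\<And>a b c. \<lbrakk>a \<in> carrier A; b \<in> carrier A\<rbrakk> \<Longrightarrow> (c \<odot> a) \<otimes> b = c \<odot> (a \<otimes> b)"
    "\<And>a b c. \<lbrakk>a \<in> carrier A; b \<in> carrier A\<rbrakk> \<Longrightarrow> a \<otimes> (c \<odot> b) = c \<odot> (a \<otimes> b)"
    "\<And>a. a \<in> carrier A \<Longrightarrow> adj A a \<in> carrier A"
    "\<And>a b. \<lbrakk>a \<in> carrier A; b \<in> carrier A\<rbrakk> \<Longrightarrow> adj A (a \<oplus> b) = adj A a \<oplus> adj A b"
    "\<And>a b. \<lbrakk>a \<in> carrier A; b \<in> carrier A\<rbrakk> \<Longrightarrow> adj A (a \<otimes> b) = adj A b \<otimes> adj A a"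
    "\<And>a c. a \<in> carrier A \<Longrightarrow> adj A (c \<odot> a) = cnj c \<odot> adj A a"
    "\<And>a. a \<in> carrier A \<Longrightarrow> adj A (adj A a) = a"
    "\<And>a b. \<lbrakk>a \<in> carrier A; b \<in> carrier A\<rbrakk> \<Longrightarrow> cnorm A (a \<oplus> b) \<le> cnorm A a + cnorm A b"
    "\<And>a b. \<lbrakk>a \<in> carrier A; b \<in> carrier A\<rbrakk> \<Longrightarrow> cnorm A (a \<otimes> b) \<le> cnorm A a * cnorm A b"
    "\<And>a c. a \<in> carrier A \<Longrightarrow> cnorm A (c \<odot> a) = cmod c * cnorm A a"
    "\<And>a. \<lbrakk>a \<in> carrier A; cnorm A a = 0\<rbrakk> \<Longrightarrow> a = \<zero>"
    "\<And>a. a \<in> carrier A \<Longrightarrow> cnorm A (adj A a \<otimes> a) = (cnorm A a)\<^sup>2"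
    "\<And>s. \<lbrakk>\<And>n. s n \<in> carrier A;
        \<forall>e>0. \<exists>M. \<forall>m\<ge>M. \<forall>n\<ge>M. cnorm A (s m \<oplus> (-1) \<odot> s n) < e\<rbrakk>
      \<Longrightarrow> \<exists>a\<in>carrier A. (\<lambda>n. cnorm A (s n \<oplus> (-1) \<odot> a)) \<longlonglongrightarrow> 0"
  shows "cstar_algebra A"
proof -
  have neg: "(-1) \<odot> a \<oplus> a = \<zero>" if "a \<in> carrier A" for a
    using assms(14)[of a "-1" 1] assms(15)[of a] assms(18)[of a] that by simp
  have "abelian_group A"
    by (rule abelian_groupI)
      (fact assms(1) assms(3) assms(5) assms(6) assms(7) | blast intro: neg assms(13))+
  moreover have "Group.monoid A"
    by (rule Group.monoidI) (fact assms(2) assms(4) assms(8) assms(9) assms(10))+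
  ultimately have "ring A"
    by (rule ringI) (fact assms(11) assms(12))+
  then show ?thesis
    by (rule cstar_algebra.intro, intro cstar_algebra_axioms.intro) (rule assms(13-31); assumption?)+
qed

context cstar_algebra
begin

lemma smult_zero_left [simp]: "a \<in> carrier A \<Longrightarrow> 0 \<odot> a = \<zero>"
  using smult_add_left[of a 0 0] by (simp add: add.l_cancel_one')

lemma minus_eq_smult: "a \<in> carrier A \<Longrightarrow> \<ominus> a = (-1) \<odot> a"
  by (rule minus_equality[OF _ _ ]) (use smult_add_left[of a "-1" 1] in auto)

lemma diff_eq_smult: "a \<in> carrier A \<Longrightarrow> b \<in> carrier A \<Longrightarrow> a \<ominus> b = a \<oplus> (-1) \<odot> b"
  by (simp add: a_minus_def minus_eq_smult)

lemma smult_zero_right [simp]: "c \<odot> \<zero> = \<zero>"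
  using smult_smult[of \<zero> c 0] smult_zero_left[of \<zero>] by simp

lemma smult_minus: "a \<in> carrier A \<Longrightarrow> c \<odot> (\<ominus> a) = \<ominus> (c \<odot> a)"
  by (simp add: minus_eq_smult)

lemma smult_diff: "\<lbrakk>a \<in> carrier A; b \<in> carrier A\<rbrakk> \<Longrightarrow> c \<odot> (a \<ominus> b) = c \<odot> a \<ominus> c \<odot> b"
  by (simp add: a_minus_def smult_add_right smult_minus)

lemma adj_minus [simp]: "a \<in> carrier A \<Longrightarrow> adj A (\<ominus> a) = \<ominus> adj A a"
  by (simp add: minus_eq_smult)

lemma adj_diff [simp]: "\<lbrakk>a \<in> carrier A; b \<in> carrier A\<rbrakk> \<Longrightarrow> adj A (a \<ominus> b) = adj A a \<ominus> adj A b"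
  by (simp add: a_minus_def)

lemma adj_zero [simp]: "adj A \<zero> = \<zero>"
  using adj_smult[of \<zero> 0] by simp

lemma adj_one [simp]: "adj A \<one> = \<one>"
  by (metis adj_adj adj_closed adj_mult l_one one_closed r_one)

lemma norm_zero [simp]: "cnorm A \<zero> = 0"
  using norm_smult[of \<zero> 0] by simp

lemma norm_minus [simp]: "a \<in> carrier A \<Longrightarrow> cnorm A (\<ominus> a) = cnorm A a"
  by (simp add: minus_eq_smult)

lemma norm_nonneg [simp]: "a \<in> carrier A \<Longrightarrow> 0 \<le> cnorm A a"
  using norm_add[of a "\<ominus> a"] by (simp add: r_neg)

lemma norm_diff_commute: "\<lbrakk>a \<in> carrier A; b \<in> carrier A\<rbrakk> \<Longrightarrow> cnorm A (a \<ominus> b) = cnorm A (b \<ominus> a)"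
  using norm_minus[of "a \<ominus> b"] by (simp add: a_minus_def minus_add a_comm)

lemma diff_diff_add: "\<lbrakk>a \<in> carrier A; b \<in> carrier A; c \<in> carrier A\<rbrakk> \<Longrightarrow> (a \<ominus> b) \<oplus> (b \<ominus> c) = a \<ominus> c"
  by (simp add: a_minus_def a_assoc) (simp add: r_neg1)

lemma norm_triangle: "\<lbrakk>a \<in> carrier A; b \<in> carrier A; c \<in> carrier A\<rbrakk>
    \<Longrightarrow> cnorm A (a \<ominus> c) \<le> cnorm A (a \<ominus> b) + cnorm A (b \<ominus> c)"
  using norm_add[of "a \<ominus> b" "b \<ominus> c"] by (simp add: diff_diff_add)

lemma norm_triangle2: "\<lbrakk>a \<in> carrier A; b \<in> carrier A\<rbrakk> \<Longrightarrow> cnorm A a \<le> cnorm A b + cnorm A (a \<ominus> b)"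
  using norm_triangle[of a b \<zero>] by (simp add: a_minus_def add.inv_one)

lemma diff_add_cancel: "\<lbrakk>a \<in> carrier A; b \<in> carrier A\<rbrakk> \<Longrightarrow> (a \<ominus> b) \<oplus> b = a"
  by (simp add: a_minus_def a_assoc l_neg)

lemma diff_eq_zero_iff: "\<lbrakk>a \<in> carrier A; b \<in> carrier A\<rbrakk> \<Longrightarrow> a \<ominus> b = \<zero> \<longleftrightarrow> a = b"
  using diff_add_cancel[of a b] by (auto simp: a_minus_def r_neg)

lemma eq_if_norm_diff: "\<lbrakk>a \<in> carrier A; b \<in> carrier A; cnorm A (a \<ominus> b) = 0\<rbrakk> \<Longrightarrow> a = b"
  using norm_eq_zero[of "a \<ominus> b"] by (simp add: diff_eq_zero_iff)

lemma norm_adj [simp]: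
  assumes "a \<in> carrier A" shows "cnorm A (adj A a) = cnorm A a"
proof -
  have "cnorm A b \<le> cnorm A (adj A b)" if b: "b \<in> carrier A" for b
  proof (cases "cnorm A b = 0")
    case False
    have "cnorm A b * cnorm A b \<le> cnorm A (adj A b) * cnorm A b"
      using norm_cstar[OF b] norm_mult[of "adj A b" b] b by (simp add: power2_eq_square)
    then show ?thesis using False norm_nonneg[OF b] by simp
  qed (use b in simp)
  from this[of a] this[of "adj A a"] assms show ?thesis by simp
qed

lemma norm_one_le: "cnorm A \<one> \<le> 1"
  using norm_cstar[of \<one>] by (auto simp: power2_eq_square)

lemma norm_isometry_le:
  assumes "a \<in> carrier A" "cnorm A (adj A a \<otimes> a) \<le> 1" shows "cnorm A a \<le> 1"
  using norm_cstar[OF assms(1)] assms by (simp add: abs_square_le_1)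

lemma finsum_in [simp, intro]: "(\<And>i. i \<in> I \<Longrightarrow> f i \<in> carrier A) \<Longrightarrow> finsum A f I \<in> carrier A"
  by (rule finsum_closed) auto

lemma smult_finsum: "(\<And>i. i \<in> I \<Longrightarrow> f i \<in> carrier A) \<Longrightarrow> c \<odot> finsum A f I = (\<Oplus>i\<in>I. c \<odot> f i)"
  by (induct I rule: infinite_finite_induct) (auto simp: smult_add_right Pi_def)

lemma adj_finsum [simp]: "(\<And>i. i \<in> I \<Longrightarrow> f i \<in> carrier A) \<Longrightarrow> adj A (finsum A f I) = (\<Oplus>i\<in>I. adj A (f i))"
  by (induct I rule: infinite_finite_induct) (auto simp: Pi_def)

lemma norm_finsum: "(\<And>i. i \<in> I \<Longrightarrow> f i \<in> carrier A) \<Longrightarrow> cnorm A (finsum A f I) \<le> (\<Sum>i\<in>I. cnorm A (f i))"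
proof (induct I rule: infinite_finite_induct)
  case (insert x F)
  then have "cnorm A (finsum A f (insert x F)) \<le> cnorm A (f x) + cnorm A (finsum A f F)"
    by (auto simp: Pi_def intro!: norm_add)
  with insert show ?case by fastforce
qed auto

lemma finsum_mult_left: "\<lbrakk>a \<in> carrier A; \<And>i. i \<in> I \<Longrightarrow> f i \<in> carrier A\<rbrakk>
    \<Longrightarrow> a \<otimes> finsum A f I = (\<Oplus>i\<in>I. a \<otimes> f i)"
  by (induct I rule: infinite_finite_induct) (auto simp: r_distr Pi_def)

lemma finsum_mult_right: "\<lbrakk>a \<in> carrier A; \<And>i. i \<in> I \<Longrightarrow> f i \<in> carrier A\<rbrakk>
    \<Longrightarrow> finsum A f I \<otimes> a = (\<Oplus>i\<in>I. f i \<otimes> a)"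
  by (induct I rule: infinite_finite_induct) (auto simp: l_distr Pi_def)

lemma finsum_eq: "\<lbrakk>I = J; \<And>i. i \<in> J \<Longrightarrow> f i = g i; \<And>i. i \<in> J \<Longrightarrow> g i \<in> carrier A\<rbrakk>
    \<Longrightarrow> finsum A f I = finsum A g J"
  by (rule finsum_cong') auto

lemma finsum_all_zero: "(\<And>i. i \<in> I \<Longrightarrow> f i = \<zero>) \<Longrightarrow> finsum A f I = \<zero>"
  by (rule add.finprod_one_eqI)

lemma finsum_pairs:
  assumes "finite I" "finite J" "\<And>i j. i \<in> I \<Longrightarrow> j \<in> J \<Longrightarrow> f i j \<in> carrier A"
  shows "(\<Oplus>i\<in>I. \<Oplus>j\<in>J. f i j) = (\<Oplus>p\<in>I \<times> J. f (fst p) (snd p))"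
  using assms(1,3)
proof (induct I)
  case (insert x F)
  have eq: "insert x F \<times> J = (\<lambda>j. (x, j)) ` J \<union> F \<times> J" by auto
  have "(\<Oplus>p\<in>insert x F \<times> J. f (fst p) (snd p))
      = (\<Oplus>p\<in>(\<lambda>j. (x, j)) ` J. f (fst p) (snd p)) \<oplus> (\<Oplus>p\<in>F \<times> J. f (fst p) (snd p))"
    unfolding eq using insert assms(2) by (intro finsum_Un_disjoint) auto
  also have "(\<Oplus>p\<in>(\<lambda>j. (x, j)) ` J. f (fst p) (snd p)) = (\<Oplus>j\<in>J. f x j)"
    using insert(4) by (subst finsum_reindex) (auto simp: inj_on_def)
  finally show ?case using insert by (auto simp: Pi_def)
qed simp

lemma finsum_swap:
  assumes "finite I" "finite J" "\<And>i j. i \<in> I \<Longrightarrow> j \<in> J \<Longrightarrow> f i j \<in> carrier A"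
  shows "(\<Oplus>i\<in>I. \<Oplus>j\<in>J. f i j) = (\<Oplus>j\<in>J. \<Oplus>i\<in>I. f i j)"
proof -
  have "(\<Oplus>p\<in>J \<times> I. f (snd p) (fst p)) = (\<Oplus>p\<in>prod.swap ` (I \<times> J). f (snd p) (fst p))"
    by (simp add: product_swap)
  also have "\<dots> = (\<Oplus>p\<in>I \<times> J. f (fst p) (snd p))"
    using assms by (subst finsum_reindex) auto
  finally show ?thesis using assms by (simp add: finsum_pairs)
qed

lemma finsum_single:
  assumes "finite I" "i \<in> I" "f i \<in> carrier A" "\<And>j. j \<in> I \<Longrightarrow> j \<noteq> i \<Longrightarrow> f j = \<zero>"
  shows "finsum A f I = f i"
proof -
  have "finsum A f I = (\<Oplus>j\<in>I. if i = j then f j else \<zero>)"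
    using assms by (intro finsum_eq) auto
  also have "\<dots> = f i" using assms by (intro finsum_singleton) (auto simp: Pi_def, metis zero_closed)
  finally show ?thesis .
qed

lemma finsum_subset:
  assumes "finite I" "J \<subseteq> I" "\<And>j. j \<in> J \<Longrightarrow> f j \<in> carrier A" "\<And>j. j \<in> I - J \<Longrightarrow> f j = \<zero>"
  shows "finsum A f I = finsum A f J"
proof -
  have "finsum A f (J \<union> (I - J)) = finsum A f J \<oplus> finsum A f (I - J)"
    using assms by (intro finsum_Un_disjoint) (auto intro: finite_subset)
  moreover have "J \<union> (I - J) = I" using assms by blast
  moreover have "finsum A f (I - J) = \<zero>" using assms(4) by (rule finsum_all_zero)
  ultimately show ?thesis using assms by simp
qed

section \<open>Convergence in norm\<close>

definition conv :: "(nat \<Rightarrow> 'a) \<Rightarrow> 'a \<Rightarrow> bool" where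
  "conv s a \<longleftrightarrow> (\<forall>n. s n \<in> carrier A) \<and> a \<in> carrier A \<and> (\<lambda>n. cnorm A (s n \<ominus> a)) \<longlonglongrightarrow> 0"

lemma convI:
  assumes "\<And>n. s n \<in> carrier A" "a \<in> carrier A" "\<And>n. cnorm A (s n \<ominus> a) \<le> h n" "h \<longlonglongrightarrow> 0"
  shows "conv s a"
  unfolding conv_def
proof (intro conjI allI)
  show "(\<lambda>n. cnorm A (s n \<ominus> a)) \<longlonglongrightarrow> 0"
    by (rule tendsto_sandwich[OF _ _ tendsto_const assms(4)]) (use assms in auto)
qed (use assms in auto)

lemma conv_unique: assumes "conv s a" "conv s b" shows "a = b"
proof -
  have "cnorm A (a \<ominus> b) \<le> cnorm A (s n \<ominus> a) + cnorm A (s n \<ominus> b)" for n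
    using assms norm_triangle[of a "s n" b] norm_diff_commute[of a "s n"] by (auto simp: conv_def)
  moreover have "(\<lambda>n. cnorm A (s n \<ominus> a) + cnorm A (s n \<ominus> b)) \<longlonglongrightarrow> 0 + 0"
    using assms unfolding conv_def by (intro tendsto_add) auto
  ultimately have "cnorm A (a \<ominus> b) \<le> 0 + 0"
    by (intro LIMSEQ_le_const) auto
  then have "cnorm A (a \<ominus> b) = 0"
    using assms norm_nonneg[of "a \<ominus> b"] unfolding conv_def by (auto intro: antisym)
  then show ?thesis using assms unfolding conv_def by (intro eq_if_norm_diff) auto
qed

lemma conv_const: "a \<in> carrier A \<Longrightarrow> conv (\<lambda>_. a) a"
  by (simp add: conv_def r_neg a_minus_def)

lemma conv_norm: assumes "conv s a" shows "(\<lambda>n. cnorm A (s n)) \<longlonglongrightarrow> cnorm A a"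
proof -
  have "norm (cnorm A (s n) - cnorm A a) \<le> cnorm A (s n \<ominus> a)" for n
    using assms norm_triangle2[of a "s n"] norm_triangle2[of "s n" a] norm_diff_commute[of a "s n"]
    by (auto simp: conv_def)
  moreover have "(\<lambda>n. cnorm A (s n \<ominus> a)) \<longlonglongrightarrow> 0" using assms by (simp add: conv_def)
  ultimately have "(\<lambda>n. cnorm A (s n) - cnorm A a) \<longlonglongrightarrow> 0"
    by (rule Lim_null_comparison[OF always_eventually[OF allI]])
  then show ?thesis by (rule LIM_zero_cancel)
qed

lemma add_add_swap: "\<lbrakk>a \<in> carrier A; b \<in> carrier A; c \<in> carrier A; d \<in> carrier A\<rbrakk>
    \<Longrightarrow> (a \<oplus> b) \<oplus> (c \<oplus> d) = (a \<oplus> c) \<oplus> (b \<oplus> d)"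
  by (metis a_assoc a_closed a_lcomm)

lemma add_diff_add: "\<lbrakk>a \<in> carrier A; b \<in> carrier A; c \<in> carrier A; d \<in> carrier A\<rbrakk>
    \<Longrightarrow> (a \<oplus> b) \<ominus> (c \<oplus> d) = (a \<ominus> c) \<oplus> (b \<ominus> d)"
  using add_add_swap[of a b "(-1) \<odot> c" "(-1) \<odot> d"] by (simp add: diff_eq_smult smult_add_right)

lemma mult_diff_mult: assumes "a \<in> carrier A" "b \<in> carrier A" "c \<in> carrier A" "d \<in> carrier A"
  shows "(a \<otimes> b) \<ominus> (c \<otimes> d) = a \<otimes> (b \<ominus> d) \<oplus> (a \<ominus> c) \<otimes> d"
  using diff_diff_add[of "a \<otimes> b" "a \<otimes> d" "c \<otimes> d"] assms
  by (simp add: a_minus_def r_distr l_distr l_minus r_minus)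

lemma conv_add: assumes "conv s a" "conv t b" shows "conv (\<lambda>n. s n \<oplus> t n) (a \<oplus> b)"
proof (rule convI)
  show "cnorm A ((s n \<oplus> t n) \<ominus> (a \<oplus> b)) \<le> cnorm A (s n \<ominus> a) + cnorm A (t n \<ominus> b)" for n
    using assms by (auto simp: conv_def add_diff_add intro!: norm_add)
  show "(\<lambda>n. cnorm A (s n \<ominus> a) + cnorm A (t n \<ominus> b)) \<longlonglongrightarrow> 0"
    using assms tendsto_add[of _ 0 _ _ 0] by (auto simp: conv_def)
qed (use assms in \<open>auto simp: conv_def\<close>)

lemma conv_mult: assumes "conv s a" "conv t b" shows "conv (\<lambda>n. s n \<otimes> t n) (a \<otimes> b)"
proof (rule convI)
  show "cnorm A ((s n \<otimes> t n) \<ominus> (a \<otimes> b)) \<le> cnorm A (s n) * cnorm A (t n \<ominus> b) + cnorm A (s n \<ominus> a) * cnorm A b" for n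
    using assms by (auto simp: conv_def mult_diff_mult intro!: order_trans[OF norm_add] add_mono norm_mult)
  have "(\<lambda>n. cnorm A (s n) * cnorm A (t n \<ominus> b) + cnorm A (s n \<ominus> a) * cnorm A b)
      \<longlonglongrightarrow> cnorm A a * 0 + 0 * cnorm A b"
    using assms conv_norm[OF assms(1)] by (intro tendsto_intros) (auto simp: conv_def)
  then show "(\<lambda>n. cnorm A (s n) * cnorm A (t n \<ominus> b) + cnorm A (s n \<ominus> a) * cnorm A b) \<longlonglongrightarrow> 0"
    by simp
qed (use assms in \<open>auto simp: conv_def\<close>)

lemma conv_smult: assumes "conv s a" shows "conv (\<lambda>n. c \<odot> s n) (c \<odot> a)"
proof (rule convI)
  show "cnorm A (c \<odot> s n \<ominus> c \<odot> a) \<le> cmod c * cnorm A (s n \<ominus> a)" for n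
    using assms by (auto simp: conv_def simp flip: smult_diff)
  show "(\<lambda>n. cmod c * cnorm A (s n \<ominus> a)) \<longlonglongrightarrow> 0"
    using assms tendsto_mult[of "\<lambda>_. cmod c" "cmod c" _ _ 0] by (auto simp: conv_def)
qed (use assms in \<open>auto simp: conv_def\<close>)

lemma conv_adj: assumes "conv s a" shows "conv (\<lambda>n. adj A (s n)) (adj A a)"
  using assms by (auto simp: conv_def simp flip: adj_diff)

lemma cauchy_conv:
  assumes "\<And>n. s n \<in> carrier A"
    and "\<forall>e>0. \<exists>M. \<forall>m\<ge>M. \<forall>n\<ge>M. cnorm A (s m \<ominus> s n) < e"
  shows "\<exists>a. conv s a"
  using complete[of s] assms by (auto simp: conv_def diff_eq_smult)

lemma approx_conv:
  assumes "a \<in> carrier A" "\<And>e. e > 0 \<Longrightarrow> \<exists>b\<in>S. cnorm A (a \<ominus> b) < e" "S \<subseteq> carrier A"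
  shows "\<exists>s. (\<forall>n. s n \<in> S) \<and> conv s a"
proof -
  have "\<exists>b\<in>S. cnorm A (a \<ominus> b) < 1 / Suc n" for n by (rule assms(2)) simp
  then obtain s where s: "\<And>n. s n \<in> S" "\<And>n. cnorm A (a \<ominus> s n) < 1 / Suc n" by metis
  have "conv s a"
  proof (rule convI)
    show "cnorm A (s n \<ominus> a) \<le> 1 / Suc n" for n
      using s[of n] assms norm_diff_commute[of a "s n"] by auto
    show "(\<lambda>n. 1 / real (Suc n)) \<longlonglongrightarrow> 0" using LIMSEQ_inverse_real_of_nat by (simp add: field_simps)
  qed (use s assms in auto)
  with s show ?thesis by blast
qed

end

section \<open>Unital *-homomorphisms\<close>

lemma star_homD:
  assumes "f \<in> star_hom A B"
  shows "f \<in> carrier A \<rightarrow>\<^sub>E carrier B"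
    "\<And>a. a \<in> carrier A \<Longrightarrow> f a \<in> carrier B"
    "\<And>a b. \<lbrakk>a \<in> carrier A; b \<in> carrier A\<rbrakk> \<Longrightarrow> f (a \<oplus>\<^bsub>A\<^esub> b) = f a \<oplus>\<^bsub>B\<^esub> f b"
    "\<And>a b. \<lbrakk>a \<in> carrier A; b \<in> carrier A\<rbrakk> \<Longrightarrow> f (a \<otimes>\<^bsub>A\<^esub> b) = f a \<otimes>\<^bsub>B\<^esub> f b"
    "f \<one>\<^bsub>A\<^esub> = \<one>\<^bsub>B\<^esub>"
    "\<And>a c. a \<in> carrier A \<Longrightarrow> f (c \<odot>\<^bsub>A\<^esub> a) = c \<odot>\<^bsub>B\<^esub> f a"
    "\<And>a. a \<in> carrier A \<Longrightarrow> f (adj A a) = adj B (f a)"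
    "\<And>a. a \<in> carrier A \<Longrightarrow> cnorm B (f a) \<le> cnorm A a"
  using assms unfolding star_hom_def
  by (auto simp: ring_hom_closed ring_hom_add ring_hom_mult ring_hom_one PiE_iff)

lemma star_homI:
  assumes "\<And>a. a \<in> carrier A \<Longrightarrow> f a \<in> carrier B"
    "\<And>a b. \<lbrakk>a \<in> carrier A; b \<in> carrier A\<rbrakk> \<Longrightarrow> f (a \<oplus>\<^bsub>A\<^esub> b) = f a \<oplus>\<^bsub>B\<^esub> f b"
    "\<And>a b. \<lbrakk>a \<in> carrier A; b \<in> carrier A\<rbrakk> \<Longrightarrow> f (a \<otimes>\<^bsub>A\<^esub> b) = f a \<otimes>\<^bsub>B\<^esub> f b"
    "f \<one>\<^bsub>A\<^esub> = \<one>\<^bsub>B\<^esub>"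
    "\<And>a c. a \<in> carrier A \<Longrightarrow> f (c \<odot>\<^bsub>A\<^esub> a) = c \<odot>\<^bsub>B\<^esub> f a"
    "\<And>a. a \<in> carrier A \<Longrightarrow> f (adj A a) = adj B (f a)"
    "\<And>a. a \<in> carrier A \<Longrightarrow> cnorm B (f a) \<le> cnorm A a"
    "f \<in> extensional (carrier A)"
  shows "f \<in> star_hom A B"
  using assms unfolding star_hom_def by (auto intro!: ring_hom_memI)

lemma star_hom_compose:
  assumes "cstar_algebra A" "f \<in> star_hom A B" "g \<in> star_hom B C"
  shows "compose (carrier A) g f \<in> star_hom A C"
proof -
  interpret cstar_algebra A by fact
  note f = star_homD[OF assms(2)] and g = star_homD[OF assms(3)]
  show ?thesis
    by (rule star_homI)
      (auto simp: compose_def f g intro!: order_trans[OF g(8) f(8)])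
qed

lemma star_hom_zero:
  assumes "cstar_algebra A" "cstar_algebra B" "f \<in> star_hom A B" shows "f \<zero>\<^bsub>A\<^esub> = \<zero>\<^bsub>B\<^esub>"
proof -
  interpret A: cstar_algebra A by fact
  interpret B: cstar_algebra B by fact
  show ?thesis using star_homD(6)[OF assms(3), of "\<zero>\<^bsub>A\<^esub>" 0] star_homD(2)[OF assms(3)] by simp
qed

lemma star_hom_diff:
  assumes "cstar_algebra A" "cstar_algebra B" "f \<in> star_hom A B" "a \<in> carrier A" "b \<in> carrier A"
  shows "f (a \<ominus>\<^bsub>A\<^esub> b) = f a \<ominus>\<^bsub>B\<^esub> f b"
proof -
  interpret A: cstar_algebra A by fact
  interpret B: cstar_algebra B by fact
  show ?thesis using assms star_homD[OF assms(3)] by (simp add: A.diff_eq_smult B.diff_eq_smult)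
qed

lemma star_hom_finsum:
  assumes "cstar_algebra A" "cstar_algebra B" "f \<in> star_hom A B" "\<And>i. i \<in> I \<Longrightarrow> h i \<in> carrier A"
  shows "f (finsum A h I) = (\<Oplus>\<^bsub>B\<^esub>i\<in>I. f (h i))"
proof -
  interpret A: cstar_algebra A by fact
  interpret B: cstar_algebra B by fact
  show ?thesis using assms(4)
    by (induct I rule: infinite_finite_induct)
      (auto simp: star_hom_zero[OF assms(1-3)] star_homD[OF assms(3)] Pi_def)
qed

text \<open>Contractivity is a clause of \<open>star_hom\<close>, so continuity is immediate; it
  carries every later extension of an identity from generators to the closure.\<close>

lemma star_hom_conv:
  assumes "cstar_algebra A" "cstar_algebra B" "f \<in> star_hom A B" "cstar_algebra.conv A s a"
  shows "cstar_algebra.conv B (\<lambda>n. f (s n)) (f a)"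
proof -
  interpret A: cstar_algebra A by fact
  interpret B: cstar_algebra B by fact
  note f = star_homD[OF assms(3)]
  show ?thesis
  proof (rule B.convI)
    show "cnorm B (f (s n) \<ominus>\<^bsub>B\<^esub> f a) \<le> cnorm A (s n \<ominus>\<^bsub>A\<^esub> a)" for n
      using assms(4) f(8)[of "s n \<ominus>\<^bsub>A\<^esub> a"] by (auto simp: A.conv_def star_hom_diff[OF assms(1-3)])
    show "(\<lambda>n. cnorm A (s n \<ominus>\<^bsub>A\<^esub> a)) \<longlonglongrightarrow> 0" using assms(4) by (simp add: A.conv_def)
  qed (use assms(4) f in \<open>auto simp: A.conv_def\<close>)
qed

section \<open>Orthogonality of projections with sum one\<close>

context cstar_algebra
begin

lemma finsum_const_smult: "\<lbrakk>finite I; a \<in> carrier A\<rbrakk> \<Longrightarrow> (\<Oplus>i\<in>I. a) = of_nat (card I) \<odot> a"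
  by (induct I rule: finite_induct) (auto simp: smult_add_left Pi_def)

text \<open>The unit of a corner is an extreme point of the unit ball.  Spectral theory is avoided: for
  \<open>m = 0\<close> the following bound reads \<open>n \<parallel>z\<parallel> \<le> \<surd>n\<close> for all \<open>n\<close>.\<close>

lemma corner_norm_bound:
  assumes p: "p \<in> carrier A" "p \<otimes> p = p" "cnorm A p \<le> 1"
    and z: "z \<in> carrier A" "p \<otimes> z = z" "z \<otimes> p = z"
    and le: "cnorm A (p \<oplus> z) \<le> 1" "cnorm A (p \<oplus> (-1) \<odot> z) \<le> 1"
  shows "cnorm A (complex_of_real m \<odot> p \<oplus> of_nat n \<odot> z) \<le> sqrt (m\<^sup>2 + n)"
proof (induct n arbitrary: m)
  case 0
  then show ?case using p z by (simp add: mult_left_le)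
next
  case (Suc n)
  \<comment> \<open>\<open>L a b c\<close> is a p + b z + c z^2. In the average of (p + z)((m + 1) p
    + n z) and (p - z)((m - 1) p + n z) the z^2 terms cancel and m p + (n + 1) z remains, so one
    more z is traded for the shifts m + 1 and m - 1.\<close>
  define L where "L a b c = a \<odot> p \<oplus> (b \<odot> z \<oplus> c \<odot> (z \<otimes> z))" for a b c
  define u where "u m = complex_of_real m \<odot> p \<oplus> of_nat n \<odot> z" for m
  have u: "u m \<in> carrier A" for m using p z by (simp add: u_def)
  have L_add: "L a b c \<oplus> L a' b' c' = L (a + a') (b + b') (c + c')" for a b c a' b' c'
    using p z by (simp add: L_def smult_add_left add_add_swap)
  have L_smult: "d \<odot> L a b c = L (d * a) (d * b) (d * c)" for a b c d
    using p z by (simp add: L_def smult_add_right)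
  have mult: "(p \<oplus> e \<odot> z) \<otimes> (a \<odot> p \<oplus> b \<odot> z) = L a (b + e * a) (e * b)" for a b e
  proof -
    have "(p \<oplus> e \<odot> z) \<otimes> (a \<odot> p \<oplus> b \<odot> z)
        = (a \<odot> p \<oplus> b \<odot> z) \<oplus> ((e * a) \<odot> z \<oplus> (e * b) \<odot> (z \<otimes> z))"
      using p z by (subst l_distr) (simp_all add: r_distr smult_add_right mult.commute)
    then show ?thesis using p z by (simp add: L_def smult_add_left a_assoc)
  qed
  have eq: "complex_of_real m \<odot> p \<oplus> of_nat (Suc n) \<odot> z
      = (1/2) \<odot> ((p \<oplus> 1 \<odot> z) \<otimes> u (m + 1) \<oplus> (p \<oplus> (-1) \<odot> z) \<otimes> u (m - 1))"
    unfolding u_def mult L_add L_smult using p z by (simp add: L_def algebra_simps add_divide_distrib)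
  have step: "cnorm A (v \<otimes> u m') \<le> sqrt (m'\<^sup>2 + n)" if "v \<in> carrier A" "cnorm A v \<le> 1" for v m'
    using mult_mono[OF that(2) Suc[of m', folded u_def]] that norm_mult[of v "u m'"] u[of m'] by simp
  have "cnorm A (complex_of_real m \<odot> p \<oplus> of_nat (Suc n) \<odot> z)
      \<le> (1/2) * (1 * sqrt ((m + 1)\<^sup>2 + n) + 1 * sqrt ((m - 1)\<^sup>2 + n))"
    unfolding eq using p z u le
    by (auto intro!: order_trans[OF norm_add] add_mono step)
  also have "\<dots> \<le> sqrt (m\<^sup>2 + Suc n)"
  proof (rule real_le_rsqrt)
    \<comment> \<open>The average of \<open>a\<close> and \<open>b\<close> is at most their
      quadratic mean, and a^2 + b^2 = 2 (m^2 + n + 1). The bound sqrt(m^2 + n) is the root mean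
      square of m plus a sum of n independent signs.\<close>
    define a b where "a = sqrt ((m + 1)\<^sup>2 + n)" and "b = sqrt ((m - 1)\<^sup>2 + n)"
    have "a\<^sup>2 = (m + 1)\<^sup>2 + n" "b\<^sup>2 = (m - 1)\<^sup>2 + n" by (simp_all add: a_def b_def)
    then have "a\<^sup>2 + b\<^sup>2 = 2 * (m\<^sup>2 + Suc n)" by (simp add: power2_eq_square algebra_simps)
    moreover have "((1/2) * (1 * a + 1 * b))\<^sup>2 \<le> (a\<^sup>2 + b\<^sup>2) / 2"
      using sum_squares_bound[of a b] by (simp add: power2_eq_square algebra_simps)
    ultimately show "((1/2) * (1 * a + 1 * b))\<^sup>2 \<le> m\<^sup>2 + Suc n" by simp
  qed
  finally show ?case .
qed

lemma corner_extreme: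
  assumes p: "p \<in> carrier A" "p \<otimes> p = p" "cnorm A p \<le> 1"
    and z: "z \<in> carrier A" "p \<otimes> z = z" "z \<otimes> p = z"
    and le: "cnorm A (p \<oplus> z) \<le> 1" "cnorm A (p \<oplus> (-1) \<odot> z) \<le> 1"
  shows "z = \<zero>"
proof -
  have *: "real n * cnorm A z \<le> sqrt n" for n
    using corner_norm_bound[OF assms, of 0 n] p z by simp
  have "cnorm A z \<le> 0"
  proof (rule ccontr)
    assume "\<not> cnorm A z \<le> 0"
    then have pos: "cnorm A z > 0" by simp
    obtain n :: nat where n: "1 / (cnorm A z)\<^sup>2 < n" using reals_Archimedean2 by blast
    have "n > 0" using n pos by (cases n) (auto simp: zero_less_divide_iff not_less)
    have "(real n * cnorm A z)\<^sup>2 \<le> (sqrt n)\<^sup>2" using *[of n] pos by (intro power_mono) auto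
    then have "real n * (cnorm A z)\<^sup>2 \<le> 1" using \<open>n > 0\<close> by (simp add: power2_eq_square mult_ac)
    with n pos show False by (simp add: divide_less_eq)
  qed
  with z show ?thesis by (intro norm_eq_zero) (auto intro: antisym)
qed

definition projection :: "'a \<Rightarrow> bool" where
  "projection p \<longleftrightarrow> p \<in> carrier A \<and> adj A p = p \<and> p \<otimes> p = p"

lemma projection_norm: "projection p \<Longrightarrow> cnorm A p \<le> 1"
  using norm_cstar[of p] by (auto simp: projection_def power2_eq_square)

text \<open>The compressions y_k = p_i p_k p_i have total p_i, and y_i = p_i, so those with k
  \<noteq> i add up to 0. Positivity would make each of them vanish; instead a multiple of y_j is
  shown to be both addable to and subtractable from p_i within the unit ball of the corner, and
  \<open>corner_extreme\<close> applies. The C*-identity turns y_j = 0 into p_j p_i = 0.\<close>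

lemma projections_sum_one_orthogonal:
  assumes I: "finite I" "\<And>i. i \<in> I \<Longrightarrow> projection (p i)" and one: "finsum A p I = \<one>"
    and ij: "i \<in> I" "j \<in> I" "i \<noteq> j"
  shows "p j \<otimes> p i = \<zero>"
proof -
  have [simp]: "p k \<in> carrier A" "adj A (p k) = p k" "p k \<otimes> p k = p k" if "k \<in> I" for k
    using I(2)[OF that] by (auto simp: projection_def)
  have idem [simp]: "p k \<otimes> (p k \<otimes> a) = p k \<otimes> a" if "k \<in> I" "a \<in> carrier A" for k a
    using that by (simp flip: m_assoc)
  define y where "y k = p i \<otimes> (p k \<otimes> p i)" for k
  have y [simp]: "y k \<in> carrier A" "p i \<otimes> y k = y k" "y k \<otimes> p i = y k" if "k \<in> I" for k
    using that ij by (simp_all add: y_def m_assoc)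
  define K where "K = I - {i, j}"
  have K: "finite K" "K \<subseteq> I" "i \<notin> K" "j \<notin> K" "I = insert i (insert j K)" using I ij by (auto simp: K_def)
  have "(\<Oplus>k\<in>I. y k) = p i \<otimes> (finsum A p I \<otimes> p i)"
    using I ij by (simp add: y_def finsum_mult_left finsum_mult_right)
  also have "\<dots> = p i" using one ij by simp
  finally have "(\<Oplus>k\<in>I. y k) = p i" .
  moreover have "(\<Oplus>k\<in>I. y k) = p i \<oplus> (y j \<oplus> (\<Oplus>k\<in>K. y k))"
  proof -
    have "y i = p i" using ij by (simp add: y_def)
    moreover have "y k \<in> carrier A" if "k \<in> K" for k using that K by auto
    ultimately show ?thesis unfolding K(5) using K(1,3,4) ij by (simp add: Pi_def)
  qed
  ultimately have "p i \<oplus> (y j \<oplus> (\<Oplus>k\<in>K. y k)) = p i \<oplus> \<zero>"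
    using ij by simp
  moreover have yK: "(\<Oplus>k\<in>K. y k) \<in> carrier A" using K by (intro finsum_in) auto
  ultimately have "y j \<oplus> (\<Oplus>k\<in>K. y k) = \<zero>"
    using ij by (metis r_neg1 a_closed y(1) \<open>\<And>k. k \<in> I \<Longrightarrow> p k \<in> carrier A\<close> zero_closed)
  then have "\<ominus> y j = (\<Oplus>k\<in>K. y k)"
    using ij yK by (intro minus_equality) (auto simp: a_comm)
  then have yj: "(\<Oplus>k\<in>K. y k) = (-1) \<odot> y j"
    using ij by (simp add: minus_eq_smult)
  \<comment> \<open>The reflection r = 1 - 2 p_k is a self-adjoint unitary, so its compression p_i -
    2 y_k is a contraction.\<close>
  have refl: "cnorm A (p i \<oplus> (-2) \<odot> y k) \<le> 1" if "k \<in> I" for k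
  proof -
    define r where "r = \<one> \<oplus> (-2) \<odot> p k"
    have r: "r \<in> carrier A" using that by (simp add: r_def)
    have "adj A r \<otimes> r = \<one> \<oplus> ((-2) \<odot> p k \<oplus> ((-2) \<odot> p k \<oplus> 4 \<odot> p k))"
      using that by (simp add: r_def l_distr r_distr a_assoc smult_add_right)
    also have "\<dots> = \<one>" using that by (simp flip: smult_add_left)
    finally have nr: "cnorm A r \<le> 1" using norm_isometry_le[OF r] norm_one_le by simp
    have "p i \<oplus> (-2) \<odot> y k = p i \<otimes> (r \<otimes> p i)"
      using that ij by (simp add: r_def y_def l_distr r_distr)
    also have "cnorm A \<dots> \<le> 1 * (1 * 1)"
      using ij r nr projection_norm[OF I(2)]
      by (intro order_trans[OF norm_mult] mult_mono) auto
    finally show ?thesis by simp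
  qed
  \<comment> \<open>\<open>m\<close> counts the contractions averaged below: p_i itself and p_i - 2
    y_k for each k in \<open>K\<close>. As the y_k over \<open>K\<close> sum to - y_j, the average
    is p_i + (2/m) y_j, which dictates the factor in \<open>z\<close>. The other bound holds because
    p_i - z is a convex combination of p_i and p_i - 2 y_j, with weight 1/m on the latter.\<close>
  define m where "m = Suc (card K)"
  define z where "z = (2 / of_nat m) \<odot> y j"
  have m: "1 \<le> real m" "m > 0" by (auto simp: m_def)
  have "z = \<zero>"
  proof (rule corner_extreme[of "p i"])
    have sc: "cnorm A (of_real a \<odot> v) \<le> a" if "v \<in> carrier A" "cnorm A v \<le> 1" "0 \<le> a" for a v
      using that by (simp add: mult_left_le)
    have mc: "1 + complex_of_nat (card K) = of_nat m" by (simp add: m_def)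
    have comb: "a \<odot> p i \<oplus> b \<odot> (p i \<oplus> (-2) \<odot> y j) = (a + b) \<odot> p i \<oplus> (- 2 * b) \<odot> y j" for a b
      using ij by (simp add: smult_add_right smult_add_left a_assoc mult.commute)
    have "p i \<oplus> (-1) \<odot> z = (of_real (1 - 1 / m)) \<odot> p i \<oplus> (of_real (1 / m)) \<odot> (p i \<oplus> (-2) \<odot> y j)"
      using ij comb[of "of_real (1 - 1 / m)" "of_real (1 / m)"] by (simp add: z_def)
    also have "cnorm A \<dots> \<le> (1 - 1 / m) + (1 / m)"
      using ij refl[of j] projection_norm[OF I(2), of i] m
      by (intro order_trans[OF norm_add add_mono[OF sc sc]]) auto
    finally show "cnorm A (p i \<oplus> (-1) \<odot> z) \<le> 1" by simp
    have "(\<Oplus>k\<in>K. p i \<oplus> (-2) \<odot> y k) = of_nat (card K) \<odot> p i \<oplus> (-2) \<odot> (\<Oplus>k\<in>K. y k)"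
      using K ij by (subst finsum_addf) (auto simp: finsum_const_smult smult_finsum subset_eq Pi_def)
    then have "p i \<oplus> (\<Oplus>k\<in>K. p i \<oplus> (-2) \<odot> y k) = (1 + of_nat (card K)) \<odot> p i \<oplus> 2 \<odot> y j"
      using K ij by (simp add: yj smult_add_left a_assoc)
    then have "p i \<oplus> z = (1 / of_nat m) \<odot> (p i \<oplus> (\<Oplus>k\<in>K. p i \<oplus> (-2) \<odot> y k))"
      using ij m mc by (simp add: z_def smult_add_right)
    also have "cnorm A \<dots> \<le> 1 / m * (1 + (\<Sum>k\<in>K. 1))"
    proof -
      have "cnorm A (p i \<oplus> (\<Oplus>k\<in>K. p i \<oplus> (-2) \<odot> y k)) \<le> 1 + (\<Sum>k\<in>K. 1)"
      proof -
        have c: "p i \<oplus> (-2) \<odot> y k \<in> carrier A" if "k \<in> K" for k using that K ij by auto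
        have "cnorm A (\<Oplus>k\<in>K. p i \<oplus> (-2) \<odot> y k) \<le> (\<Sum>k\<in>K. 1)"
          by (rule order_trans[OF norm_finsum sum_mono]) (use c K refl in auto)
        with norm_add[of "p i" "\<Oplus>k\<in>K. p i \<oplus> (-2) \<odot> y k"] projection_norm[OF I(2), of i] c ij
        show ?thesis by fastforce
      qed
      then show ?thesis using K ij m by (subst norm_smult) (auto simp: norm_divide divide_right_mono subset_eq)
    qed
    finally show "cnorm A (p i \<oplus> z) \<le> 1" using m by (simp add: m_def)
  qed (use ij projection_norm[OF I(2)] in \<open>auto simp: z_def\<close>)
  then have "(of_nat m / 2) \<odot> z = \<zero>" by simp
  then have "y j = \<zero>" using ij m by (simp add: z_def)
  then have "adj A (p j \<otimes> p i) \<otimes> (p j \<otimes> p i) = \<zero>" using ij by (simp add: y_def m_assoc)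
  then show ?thesis using norm_cstar[of "p j \<otimes> p i"] ij by (simp add: norm_eq_zero)
qed

end

section \<open>Noncommutative *-polynomials\<close>

lemma free_on_zero [simp]: "0 \<in> free_on X"
  by (simp add: free_on_def)

lemma free_on_single: "fst ` set (letters w) \<subseteq> X \<Longrightarrow> Poly_Mapping.single w c \<in> free_on X"
  by (simp add: free_on_def)

lemma free_on_one [simp]: "1 \<in> free_on X"
  by (simp add: free_on_def zero_star_word_def)

lemma free_on_add [simp]: "\<lbrakk>p \<in> free_on X; q \<in> free_on X\<rbrakk> \<Longrightarrow> p + q \<in> free_on X"
  using keys_add[of p q] by (fastforce simp: free_on_def)

lemma free_on_mult [simp]: "\<lbrakk>p \<in> free_on X; q \<in> free_on X\<rbrakk> \<Longrightarrow> p * q \<in> free_on X"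
  using keys_mult[of p q] by (fastforce simp: free_on_def plus_star_word_def)

lemma free_on_gen [simp]: "free_gen g \<in> free_on X \<longleftrightarrow> g \<in> X"
  by (simp add: free_on_def free_gen_def)

lemma free_on_scale [simp]: "p \<in> free_on X \<Longrightarrow> free_scale c p \<in> free_on X"
  by (simp add: free_scale_def free_on_single zero_star_word_def)

lemma free_on_sum [simp]: "(\<And>i. i \<in> I \<Longrightarrow> f i \<in> free_on X) \<Longrightarrow> sum f I \<in> free_on X"
  by (induct I rule: infinite_finite_induct) auto

lemma free_scale_uminus: "- p = free_scale (-1) p"
  by (simp add: free_scale_def single_uminus)

lemma free_on_uminus [simp]: "p \<in> free_on X \<Longrightarrow> - p \<in> free_on X"
  by (simp add: free_scale_uminus)

lemma free_on_diff [simp]: "\<lbrakk>p \<in> free_on X; q \<in> free_on X\<rbrakk> \<Longrightarrow> p - q \<in> free_on X"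
  using free_on_add[of p X "- q"] by simp

lemma free_on_induct [consumes 1, case_names single add]:
  assumes p: "p \<in> free_on X"
    and single: "\<And>w c. fst ` set (letters w) \<subseteq> X \<Longrightarrow> P (Poly_Mapping.single w c)"
    and add: "\<And>p q. \<lbrakk>p \<in> free_on X; q \<in> free_on X; P p; P q\<rbrakk> \<Longrightarrow> P (p + q)"
  shows "P p"
proof -
  have "(\<Sum>w\<in>W. Poly_Mapping.single w (Poly_Mapping.lookup p w)) \<in> free_on X \<and> P (\<Sum>w\<in>W. Poly_Mapping.single w (Poly_Mapping.lookup p w))"
    if "finite W" "W \<subseteq> Poly_Mapping.keys p" for W
    using that
  proof (induct W rule: finite_induct)
    case empty
    then show ?case using single[of 0 0] by (simp add: zero_star_word_def)
  next
    case (insert w W)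
    then have "fst ` set (letters w) \<subseteq> X" using p by (auto simp: free_on_def)
    from free_on_single[OF this] single[OF this] insert show ?case by (simp add: add)
  qed
  from this[of "Poly_Mapping.keys p"] have "P (\<Sum>w\<in>Poly_Mapping.keys p. Poly_Mapping.single w (Poly_Mapping.lookup p w))" by simp
  also have "(\<Sum>w\<in>Poly_Mapping.keys p. Poly_Mapping.single w (Poly_Mapping.lookup p w)) = p"
    by (rule poly_mapping_eqI) (auto simp: lookup_sum lookup_single when_def in_keys_iff)
  finally show ?thesis .
qed

lemma word_adj_adj [simp]: "word_adj (word_adj w) = w"
  by (cases w) (simp add: word_adj_def rev_map comp_def case_prod_unfold)

text \<open>Since \<open>word_adj\<close> is an involution, exactly one word contributes to each
  coefficient. The additive and involutive laws of \<open>free_adj\<close> then become pointwise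
  identities.\<close>

lemma lookup_free_adj: "Poly_Mapping.lookup (free_adj p) w = cnj (Poly_Mapping.lookup p (word_adj w))"
proof -
  have "Poly_Mapping.lookup (free_adj p) w
      = (\<Sum>v\<in>Poly_Mapping.keys p. if v = word_adj w then cnj (Poly_Mapping.lookup p v) else 0)"
    unfolding free_adj_def lookup_sum by (rule sum.cong) (auto simp: lookup_single when_def)
  then show ?thesis by (auto simp: in_keys_iff)
qed

lemma free_adj_add: "free_adj (p + q) = free_adj p + free_adj q"
  by (rule poly_mapping_eqI) (simp add: lookup_free_adj lookup_add)

lemma free_adj_single: "free_adj (Poly_Mapping.single w c) = Poly_Mapping.single (word_adj w) (cnj c)"
  by (rule poly_mapping_eqI) (auto simp: lookup_free_adj lookup_single when_def)

lemma free_adj_adj [simp]: "free_adj (free_adj p) = p"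
  by (rule poly_mapping_eqI) (simp add: lookup_free_adj)

lemma free_adj_uminus: "free_adj (- p) = - free_adj p"
  by (rule poly_mapping_eqI) (simp add: lookup_free_adj)

lemma free_adj_diff: "free_adj (p - q) = free_adj p - free_adj q"
  using free_adj_add[of p "- q"] by (simp add: free_adj_uminus)

lemma free_on_adj [simp]: "p \<in> free_on X \<Longrightarrow> free_adj p \<in> free_on X"
proof (induct p rule: free_on_induct)
  case (single w c)
  then have "fst ` set (letters (word_adj w)) \<subseteq> X" by (force simp: word_adj_def)
  then show ?case by (simp add: free_adj_single free_on_single)
qed (simp add: free_adj_add)

lemma free_on_UNIV [simp]: "p \<in> free_on UNIV"
  by (simp add: free_on_def)

lemma word_adj_plus: "word_adj (v + w) = word_adj w + word_adj v"
  by (simp add: word_adj_def plus_star_word_def)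

lemma free_adj_mult: "free_adj (p * q) = free_adj q * free_adj p"
proof -
  have "free_adj (Poly_Mapping.single w c * q) = free_adj q * free_adj (Poly_Mapping.single w c)" for w c
    using free_on_UNIV[of q]
    by (induct q rule: free_on_induct)
      (simp_all add: mult_single free_adj_single word_adj_plus mult.commute free_adj_add distrib_left distrib_right)
  note * = this
  show ?thesis using free_on_UNIV[of p]
    by (induct p rule: free_on_induct) (simp_all add: * free_adj_add distrib_left distrib_right)
qed

lemma free_adj_scale: "free_adj (free_scale c p) = free_scale (cnj c) (free_adj p)"
  using free_on_UNIV[of p] unfolding free_scale_def
  by (induct p rule: free_on_induct)
    (simp_all add: mult_single free_adj_single free_adj_add distrib_left)

lemma free_scale_simps:
  "free_scale c (p + q) = free_scale c p + free_scale c q"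
  "free_scale c (p - q) = free_scale c p - free_scale c q"
  "free_scale (c + d) p = free_scale c p + free_scale d p"
  "free_scale c (free_scale d p) = free_scale (c * d) p"
  "free_scale 1 p = p" "free_scale 0 p = 0"
  "free_scale c p * q = free_scale c (p * q)"
  by (simp_all add: free_scale_def distrib_left distrib_right single_add right_diff_distrib
      mult_single mult.assoc[symmetric])

lemma free_scale_mult_right: "p * free_scale c q = free_scale c (p * q)"
proof -
  have "p * Poly_Mapping.single 0 c = Poly_Mapping.single 0 c * p"
    using free_on_UNIV[of p]
    by (induct p rule: free_on_induct) (simp_all add: mult_single distrib_left distrib_right mult.commute)
  then show ?thesis by (simp add: free_scale_def mult.assoc[symmetric])
qed

section \<open>Evaluation of *-polynomials in a C*-algebra\<close>

definition word_val :: "('a, 'm) cstar_scheme \<Rightarrow> ('g \<Rightarrow> 'a) \<Rightarrow> ('g \<times> bool) list \<Rightarrow> 'a" where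
  "word_val A x ls = foldr (\<lambda>(g, b) a. (if b then adj A (x g) else x g) \<otimes>\<^bsub>A\<^esub> a) ls \<one>\<^bsub>A\<^esub>"

definition ev :: "('a, 'm) cstar_scheme \<Rightarrow> ('g \<Rightarrow> 'a) \<Rightarrow> 'g free_star \<Rightarrow> 'a" where
  "ev A x p = (\<Oplus>\<^bsub>A\<^esub>w\<in>Poly_Mapping.keys p. Poly_Mapping.lookup p w \<odot>\<^bsub>A\<^esub> word_val A x (letters w))"

locale cstar_eval = cstar_algebra A for A :: "('a, 'm) cstar_scheme" (structure) +
  fixes X :: "'g set" and x :: "'g \<Rightarrow> 'a"
  assumes x_closed [simp]: "g \<in> X \<Longrightarrow> x g \<in> carrier A"
begin

lemma word_val_closed [simp]: "fst ` set ls \<subseteq> X \<Longrightarrow> word_val A x ls \<in> carrier A"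
  by (induct ls) (auto simp: word_val_def)

lemma word_val_append: "\<lbrakk>fst ` set ls \<subseteq> X; fst ` set ms \<subseteq> X\<rbrakk>
    \<Longrightarrow> word_val A x (ls @ ms) = word_val A x ls \<otimes> word_val A x ms"
proof (induct ls)
  case Nil
  then show ?case using word_val_closed[of ms] by (simp add: word_val_def)
next
  case (Cons l ls)
  then show ?case using word_val_closed[of ms] word_val_closed[of ls]
    by (auto simp: word_val_def m_assoc split: prod.splits)
qed

lemma word_val_adj: "fst ` set ls \<subseteq> X
    \<Longrightarrow> word_val A x (rev (map (\<lambda>(g, b). (g, \<not> b)) ls)) = adj A (word_val A x ls)"
proof (induct ls)
  case (Cons l ls)
  obtain g b where l: "l = (g, b)" by force
  have g: "g \<in> X" using Cons l by simp
  have "fst ` set (rev (map (\<lambda>(g, b). (g, \<not> b)) ls)) \<subseteq> X" using Cons by force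
  then show ?case using Cons g word_val_closed[of ls]
    by (subst list.map, subst rev.simps, subst word_val_append) (auto simp: l word_val_def)
qed (simp add: word_val_def)

text \<open>Cancellation can remove keys from a sum of polynomials, so sums over the keys of p, q
  and p + q do not range over the same words. A common finite superset lets the coefficients be
  added.\<close>

lemma ev_superset:
  assumes "finite S" "Poly_Mapping.keys p \<subseteq> S" "\<And>w. w \<in> S \<Longrightarrow> fst ` set (letters w) \<subseteq> X"
  shows "ev A x p = (\<Oplus>w\<in>S. Poly_Mapping.lookup p w \<odot> word_val A x (letters w))"
  unfolding ev_def
proof (rule finsum_subset[symmetric])
  show "Poly_Mapping.lookup p w \<odot> word_val A x (letters w) = \<zero>" if "w \<in> S - Poly_Mapping.keys p" for w
    using that word_val_closed[OF assms(3), of w] by (simp add: in_keys_iff)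
  show "Poly_Mapping.lookup p w \<odot> word_val A x (letters w) \<in> carrier A" if "w \<in> Poly_Mapping.keys p" for w
    using that assms(2) word_val_closed[OF assms(3), of w] by auto
qed (fact assms)+

lemma ev_closed [simp]: "p \<in> free_on X \<Longrightarrow> ev A x p \<in> carrier A"
  unfolding ev_def by (intro finsum_in) (auto simp: free_on_def)

lemma ev_single: "fst ` set (letters w) \<subseteq> X \<Longrightarrow> ev A x (Poly_Mapping.single w c) = c \<odot> word_val A x (letters w)"
  by (subst ev_superset[of "{w}"]) auto

lemma ev_add [simp]: assumes "p \<in> free_on X" "q \<in> free_on X"
  shows "ev A x (p + q) = ev A x p \<oplus> ev A x q"
proof -
  let ?S = "Poly_Mapping.keys p \<union> Poly_Mapping.keys q"
  have S: "\<And>w. w \<in> ?S \<Longrightarrow> fst ` set (letters w) \<subseteq> X" using assms by (auto simp: free_on_def)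
  have c: "word_val A x (letters w) \<in> carrier A" if "w \<in> ?S" for w
    using S[OF that] by (rule word_val_closed)
  have "ev A x (p + q) = (\<Oplus>w\<in>?S. Poly_Mapping.lookup p w \<odot> word_val A x (letters w)
      \<oplus> Poly_Mapping.lookup q w \<odot> word_val A x (letters w))"
    unfolding ev_superset[of ?S "p + q", OF _ keys_add S, simplified]
    by (rule finsum_eq) (auto simp: lookup_add smult_add_left c)
  also have "\<dots> = (\<Oplus>w\<in>?S. Poly_Mapping.lookup p w \<odot> word_val A x (letters w))
      \<oplus> (\<Oplus>w\<in>?S. Poly_Mapping.lookup q w \<odot> word_val A x (letters w))"
    using c by (intro finsum_addf) auto
  also have "\<dots> = ev A x p \<oplus> ev A x q"
    using ev_superset[of ?S p, OF _ _ S] ev_superset[of ?S q, OF _ _ S] by simp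
  finally show ?thesis .
qed

lemma ev_zero [simp]: "ev A x 0 = \<zero>"
  by (simp add: ev_def)

lemma ev_one [simp]: "ev A x 1 = \<one>"
proof -
  have "ev A x (Poly_Mapping.single 0 1) = \<one>"
    by (subst ev_single) (auto simp: zero_star_word_def word_val_def)
  then show ?thesis by simp
qed

lemma ev_gen [simp]: "g \<in> X \<Longrightarrow> ev A x (free_gen g) = x g"
  unfolding free_gen_def by (subst ev_single) (auto simp: word_val_def)

lemma ev_mult [simp]: assumes "p \<in> free_on X" "q \<in> free_on X"
  shows "ev A x (p * q) = ev A x p \<otimes> ev A x q"
proof -
  have *: "ev A x (Poly_Mapping.single w c * q) = ev A x (Poly_Mapping.single w c) \<otimes> ev A x q"
    if w: "fst ` set (letters w) \<subseteq> X" for w c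
    using assms(2)
  proof (induct q rule: free_on_induct)
    case (single v d)
    have "fst ` set (letters (w + v)) \<subseteq> X" using w single by (auto simp: plus_star_word_def)
    with w single show ?case
      by (simp add: mult_single ev_single word_val_append plus_star_word_def mult.commute)
  next
    case (add p q)
    with w free_on_single[OF w] show ?case by (simp add: distrib_left r_distr)
  qed
  show ?thesis using assms(1)
  proof (induct p rule: free_on_induct)
    case (add p p')
    then show ?case using assms(2) by (simp add: distrib_right l_distr)
  qed (rule *)
qed

lemma ev_scale [simp]: "p \<in> free_on X \<Longrightarrow> ev A x (free_scale c p) = c \<odot> ev A x p"
  unfolding free_scale_def by (subst ev_mult)
    (auto simp: free_on_single zero_star_word_def ev_single word_val_def)

lemma ev_uminus [simp]: "p \<in> free_on X \<Longrightarrow> ev A x (- p) = \<ominus> ev A x p"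
  by (simp add: free_scale_uminus minus_eq_smult)

lemma ev_diff [simp]: "\<lbrakk>p \<in> free_on X; q \<in> free_on X\<rbrakk> \<Longrightarrow> ev A x (p - q) = ev A x p \<ominus> ev A x q"
  using ev_add[of p "- q"] by (simp add: a_minus_def)

lemma ev_sum [simp]: "(\<And>i. i \<in> I \<Longrightarrow> f i \<in> free_on X) \<Longrightarrow> ev A x (sum f I) = (\<Oplus>i\<in>I. ev A x (f i))"
  by (induct I rule: infinite_finite_induct) (auto simp: Pi_def)

lemma ev_adj [simp]: "p \<in> free_on X \<Longrightarrow> ev A x (free_adj p) = adj A (ev A x p)"
proof (induct p rule: free_on_induct)
  case (single w c)
  then have "fst ` set (letters (word_adj w)) \<subseteq> X" by (force simp: word_adj_def)
  with single show ?case by (simp add: free_adj_single ev_single) (simp add: word_adj_def word_val_adj)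
qed (simp add: free_adj_add)

text \<open>This is how a concrete family enters the universal property: its pulled-back norm
  competes in the supremum that defines the universal seminorm.\<close>

lemma cstar_seminorm_ev: "cstar_seminorm X (\<lambda>p. cnorm A (ev A x p))"
  unfolding cstar_seminorm_def by (auto simp: norm_add norm_mult norm_cstar)

end

lemma free_adj_one [simp]: "free_adj (1 :: 'g free_star) = 1"
proof -
  have "word_adj (0 :: 'g star_word) = 0" by (simp add: word_adj_def zero_star_word_def)
  then show ?thesis using free_adj_single[of "0 :: 'g star_word" 1] by simp
qed

section \<open>Completion of a C*-seminorm\<close>

text \<open>The construction of \<open>univ_cstar\<close> with an arbitrary seminorm in place of the
  universal one; the theory of the completion uses only that the seminorm is a C*-seminorm.\<close>

definition completion :: "'g set \<Rightarrow> ('g free_star \<Rightarrow> real) \<Rightarrow> 'g univ_elem cstar" where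
  "completion X N =
     (let C = cauchy_ring X N; I = null_ideal X N; Q = C Quot I in
      \<lparr>carrier = carrier Q, mult = mult Q, one = one Q, zero = zero Q, add = add Q,
       smult = (\<lambda>c S. \<Union>s\<in>S. I +>\<^bsub>C\<^esub> (\<lambda>n. free_scale c (s n))),
       adj = (\<lambda>S. (\<lambda>s n. free_adj (s n)) ` S),
       cnorm = (\<lambda>S. THE r. \<exists>s\<in>S. (\<lambda>n. N (s n)) \<longlonglongrightarrow> r)\<rparr>)"

lemma univ_cstar_completion: "univ_cstar X R = completion X (universal_seminorm X R)"
  by (simp add: univ_cstar_def completion_def Let_def)

locale seminormed =
  fixes X :: "'g set" and N :: "'g free_star \<Rightarrow> real"
  assumes seminorm: "cstar_seminorm X N"
begin

lemma N_add: "\<lbrakk>p \<in> free_on X; q \<in> free_on X\<rbrakk> \<Longrightarrow> N (p + q) \<le> N p + N q"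
  and N_mult: "\<lbrakk>p \<in> free_on X; q \<in> free_on X\<rbrakk> \<Longrightarrow> N (p * q) \<le> N p * N q"
  and N_scale [simp]: "p \<in> free_on X \<Longrightarrow> N (free_scale c p) = cmod c * N p"
  and N_nonneg [simp]: "p \<in> free_on X \<Longrightarrow> 0 \<le> N p"
  and N_cstar: "p \<in> free_on X \<Longrightarrow> N (free_adj p * p) = (N p)\<^sup>2"
  using seminorm unfolding cstar_seminorm_def by blast+

lemma N_zero [simp]: "N 0 = 0"
  using N_scale[of 0 0] by (simp add: free_scale_def)

lemma N_uminus [simp]: "p \<in> free_on X \<Longrightarrow> N (- p) = N p"
  by (simp add: free_scale_uminus)

lemma N_diff_commute: "\<lbrakk>p \<in> free_on X; q \<in> free_on X\<rbrakk> \<Longrightarrow> N (p - q) = N (q - p)"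
  using N_uminus[of "p - q"] by simp

lemma N_diff: "\<lbrakk>p \<in> free_on X; q \<in> free_on X\<rbrakk> \<Longrightarrow> N (p - q) \<le> N p + N q"
  using N_add[of p "- q"] by simp

lemma N_triangle: "\<lbrakk>p \<in> free_on X; q \<in> free_on X; r \<in> free_on X\<rbrakk> \<Longrightarrow> N (p - r) \<le> N (p - q) + N (q - r)"
  using N_add[of "p - q" "q - r"] by simp

lemma N_diff_abs: "\<lbrakk>p \<in> free_on X; q \<in> free_on X\<rbrakk> \<Longrightarrow> \<bar>N p - N q\<bar> \<le> N (p - q)"
  using N_triangle[of p q 0] N_triangle[of q p 0] N_diff_commute[of p q] by auto

lemma N_one_le: "N 1 \<le> 1"
  using N_cstar[of 1] by (auto simp: power2_eq_square)

lemma N_adj [simp]: assumes "p \<in> free_on X" shows "N (free_adj p) = N p"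
proof -
  have "N q \<le> N (free_adj q)" if q: "q \<in> free_on X" for q
  proof (cases "N q = 0")
    case False
    have "N q * N q \<le> N (free_adj q) * N q"
      using N_cstar[OF q] N_mult[of "free_adj q" q] q by (simp add: power2_eq_square)
    then show ?thesis using False N_nonneg[OF q] by simp
  qed (use q in simp)
  from this[of p] this[of "free_adj p"] assms show ?thesis by simp
qed

definition Cau :: "(nat \<Rightarrow> 'g free_star) \<Rightarrow> bool" where
  "Cau s \<longleftrightarrow> (\<forall>n. s n \<in> free_on X) \<and> (\<forall>e>0. \<exists>M. \<forall>m\<ge>M. \<forall>n\<ge>M. N (s m - s n) < e)"

definition Nul :: "(nat \<Rightarrow> 'g free_star) \<Rightarrow> bool" where
  "Nul s \<longleftrightarrow> (\<forall>n. s n \<in> free_on X) \<and> (\<lambda>n. N (s n)) \<longlonglongrightarrow> 0"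

lemma Cau_in [simp]: "Cau s \<Longrightarrow> s n \<in> free_on X"
  by (simp add: Cau_def)

lemma Nul_in [simp]: "Nul s \<Longrightarrow> s n \<in> free_on X"
  by (simp add: Nul_def)

lemma NulI: assumes "\<And>n. s n \<in> free_on X" "\<And>n. N (s n) \<le> h n" "h \<longlonglongrightarrow> 0" shows "Nul s"
  unfolding Nul_def using assms
  by (auto intro!: tendsto_sandwich[OF _ _ tendsto_const assms(3)] always_eventually)

text \<open>One Lipschitz estimate serves all operations: sums have constants 1, scalar multiples
  \<open>cmod c\<close>, and products the norm bound of the other factor.\<close>

lemma CauI:
  assumes "\<And>n. s n \<in> free_on X" "\<And>m n. N (s m - s n) \<le> K * N (t m - t n) + L * N (u m - u n)"
    and "Cau t" "Cau u" "0 \<le> K" "0 \<le> L"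
  shows "Cau s"
  unfolding Cau_def
proof (intro conjI allI impI)
  fix e :: real assume e: "e > 0"
  \<comment> \<open>The summand 1 keeps the denominator positive when both constants are 0.\<close>
  define d where "d = e / (K + L + 1)"
  have d0: "d > 0" using e assms(5,6) by (simp add: d_def)
  have "(K + L + 1) * d = e" using assms(5,6) by (simp add: d_def)
  with d0 have d: "d > 0" "K * d + L * d < e" by (auto simp: algebra_simps)
  obtain M1 where M1: "\<And>m n. m \<ge> M1 \<Longrightarrow> n \<ge> M1 \<Longrightarrow> N (t m - t n) < d" using assms(3) d(1) unfolding Cau_def by blast
  obtain M2 where M2: "\<And>m n. m \<ge> M2 \<Longrightarrow> n \<ge> M2 \<Longrightarrow> N (u m - u n) < d" using assms(4) d(1) unfolding Cau_def by blast
  have "N (s m - s n) < e" if "m \<ge> max M1 M2" "n \<ge> max M1 M2" for m n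
  proof -
    have "K * N (t m - t n) \<le> K * d" "L * N (u m - u n) \<le> L * d"
      using M1[of m n] M2[of m n] that assms(5,6) by (auto intro!: mult_left_mono)
    then show ?thesis using assms(2)[of m n] d(2) by linarith
  qed
  then show "\<exists>M. \<forall>m\<ge>M. \<forall>n\<ge>M. N (s m - s n) < e" by blast
qed (use assms in auto)

lemma Cau_const [simp]: "p \<in> free_on X \<Longrightarrow> Cau (\<lambda>_. p)"
  by (simp add: Cau_def)

lemma Cau_norm_convergent: assumes "Cau s" shows "convergent (\<lambda>n. N (s n))"
proof -
  have "Cauchy (\<lambda>n. N (s n))"
    unfolding Cauchy_def dist_real_def
    using assms N_diff_abs unfolding Cau_def by (meson le_less_trans)
  then show ?thesis by (rule Cauchy_convergent)
qed

lemma Cau_bounded: assumes "Cau s" obtains K where "0 \<le> K" "\<And>n. N (s n) \<le> K"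
proof -
  have "Bseq (\<lambda>n. N (s n))" using Cau_norm_convergent[OF assms] by (rule convergent_imp_Bseq)
  then obtain K where "K > 0" "\<And>n. norm (N (s n)) \<le> K" by (auto simp: Bseq_def)
  then show ?thesis by (intro that[of K]) (auto simp: abs_le_iff)
qed

lemma Cau_add [simp]: assumes "Cau s" "Cau t" shows "Cau (\<lambda>n. s n + t n)"
proof (rule CauI[OF _ _ assms, of _ 1 1])
  show "N (s m + t m - (s n + t n)) \<le> 1 * N (s m - s n) + 1 * N (t m - t n)" for m n
    using N_add[of "s m - s n" "t m - t n"] assms by (simp add: algebra_simps)
qed (use assms in auto)

lemma Cau_scale [simp]: assumes "Cau s" shows "Cau (\<lambda>n. free_scale c (s n))"
proof (rule CauI[OF _ _ assms assms, of _ "cmod c" 0])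
  show "N (free_scale c (s m) - free_scale c (s n)) \<le> cmod c * N (s m - s n) + 0 * N (s m - s n)" for m n
    using assms by (simp flip: free_scale_simps)
qed (use assms in auto)

lemma Cau_diff [simp]: "\<lbrakk>Cau s; Cau t\<rbrakk> \<Longrightarrow> Cau (\<lambda>n. s n - t n)"
  using Cau_add[OF _ Cau_scale, of s t "-1"] by (simp flip: free_scale_uminus)

lemma Cau_uminus [simp]: "Cau s \<Longrightarrow> Cau (\<lambda>n. - s n)"
  using Cau_scale[of s "-1"] by (simp flip: free_scale_uminus)

lemma Cau_adj [simp]: assumes "Cau s" shows "Cau (\<lambda>n. free_adj (s n))"
proof (rule CauI[OF _ _ assms assms, of _ 1 0])
  show "N (free_adj (s m) - free_adj (s n)) \<le> 1 * N (s m - s n) + 0 * N (s m - s n)" for m n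
    using assms by (simp flip: free_adj_diff)
qed (use assms in auto)

lemma Cau_mult [simp]: assumes "Cau s" "Cau t" shows "Cau (\<lambda>n. s n * t n)"
proof -
  obtain K where K: "0 \<le> K" "\<And>n. N (s n) \<le> K" by (rule Cau_bounded[OF assms(1)]) blast
  obtain L where L: "0 \<le> L" "\<And>n. N (t n) \<le> L" by (rule Cau_bounded[OF assms(2)]) blast
  show ?thesis
  proof (rule CauI[OF _ _ assms(1,2) L(1) K(1)])
    fix m n
    have "s m * t m - s n * t n = (s m - s n) * t m + s n * (t m - t n)" by (simp add: algebra_simps)
    also have "N \<dots> \<le> N (s m - s n) * N (t m) + N (s n) * N (t m - t n)"
      using assms by (intro order_trans[OF N_add] add_mono N_mult) auto
    also have "\<dots> \<le> L * N (s m - s n) + K * N (t m - t n)"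
      using K L assms by (subst mult.commute) (intro add_mono mult_right_mono, auto)
    finally show "N (s m * t m - s n * t n) \<le> L * N (s m - s n) + K * N (t m - t n)" .
  qed (use assms in auto)
qed

lemma Nul_add: assumes "Nul s" "Nul t" shows "Nul (\<lambda>n. s n + t n)"
proof (rule NulI)
  show "(\<lambda>n. N (s n) + N (t n)) \<longlonglongrightarrow> 0" using assms tendsto_add[of _ 0 _ _ 0] by (auto simp: Nul_def)
qed (use assms in \<open>auto intro: N_add\<close>)

lemma Nul_scale: assumes "Nul s" shows "Nul (\<lambda>n. free_scale c (s n))"
proof (rule NulI)
  show "(\<lambda>n. cmod c * N (s n)) \<longlonglongrightarrow> 0" using assms tendsto_mult[of "\<lambda>_. cmod c" "cmod c" _ _ 0] by (auto simp: Nul_def)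
qed (use assms in auto)

lemma Nul_uminus: "Nul s \<Longrightarrow> Nul (\<lambda>n. - s n)"
  using Nul_scale[of s "-1"] by (simp flip: free_scale_uminus)

lemma Nul_diff: "\<lbrakk>Nul s; Nul t\<rbrakk> \<Longrightarrow> Nul (\<lambda>n. s n - t n)"
  using Nul_add[OF _ Nul_uminus, of s t] by simp

lemma Nul_adj: "Nul s \<Longrightarrow> Nul (\<lambda>n. free_adj (s n))"
  by (simp add: Nul_def)

lemma Nul_mult: assumes "Cau s" "Nul t" shows "Nul (\<lambda>n. s n * t n)" "Nul (\<lambda>n. t n * s n)"
proof -
  obtain K where K: "0 \<le> K" "\<And>n. N (s n) \<le> K" by (rule Cau_bounded[OF assms(1)]) blast
  have lim: "(\<lambda>n. K * N (t n)) \<longlonglongrightarrow> 0" using assms(2) tendsto_mult[of "\<lambda>_. K" K _ _ 0] by (auto simp: Nul_def)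
  have "N (s n * t n) \<le> K * N (t n)" "N (t n * s n) \<le> K * N (t n)" for n
    using N_mult[of "s n" "t n"] N_mult[of "t n" "s n"] mult_right_mono[OF K(2)[of n], of "N (t n)"] assms
    by (auto simp: mult.commute)
  then show "Nul (\<lambda>n. s n * t n)" "Nul (\<lambda>n. t n * s n)"
    using assms by (auto intro!: NulI[OF _ _ lim])
qed

lemma Nul_Cau: assumes "Nul s" shows "Cau s"
  unfolding Cau_def
proof (intro conjI allI impI)
  fix e :: real assume "e > 0"
  then have "eventually (\<lambda>n. N (s n) < e / 2) sequentially"
    using assms by (intro order_tendstoD(2)[of _ 0]) (auto simp: Nul_def)
  then obtain M where "\<And>n. n \<ge> M \<Longrightarrow> N (s n) < e / 2" by (auto simp: eventually_sequentially)
  then have "N (s m - s n) < e" if "m \<ge> M" "n \<ge> M" for m n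
    using N_diff[of "s m" "s n"] that assms by (smt (verit) Nul_in field_sum_of_halves)
  then show "\<exists>M. \<forall>m\<ge>M. \<forall>n\<ge>M. N (s m - s n) < e" by blast
qed (use assms in auto)

definition cls :: "(nat \<Rightarrow> 'g free_star) \<Rightarrow> 'g univ_elem" where
  "cls s = null_ideal X N +>\<^bsub>cauchy_ring X N\<^esub> s"

lemma carrier_cauchy_ring: "s \<in> carrier (cauchy_ring X N) \<longleftrightarrow> Cau s"
  by (simp add: cauchy_ring_def Cau_def)

lemma in_null_ideal: "s \<in> null_ideal X N \<longleftrightarrow> Nul s"
  unfolding null_ideal_def mem_Collect_eq carrier_cauchy_ring
  using Nul_Cau[of s] by (auto simp only: Nul_def Cau_def)

lemma cls_conv: "cls s = {t. \<exists>h. Nul h \<and> t = (\<lambda>n. h n + s n)}"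
proof -
  have "h \<oplus>\<^bsub>cauchy_ring X N\<^esub> s = (\<lambda>n. h n + s n)" for h by (simp add: cauchy_ring_def)
  then show ?thesis unfolding cls_def a_r_coset_def' by (auto simp only: in_null_ideal UN_iff singleton_iff)
qed

lemma in_cls: assumes "Cau s" shows "t \<in> cls s \<longleftrightarrow> Cau t \<and> Nul (\<lambda>n. t n - s n)"
proof
  assume "t \<in> cls s"
  then obtain h where h: "Nul h" "t = (\<lambda>n. h n + s n)" by (auto simp: cls_conv)
  then show "Cau t \<and> Nul (\<lambda>n. t n - s n)" using assms Nul_Cau[OF h(1)] by simp
next
  assume "Cau t \<and> Nul (\<lambda>n. t n - s n)"
  moreover have "t = (\<lambda>n. (t n - s n) + s n)" by simp
  ultimately show "t \<in> cls s" unfolding cls_conv by blast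
qed

lemma cls_self: "Cau s \<Longrightarrow> s \<in> cls s"
  by (simp add: in_cls Nul_def)

lemma cls_eq_iff: assumes "Cau s" "Cau t" shows "cls s = cls t \<longleftrightarrow> Nul (\<lambda>n. s n - t n)"
proof
  assume "cls s = cls t"
  then show "Nul (\<lambda>n. s n - t n)" using cls_self[of s] assms by (simp add: in_cls)
next
  assume *: "Nul (\<lambda>n. s n - t n)"
  have "Nul (\<lambda>n. u n - t n) \<longleftrightarrow> Nul (\<lambda>n. u n - s n)" for u
    using Nul_add[OF _ *, of "\<lambda>n. u n - s n"] Nul_diff[OF _ *, of "\<lambda>n. u n - t n"] by auto
  then show "cls s = cls t" using assms by (auto simp: in_cls)
qed

abbreviation "Q \<equiv> completion X N"

lemma carrier_Q: "S \<in> carrier Q \<longleftrightarrow> (\<exists>s. Cau s \<and> S = cls s)"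
  by (auto simp: completion_def Let_def FactRing_def A_RCOSETS_def' carrier_cauchy_ring cls_def Bex_def
      simp flip: carrier_cauchy_ring)

lemma cls_in: "Cau s \<Longrightarrow> cls s \<in> carrier Q"
  unfolding carrier_Q by blast

lemma carrier_QE: assumes "S \<in> carrier Q" obtains s where "Cau s" "S = cls s"
  using assms carrier_Q by blast

lemma zero_Q: "\<zero>\<^bsub>Q\<^esub> = cls (\<lambda>_. 0)"
  by (auto simp: completion_def Let_def FactRing_def in_cls in_null_ideal Nul_Cau)

lemma one_Q: "\<one>\<^bsub>Q\<^esub> = cls (\<lambda>_. 1)"
  by (auto simp: completion_def Let_def FactRing_def cls_def cauchy_ring_def)

text \<open>The quotient defines products and scalar multiples as unions over representatives.
  Independence of the representative collapses such a union to one class, because classes are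
  nonempty.\<close>

lemma union_cls: assumes "Cau s" "\<And>t. t \<in> cls s \<Longrightarrow> f t = S" shows "(\<Union>t\<in>cls s. f t) = S"
  using assms cls_self[OF assms(1)] by auto

text \<open>Addition of cosets is elementwise, not a union of cosets, so both inclusions are needed;
  an element w of the target splits as (w - t) + t.\<close>

lemma add_Q: assumes "Cau s" "Cau t" shows "cls s \<oplus>\<^bsub>Q\<^esub> cls t = cls (\<lambda>n. s n + t n)"
proof -
  have "cls s \<oplus>\<^bsub>Q\<^esub> cls t = (\<Union>u\<in>cls s. \<Union>v\<in>cls t. {\<lambda>n. u n + v n})"
    by (simp add: completion_def Let_def FactRing_def set_add_def set_mult_def cauchy_ring_def)
  also have "\<dots> = cls (\<lambda>n. s n + t n)"
  proof (intro equalityI subsetI)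
    fix w assume "w \<in> (\<Union>u\<in>cls s. \<Union>v\<in>cls t. {\<lambda>n. u n + v n})"
    then obtain u v where uv: "Cau u" "Nul (\<lambda>n. u n - s n)" "Cau v" "Nul (\<lambda>n. v n - t n)"
      "w = (\<lambda>n. u n + v n)" using assms by (auto simp: in_cls)
    then show "w \<in> cls (\<lambda>n. s n + t n)"
      using Nul_add[OF uv(2,4)] assms by (simp add: in_cls algebra_simps)
  next
    fix w assume w: "w \<in> cls (\<lambda>n. s n + t n)"
    then have "(\<lambda>n. w n - t n) \<in> cls s" using assms by (simp add: in_cls algebra_simps)
    moreover have "w = (\<lambda>n. (w n - t n) + t n)" by simp
    ultimately show "w \<in> (\<Union>u\<in>cls s. \<Union>v\<in>cls t. {\<lambda>n. u n + v n})"
      using cls_self[OF assms(2)] by blast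
  qed
  finally show ?thesis .
qed

lemma mult_Q: assumes "Cau s" "Cau t" shows "cls s \<otimes>\<^bsub>Q\<^esub> cls t = cls (\<lambda>n. s n * t n)"
proof -
  have "cls s \<otimes>\<^bsub>Q\<^esub> cls t = (\<Union>u\<in>cls s. \<Union>v\<in>cls t. cls (\<lambda>n. u n * v n))"
    by (simp add: completion_def Let_def FactRing_def rcoset_mult_def cls_def cauchy_ring_def)
  also have "\<dots> = cls (\<lambda>n. s n * t n)"
  proof (intro union_cls assms)
    fix u v assume "u \<in> cls s" "v \<in> cls t"
    then have uv: "Cau u" "Nul (\<lambda>n. u n - s n)" "Cau v" "Nul (\<lambda>n. v n - t n)"
      using assms by (auto simp: in_cls)
    have "Nul (\<lambda>n. u n * (v n - t n) + (u n - s n) * t n)"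
      using uv assms by (intro Nul_add Nul_mult)
    then show "cls (\<lambda>n. u n * v n) = cls (\<lambda>n. s n * t n)"
      using uv assms by (subst cls_eq_iff) (auto simp: algebra_simps)
  qed
  finally show ?thesis .
qed

lemma smult_Q: assumes "Cau s" shows "c \<odot>\<^bsub>Q\<^esub> cls s = cls (\<lambda>n. free_scale c (s n))"
proof -
  have "c \<odot>\<^bsub>Q\<^esub> cls s = (\<Union>u\<in>cls s. cls (\<lambda>n. free_scale c (u n)))"
    by (simp add: completion_def Let_def cls_def)
  also have "\<dots> = cls (\<lambda>n. free_scale c (s n))"
  proof (intro union_cls assms)
    fix u assume "u \<in> cls s"
    then show "cls (\<lambda>n. free_scale c (u n)) = cls (\<lambda>n. free_scale c (s n))"
      using assms Nul_scale[of "\<lambda>n. u n - s n" c] by (auto simp: in_cls cls_eq_iff free_scale_simps)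
  qed
  finally show ?thesis .
qed

lemma adj_Q: assumes "Cau s" shows "adj Q (cls s) = cls (\<lambda>n. free_adj (s n))"
proof -
  have "adj Q (cls s) = (\<lambda>s n. free_adj (s n)) ` cls s"
    by (simp add: completion_def Let_def)
  also have "\<dots> = cls (\<lambda>n. free_adj (s n))"
  proof (intro equalityI subsetI)
    fix w assume "w \<in> (\<lambda>s n. free_adj (s n)) ` cls s"
    then show "w \<in> cls (\<lambda>n. free_adj (s n))"
      using assms Nul_adj by (fastforce simp: in_cls simp flip: free_adj_diff)
  next
    fix w assume w: "w \<in> cls (\<lambda>n. free_adj (s n))"
    then have "(\<lambda>n. free_adj (w n)) \<in> cls s"
      using assms Nul_adj[of "\<lambda>n. w n - free_adj (s n)"] by (auto simp: in_cls free_adj_diff)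
    then show "w \<in> (\<lambda>s n. free_adj (s n)) ` cls s" by (intro image_eqI) auto
  qed
  finally show ?thesis .
qed

text \<open>The description in \<open>cnorm\<close> denotes because equivalent sequences have
  seminorms that differ by a null sequence.\<close>

lemma norm_Q: assumes "Cau s" shows "(\<lambda>n. N (s n)) \<longlonglongrightarrow> cnorm Q (cls s)"
proof -
  obtain r where r: "(\<lambda>n. N (s n)) \<longlonglongrightarrow> r" using Cau_norm_convergent[OF assms] by (auto simp: convergent_def)
  have "cnorm Q (cls s) = (THE r. \<exists>t\<in>cls s. (\<lambda>n. N (t n)) \<longlonglongrightarrow> r)"
    by (simp add: completion_def Let_def)
  also have "\<dots> = r"
  proof (rule the_equality)
    show "\<exists>t\<in>cls s. (\<lambda>n. N (t n)) \<longlonglongrightarrow> r" using cls_self[OF assms] r by blast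
    fix r' assume "\<exists>t\<in>cls s. (\<lambda>n. N (t n)) \<longlonglongrightarrow> r'"
    then obtain t where t: "Cau t" "Nul (\<lambda>n. t n - s n)" "(\<lambda>n. N (t n)) \<longlonglongrightarrow> r'"
      using assms by (auto simp: in_cls)
    have "(\<lambda>n. N (t n) - N (s n)) \<longlonglongrightarrow> 0"
    proof (rule Lim_null_comparison[OF always_eventually[OF allI]])
      show "norm (N (t n) - N (s n)) \<le> N (t n - s n)" for n
        using N_diff_abs t assms by simp
    qed (use t in \<open>simp add: Nul_def\<close>)
    moreover have "(\<lambda>n. N (t n) - N (s n)) \<longlonglongrightarrow> r' - r" by (intro tendsto_diff t r)
    ultimately show "r' = r" using LIMSEQ_unique by fastforce
  qed
  finally show ?thesis using r by simp
qed

lemma norm_Q_le: assumes "Cau s" "\<And>n. n \<ge> M \<Longrightarrow> N (s n) \<le> K" shows "cnorm Q (cls s) \<le> K"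
  using norm_Q[OF assms(1)] by (rule LIMSEQ_le_const2) (use assms(2) in blast)

lemmas Q_simps = zero_Q one_Q add_Q mult_Q smult_Q adj_Q

text \<open>Diagonal argument: from each representative \<open>s k\<close> the entry
  \<open>p k\<close> is chosen within 1/(k + 1) of all later entries. Then \<open>p j\<close> and
  \<open>p k\<close> are as close as the classes up to these errors, so \<open>p\<close> is Cauchy
  and its class is the limit.\<close>

lemma complete_Q:
  assumes S: "\<And>n. S n \<in> carrier Q"
    and cauchy: "\<forall>e>0. \<exists>M. \<forall>m\<ge>M. \<forall>n\<ge>M. cnorm Q (S m \<oplus>\<^bsub>Q\<^esub> (-1) \<odot>\<^bsub>Q\<^esub> S n) < e"
  shows "\<exists>a\<in>carrier Q. (\<lambda>n. cnorm Q (S n \<oplus>\<^bsub>Q\<^esub> (-1) \<odot>\<^bsub>Q\<^esub> a)) \<longlonglongrightarrow> 0"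
proof -
  obtain s where s: "\<And>k. Cau (s k)" "\<And>k. S k = cls (s k)" using S unfolding carrier_Q by metis
  have minus: "cls u \<oplus>\<^bsub>Q\<^esub> (-1) \<odot>\<^bsub>Q\<^esub> cls v = cls (\<lambda>n. u n - v n)" if "Cau u" "Cau v" for u v
    using that by (simp add: Q_simps flip: free_scale_uminus)
  have "\<exists>M. \<forall>m\<ge>M. N (s k m - s k M) < 1 / Suc k" for k
  proof -
    have "0 < 1 / real (Suc k)" by simp
    then show ?thesis using s(1)[of k] unfolding Cau_def by blast
  qed
  then obtain M where M: "\<And>k m. m \<ge> M k \<Longrightarrow> N (s k m - s k (M k)) < 1 / Suc k" by metis
  define p where "p k = s k (M k)" for k
  have p [simp]: "p k \<in> free_on X" for k using s by (simp add: p_def)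
  have pp: "N (p j - p k) \<le> cnorm Q (S j \<oplus>\<^bsub>Q\<^esub> (-1) \<odot>\<^bsub>Q\<^esub> S k) + 1 / Suc j + 1 / Suc k" for j k
  proof -
    have "(\<lambda>m. N (s j m - s k m) + 1 / Suc j + 1 / Suc k) \<longlonglongrightarrow> cnorm Q (cls (\<lambda>m. s j m - s k m)) + 1 / Suc j + 1 / Suc k"
      using s by (intro tendsto_add tendsto_const norm_Q) auto
    then have "N (p j - p k) \<le> cnorm Q (cls (\<lambda>m. s j m - s k m)) + 1 / Suc j + 1 / Suc k"
    proof (rule LIMSEQ_le_const, intro exI[of _ "max (M j) (M k)"] allI impI)
      fix m assume "m \<ge> max (M j) (M k)"
      then have "N (s j m - p j) < 1 / Suc j" "N (s k m - p k) < 1 / Suc k" unfolding p_def using M[of j m] M[of k m] by simp_all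
      moreover have "N (p j - p k) \<le> N (p j - s j m) + (N (s j m - s k m) + N (s k m - p k))"
        using N_triangle[of "p j" "s j m" "p k"] N_triangle[of "s j m" "s k m" "p k"] s by simp
      ultimately show "N (p j - p k) \<le> N (s j m - s k m) + 1 / Suc j + 1 / Suc k"
        using N_diff_commute[of "p j" "s j m"] s by simp
    qed
    then show ?thesis using s by (simp add: minus)
  qed
  have lim: "(\<lambda>n. 1 / real (Suc n)) \<longlonglongrightarrow> 0" using LIMSEQ_inverse_real_of_nat by (simp add: field_simps)
  have small: "\<exists>M. \<forall>n\<ge>M. 1 / real (Suc n) < e" if "e > 0" for e
    using order_tendstoD(2)[OF lim that] by (simp add: eventually_sequentially)
  have Cp: "Cau p"
    unfolding Cau_def
  proof (intro conjI allI impI)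
    fix e :: real assume "e > 0"
    then have e: "e / 3 > 0" by simp
    obtain A where A: "\<And>m n. m \<ge> A \<Longrightarrow> n \<ge> A \<Longrightarrow> cnorm Q (S m \<oplus>\<^bsub>Q\<^esub> (-1) \<odot>\<^bsub>Q\<^esub> S n) < e / 3"
      using cauchy e by blast
    obtain B where B: "\<And>n. n \<ge> B \<Longrightarrow> 1 / real (Suc n) < e / 3" using small[OF e] by blast
    have "N (p m - p n) < e" if "m \<ge> max A B" "n \<ge> max A B" for m n
      using pp[of m n] A[of m n] B[of m] B[of n] that by simp
    then show "\<exists>M. \<forall>m\<ge>M. \<forall>n\<ge>M. N (p m - p n) < e" by blast
  qed simp
  have "(\<lambda>k. cnorm Q (S k \<oplus>\<^bsub>Q\<^esub> (-1) \<odot>\<^bsub>Q\<^esub> cls p)) \<longlonglongrightarrow> 0"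
  proof (rule LIMSEQ_I)
    fix e :: real assume "e > 0"
    then have e: "e / 3 > 0" by simp
    obtain A where A: "\<And>m n. m \<ge> A \<Longrightarrow> n \<ge> A \<Longrightarrow> N (p m - p n) < e / 3"
      using Cp e unfolding Cau_def by blast
    obtain B where B: "\<And>n. n \<ge> B \<Longrightarrow> 1 / real (Suc n) < e / 3" using small[OF e] by blast
    have "norm (cnorm Q (S k \<oplus>\<^bsub>Q\<^esub> (-1) \<odot>\<^bsub>Q\<^esub> cls p) - 0) < e" if k: "k \<ge> max A B" for k
    proof -
      have "cnorm Q (cls (\<lambda>m. s k m - p m)) \<le> e / 3 + e / 3"
      proof (rule norm_Q_le[where M = "max A (M k)"])
        fix m assume m: "m \<ge> max A (M k)"
        then have "N (s k m - p k) < 1 / Suc k" unfolding p_def using M[of k m] by simp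
        then show "N (s k m - p m) \<le> e / 3 + e / 3"
          using N_triangle[of "s k m" "p k" "p m"] A[of k m] B[of k] k m s by simp
      qed (use s Cp in simp)
      moreover have "0 \<le> cnorm Q (cls (\<lambda>m. s k m - p m))"
        using s Cp by (intro LIMSEQ_le_const[OF norm_Q]) auto
      ultimately show ?thesis using s Cp \<open>e > 0\<close> by (simp add: minus)
    qed
    then show "\<exists>no. \<forall>n\<ge>no. norm (cnorm Q (S n \<oplus>\<^bsub>Q\<^esub> (-1) \<odot>\<^bsub>Q\<^esub> cls p) - 0) < e" by blast
  qed
  then show ?thesis using Cp carrier_Q by blast
qed

lemma cstar_algebra_Q: "cstar_algebra Q"
proof (rule cstar_algebraI)
  fix S T assume ST: "S \<in> carrier Q" "T \<in> carrier Q"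
  then obtain s t where [simp]: "Cau s" "Cau t" "S = cls s" "T = cls t" by (auto simp: carrier_Q)
  note st = norm_Q[of s] norm_Q[of t]
  show "cnorm Q (S \<oplus>\<^bsub>Q\<^esub> T) \<le> cnorm Q S + cnorm Q T"
    using LIMSEQ_le[OF norm_Q tendsto_add[OF st], of "\<lambda>n. s n + t n"] by (auto simp: Q_simps N_add)
  show "cnorm Q (S \<otimes>\<^bsub>Q\<^esub> T) \<le> cnorm Q S * cnorm Q T"
    using LIMSEQ_le[OF norm_Q tendsto_mult[OF st], of "\<lambda>n. s n * t n"] by (auto simp: Q_simps N_mult)
next
  fix S assume "S \<in> carrier Q"
  then obtain s where [simp]: "Cau s" "S = cls s" by (auto simp: carrier_Q)
  note s = norm_Q[of s]
  show "cnorm Q (c \<odot>\<^bsub>Q\<^esub> S) = cmod c * cnorm Q S" for c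
  proof -
    have "(\<lambda>n. cmod c * N (s n)) \<longlonglongrightarrow> cnorm Q (cls (\<lambda>n. free_scale c (s n)))"
      using norm_Q[of "\<lambda>n. free_scale c (s n)"] by simp
    moreover have "(\<lambda>n. cmod c * N (s n)) \<longlonglongrightarrow> cmod c * cnorm Q (cls s)"
      by (intro tendsto_mult_left s) simp
    ultimately show ?thesis using LIMSEQ_unique by (auto simp: Q_simps)
  qed
  show "cnorm Q (adj Q S \<otimes>\<^bsub>Q\<^esub> S) = (cnorm Q S)\<^sup>2"
  proof -
    have "(\<lambda>n. (N (s n))\<^sup>2) \<longlonglongrightarrow> cnorm Q (cls (\<lambda>n. free_adj (s n) * s n))"
      using norm_Q[of "\<lambda>n. free_adj (s n) * s n"] by (simp add: N_cstar)
    moreover have "(\<lambda>n. (N (s n))\<^sup>2) \<longlonglongrightarrow> (cnorm Q (cls s))\<^sup>2"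
      by (intro tendsto_power s) simp
    ultimately show ?thesis using LIMSEQ_unique by (auto simp: Q_simps)
  qed
  show "S = \<zero>\<^bsub>Q\<^esub>" if "cnorm Q S = 0"
    using s that by (simp add: Q_simps cls_eq_iff Nul_def)
next
  show "\<zero>\<^bsub>Q\<^esub> \<in> carrier Q" "\<one>\<^bsub>Q\<^esub> \<in> carrier Q"
    unfolding zero_Q one_Q by (simp_all add: cls_in)
qed (fact complete_Q | (auto elim!: carrier_QE simp: cls_in Q_simps algebra_simps free_scale_simps free_scale_mult_right
      free_adj_add free_adj_mult free_adj_scale))+

end

section \<open>The universal property\<close>

definition admissible :: "'g set \<Rightarrow> 'g relations \<Rightarrow> ('g free_star \<Rightarrow> real) \<Rightarrow> bool" where
  "admissible X R N \<longleftrightarrow> cstar_seminorm X N \<and> (\<forall>(r, \<eta>)\<in>R. N r \<le> \<eta>)"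

text \<open>The bound on a generator is uniform over all admissible seminorms; otherwise the
  supremum would be taken over an unbounded set of reals and carry no information.\<close>

locale cstar_presentation =
  fixes X :: "'g set" and R :: "'g relations"
  assumes wf: "\<And>r \<eta>. (r, \<eta>) \<in> R \<Longrightarrow> r \<in> free_on X \<and> 0 \<le> \<eta>"
    and gens_bounded: "\<And>g. g \<in> X \<Longrightarrow> \<exists>K. \<forall>N. admissible X R N \<longrightarrow> N (free_gen g) \<le> K"
begin

abbreviation "N0 \<equiv> universal_seminorm X R"

lemma admissible_seminormed: "admissible X R N \<Longrightarrow> seminormed X N"
  by (simp add: admissible_def seminormed_def)

text \<open>Keeps the set under the supremum nonempty; it corresponds to the zero algebra, in which
  every relation holds.\<close>

lemma admissible_zero: "admissible X R (\<lambda>_. 0)"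
  using wf by (auto simp: admissible_def cstar_seminorm_def)

lemma words_bounded: "fst ` set ls \<subseteq> X \<Longrightarrow> \<exists>K. \<forall>N. admissible X R N \<longrightarrow> N (Poly_Mapping.single (Word ls) 1) \<le> K"
proof (induct ls)
  case Nil
  have "Poly_Mapping.single (Word []) 1 = (1 :: 'g free_star)" by (simp flip: zero_star_word_def)
  then show ?case using seminormed.N_one_le[OF admissible_seminormed] by metis
next
  case (Cons l ls)
  obtain g b where l: "l = (g, b)" by force
  have g: "g \<in> X" and ls: "fst ` set ls \<subseteq> X" using Cons l by auto
  obtain K where K: "\<And>N. admissible X R N \<Longrightarrow> N (Poly_Mapping.single (Word ls) 1) \<le> K" using Cons ls by blast
  obtain L where L: "\<And>N. admissible X R N \<Longrightarrow> N (free_gen g) \<le> L" using gens_bounded[OF g] by blast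
  define a where "a = (if b then free_adj (free_gen g) else free_gen g)"
  have a: "a \<in> free_on X" using g by (simp add: a_def)
  have wl: "Poly_Mapping.single (Word ls) 1 \<in> free_on X" using ls by (intro free_on_single) simp
  have eq: "Poly_Mapping.single (Word (l # ls)) 1 = a * Poly_Mapping.single (Word ls) 1"
    by (auto simp: a_def l free_gen_def free_adj_single word_adj_def mult_single plus_star_word_def)
  have "N (Poly_Mapping.single (Word (l # ls)) 1) \<le> L * K" if N: "admissible X R N" for N
  proof -
    interpret seminormed X N using N by (rule admissible_seminormed)
    have aL: "N a \<le> L" using L[OF N] g by (simp add: a_def)
    have "N (a * Poly_Mapping.single (Word ls) 1) \<le> N a * N (Poly_Mapping.single (Word ls) 1)"
      using a wl by (rule N_mult)
    also have "\<dots> \<le> L * K" using aL K[OF N] N_nonneg[OF a] N_nonneg[OF wl] by (intro mult_mono) auto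
    finally show ?thesis by (simp add: eq)
  qed
  then show ?case by blast
qed

lemma bounded: "p \<in> free_on X \<Longrightarrow> \<exists>K. \<forall>N. admissible X R N \<longrightarrow> N p \<le> K"
proof (induct p rule: free_on_induct)
  case (single w c)
  then obtain K where K: "\<And>N. admissible X R N \<Longrightarrow> N (Poly_Mapping.single w 1) \<le> K"
    using words_bounded[of "letters w"] by auto
  have eq: "Poly_Mapping.single w c = free_scale c (Poly_Mapping.single w 1)"
    by (simp add: free_scale_def mult_single)
  have "N (Poly_Mapping.single w c) \<le> cmod c * K" if N: "admissible X R N" for N
    unfolding eq using seminormed.N_scale[OF admissible_seminormed[OF N] free_on_single[OF single]] K[OF N]
    by (simp add: mult_left_mono)
  then show ?case by blast
next
  case (add p q)
  then obtain K L where "\<And>N. admissible X R N \<Longrightarrow> N p \<le> K" "\<And>N. admissible X R N \<Longrightarrow> N q \<le> L" by blast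
  then have "N (p + q) \<le> K + L" if "admissible X R N" for N
    using seminormed.N_add[OF admissible_seminormed[OF that] add(1,2)] that by fastforce
  then show ?case by blast
qed

lemma N0_def: "N0 p = Sup {N p | N. admissible X R N}"
  by (simp add: universal_seminorm_def admissible_def)

lemma le_N0: "\<lbrakk>admissible X R N; p \<in> free_on X\<rbrakk> \<Longrightarrow> N p \<le> N0 p"
  unfolding N0_def using bounded[of p] by (intro cSup_upper) (auto simp: bdd_above_def)

lemma N0_le: "(\<And>N. admissible X R N \<Longrightarrow> N p \<le> K) \<Longrightarrow> N0 p \<le> K"
  unfolding N0_def using admissible_zero by (intro cSup_least) auto

lemma N0_nonneg: "p \<in> free_on X \<Longrightarrow> 0 \<le> N0 p"
  using le_N0[OF admissible_zero] .

text \<open>The inequalities pass to the supremum term by term. The two equalities need a converse: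
  for scalars the inequality is applied again with 1/c, and for the C*-identity the square roots of
  the values at \<open>free_adj p * p\<close> bound every \<open>N p\<close>.\<close>

lemma cstar_seminorm_N0: "cstar_seminorm X N0"
  unfolding cstar_seminorm_def
proof (intro ballI conjI allI)
  note sn = seminormed.N_add seminormed.N_mult seminormed.N_scale seminormed.N_nonneg seminormed.N_cstar
  note sn = sn[OF admissible_seminormed]
  fix p assume p: "p \<in> free_on X"
  show "0 \<le> N0 p" using p by (rule N0_nonneg)
  show "N0 (p + q) \<le> N0 p + N0 q" if q: "q \<in> free_on X" for q
  proof (rule N0_le)
    fix N assume N: "admissible X R N"
    show "N (p + q) \<le> N0 p + N0 q"
      using sn(1)[OF N p q] le_N0[OF N p] le_N0[OF N q] by linarith
  qed
  show "N0 (p * q) \<le> N0 p * N0 q" if q: "q \<in> free_on X" for q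
  proof (rule N0_le)
    fix N assume N: "admissible X R N"
    show "N (p * q) \<le> N0 p * N0 q"
      using sn(2)[OF N p q] mult_mono[OF le_N0[OF N p] le_N0[OF N q] N0_nonneg[OF p] sn(4)[OF N q]] by linarith
  qed
  have le: "N0 (free_scale c q) \<le> cmod c * N0 q" if "q \<in> free_on X" for c q
  proof (rule N0_le)
    fix N assume N: "admissible X R N"
    show "N (free_scale c q) \<le> cmod c * N0 q"
      using sn(3)[OF N that, of c] le_N0[OF N that] by (simp add: mult_left_mono)
  qed
  show "N0 (free_scale c p) = cmod c * N0 p" for c
  proof (cases "c = 0")
    case True
    then show ?thesis using le[OF p, of c] N0_nonneg[of "free_scale c p"] p by simp
  next
    case False
    have "N0 p \<le> cmod (1 / c) * N0 (free_scale c p)"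
      using le[of "free_scale c p" "1 / c"] p False by (simp add: free_scale_simps)
    then have "cmod c * N0 p \<le> N0 (free_scale c p)" using False by (simp add: norm_divide field_simps)
    with le[OF p, of c] show ?thesis by simp
  qed
  show "N0 (free_adj p * p) = (N0 p)\<^sup>2"
  proof (rule antisym)
    show "N0 (free_adj p * p) \<le> (N0 p)\<^sup>2"
    proof (rule N0_le)
      fix N assume N: "admissible X R N"
      show "N (free_adj p * p) \<le> (N0 p)\<^sup>2"
        using sn(5)[OF N p] power_mono[OF le_N0[OF N p] sn(4)[OF N p], of 2] by simp
    qed
    have "N0 p \<le> sqrt (N0 (free_adj p * p))"
    proof (rule N0_le)
      fix N assume N: "admissible X R N"
      have "(N p)\<^sup>2 \<le> N0 (free_adj p * p)" using sn(5)[OF N p] le_N0[OF N, of "free_adj p * p"] p by simp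
      then show "N p \<le> sqrt (N0 (free_adj p * p))" by (rule real_le_rsqrt)
    qed
    then have "(N0 p)\<^sup>2 \<le> (sqrt (N0 (free_adj p * p)))\<^sup>2" using N0_nonneg[OF p] by (rule power_mono)
    then show "(N0 p)\<^sup>2 \<le> N0 (free_adj p * p)" using N0_nonneg[of "free_adj p * p"] p by simp
  qed
qed

text \<open>The supremum is a maximum: the largest seminorm satisfies the relations itself, so they
  hold in the completion.\<close>

lemma admissible_N0: "admissible X R N0"
  unfolding admissible_def using cstar_seminorm_N0 by (auto intro!: N0_le simp: admissible_def)

sublocale N0: seminormed X N0
  by (rule admissible_seminormed[OF admissible_N0])

abbreviation "W \<equiv> univ_cstar X R"
abbreviation "gen \<equiv> univ_gen X R"

sublocale W: cstar_algebra W
  using N0.cstar_algebra_Q by (simp add: univ_cstar_completion)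

lemma gen_cls: "gen g = N0.cls (\<lambda>_. free_gen g)"
  by (simp add: univ_gen_def N0.cls_def Let_def)

sublocale W: cstar_eval W X gen
  by unfold_locales (simp add: gen_cls univ_cstar_completion N0.cls_in)

lemma ev_gen_cls: "p \<in> free_on X \<Longrightarrow> ev W gen p = N0.cls (\<lambda>_. p)"
proof (induct p rule: free_on_induct)
  case (single w c)
  note Q = N0.Q_simps[folded univ_cstar_completion]
  have "word_val W gen ls = N0.cls (\<lambda>_. Poly_Mapping.single (Word ls) 1)" if "fst ` set ls \<subseteq> X" for ls
    using that
  proof (induct ls)
    case Nil
    then show ?case by (simp add: word_val_def Q flip: zero_star_word_def)
  next
    case (Cons l ls)
    then have wl: "Poly_Mapping.single (Word ls) 1 \<in> free_on X" by (intro free_on_single) auto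
    from Cons show ?case
      by (cases l) (auto simp: word_val_def gen_cls Q wl,
          auto simp: free_gen_def free_adj_single word_adj_def mult_single plus_star_word_def)
  qed
  moreover have "Poly_Mapping.single w 1 \<in> free_on X" using single by (rule free_on_single)
  ultimately show ?case using single
    by (simp add: W.ev_single Q) (simp add: free_scale_def mult_single)
qed (simp add: N0.add_Q[folded univ_cstar_completion])

lemma norm_ev_gen: "p \<in> free_on X \<Longrightarrow> cnorm W (ev W gen p) = N0 p"
  using N0.norm_Q[of "\<lambda>_. p", folded univ_cstar_completion] by (simp add: ev_gen_cls LIMSEQ_const_iff)

lemma relation_norm: "(r, \<eta>) \<in> R \<Longrightarrow> cnorm W (ev W gen r) \<le> \<eta>"
  using wf[of r \<eta>] admissible_N0 by (auto simp: norm_ev_gen admissible_def)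

lemma relation_zero: "(r, 0) \<in> R \<Longrightarrow> ev W gen r = \<zero>\<^bsub>W\<^esub>"
  using relation_norm[of r 0] wf[of r 0] W.norm_nonneg[OF W.ev_closed, of r] by (intro W.norm_eq_zero) (auto intro: antisym)

text \<open>The entries of a Cauchy sequence representing \<open>a\<close>, taken as constant
  sequences, are the approximants.\<close>

lemma dense: assumes "a \<in> carrier W" shows "\<exists>s. (\<forall>n. s n \<in> free_on X) \<and> W.conv (\<lambda>n. ev W gen (s n)) a"
proof -
  obtain s where s: "N0.Cau s" "a = N0.cls s" using assms N0.carrier_Q by (auto simp: univ_cstar_completion)
  note Q = N0.Q_simps[folded univ_cstar_completion]
  have diff: "ev W gen (s k) \<ominus>\<^bsub>W\<^esub> a = N0.cls (\<lambda>m. s k - s m)" for k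
  proof -
    have "N0.cls (\<lambda>_. s k) \<in> carrier W" using s by (simp add: N0.cls_in univ_cstar_completion)
    then show ?thesis using s assms by (simp add: W.diff_eq_smult ev_gen_cls Q flip: free_scale_uminus)
  qed
  have "(\<lambda>k. cnorm W (ev W gen (s k) \<ominus>\<^bsub>W\<^esub> a)) \<longlonglongrightarrow> 0"
  proof (rule LIMSEQ_I)
    fix e :: real assume "e > 0"
    then have "e / 2 > 0" by simp
    then obtain M where M: "\<And>m n. m \<ge> M \<Longrightarrow> n \<ge> M \<Longrightarrow> N0 (s m - s n) < e / 2"
      using s unfolding N0.Cau_def by blast
    have "norm (cnorm W (ev W gen (s k) \<ominus>\<^bsub>W\<^esub> a) - 0) < e" if "k \<ge> M" for k
    proof -
      have "cnorm W (N0.cls (\<lambda>m. s k - s m)) \<le> e / 2"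
        unfolding univ_cstar_completion
        using M[OF that] s by (intro N0.norm_Q_le[where M = M]) (auto intro: less_imp_le)
      moreover have "0 \<le> cnorm W (ev W gen (s k) \<ominus>\<^bsub>W\<^esub> a)" using s assms by (intro W.norm_nonneg) simp
      ultimately show ?thesis using \<open>e > 0\<close> by (simp add: diff)
    qed
    then show "\<exists>no. \<forall>n\<ge>no. norm (cnorm W (ev W gen (s n) \<ominus>\<^bsub>W\<^esub> a) - 0) < e" by blast
  qed
  then show ?thesis using s assms by (intro exI[of _ s]) (auto simp: W.conv_def)
qed

text \<open>A norm-closed property that holds at the generators and is stable under the operations
  holds everywhere. Uniqueness of homomorphisms, commutation with an element and agreement in a
  corner are all proved by this one induction.\<close>

lemma univ_induct [consumes 1, case_names gen one add mult smult adj lim]: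
  assumes a: "a \<in> carrier W"
    and gen: "\<And>g. g \<in> X \<Longrightarrow> P (gen g)"
    and one: "P \<one>\<^bsub>W\<^esub>"
    and add: "\<And>a b. \<lbrakk>a \<in> carrier W; b \<in> carrier W; P a; P b\<rbrakk> \<Longrightarrow> P (a \<oplus>\<^bsub>W\<^esub> b)"
    and mult: "\<And>a b. \<lbrakk>a \<in> carrier W; b \<in> carrier W; P a; P b\<rbrakk> \<Longrightarrow> P (a \<otimes>\<^bsub>W\<^esub> b)"
    and smult: "\<And>a c. \<lbrakk>a \<in> carrier W; P a\<rbrakk> \<Longrightarrow> P (c \<odot>\<^bsub>W\<^esub> a)"
    and adj: "\<And>a. \<lbrakk>a \<in> carrier W; P a\<rbrakk> \<Longrightarrow> P (adj W a)"
    and lim: "\<And>s a. \<lbrakk>W.conv s a; \<And>n. P (s n)\<rbrakk> \<Longrightarrow> P a"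
  shows "P a"
proof -
  have word: "P (word_val W gen ls)" if "fst ` set ls \<subseteq> X" for ls
    using that
  proof (induct ls)
    case (Cons l ls)
    then show ?case using W.word_val_closed[of ls]
      by (cases l) (auto simp: word_val_def intro!: mult adj gen)
  qed (simp add: word_val_def one)
  have poly: "P (ev W gen p)" if "p \<in> free_on X" for p
    using that
    by (induct p rule: free_on_induct) (auto simp: W.ev_single intro!: smult add word)
  show ?thesis using dense[OF a] lim poly by blast
qed

lemma star_hom_eqI:
  assumes B: "cstar_algebra B" and f: "f \<in> star_hom W B" and h: "h \<in> star_hom W B"
    and eq: "\<And>g. g \<in> X \<Longrightarrow> f (gen g) = h (gen g)"
  shows "f = h"
proof (rule extensionalityI)
  fix a assume "a \<in> carrier W"
  then show "f a = h a"
  proof (induct a rule: univ_induct)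
    case (lim s a)
    have "cstar_algebra.conv B (\<lambda>n. f (s n)) (f a)" "cstar_algebra.conv B (\<lambda>n. f (s n)) (h a)"
      using star_hom_conv[OF W.cstar_algebra_axioms B f lim(1)] star_hom_conv[OF W.cstar_algebra_axioms B h lim(1)] lim(2)
      by auto
    then show ?case by (rule cstar_algebra.conv_unique[OF B])
  qed (simp_all add: eq star_homD[OF f] star_homD[OF h])
qed (use f h in \<open>auto simp: star_hom_def\<close>)

text \<open>The homomorphism is the closure of the graph that sends a polynomial evaluated at the
  generators to the same polynomial evaluated at \<open>y\<close>. The pulled-back norm is
  admissible, hence dominated by the universal one; this domination makes the closure single-valued,
  total by completeness of \<open>B\<close>, and contractive.\<close>

theorem universal:
  assumes B: "cstar_algebra B" and y: "\<And>g. g \<in> X \<Longrightarrow> y g \<in> carrier B"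
    and rel: "\<And>r \<eta>. (r, \<eta>) \<in> R \<Longrightarrow> cnorm B (ev B y r) \<le> \<eta>"
  shows "\<exists>\<phi>\<in>star_hom W B. \<forall>g\<in>X. \<phi> (gen g) = y g"
proof -
  interpret B: cstar_eval B X y by (intro cstar_eval.intro B cstar_eval_axioms.intro y)
  have "admissible X R (\<lambda>p. cnorm B (ev B y p))"
    using rel B.cstar_seminorm_ev by (auto simp: admissible_def)
  then have le: "cnorm B (ev B y p) \<le> cnorm W (ev W gen p)" if "p \<in> free_on X" for p
    using le_N0[of "\<lambda>p. cnorm B (ev B y p)" p] that by (simp add: norm_ev_gen)
  \<comment> \<open>\<open>rl\<close> is the closure of the graph, expressed through one sequence of
    polynomials that converges on both sides.\<close>
  define rl where "rl a b \<longleftrightarrow> (\<exists>s. (\<forall>n. s n \<in> free_on X) \<and> W.conv (\<lambda>n. ev W gen (s n)) a \<and> B.conv (\<lambda>n. ev B y (s n)) b)" for a b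
  have rl_closed: "a \<in> carrier W" "b \<in> carrier B" if "rl a b" for a b
    using that by (auto simp: rl_def W.conv_def B.conv_def)
  have rl_norm: "cnorm B b \<le> cnorm W a" if ab: "rl a b" for a b
  proof -
    obtain s where s: "\<And>n. s n \<in> free_on X" "W.conv (\<lambda>n. ev W gen (s n)) a" "B.conv (\<lambda>n. ev B y (s n)) b"
      using ab unfolding rl_def by blast
    show ?thesis by (rule LIMSEQ_le[OF B.conv_norm[OF s(3)] W.conv_norm[OF s(2)]]) (use le s(1) in blast)
  qed
  have rl_smult: "rl (c \<odot>\<^bsub>W\<^esub> a) (c \<odot>\<^bsub>B\<^esub> b)" if "rl a b" for a b c
    using that unfolding rl_def
  proof (elim exE conjE)
    fix s assume "\<forall>n. s n \<in> free_on X" "W.conv (\<lambda>n. ev W gen (s n)) a" "B.conv (\<lambda>n. ev B y (s n)) b"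
    then show "\<exists>s. (\<forall>n. s n \<in> free_on X) \<and> W.conv (\<lambda>n. ev W gen (s n)) (c \<odot>\<^bsub>W\<^esub> a) \<and> B.conv (\<lambda>n. ev B y (s n)) (c \<odot>\<^bsub>B\<^esub> b)"
      using W.conv_smult[of "\<lambda>n. ev W gen (s n)" a c] B.conv_smult[of "\<lambda>n. ev B y (s n)" b c]
      by (intro exI[of _ "\<lambda>n. free_scale c (s n)"]) simp
  qed
  have rl_adj: "rl (adj W a) (adj B b)" if "rl a b" for a b
    using that unfolding rl_def
  proof (elim exE conjE)
    fix s assume "\<forall>n. s n \<in> free_on X" "W.conv (\<lambda>n. ev W gen (s n)) a" "B.conv (\<lambda>n. ev B y (s n)) b"
    then show "\<exists>s. (\<forall>n. s n \<in> free_on X) \<and> W.conv (\<lambda>n. ev W gen (s n)) (adj W a) \<and> B.conv (\<lambda>n. ev B y (s n)) (adj B b)"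
      using W.conv_adj[of "\<lambda>n. ev W gen (s n)" a] B.conv_adj[of "\<lambda>n. ev B y (s n)" b]
      by (intro exI[of _ "\<lambda>n. free_adj (s n)"]) simp
  qed
  have rl_add: "rl (a \<oplus>\<^bsub>W\<^esub> a') (b \<oplus>\<^bsub>B\<^esub> b')" and rl_mult: "rl (a \<otimes>\<^bsub>W\<^esub> a') (b \<otimes>\<^bsub>B\<^esub> b')"
    if ab: "rl a b" "rl a' b'" for a b a' b'
  proof -
    obtain s where s: "\<And>n. s n \<in> free_on X" "W.conv (\<lambda>n. ev W gen (s n)) a" "B.conv (\<lambda>n. ev B y (s n)) b"
      using ab(1) unfolding rl_def by blast
    obtain t where t: "\<And>n. t n \<in> free_on X" "W.conv (\<lambda>n. ev W gen (t n)) a'" "B.conv (\<lambda>n. ev B y (t n)) b'"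
      using ab(2) unfolding rl_def by blast
    show "rl (a \<oplus>\<^bsub>W\<^esub> a') (b \<oplus>\<^bsub>B\<^esub> b')"
      unfolding rl_def using W.conv_add[OF s(2) t(2)] B.conv_add[OF s(3) t(3)] s(1) t(1)
      by (intro exI[of _ "\<lambda>n. s n + t n"]) simp
    show "rl (a \<otimes>\<^bsub>W\<^esub> a') (b \<otimes>\<^bsub>B\<^esub> b')"
      unfolding rl_def using W.conv_mult[OF s(2) t(2)] B.conv_mult[OF s(3) t(3)] s(1) t(1)
      by (intro exI[of _ "\<lambda>n. s n * t n"]) simp
  qed
  \<comment> \<open>The graph is linear, so two values at \<open>a\<close> give a value at a - a =
    0, where the norm bound forces their difference to vanish.\<close>
  have rl_unique: "b = b'" if "rl a b" "rl a b'" for a b b'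
  proof -
    have "cnorm B (b \<ominus>\<^bsub>B\<^esub> b') \<le> cnorm W (a \<ominus>\<^bsub>W\<^esub> a)"
      using rl_norm[OF rl_add[OF that(1) rl_smult[OF that(2), of "-1"]]] rl_closed[OF that(1)] rl_closed[OF that(2)]
      by (simp add: W.diff_eq_smult B.diff_eq_smult)
    also have "\<dots> = 0" using rl_closed[OF that(1)] by (simp add: a_minus_def W.r_neg)
    finally show ?thesis
      using rl_closed[OF that(1)] rl_closed[OF that(2)] B.norm_nonneg[of "b \<ominus>\<^bsub>B\<^esub> b'"]
      by (intro B.eq_if_norm_diff) (auto intro: antisym)
  qed
  have rl_ev: "rl (ev W gen p) (ev B y p)" if "p \<in> free_on X" for p
    unfolding rl_def using that by (intro exI[of _ "\<lambda>_. p"]) (simp add: W.conv_const B.conv_const)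
  have rl_ex: "\<exists>b. rl a b" if a: "a \<in> carrier W" for a
  proof -
    obtain s where s: "\<And>n. s n \<in> free_on X" "W.conv (\<lambda>n. ev W gen (s n)) a" using dense[OF a] by blast
    have "\<exists>b. B.conv (\<lambda>n. ev B y (s n)) b"
    proof (rule B.cauchy_conv)
      show "\<forall>e>0. \<exists>M. \<forall>m\<ge>M. \<forall>n\<ge>M. cnorm B (ev B y (s m) \<ominus>\<^bsub>B\<^esub> ev B y (s n)) < e"
      proof (intro allI impI)
        fix e :: real assume "e > 0"
        then have "\<forall>\<^sub>F n in sequentially. cnorm W (ev W gen (s n) \<ominus>\<^bsub>W\<^esub> a) < e / 2"
          using s(2) by (intro order_tendstoD(2)[of _ 0]) (auto simp: W.conv_def)
        then obtain M where M: "\<And>n. n \<ge> M \<Longrightarrow> cnorm W (ev W gen (s n) \<ominus>\<^bsub>W\<^esub> a) < e / 2"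
          by (auto simp: eventually_sequentially)
        have "cnorm B (ev B y (s m) \<ominus>\<^bsub>B\<^esub> ev B y (s n)) < e" if "m \<ge> M" "n \<ge> M" for m n
        proof -
          have "cnorm B (ev B y (s m) \<ominus>\<^bsub>B\<^esub> ev B y (s n)) \<le> cnorm W (ev W gen (s m) \<ominus>\<^bsub>W\<^esub> ev W gen (s n))"
            using le[of "s m - s n"] s(1) by simp
          also have "\<dots> \<le> cnorm W (ev W gen (s m) \<ominus>\<^bsub>W\<^esub> a) + cnorm W (a \<ominus>\<^bsub>W\<^esub> ev W gen (s n))"
            using s(1) a by (intro W.norm_triangle) auto
          also have "\<dots> < e"
            using M[OF that(1)] M[OF that(2)] W.norm_diff_commute[of a "ev W gen (s n)"] s(1) a by simp
          finally show ?thesis .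
        qed
        then show "\<exists>M. \<forall>m\<ge>M. \<forall>n\<ge>M. cnorm B (ev B y (s m) \<ominus>\<^bsub>B\<^esub> ev B y (s n)) < e" by blast
      qed
    qed (use s in simp)
    then show ?thesis using s by (auto simp: rl_def)
  qed
  define \<phi> where "\<phi> = restrict (\<lambda>a. THE b. rl a b) (carrier W)"
  have \<phi>: "rl a (\<phi> a)" if "a \<in> carrier W" for a
    using rl_ex[OF that] rl_unique that by (auto simp: \<phi>_def intro: theI2)
  have \<phi>_eq: "\<phi> a = b" if "rl a b" for a b
    using rl_unique[OF \<phi> that] rl_closed[OF that] by simp
  have "\<phi> \<in> star_hom W B"
  proof (rule star_homI)
    show "\<phi> \<one>\<^bsub>W\<^esub> = \<one>\<^bsub>B\<^esub>" using rl_ev[of 1] by (intro \<phi>_eq) simp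
    show "\<phi> \<in> extensional (carrier W)" by (simp add: \<phi>_def)
  qed (auto intro!: \<phi>_eq rl_add rl_mult rl_smult rl_adj \<phi> rl_norm rl_closed(2)[OF \<phi>])
  moreover have "\<phi> (gen g) = y g" if "g \<in> X" for g
    using rl_ev[of "free_gen g"] that by (intro \<phi>_eq) simp
  ultimately show ?thesis by blast
qed

end

section \<open>Operators on square-summable families\<close>

definition unit_vec :: "'i \<Rightarrow> 'i \<Rightarrow> complex" where
  "unit_vec i = (\<lambda>j. if j = i then 1 else 0)"

lemma ell2_norm_nonneg [simp]: "0 \<le> ell2_norm x"
  by (simp add: ell2_norm_def infsum_nonneg)

lemma ell2_norm_power2: "(ell2_norm x)\<^sup>2 = (\<Sum>\<^sub>\<infinity>i. (cmod (x i))\<^sup>2)"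
  by (simp add: ell2_norm_def infsum_nonneg)

lemma L2_set_le_ell2_norm: assumes "x \<in> ell2" shows "L2_set (\<lambda>i. cmod (x i)) F \<le> ell2_norm x"
proof (cases "finite F")
  case True
  with assms have "(\<Sum>i\<in>F. (cmod (x i))\<^sup>2) \<le> (\<Sum>\<^sub>\<infinity>i. (cmod (x i))\<^sup>2)"
    by (intro finite_sum_le_infsum) (auto simp: ell2_def)
  then show ?thesis by (simp add: L2_set_def ell2_norm_def)
qed simp

text \<open>Bounds on all finite sections decide membership and norm together, so the triangle and
  Cauchy-Schwarz inequalities for \<open>ell2\<close> are inherited from the finite ones for
  \<open>L2_set\<close>.\<close>

lemma ell2I:
  assumes "\<And>F. finite F \<Longrightarrow> L2_set (\<lambda>i. cmod (x i)) F \<le> K"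
  shows "x \<in> ell2" "ell2_norm x \<le> K"
proof -
  have K: "0 \<le> K" using assms[of "{}"] by simp
  have le: "(\<Sum>i\<in>F. (cmod (x i))\<^sup>2) \<le> K\<^sup>2" if "finite F" for F
    using assms[OF that] unfolding L2_set_def by (rule sqrt_le_D)
  then show x: "x \<in> ell2"
    unfolding ell2_def by (auto intro!: nonneg_bdd_above_summable_on exI[of _ "K\<^sup>2"] simp: bdd_above_def)
  have "(\<Sum>\<^sub>\<infinity>i. (cmod (x i))\<^sup>2) \<le> K\<^sup>2"
    using x le by (intro infsum_le_finite_sums) (auto simp: ell2_def)
  then show "ell2_norm x \<le> K" using K by (simp add: ell2_norm_def real_le_lsqrt infsum_nonneg)
qed

lemma cmod_le_ell2_norm: "x \<in> ell2 \<Longrightarrow> cmod (x i) \<le> ell2_norm x"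
  using L2_set_le_ell2_norm[of x "{i}"] by (simp add: L2_set_def)

lemma ell2_add: assumes "x \<in> ell2" "y \<in> ell2"
  shows "(\<lambda>i. x i + y i) \<in> ell2" "ell2_norm (\<lambda>i. x i + y i) \<le> ell2_norm x + ell2_norm y"
proof -
  have "L2_set (\<lambda>i. cmod (x i + y i)) F \<le> ell2_norm x + ell2_norm y" for F
  proof -
    have "L2_set (\<lambda>i. cmod (x i + y i)) F \<le> L2_set (\<lambda>i. cmod (x i) + cmod (y i)) F"
      by (rule L2_set_mono) (auto intro: norm_triangle_ineq)
    also have "\<dots> \<le> L2_set (\<lambda>i. cmod (x i)) F + L2_set (\<lambda>i. cmod (y i)) F"
      by (rule L2_set_triangle_ineq)
    also have "\<dots> \<le> ell2_norm x + ell2_norm y"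
      using assms by (intro add_mono L2_set_le_ell2_norm)
    finally show ?thesis .
  qed
  then show "(\<lambda>i. x i + y i) \<in> ell2" "ell2_norm (\<lambda>i. x i + y i) \<le> ell2_norm x + ell2_norm y"
    using ell2I[of "\<lambda>i. x i + y i"] by blast+
qed

lemma ell2_zero [simp]: "(\<lambda>_. 0) \<in> ell2" "ell2_norm (\<lambda>_. 0) = 0"
  by (simp_all add: ell2_def ell2_norm_def)

lemma ell2_scale [simp]: assumes "x \<in> ell2"
  shows "(\<lambda>i. c * x i) \<in> ell2" "ell2_norm (\<lambda>i. c * x i) = cmod c * ell2_norm x"
proof -
  have "(\<lambda>i. (cmod c)\<^sup>2 * (cmod (x i))\<^sup>2) summable_on UNIV"
    using assms by (intro summable_on_cmult_right) (simp add: ell2_def)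
  then show "(\<lambda>i. c * x i) \<in> ell2" by (simp add: ell2_def norm_mult power_mult_distrib)
  show "ell2_norm (\<lambda>i. c * x i) = cmod c * ell2_norm x"
    by (simp add: ell2_norm_def norm_mult power_mult_distrib infsum_cmult_right' real_sqrt_mult)
qed

lemma ell2_norm_eq_zero: "\<lbrakk>x \<in> ell2; ell2_norm x = 0\<rbrakk> \<Longrightarrow> x i = 0"
  using cmod_le_ell2_norm[of x i] by simp

lemma unit_vec_ell2 [simp]: "unit_vec i \<in> ell2" "ell2_norm (unit_vec i) \<le> 1"
proof -
  have "L2_set (\<lambda>j. cmod (unit_vec i j)) F \<le> 1" if "finite F" for F
  proof -
    have "(\<Sum>j\<in>F. (cmod (unit_vec i j))\<^sup>2) = (\<Sum>j\<in>F. if j = i then 1 else 0)"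
      by (rule sum.cong) (auto simp: unit_vec_def)
    then show ?thesis using that by (simp add: L2_set_def)
  qed
  then show "unit_vec i \<in> ell2" "ell2_norm (unit_vec i) \<le> 1" using ell2I[of "unit_vec i" 1] by blast+
qed

lemma inner_abs_summable: assumes "x \<in> ell2" "y \<in> ell2" shows "(\<lambda>i. norm (cnj (x i) * y i)) summable_on A"
proof -
  have "(\<lambda>i. norm (cnj (x i) * cnj (x i))) summable_on A" "(\<lambda>i. norm (y i * y i)) summable_on A"
    using assms summable_on_subset_banach[OF _ subset_UNIV]
    by (auto simp: ell2_def norm_mult power2_eq_square)
  then show ?thesis by (rule Infinite_Sum.abs_summable_product)
qed

lemma inner_summable: assumes "x \<in> ell2" "y \<in> ell2" shows "(\<lambda>i. cnj (x i) * y i) summable_on UNIV"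
  using inner_abs_summable[OF assms] by (rule Infinite_Sum.abs_summable_summable)

lemma inner_abs_le: assumes "x \<in> ell2" "y \<in> ell2"
  shows "(\<Sum>\<^sub>\<infinity>i. cmod (cnj (x i) * y i)) \<le> ell2_norm x * ell2_norm y"
proof (rule infsum_le_finite_sums[OF inner_abs_summable[OF assms]])
  fix F :: "'a set"
  have "(\<Sum>i\<in>F. cmod (cnj (x i) * y i)) \<le> L2_set (\<lambda>i. cmod (x i)) F * L2_set (\<lambda>i. cmod (y i)) F"
    using L2_set_mult_ineq[of "\<lambda>i. cmod (x i)" "\<lambda>i. cmod (y i)" F] by (simp add: norm_mult)
  also have "\<dots> \<le> ell2_norm x * ell2_norm y"
    using assms by (intro mult_mono L2_set_le_ell2_norm) auto
  finally show "(\<Sum>i\<in>F. cmod (cnj (x i) * y i)) \<le> ell2_norm x * ell2_norm y" .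
qed

lemma inner_le: assumes "x \<in> ell2" "y \<in> ell2" shows "cmod (ell2_inner x y) \<le> ell2_norm x * ell2_norm y"
  unfolding ell2_inner_def
  using norm_infsum_bound[OF inner_abs_summable[OF assms, of UNIV]] inner_abs_le[OF assms] by simp

lemma inner_add_right: "\<lbrakk>x \<in> ell2; y \<in> ell2; z \<in> ell2\<rbrakk>
    \<Longrightarrow> ell2_inner x (\<lambda>i. y i + z i) = ell2_inner x y + ell2_inner x z"
  by (simp add: ell2_inner_def distrib_left infsum_add inner_summable)

lemma inner_scale_right: "ell2_inner x (\<lambda>i. c * y i) = c * ell2_inner x y"
  by (simp add: ell2_inner_def mult.left_commute[of _ c] infsum_cmult_right')

lemma inner_commute: "ell2_inner x y = cnj (ell2_inner y x)"
  unfolding ell2_inner_def infsum_cnj[symmetric] by (simp add: mult.commute)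

lemma inner_self: assumes "x \<in> ell2" shows "ell2_inner x x = complex_of_real ((ell2_norm x)\<^sup>2)"
proof -
  have eq: "cnj (x i) * x i = complex_of_real ((cmod (x i))\<^sup>2)" for i
    using complex_norm_square[of "x i"] by (simp add: mult.commute)
  have "((\<lambda>i. complex_of_real ((cmod (x i))\<^sup>2)) has_sum complex_of_real ((ell2_norm x)\<^sup>2)) UNIV"
    using assms by (intro has_sum_of_real) (simp add: ell2_norm_power2 ell2_def)
  then show ?thesis unfolding ell2_inner_def eq by (rule infsumI)
qed

lemma inner_unit_vec_right: "ell2_inner x (unit_vec i) = cnj (x i)"
proof -
  have "ell2_inner x (unit_vec i) = (\<Sum>\<^sub>\<infinity>j\<in>{i}. cnj (x j) * unit_vec i j)"
    unfolding ell2_inner_def by (rule infsum_cong_neutral) (auto simp: unit_vec_def)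
  then show ?thesis by (simp add: unit_vec_def)
qed

lemma inner_unit_vec_left: "ell2_inner (unit_vec i) x = x i"
  by (subst inner_commute) (simp add: inner_unit_vec_right)

text \<open>The representing vector is read off from the unit vectors. Applying f to a finite
  section of \<open>v\<close> gives the square of its norm, so each section has norm at most K and
  \<open>v\<close> is square-summable. The formula holds on finite truncations of y and passes to
  the limit because f is bounded.\<close>

lemma riesz:
  fixes f :: "('i \<Rightarrow> complex) \<Rightarrow> complex"
  assumes add: "\<And>x y. \<lbrakk>x \<in> ell2; y \<in> ell2\<rbrakk> \<Longrightarrow> f (\<lambda>i. x i + y i) = f x + f y"
    and scale: "\<And>c x. x \<in> ell2 \<Longrightarrow> f (\<lambda>i. c * x i) = c * f x"
    and bound: "\<And>x. x \<in> ell2 \<Longrightarrow> cmod (f x) \<le> K * ell2_norm x" and "0 \<le> K"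
  defines "v \<equiv> \<lambda>i. cnj (f (unit_vec i))"
  shows "v \<in> ell2" "ell2_norm v \<le> K" "\<And>y. y \<in> ell2 \<Longrightarrow> f y = ell2_inner v y"
proof -
  define tr where "tr F y = (\<lambda>i. if i \<in> F then y i else 0 :: complex)" for F and y :: "'i \<Rightarrow> complex"
  have f0: "f (\<lambda>_. 0) = 0" using scale[of "\<lambda>_. 0" 0] by simp
  have tr: "tr F y \<in> ell2 \<and> f (tr F y) = (\<Sum>i\<in>F. cnj (v i) * y i)" if "finite F" for F y
    using that
  proof (induct F)
    case empty
    then show ?case by (simp add: tr_def f0)
  next
    case (insert j F)
    have eq: "tr (insert j F) y = (\<lambda>i. y j * unit_vec j i + tr F y i)"
      using insert(2) by (auto simp: tr_def unit_vec_def)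
    show ?case unfolding eq using insert by (simp add: ell2_add add scale v_def)
  qed
  have tr_norm: "ell2_norm (tr F y) \<le> L2_set (\<lambda>i. cmod (y i)) F" if "finite F" for F y
  proof (rule ell2I(2))
    fix G :: "'i set" assume "finite G"
    have "L2_set (\<lambda>i. cmod (tr F y i)) G = sqrt (\<Sum>i\<in>G \<inter> F. (cmod (y i))\<^sup>2)"
      using \<open>finite G\<close> unfolding L2_set_def
      by (subst sum.inter_restrict) (auto intro!: arg_cong[where f = sqrt] sum.cong simp: tr_def)
    also have "\<dots> \<le> L2_set (\<lambda>i. cmod (y i)) F"
      using that unfolding L2_set_def by (intro real_sqrt_le_mono sum_mono2) auto
    finally show "L2_set (\<lambda>i. cmod (tr F y i)) G \<le> L2_set (\<lambda>i. cmod (y i)) F" .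
  qed
  have vK: "L2_set (\<lambda>i. cmod (v i)) F \<le> K" if "finite F" for F
  proof (cases "L2_set (\<lambda>i. cmod (v i)) F = 0")
    case False
    have "f (tr F v) = complex_of_real ((L2_set (\<lambda>i. cmod (v i)) F)\<^sup>2)"
    proof -
      have "complex_of_real ((L2_set (\<lambda>i. cmod (v i)) F)\<^sup>2) = (\<Sum>i\<in>F. complex_of_real ((cmod (v i))\<^sup>2))"
        by (simp add: L2_set_def sum_nonneg)
      then show ?thesis unfolding complex_norm_square using tr[OF that, of v] by (simp add: mult.commute)
    qed
    then have "(L2_set (\<lambda>i. cmod (v i)) F)\<^sup>2 = cmod (f (tr F v))" by (simp add: norm_power)
    also have "\<dots> \<le> K * ell2_norm (tr F v)" using tr[OF that] by (intro bound) simp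
    also have "\<dots> \<le> K * L2_set (\<lambda>i. cmod (v i)) F"
      using tr_norm[OF that] \<open>0 \<le> K\<close> by (intro mult_left_mono)
    finally show ?thesis using False L2_set_nonneg[of "\<lambda>i. cmod (v i)" F] by (simp add: power2_eq_square)
  qed (use \<open>0 \<le> K\<close> in simp)
  show v: "v \<in> ell2" "ell2_norm v \<le> K" using ell2I[of v K] vK by blast+
  show "f y = ell2_inner v y" if y: "y \<in> ell2" for y
  proof -
    have "((\<lambda>i. cnj (v i) * y i) has_sum ell2_inner v y) UNIV"
      using inner_summable[OF v(1) y] unfolding ell2_inner_def by (rule has_sum_infsum)
    then have "(sum (\<lambda>i. cnj (v i) * y i) \<longlongrightarrow> ell2_inner v y) (finite_subsets_at_top UNIV)"
      by (simp add: has_sum_def)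
    moreover have "(sum (\<lambda>i. cnj (v i) * y i) \<longlongrightarrow> f y) (finite_subsets_at_top UNIV)"
    proof (rule Lim_transform)
      have ysum: "((\<lambda>i. (cmod (y i))\<^sup>2) has_sum (ell2_norm y)\<^sup>2) UNIV"
        using y by (simp add: ell2_norm_power2 ell2_def)
      \<comment> \<open>K times the norm of y outside F, which dominates the truncation error and
        tends to 0.\<close>
      have "((\<lambda>F. K * sqrt ((ell2_norm y)\<^sup>2 - (\<Sum>i\<in>F. (cmod (y i))\<^sup>2))) \<longlongrightarrow> K * sqrt ((ell2_norm y)\<^sup>2 - (ell2_norm y)\<^sup>2))
          (finite_subsets_at_top UNIV)"
        using ysum unfolding has_sum_def by (intro tendsto_intros)
      then have lim: "((\<lambda>F. K * sqrt ((ell2_norm y)\<^sup>2 - (\<Sum>i\<in>F. (cmod (y i))\<^sup>2))) \<longlongrightarrow> 0) (finite_subsets_at_top UNIV)"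
        by simp
      show "((\<lambda>F. sum (\<lambda>i. cnj (v i) * y i) F - f y) \<longlongrightarrow> 0) (finite_subsets_at_top UNIV)"
      proof (rule Lim_null_comparison[OF _ lim])
        have "norm (sum (\<lambda>i. cnj (v i) * y i) F - f y) \<le> K * sqrt ((ell2_norm y)\<^sup>2 - (\<Sum>i\<in>F. (cmod (y i))\<^sup>2))"
          if F: "finite F" for F
        proof -
          define d where "d = (\<lambda>i. tr F y i + (-1) * y i)"
          have d: "d \<in> ell2" unfolding d_def using tr[OF F] y by (intro ell2_add ell2_scale) auto
          have "f d = f (tr F y) + (-1) * f y"
            unfolding d_def using tr[OF F] y scale[OF y, of "-1"] ell2_scale(1)[OF y, of "-1"]
            by (subst add) auto
          then have "norm (sum (\<lambda>i. cnj (v i) * y i) F - f y) \<le> K * ell2_norm d"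
            using bound[OF d] tr[OF F] by simp
          also have "ell2_norm d \<le> sqrt ((ell2_norm y)\<^sup>2 - (\<Sum>i\<in>F. (cmod (y i))\<^sup>2))"
          proof (rule ell2I(2))
            fix G :: "'i set" assume G: "finite G"
            have "(\<Sum>i\<in>G. (cmod (d i))\<^sup>2) = (\<Sum>i\<in>G - F. (cmod (y i))\<^sup>2)"
              using G by (intro sum.mono_neutral_cong_right) (auto simp: d_def tr_def)
            moreover have "(\<Sum>i\<in>(G - F) \<union> F. (cmod (y i))\<^sup>2) = (\<Sum>i\<in>G - F. (cmod (y i))\<^sup>2) + (\<Sum>i\<in>F. (cmod (y i))\<^sup>2)"
              using G F by (intro sum.union_disjoint) auto
            moreover have "(\<Sum>i\<in>(G - F) \<union> F. (cmod (y i))\<^sup>2) \<le> (ell2_norm y)\<^sup>2"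
              using G F by (intro finite_sum_le_has_sum[OF ysum]) auto
            ultimately show "L2_set (\<lambda>i. cmod (d i)) G \<le> sqrt ((ell2_norm y)\<^sup>2 - (\<Sum>i\<in>F. (cmod (y i))\<^sup>2))"
              unfolding L2_set_def by (intro real_sqrt_le_mono) simp
          qed
          finally show ?thesis using \<open>0 \<le> K\<close> by (simp add: mult_left_mono)
        qed
        then show "\<forall>\<^sub>F F in finite_subsets_at_top UNIV. norm (sum (\<lambda>i. cnj (v i) * y i) F - f y)
            \<le> K * sqrt ((ell2_norm y)\<^sup>2 - (\<Sum>i\<in>F. (cmod (y i))\<^sup>2))"
          by (auto intro: eventually_finite_subsets_at_top_weakI)
      qed
    qed simp
    ultimately show ?thesis using tendsto_unique[OF finite_subsets_at_top_neq_bot] by blast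
  qed
qed

section \<open>Bounded operators, their norm and adjoints\<close>

definition opn :: "'i operator \<Rightarrow> real" where
  "opn T = Sup {ell2_norm (T x) | x. x \<in> ell2 \<and> ell2_norm x \<le> 1}"

lemma bounded_opsD:
  assumes "T \<in> bounded_ops"
  shows "T \<in> ell2 \<rightarrow>\<^sub>E ell2" "\<And>x. x \<in> ell2 \<Longrightarrow> T x \<in> ell2"
    "\<And>x y. \<lbrakk>x \<in> ell2; y \<in> ell2\<rbrakk> \<Longrightarrow> T (\<lambda>i. x i + y i) = (\<lambda>i. T x i + T y i)"
    "\<And>c x. x \<in> ell2 \<Longrightarrow> T (\<lambda>i. c * x i) = (\<lambda>i. c * T x i)"
  using assms by (auto simp: bounded_ops_def PiE_iff)

lemma opn_bound: assumes "T \<in> bounded_ops" shows "x \<in> ell2 \<Longrightarrow> ell2_norm (T x) \<le> opn T * ell2_norm x" "0 \<le> opn T"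
proof -
  note T = bounded_opsD[OF assms]
  obtain K where K: "\<And>x. x \<in> ell2 \<Longrightarrow> ell2_norm (T x) \<le> K * ell2_norm x"
    using assms unfolding bounded_ops_def by blast
  have bdd: "bdd_above {ell2_norm (T x) | x. x \<in> ell2 \<and> ell2_norm x \<le> 1}"
  proof (rule bdd_aboveI[of _ "\<bar>K\<bar>"], safe)
    fix x :: "'a \<Rightarrow> complex" assume "x \<in> ell2" "ell2_norm x \<le> 1"
    then show "ell2_norm (T x) \<le> \<bar>K\<bar>"
      using K[of x] mult_right_mono[OF abs_ge_self, of "ell2_norm x" K] mult_left_le[of "ell2_norm x" "\<bar>K\<bar>"]
      by simp
  qed
  then have unit: "ell2_norm (T x) \<le> opn T" if "x \<in> ell2" "ell2_norm x \<le> 1" for x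
    unfolding opn_def using that by (intro cSup_upper) auto
  show "0 \<le> opn T" using order_trans[OF _ unit[of "\<lambda>_. 0"]] by simp
  show "ell2_norm (T x) \<le> opn T * ell2_norm x" if x: "x \<in> ell2"
  proof (cases "ell2_norm x = 0")
    case True
    then show ?thesis using K[OF x] by simp
  next
    case False
    then have pos: "ell2_norm x > 0" using ell2_norm_nonneg[of x] by linarith
    define y where "y = (\<lambda>i. complex_of_real (1 / ell2_norm x) * x i)"
    have "y \<in> ell2" "ell2_norm y \<le> 1" using ell2_scale[OF x, of "complex_of_real (1 / ell2_norm x)"] pos
      by (simp_all add: y_def norm_divide)
    then have "ell2_norm (T y) \<le> opn T" by (rule unit)
    moreover have "T y = (\<lambda>i. complex_of_real (1 / ell2_norm x) * T x i)" unfolding y_def using x by (rule T)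
    ultimately show ?thesis
      using x pos ell2_scale(2)[OF T(2)[OF x], of "complex_of_real (1 / ell2_norm x)"]
      by (simp add: norm_divide field_simps) (metis mult_left_mono less_imp_le)
  qed
qed

lemma opn_le: assumes "\<And>x. x \<in> ell2 \<Longrightarrow> ell2_norm (T x) \<le> K * ell2_norm x" "0 \<le> K" shows "opn T \<le> K"
  unfolding opn_def
proof (rule cSup_least)
  show "{ell2_norm (T x) | x. x \<in> ell2 \<and> ell2_norm x \<le> 1} \<noteq> {}" using ell2_zero by fastforce
  fix r assume "r \<in> {ell2_norm (T x) | x. x \<in> ell2 \<and> ell2_norm x \<le> 1}"
  then obtain x where "x \<in> ell2" "ell2_norm x \<le> 1" "r = ell2_norm (T x)" by blast
  then show "r \<le> K" using assms(1)[of x] mult_left_le[OF _ assms(2), of "ell2_norm x"] by simp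
qed

lemma bounded_opsI:
  assumes "\<And>x. x \<in> ell2 \<Longrightarrow> T x \<in> ell2" "T \<in> extensional ell2"
    "\<And>x y i. \<lbrakk>x \<in> ell2; y \<in> ell2\<rbrakk> \<Longrightarrow> T (\<lambda>i. x i + y i) i = T x i + T y i"
    "\<And>c x i. x \<in> ell2 \<Longrightarrow> T (\<lambda>i. c * x i) i = c * T x i"
    "\<And>x. x \<in> ell2 \<Longrightarrow> ell2_norm (T x) \<le> K * ell2_norm x"
  shows "T \<in> bounded_ops"
  using assms unfolding bounded_ops_def by (auto simp: PiE_iff fun_eq_iff intro!: exI[of _ K])

lemma bounded_ops_eqI:
  assumes "S \<in> bounded_ops" "T \<in> bounded_ops" "\<And>x i. x \<in> ell2 \<Longrightarrow> S x i = T x i" shows "S = T"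
  using assms by (intro PiE_ext[of S ell2 "\<lambda>_. ell2" T]) (auto dest: bounded_opsD(1))

text \<open>Coordinate i of the adjoint applied to x is the inner product of T e_i with x. This is
  also the vector that \<open>riesz\<close> assigns to the functional sending y to the inner product
  of x with T y.\<close>

definition op_adj :: "'i operator \<Rightarrow> 'i operator" where
  "op_adj T = (\<lambda>x\<in>ell2. \<lambda>i. cnj (ell2_inner x (T (unit_vec i))))"

lemma op_adj:
  assumes T: "T \<in> bounded_ops"
  shows "op_adj T \<in> bounded_ops" "opn (op_adj T) \<le> opn T"
    "\<And>x y. \<lbrakk>x \<in> ell2; y \<in> ell2\<rbrakk> \<Longrightarrow> ell2_inner (op_adj T x) y = ell2_inner x (T y)"
proof -
  note Tl = bounded_opsD[OF T]
  have r: "op_adj T x \<in> ell2 \<and> ell2_norm (op_adj T x) \<le> opn T * ell2_norm x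
      \<and> (\<forall>y\<in>ell2. ell2_inner x (T y) = ell2_inner (op_adj T x) y)" if x: "x \<in> ell2" for x
  proof -
    have 1: "ell2_inner x (T (\<lambda>i. y i + z i)) = ell2_inner x (T y) + ell2_inner x (T z)" if "y \<in> ell2" "z \<in> ell2" for y z
      using x that by (simp add: Tl inner_add_right)
    have 2: "ell2_inner x (T (\<lambda>i. c * y i)) = c * ell2_inner x (T y)" if "y \<in> ell2" for c y
      using x that by (simp add: Tl inner_scale_right)
    have 3: "cmod (ell2_inner x (T y)) \<le> (opn T * ell2_norm x) * ell2_norm y" if "y \<in> ell2" for y
    proof -
      have "cmod (ell2_inner x (T y)) \<le> ell2_norm x * ell2_norm (T y)"
        using x Tl(2)[OF that] by (rule inner_le)
      also have "\<dots> \<le> ell2_norm x * (opn T * ell2_norm y)"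
        using opn_bound(1)[OF T that] by (intro mult_left_mono) auto
      finally show ?thesis by (simp add: mult_ac)
    qed
    have 4: "0 \<le> opn T * ell2_norm x" using opn_bound(2)[OF T] by simp
    have v: "op_adj T x = (\<lambda>i. cnj (ell2_inner x (T (unit_vec i))))" using x by (simp add: op_adj_def)
    show ?thesis unfolding v using riesz[of "\<lambda>y. ell2_inner x (T y)" "opn T * ell2_norm x", OF 1 2 3 4]
      by blast
  qed
  show "op_adj T \<in> bounded_ops"
  proof (rule bounded_opsI)
    fix x y :: "'a \<Rightarrow> complex" and i assume xy: "x \<in> ell2" "y \<in> ell2"
    show "op_adj T (\<lambda>i. x i + y i) i = op_adj T x i + op_adj T y i"
      using xy ell2_add[OF xy] inner_add_right[of "T (unit_vec i)" x y] Tl(2)[of "unit_vec i"]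
      by (simp add: op_adj_def inner_commute[of _ "T (unit_vec i)"])
  next
    fix x :: "'a \<Rightarrow> complex" and c i assume x: "x \<in> ell2"
    show "op_adj T (\<lambda>i. c * x i) i = c * op_adj T x i"
      using x by (simp add: op_adj_def inner_commute[of _ "T (unit_vec i)"] inner_scale_right)
  next
    show "op_adj T \<in> extensional ell2" by (simp add: op_adj_def)
  qed (use r in blast)+
  show "opn (op_adj T) \<le> opn T" using r opn_bound(2)[OF T] by (intro opn_le) auto
  show "ell2_inner (op_adj T x) y = ell2_inner x (T y)" if "x \<in> ell2" "y \<in> ell2" for x y
    using r that by simp
qed

lemma op_adj_unique:
  assumes "S \<in> bounded_ops" "T \<in> bounded_ops"
    "\<And>x y. \<lbrakk>x \<in> ell2; y \<in> ell2\<rbrakk> \<Longrightarrow> ell2_inner (S x) y = ell2_inner x (T y)"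
  shows "S = op_adj T"
proof (rule bounded_ops_eqI[OF assms(1) op_adj(1)[OF assms(2)]])
  fix x :: "'a \<Rightarrow> complex" and i assume "x \<in> ell2"
  then have "ell2_inner (S x) (unit_vec i) = ell2_inner (op_adj T x) (unit_vec i)"
    using assms(3) op_adj(3)[OF assms(2)] by simp
  then show "S x i = op_adj T x i" by (simp add: inner_unit_vec_right)
qed

lemma B_ell2_simps [simp]:
  "carrier B_ell2 = bounded_ops" "mult B_ell2 = compose ell2" "one B_ell2 = (\<lambda>x\<in>ell2. x)"
  "zero B_ell2 = (\<lambda>x\<in>ell2. \<lambda>_. 0)" "add B_ell2 = (\<lambda>S T. \<lambda>x\<in>ell2. \<lambda>i. S x i + T x i)"
  "smult B_ell2 = (\<lambda>c T. \<lambda>x\<in>ell2. \<lambda>i. c * T x i)" "cnorm B_ell2 = opn"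
  by (simp_all add: B_ell2_def opn_def[abs_def])

lemma adj_B_ell2: assumes "T \<in> bounded_ops" shows "adj B_ell2 T = op_adj T"
proof -
  have "adj B_ell2 T = (THE S. S \<in> bounded_ops \<and> (\<forall>x\<in>ell2. \<forall>y\<in>ell2. ell2_inner (S x) y = ell2_inner x (T y)))"
    by (simp add: B_ell2_def)
  also have "\<dots> = op_adj T"
  proof (rule the_equality)
    show "op_adj T \<in> bounded_ops \<and> (\<forall>x\<in>ell2. \<forall>y\<in>ell2. ell2_inner (op_adj T x) y = ell2_inner x (T y))"
      using op_adj[OF assms] by blast
  qed (use op_adj_unique[OF _ assms] in blast)
  finally show ?thesis .
qed

lemma op_zero_in: "(\<lambda>x\<in>ell2. \<lambda>_. 0) \<in> bounded_ops"
  by (rule bounded_opsI[where K = 0]) (auto simp: ell2_add)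

lemma op_one_in: "(\<lambda>x\<in>ell2. x) \<in> bounded_ops"
  by (rule bounded_opsI[where K = 1]) (auto simp: ell2_add)

lemma op_add_in: assumes "S \<in> bounded_ops" "T \<in> bounded_ops"
  shows "(\<lambda>x\<in>ell2. \<lambda>i. S x i + T x i) \<in> bounded_ops" "opn (\<lambda>x\<in>ell2. \<lambda>i. S x i + T x i) \<le> opn S + opn T"
proof -
  note ST = bounded_opsD[OF assms(1)] bounded_opsD[OF assms(2)]
  have le: "ell2_norm (\<lambda>i. S x i + T x i) \<le> (opn S + opn T) * ell2_norm x" if "x \<in> ell2" for x
    using ell2_add(2)[OF ST(2,6)[OF that]] opn_bound(1)[OF assms(1) that] opn_bound(1)[OF assms(2) that]
    by (simp add: distrib_right)
  show "(\<lambda>x\<in>ell2. \<lambda>i. S x i + T x i) \<in> bounded_ops"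
    by (rule bounded_opsI[where K = "opn S + opn T"]) (use le in \<open>auto simp: ell2_add ST distrib_left\<close>)
  show "opn (\<lambda>x\<in>ell2. \<lambda>i. S x i + T x i) \<le> opn S + opn T"
    using le opn_bound(2)[OF assms(1)] opn_bound(2)[OF assms(2)] by (intro opn_le) auto
qed

lemma op_scale_in: assumes "T \<in> bounded_ops"
  shows "(\<lambda>x\<in>ell2. \<lambda>i. c * T x i) \<in> bounded_ops" "opn (\<lambda>x\<in>ell2. \<lambda>i. c * T x i) \<le> cmod c * opn T"
proof -
  note T = bounded_opsD[OF assms]
  have le: "ell2_norm (\<lambda>i. c * T x i) \<le> (cmod c * opn T) * ell2_norm x" if "x \<in> ell2" for x
    using T(2)[OF that] opn_bound(1)[OF assms that] by (simp add: mult_left_mono mult.assoc)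
  show "(\<lambda>x\<in>ell2. \<lambda>i. c * T x i) \<in> bounded_ops"
    by (rule bounded_opsI[where K = "cmod c * opn T"]) (use le in \<open>auto simp: ell2_add T distrib_left mult_ac\<close>)
  show "opn (\<lambda>x\<in>ell2. \<lambda>i. c * T x i) \<le> cmod c * opn T"
    using le opn_bound(2)[OF assms] by (intro opn_le) auto
qed

lemma op_mult_in: assumes "S \<in> bounded_ops" "T \<in> bounded_ops"
  shows "compose ell2 S T \<in> bounded_ops" "opn (compose ell2 S T) \<le> opn S * opn T"
proof -
  note ST = bounded_opsD[OF assms(1)] bounded_opsD[OF assms(2)]
  have le: "ell2_norm (S (T x)) \<le> (opn S * opn T) * ell2_norm x" if "x \<in> ell2" for x
    using opn_bound(1)[OF assms(1) ST(6)[OF that]]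
      mult_left_mono[OF opn_bound(1)[OF assms(2) that] opn_bound(2)[OF assms(1)]] by (simp add: mult.assoc)
  show "compose ell2 S T \<in> bounded_ops"
    by (rule bounded_opsI[where K = "opn S * opn T"]) (use le in \<open>auto simp: compose_def ell2_add ST\<close>)
  show "opn (compose ell2 S T) \<le> opn S * opn T"
    using le opn_bound(2)[OF assms(1)] opn_bound(2)[OF assms(2)]
    by (intro opn_le) (auto simp: compose_def)
qed

lemma op_adj_adj: "T \<in> bounded_ops \<Longrightarrow> op_adj (op_adj T) = T"
  using op_adj[of T] by (intro op_adj_unique[symmetric]) (auto, metis inner_commute)

text \<open>For the lower bound, the square of the norm of T x is the inner product of x with its
  image under the adjoint followed after T, and Cauchy-Schwarz applies.\<close>

lemma op_cstar: assumes "T \<in> bounded_ops" shows "opn (compose ell2 (op_adj T) T) = (opn T)\<^sup>2"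
proof (rule antisym)
  note T = bounded_opsD[OF assms] opn_bound[OF assms] and A = op_adj[OF assms]
  have S: "compose ell2 (op_adj T) T \<in> bounded_ops" using A(1) assms by (rule op_mult_in)
  have "opn (compose ell2 (op_adj T) T) \<le> opn (op_adj T) * opn T" using A(1) assms by (rule op_mult_in)
  also have "\<dots> \<le> opn T * opn T" using A(2) T(6) by (intro mult_right_mono)
  finally show "opn (compose ell2 (op_adj T) T) \<le> (opn T)\<^sup>2" by (simp add: power2_eq_square)
  have "opn T \<le> sqrt (opn (compose ell2 (op_adj T) T))"
  proof (rule opn_le)
    fix x :: "'a \<Rightarrow> complex" assume x: "x \<in> ell2"
    have "complex_of_real ((ell2_norm (T x))\<^sup>2) = ell2_inner (op_adj T (T x)) x"
      using x T by (simp add: A(3) inner_self)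
    then have "(ell2_norm (T x))\<^sup>2 = cmod (ell2_inner (op_adj T (T x)) x)"
      by (metis norm_of_real abs_of_nonneg zero_le_power2)
    also have "\<dots> \<le> ell2_norm (compose ell2 (op_adj T) T x) * ell2_norm x"
      using inner_le[of "op_adj T (T x)" x] x T(2) bounded_opsD(2)[OF A(1)] by (simp add: compose_def)
    also have "\<dots> \<le> opn (compose ell2 (op_adj T) T) * ell2_norm x * ell2_norm x"
      using opn_bound(1)[OF S x] by (intro mult_right_mono) auto
    finally have "(ell2_norm (T x))\<^sup>2 \<le> opn (compose ell2 (op_adj T) T) * (ell2_norm x)\<^sup>2"
      by (simp add: power2_eq_square)
    then have "ell2_norm (T x) \<le> sqrt (opn (compose ell2 (op_adj T) T) * (ell2_norm x)\<^sup>2)" by (rule real_le_rsqrt)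
    then show "ell2_norm (T x) \<le> sqrt (opn (compose ell2 (op_adj T) T)) * ell2_norm x"
      by (simp add: real_sqrt_mult)
  qed (use opn_bound(2)[OF S] in simp)
  then have "(opn T)\<^sup>2 \<le> (sqrt (opn (compose ell2 (op_adj T) T)))\<^sup>2" using T(6) by (rule power_mono)
  then show "(opn T)\<^sup>2 \<le> opn (compose ell2 (op_adj T) T)" using opn_bound(2)[OF S] by simp
qed

text \<open>Each coordinate converges, and the Cauchy estimate survives the limit because it is
  tested on finite sets of coordinates only. The form of \<open>d\<close> is what the record
  operations of \<open>B_ell2\<close> give for a difference.\<close>

lemma op_complete:
  fixes s :: "nat \<Rightarrow> 'i operator"
  defines "d \<equiv> \<lambda>S T. \<lambda>x\<in>ell2. \<lambda>i. S x i + (-1) * T x i"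
  assumes s: "\<And>n. s n \<in> bounded_ops"
    and cauchy: "\<forall>e>0. \<exists>M. \<forall>m\<ge>M. \<forall>n\<ge>M. opn (d (s m) (s n)) < e"
  shows "\<exists>T\<in>bounded_ops. (\<lambda>n. opn (d (s n) T)) \<longlonglongrightarrow> 0"
proof -
  note sl = bounded_opsD[OF s]
  have d_in: "d S T \<in> bounded_ops" if "S \<in> bounded_ops" "T \<in> bounded_ops" for S T
    using op_add_in(1)[OF that(1) op_scale_in(1)[OF that(2), of "-1"]] by (simp add: d_def cong: restrict_cong)
  have dx: "L2_set (\<lambda>i. cmod (s m x i - s n x i)) F \<le> opn (d (s m) (s n)) * ell2_norm x" if x: "x \<in> ell2" for m n x F
  proof -
    have "d (s m) (s n) x = (\<lambda>i. s m x i - s n x i)" using x by (simp add: d_def)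
    then show ?thesis
      using order_trans[OF L2_set_le_ell2_norm opn_bound(1)[OF d_in[OF s s] x]]
        bounded_opsD(2)[OF d_in[OF s s] x] by metis
  qed
  have "Cauchy (\<lambda>n. s n x i)" if x: "x \<in> ell2" for x i
  proof (rule CauchyI)
    fix e :: real assume "e > 0"
    \<comment> \<open>Adding 1 avoids a division by zero for x = 0.\<close>
    then have e: "e / (ell2_norm x + 1) > 0" by (simp add: add_nonneg_pos)
    obtain M where M: "\<And>m n. m \<ge> M \<Longrightarrow> n \<ge> M \<Longrightarrow> opn (d (s m) (s n)) < e / (ell2_norm x + 1)"
      using cauchy e by blast
    have "norm (s m x i - s n x i) < e" if "m \<ge> M" "n \<ge> M" for m n
    proof -
      have "norm (s m x i - s n x i) \<le> opn (d (s m) (s n)) * ell2_norm x"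
        using dx[OF x, of m n "{i}"] by (simp add: L2_set_def)
      also have "\<dots> \<le> e / (ell2_norm x + 1) * ell2_norm x"
        using M[OF that] by (intro mult_right_mono) auto
      also have "\<dots> < e"
      proof -
        have "ell2_norm x + 1 > 0" using ell2_norm_nonneg[of x] by linarith
        then show ?thesis using \<open>e > 0\<close> by (simp add: field_simps)
      qed
      finally show ?thesis .
    qed
    then show "\<exists>M. \<forall>m\<ge>M. \<forall>n\<ge>M. norm (s m x i - s n x i) < e" by blast
  qed
  then have "\<exists>l. (\<lambda>n. s n x i) \<longlonglongrightarrow> l" if "x \<in> ell2" for x i
    using that Cauchy_convergent convergent_def by blast
  then obtain l where l: "\<And>x i. x \<in> ell2 \<Longrightarrow> (\<lambda>n. s n x i) \<longlonglongrightarrow> l x i" by metis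
  define T where "T = restrict l ell2"
  have close: "(\<lambda>i. s n x i - l x i) \<in> ell2 \<and> ell2_norm (\<lambda>i. s n x i - l x i) \<le> e * ell2_norm x"
    if x: "x \<in> ell2" and M: "\<And>m. m \<ge> M \<Longrightarrow> opn (d (s n) (s m)) < e" for n x e M
  proof -
    have "L2_set (\<lambda>i. cmod (s n x i - l x i)) F \<le> e * ell2_norm x" if F: "finite F" for F
    proof (rule LIMSEQ_le_const2)
      show "(\<lambda>m. L2_set (\<lambda>i. cmod (s n x i - s m x i)) F) \<longlonglongrightarrow> L2_set (\<lambda>i. cmod (s n x i - l x i)) F"
        unfolding L2_set_def using l[OF x] by (intro tendsto_intros)
      show "\<exists>N. \<forall>m\<ge>N. L2_set (\<lambda>i. cmod (s n x i - s m x i)) F \<le> e * ell2_norm x"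
      proof (intro exI allI impI)
        fix m assume "M \<le> m"
        then have "opn (d (s n) (s m)) * ell2_norm x \<le> e * ell2_norm x"
          using M[of m] by (intro mult_right_mono) auto
        with dx[OF x, of n m F] show "L2_set (\<lambda>i. cmod (s n x i - s m x i)) F \<le> e * ell2_norm x" by linarith
      qed
    qed
    then show ?thesis using ell2I[of "\<lambda>i. s n x i - l x i"] by blast
  qed
  obtain M where M: "\<And>m n. m \<ge> M \<Longrightarrow> n \<ge> M \<Longrightarrow> opn (d (s m) (s n)) < 1" using cauchy zero_less_one by blast
  have T_in: "l x \<in> ell2" "ell2_norm (l x) \<le> (opn (s M) + 1) * ell2_norm x" if x: "x \<in> ell2" for x
  proof -
    have c: "(\<lambda>i. s M x i - l x i) \<in> ell2" "ell2_norm (\<lambda>i. s M x i - l x i) \<le> 1 * ell2_norm x"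
      using close[OF x, of M M 1] M by auto
    have eq: "l x = (\<lambda>i. s M x i + (-1) * (s M x i - l x i))" by auto
    show "l x \<in> ell2" by (subst eq) (intro ell2_add ell2_scale sl x c)
    have "ell2_norm (l x) \<le> ell2_norm (s M x) + ell2_norm (\<lambda>i. (-1) * (s M x i - l x i))"
      by (subst eq) (intro ell2_add ell2_scale sl x c)
    also have "\<dots> \<le> opn (s M) * ell2_norm x + ell2_norm x"
        using c opn_bound(1)[OF s[of M] x] by (subst ell2_scale) auto
    finally show "ell2_norm (l x) \<le> (opn (s M) + 1) * ell2_norm x" by (simp add: distrib_right)
  qed
  have T: "T \<in> bounded_ops"
  proof (rule bounded_opsI[where K = "opn (s M) + 1"])
    fix x y :: "'i \<Rightarrow> complex" and i assume xy: "x \<in> ell2" "y \<in> ell2"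
    have "(\<lambda>n. s n (\<lambda>i. x i + y i) i) \<longlonglongrightarrow> l x i + l y i"
      unfolding sl(3)[OF xy] using xy by (intro tendsto_add l)
    then show "T (\<lambda>i. x i + y i) i = T x i + T y i"
      using LIMSEQ_unique[OF l[OF ell2_add(1)[OF xy]]] xy by (simp add: T_def ell2_add)
  next
    fix x :: "'i \<Rightarrow> complex" and c i assume x: "x \<in> ell2"
    have "(\<lambda>n. s n (\<lambda>i. c * x i) i) \<longlonglongrightarrow> c * l x i"
      unfolding sl(4)[OF x] using x by (intro tendsto_mult_left l)
    then show "T (\<lambda>i. c * x i) i = c * T x i"
      using LIMSEQ_unique[OF l[OF ell2_scale(1)[OF x]]] x by (simp add: T_def)
  qed (use T_in in \<open>auto simp: T_def\<close>)
  have "(\<lambda>n. opn (d (s n) T)) \<longlonglongrightarrow> 0"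
  proof (rule LIMSEQ_I)
    fix e :: real assume "e > 0"
    then have "e / 2 > 0" by simp
    then obtain M where M: "\<And>m n. m \<ge> M \<Longrightarrow> n \<ge> M \<Longrightarrow> opn (d (s m) (s n)) < e / 2" using cauchy by blast
    have "norm (opn (d (s n) T) - 0) < e" if n: "n \<ge> M" for n
    proof -
      have "opn (d (s n) T) \<le> e / 2"
      proof (rule opn_le)
        fix x :: "'i \<Rightarrow> complex" assume x: "x \<in> ell2"
        have "d (s n) T x = (\<lambda>i. s n x i - l x i)" using x by (simp add: d_def T_def)
        then show "ell2_norm (d (s n) T x) \<le> e / 2 * ell2_norm x"
          using close[OF x, of M n "e / 2"] M n by simp
      qed (use \<open>e > 0\<close> in simp)
      then show ?thesis using opn_bound(2)[OF d_in[OF s T]] \<open>e > 0\<close> by simp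
    qed
    then show "\<exists>no. \<forall>n\<ge>no. norm (opn (d (s n) T) - 0) < e" by blast
  qed
  with T show ?thesis by blast
qed

lemma cstar_algebra_B_ell2: "cstar_algebra (B_ell2 :: 'i operator cstar)"
proof (rule cstar_algebraI)
  show "\<zero>\<^bsub>B_ell2\<^esub> \<in> carrier (B_ell2 :: 'i operator cstar)" "\<one>\<^bsub>B_ell2\<^esub> \<in> carrier (B_ell2 :: 'i operator cstar)"
    by (simp_all add: op_zero_in op_one_in)
next
  fix S T assume "S \<in> carrier (B_ell2 :: 'i operator cstar)" "T \<in> carrier (B_ell2 :: 'i operator cstar)"
  then have ST: "S \<in> bounded_ops" "T \<in> bounded_ops" by auto
  note S = bounded_opsD[OF ST(1)] and T = bounded_opsD[OF ST(2)]
  show "S \<oplus>\<^bsub>B_ell2\<^esub> T \<in> carrier B_ell2" "S \<otimes>\<^bsub>B_ell2\<^esub> T \<in> carrier B_ell2"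
    "cnorm B_ell2 (S \<oplus>\<^bsub>B_ell2\<^esub> T) \<le> cnorm B_ell2 S + cnorm B_ell2 T"
    "cnorm B_ell2 (S \<otimes>\<^bsub>B_ell2\<^esub> T) \<le> cnorm B_ell2 S * cnorm B_ell2 T"
    using ST by (simp_all add: op_add_in op_mult_in)
  show "S \<oplus>\<^bsub>B_ell2\<^esub> T = T \<oplus>\<^bsub>B_ell2\<^esub> S" by (simp add: add.commute)
  show "c \<odot>\<^bsub>B_ell2\<^esub> (S \<oplus>\<^bsub>B_ell2\<^esub> T) = c \<odot>\<^bsub>B_ell2\<^esub> S \<oplus>\<^bsub>B_ell2\<^esub> c \<odot>\<^bsub>B_ell2\<^esub> T" for c
    by (auto simp: restrict_def distrib_left)
  show "(c \<odot>\<^bsub>B_ell2\<^esub> S) \<otimes>\<^bsub>B_ell2\<^esub> T = c \<odot>\<^bsub>B_ell2\<^esub> (S \<otimes>\<^bsub>B_ell2\<^esub> T)" for c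
    using T by (auto simp: restrict_def compose_def)
  show "S \<otimes>\<^bsub>B_ell2\<^esub> (c \<odot>\<^bsub>B_ell2\<^esub> T) = c \<odot>\<^bsub>B_ell2\<^esub> (S \<otimes>\<^bsub>B_ell2\<^esub> T)" for c
    using S T by (auto simp: restrict_def compose_def)
  show "adj B_ell2 (S \<oplus>\<^bsub>B_ell2\<^esub> T) = adj B_ell2 S \<oplus>\<^bsub>B_ell2\<^esub> adj B_ell2 T"
    using ST S T by (simp add: adj_B_ell2 op_add_in) (auto simp: op_adj_def restrict_def inner_add_right)
  show "adj B_ell2 (S \<otimes>\<^bsub>B_ell2\<^esub> T) = adj B_ell2 T \<otimes>\<^bsub>B_ell2\<^esub> adj B_ell2 S"
  proof -
    have "compose ell2 (op_adj T) (op_adj S) = op_adj (compose ell2 S T)"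
      using op_mult_in(1)[OF op_adj(1)[OF ST(2)] op_adj(1)[OF ST(1)]] op_mult_in(1)[OF ST]
    proof (rule op_adj_unique)
      fix x y :: "'i \<Rightarrow> complex" assume "x \<in> ell2" "y \<in> ell2"
      then show "ell2_inner (compose ell2 (op_adj T) (op_adj S) x) y = ell2_inner x (compose ell2 S T y)"
        using S(2) T(2) bounded_opsD(2)[OF op_adj(1)[OF ST(1)]] op_adj(3)[OF ST(1)] op_adj(3)[OF ST(2)]
        by (simp add: compose_def)
    qed
    then show ?thesis using ST by (simp add: adj_B_ell2 op_mult_in)
  qed
next
  fix T assume "T \<in> carrier (B_ell2 :: 'i operator cstar)"
  then have Ti: "T \<in> bounded_ops" by simp
  note T = bounded_opsD[OF Ti]
  have ext: "restrict T ell2 = T" using T(1) by (rule PiE_restrict)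
  have eqT: "restrict f ell2 = T" if "\<And>x. x \<in> ell2 \<Longrightarrow> f x = T x" for f
    by (metis ext restrict_ext that)
  show "\<zero>\<^bsub>B_ell2\<^esub> \<oplus>\<^bsub>B_ell2\<^esub> T = T" "1 \<odot>\<^bsub>B_ell2\<^esub> T = T"
    by (simp_all, (rule eqT, simp)+)
  show "\<one>\<^bsub>B_ell2\<^esub> \<otimes>\<^bsub>B_ell2\<^esub> T = T" "T \<otimes>\<^bsub>B_ell2\<^esub> \<one>\<^bsub>B_ell2\<^esub> = T"
    by (insert T(2), simp_all add: compose_def, (rule eqT, simp)+)
  show "c \<odot>\<^bsub>B_ell2\<^esub> T \<in> carrier B_ell2" for c using Ti by (simp add: op_scale_in)
  show "(c + d) \<odot>\<^bsub>B_ell2\<^esub> T = c \<odot>\<^bsub>B_ell2\<^esub> T \<oplus>\<^bsub>B_ell2\<^esub> d \<odot>\<^bsub>B_ell2\<^esub> T"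
    "0 \<odot>\<^bsub>B_ell2\<^esub> T = \<zero>\<^bsub>B_ell2\<^esub>" "c \<odot>\<^bsub>B_ell2\<^esub> (d \<odot>\<^bsub>B_ell2\<^esub> T) = (c * d) \<odot>\<^bsub>B_ell2\<^esub> T" for c d
    by (auto simp: restrict_def distrib_right mult.assoc fun_eq_iff)
  show "adj B_ell2 T \<in> carrier B_ell2" "adj B_ell2 (adj B_ell2 T) = T"
    "cnorm B_ell2 (adj B_ell2 T \<otimes>\<^bsub>B_ell2\<^esub> T) = (cnorm B_ell2 T)\<^sup>2"
    using Ti by (simp_all add: adj_B_ell2 op_adj op_adj_adj op_cstar)
  show "adj B_ell2 (c \<odot>\<^bsub>B_ell2\<^esub> T) = cnj c \<odot>\<^bsub>B_ell2\<^esub> adj B_ell2 T" for c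
    using Ti by (simp add: adj_B_ell2 op_scale_in) (auto simp: op_adj_def restrict_def inner_scale_right)
  show "cnorm B_ell2 (c \<odot>\<^bsub>B_ell2\<^esub> T) = cmod c * cnorm B_ell2 T" for c
  proof (cases "c = 0")
    case True
    then show ?thesis using op_scale_in[OF Ti, of c] opn_bound(2)[OF op_scale_in(1)[OF Ti, of c]] by simp
  next
    case False
    have "T = (\<lambda>x\<in>ell2. \<lambda>i. (1 / c) * (\<lambda>x\<in>ell2. \<lambda>i. c * T x i) x i)"
      using False by (intro eqT[symmetric]) simp
    then have "opn T \<le> cmod (1 / c) * opn (\<lambda>x\<in>ell2. \<lambda>i. c * T x i)"
      using op_scale_in(2)[OF op_scale_in(1)[OF Ti, of c], of "1 / c"] by simp
    then show ?thesis using op_scale_in(2)[OF Ti, of c] False by (simp add: norm_divide field_simps)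
  qed
  show "T = \<zero>\<^bsub>B_ell2\<^esub>" if "cnorm B_ell2 T = 0"
  proof -
    have "T x i = 0" if x: "x \<in> ell2" for x i
      using opn_bound(1)[OF Ti x] \<open>cnorm B_ell2 T = 0\<close> ell2_norm_eq_zero[OF T(2)[OF x]]
      by (simp add: antisym)
    then show ?thesis unfolding B_ell2_simps by (intro eqT[symmetric]) auto
  qed
next
  fix s :: "nat \<Rightarrow> 'i operator"
  assume s: "\<And>n. s n \<in> carrier B_ell2"
    and c: "\<forall>e>0. \<exists>M. \<forall>m\<ge>M. \<forall>n\<ge>M. cnorm B_ell2 (s m \<oplus>\<^bsub>B_ell2\<^esub> (-1) \<odot>\<^bsub>B_ell2\<^esub> s n) < e"
  have eq: "S \<oplus>\<^bsub>B_ell2\<^esub> (-1) \<odot>\<^bsub>B_ell2\<^esub> T = (\<lambda>x\<in>ell2. \<lambda>i. S x i + (-1) * T x i)" for S T :: "'i operator"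
    by (auto simp: restrict_def)
  show "\<exists>a\<in>carrier B_ell2. (\<lambda>n. cnorm B_ell2 (s n \<oplus>\<^bsub>B_ell2\<^esub> (-1) \<odot>\<^bsub>B_ell2\<^esub> a)) \<longlonglongrightarrow> 0"
    unfolding eq using op_complete[of s] s c[unfolded eq] by simp
next
  fix S T U :: "'i operator"
  assume "S \<in> carrier B_ell2" "T \<in> carrier B_ell2" "U \<in> carrier B_ell2"
  then have c: "S \<in> bounded_ops" "T \<in> bounded_ops" "U \<in> bounded_ops" by auto
  note l = bounded_opsD[OF c(1)] bounded_opsD[OF c(2)] bounded_opsD[OF c(3)]
  show "(S \<oplus>\<^bsub>B_ell2\<^esub> T) \<oplus>\<^bsub>B_ell2\<^esub> U = S \<oplus>\<^bsub>B_ell2\<^esub> (T \<oplus>\<^bsub>B_ell2\<^esub> U)"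
    by (auto simp: restrict_def add.assoc)
  show "(S \<otimes>\<^bsub>B_ell2\<^esub> T) \<otimes>\<^bsub>B_ell2\<^esub> U = S \<otimes>\<^bsub>B_ell2\<^esub> (T \<otimes>\<^bsub>B_ell2\<^esub> U)"
    using l by (auto simp: restrict_def compose_def)
  show "(S \<oplus>\<^bsub>B_ell2\<^esub> T) \<otimes>\<^bsub>B_ell2\<^esub> U = S \<otimes>\<^bsub>B_ell2\<^esub> U \<oplus>\<^bsub>B_ell2\<^esub> T \<otimes>\<^bsub>B_ell2\<^esub> U"
    using l by (auto simp: restrict_def compose_def)
  show "U \<otimes>\<^bsub>B_ell2\<^esub> (S \<oplus>\<^bsub>B_ell2\<^esub> T) = U \<otimes>\<^bsub>B_ell2\<^esub> S \<oplus>\<^bsub>B_ell2\<^esub> U \<otimes>\<^bsub>B_ell2\<^esub> T"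
    using l by (auto simp: restrict_def compose_def)
qed

section \<open>Amplifications and tensor products of operators\<close>

lemma ell2_swap: fixes z :: "'i \<times> 'j \<Rightarrow> complex"
  assumes "z \<in> ell2" shows "z \<circ> prod.swap \<in> ell2" "ell2_norm (z \<circ> prod.swap) = ell2_norm z"
proof -
  have bij: "bij_betw prod.swap (UNIV :: ('j \<times> 'i) set) (UNIV :: ('i \<times> 'j) set)"
    by (rule bij_betw_byWitness[where f' = prod.swap]) auto
  show "z \<circ> prod.swap \<in> ell2"
    using assms summable_on_reindex_bij_betw[OF bij, of "\<lambda>p. (cmod (z p))\<^sup>2"] by (simp add: ell2_def)
  show "ell2_norm (z \<circ> prod.swap) = ell2_norm z"
    using infsum_reindex_bij_betw[OF bij, of "\<lambda>p. (cmod (z p))\<^sup>2"] by (simp add: ell2_norm_def)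
qed

lemma ell2_rows: fixes z :: "'i \<times> 'j \<Rightarrow> complex"
  assumes z: "z \<in> ell2"
  shows "(\<lambda>l. z (k, l)) \<in> ell2" "finite K \<Longrightarrow> (\<Sum>k\<in>K. (ell2_norm (\<lambda>l. z (k, l)))\<^sup>2) \<le> (ell2_norm z)\<^sup>2"
proof -
  have row: "L2_set (\<lambda>l. cmod (z (k, l))) F \<le> ell2_norm z" for k F
  proof -
    have "L2_set (\<lambda>l. cmod (z (k, l))) F = L2_set (\<lambda>p. cmod (z p)) (Pair k ` F)"
      by (simp add: L2_set_def sum.reindex inj_on_def)
    then show ?thesis using L2_set_le_ell2_norm[OF z] by simp
  qed
  show "(\<lambda>l. z (k, l)) \<in> ell2" using ell2I(1)[OF row] by blast
  have s: "(\<lambda>(k, l). (cmod (z (k, l)))\<^sup>2) summable_on UNIV \<times> UNIV" using z by (simp add: ell2_def case_prod_unfold)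
  have "(\<Sum>k\<in>K. (ell2_norm (\<lambda>l. z (k, l)))\<^sup>2) \<le> (\<Sum>\<^sub>\<infinity>k. (ell2_norm (\<lambda>l. z (k, l)))\<^sup>2)" if "finite K"
    using that summable_on_Sigma_banach[OF s] by (intro finite_sum_le_infsum) (auto simp: ell2_norm_power2 infsum_nonneg)
  also have "(\<Sum>\<^sub>\<infinity>k. (ell2_norm (\<lambda>l. z (k, l)))\<^sup>2) = (ell2_norm z)\<^sup>2"
    unfolding ell2_norm_power2 using infsum_Sigma'_banach[OF s] by (simp add: case_prod_unfold)
  finally show "finite K \<Longrightarrow> (\<Sum>k\<in>K. (ell2_norm (\<lambda>l. z (k, l)))\<^sup>2) \<le> (ell2_norm z)\<^sup>2" .
qed

lemma ell2_inner_rows: assumes "x \<in> ell2" "y \<in> ell2"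
  shows "ell2_inner x y = (\<Sum>\<^sub>\<infinity>k. ell2_inner (\<lambda>l. x (k, l)) (\<lambda>l. y (k, l)))"
proof -
  have "(\<lambda>(k, l). cnj (x (k, l)) * y (k, l)) summable_on UNIV \<times> UNIV"
    using inner_summable[OF assms] by (simp add: case_prod_unfold)
  from infsum_Sigma'_banach[OF this] show ?thesis by (simp add: ell2_inner_def case_prod_unfold)
qed

text \<open>\<open>amp2 T\<close> is 1 \<otimes> T and \<open>amp1 S\<close> is S \<otimes> 1: the
  operator acts in one coordinate while the other is frozen. Both are plain functions, not cut down
  to \<open>ell2\<close>; the restriction is added only in \<open>op_tensor_amp\<close>.\<close>

definition amp2 :: "'j operator \<Rightarrow> ('i \<times> 'j \<Rightarrow> complex) \<Rightarrow> ('i \<times> 'j \<Rightarrow> complex)" where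
  "amp2 T z = (\<lambda>(k, j). T (\<lambda>l. z (k, l)) j)"

definition amp1 :: "'i operator \<Rightarrow> ('i \<times> 'j \<Rightarrow> complex) \<Rightarrow> ('i \<times> 'j \<Rightarrow> complex)" where
  "amp1 S z = (\<lambda>(i, j). S (\<lambda>k. z (k, j)) i)"

text \<open>Exchanging the coordinates transports norm bounds and adjoint formulas from
  \<open>amp2\<close> to \<open>amp1\<close>.\<close>

lemma amp1_swap: "amp1 S z = amp2 S (z \<circ> prod.swap) \<circ> prod.swap"
  by (auto simp: amp1_def amp2_def fun_eq_iff)

text \<open>The operator acts on each row separately, and the squared norms of finitely many rows of
  z sum to at most the squared norm of z. A finite set of coordinates is first enlarged to a
  rectangle so that rows can be summed.\<close>

lemma amp2_ell2: fixes z :: "'i \<times> 'j \<Rightarrow> complex"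
  assumes T: "T \<in> bounded_ops" and z: "z \<in> ell2"
  shows "amp2 T z \<in> ell2" "ell2_norm (amp2 T z) \<le> opn T * ell2_norm z"
proof -
  have "L2_set (\<lambda>p. cmod (amp2 T z p)) G \<le> opn T * ell2_norm z" if G: "finite G" for G
  proof -
    have "(\<Sum>p\<in>G. (cmod (amp2 T z p))\<^sup>2) \<le> (\<Sum>p\<in>fst ` G \<times> snd ` G. (cmod (amp2 T z p))\<^sup>2)"
      using G by (intro sum_mono2) force+
    also have "\<dots> = (\<Sum>k\<in>fst ` G. \<Sum>j\<in>snd ` G. (cmod (T (\<lambda>l. z (k, l)) j))\<^sup>2)"
      by (simp add: sum.cartesian_product amp2_def case_prod_unfold)
    also have "\<dots> \<le> (\<Sum>k\<in>fst ` G. (opn T)\<^sup>2 * (ell2_norm (\<lambda>l. z (k, l)))\<^sup>2)"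
    proof (rule sum_mono)
      fix k
      have "L2_set (\<lambda>j. cmod (T (\<lambda>l. z (k, l)) j)) (snd ` G) \<le> opn T * ell2_norm (\<lambda>l. z (k, l))"
        using L2_set_le_ell2_norm[OF bounded_opsD(2)[OF T ell2_rows(1)[OF z]]] opn_bound(1)[OF T ell2_rows(1)[OF z]]
        by (rule order_trans)
      then have "(L2_set (\<lambda>j. cmod (T (\<lambda>l. z (k, l)) j)) (snd ` G))\<^sup>2 \<le> (opn T * ell2_norm (\<lambda>l. z (k, l)))\<^sup>2"
        by (rule power_mono) simp
      then show "(\<Sum>j\<in>snd ` G. (cmod (T (\<lambda>l. z (k, l)) j))\<^sup>2) \<le> (opn T)\<^sup>2 * (ell2_norm (\<lambda>l. z (k, l)))\<^sup>2"
        by (simp add: L2_set_def sum_nonneg power_mult_distrib)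
    qed
    also have "\<dots> \<le> (opn T)\<^sup>2 * (ell2_norm z)\<^sup>2"
      unfolding sum_distrib_left[symmetric] using ell2_rows(2)[OF z, of "fst ` G"] G by (intro mult_left_mono) auto
    also have "\<dots> = (opn T * ell2_norm z)\<^sup>2" by (simp add: power_mult_distrib)
    finally show ?thesis
      unfolding L2_set_def using opn_bound(2)[OF T] by (intro real_le_lsqrt sum_nonneg) auto
  qed
  then show "amp2 T z \<in> ell2" "ell2_norm (amp2 T z) \<le> opn T * ell2_norm z" using ell2I[of "amp2 T z"] by blast+
qed

lemma amp1_ell2: assumes "S \<in> bounded_ops" "z \<in> ell2"
  shows "amp1 S z \<in> ell2" "ell2_norm (amp1 S z) \<le> opn S * ell2_norm z"
  unfolding amp1_swap using assms ell2_swap[OF assms(2)] amp2_ell2[OF assms(1) ell2_swap(1)[OF assms(2)]]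
  by (simp_all add: ell2_swap)

lemma amp2_inner: assumes "T \<in> bounded_ops" "x \<in> ell2" "y \<in> ell2"
  shows "ell2_inner (amp2 (op_adj T) x) y = ell2_inner x (amp2 T y)"
  using assms by (simp add: ell2_inner_rows amp2_ell2 op_adj(1)) (simp add: amp2_def op_adj(3) ell2_rows(1))

lemma ell2_inner_swap: "ell2_inner (x \<circ> prod.swap) (y \<circ> prod.swap) = ell2_inner x y"
proof -
  have bij: "bij_betw prod.swap (UNIV :: ('j \<times> 'i) set) (UNIV :: ('i \<times> 'j) set)"
    by (rule bij_betw_byWitness[where f' = prod.swap]) auto
  show ?thesis using infsum_reindex_bij_betw[OF bij, of "\<lambda>p. cnj (x p) * y p"] by (simp add: ell2_inner_def)
qed

lemma swap_swap_fun: "(x \<circ> prod.swap) \<circ> prod.swap = x"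
  by (simp add: fun_eq_iff)

lemma amp1_inner: assumes "S \<in> bounded_ops" "x \<in> ell2" "y \<in> ell2"
  shows "ell2_inner (amp1 (op_adj S) x) y = ell2_inner x (amp1 S y)"
proof -
  have "ell2_inner (amp1 (op_adj S) x) y = ell2_inner (amp2 (op_adj S) (x \<circ> prod.swap)) (y \<circ> prod.swap)"
    using ell2_inner_swap[of "amp2 (op_adj S) (x \<circ> prod.swap)" "y \<circ> prod.swap"] by (simp add: amp1_swap swap_swap_fun)
  also have "\<dots> = ell2_inner (x \<circ> prod.swap) (amp2 S (y \<circ> prod.swap))"
    using assms by (intro amp2_inner ell2_swap)
  also have "\<dots> = ell2_inner x (amp1 S y)"
    using ell2_inner_swap[of "x \<circ> prod.swap" "amp2 S (y \<circ> prod.swap)"] by (simp add: amp1_swap swap_swap_fun)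
  finally show ?thesis .
qed

lemma ell2_tensor: assumes "s \<in> ell2" "t \<in> ell2" shows "(\<lambda>(k, l). s k * t l) \<in> ell2"
proof (rule ell2I(1))
  fix G :: "('a \<times> 'b) set" assume G: "finite G"
  have "(\<Sum>p\<in>G. (cmod (case p of (k, l) \<Rightarrow> s k * t l))\<^sup>2) \<le> (\<Sum>p\<in>fst ` G \<times> snd ` G. (cmod (case p of (k, l) \<Rightarrow> s k * t l))\<^sup>2)"
    using G by (intro sum_mono2) force+
  also have "\<dots> = (\<Sum>k\<in>fst ` G. (cmod (s k))\<^sup>2) * (\<Sum>l\<in>snd ` G. (cmod (t l))\<^sup>2)"
    by (simp add: sum_product sum.cartesian_product case_prod_unfold norm_mult power_mult_distrib)
  finally have "L2_set (\<lambda>p. cmod (case p of (k, l) \<Rightarrow> s k * t l)) G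
      \<le> L2_set (\<lambda>k. cmod (s k)) (fst ` G) * L2_set (\<lambda>l. cmod (t l)) (snd ` G)"
    unfolding L2_set_def real_sqrt_mult[symmetric] by (rule real_sqrt_le_mono)
  also have "\<dots> \<le> ell2_norm s * ell2_norm t" using assms by (intro mult_mono L2_set_le_ell2_norm) auto
  finally show "L2_set (\<lambda>p. cmod (case p of (k, l) \<Rightarrow> s k * t l)) G \<le> ell2_norm s * ell2_norm t" .
qed

lemma op_coord: assumes "T \<in> bounded_ops" "x \<in> ell2" shows "T x i = ell2_inner (op_adj T (unit_vec i)) x"
  using op_adj(3)[OF assms(1) _ assms(2), of "unit_vec i"] by (simp add: inner_unit_vec_left)

text \<open>Both coordinates are iterated sums of z against s \<otimes> t, where s and t are the
  adjoints of S and T applied to unit vectors. The product vector is square-summable, so the double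
  series converges absolutely and the order of summation may be exchanged.\<close>

lemma amp_commute: fixes z :: "'i \<times> 'j \<Rightarrow> complex"
  assumes S: "S \<in> bounded_ops" and T: "T \<in> bounded_ops" and z: "z \<in> ell2"
  shows "amp1 S (amp2 T z) = amp2 T (amp1 S z)"
proof (rule ext, clarify)
  fix i j
  define s where "s = op_adj S (unit_vec i)"
  define t where "t = op_adj T (unit_vec j)"
  have st: "s \<in> ell2" "t \<in> ell2" using bounded_opsD(2)[OF op_adj(1) unit_vec_ell2(1)] S T by (simp_all add: s_def t_def)
  have cols: "(\<lambda>k. w (k, l)) \<in> ell2" if "w \<in> ell2" for w :: "'i \<times> 'j \<Rightarrow> complex" and l
    using ell2_rows(1)[OF ell2_swap(1)[OF that]] by simp
  have "amp1 S (amp2 T z) (i, j) = (\<Sum>\<^sub>\<infinity>k. cnj (s k) * (\<Sum>\<^sub>\<infinity>l. cnj (t l) * z (k, l)))"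
  proof -
    have "amp1 S (amp2 T z) (i, j) = ell2_inner s (\<lambda>k. amp2 T z (k, j))"
      unfolding amp1_def s_def using op_coord[OF S cols[OF amp2_ell2(1)[OF T z]]] by simp
    also have "(\<lambda>k. amp2 T z (k, j)) = (\<lambda>k. ell2_inner t (\<lambda>l. z (k, l)))"
      unfolding amp2_def t_def using op_coord[OF T ell2_rows(1)[OF z]] by simp
    finally show ?thesis by (simp add: ell2_inner_def)
  qed
  also have "\<dots> = (\<Sum>\<^sub>\<infinity>k. \<Sum>\<^sub>\<infinity>l. cnj (s k) * (cnj (t l) * z (k, l)))"
    by (simp add: infsum_cmult_right')
  also have "\<dots> = (\<Sum>\<^sub>\<infinity>l. \<Sum>\<^sub>\<infinity>k. cnj (s k) * (cnj (t l) * z (k, l)))"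
  proof (rule infsum_swap_banach)
    have "(\<lambda>p. cnj (case p of (k, l) \<Rightarrow> s k * t l) * z p) summable_on UNIV"
      using ell2_tensor[OF st] z by (rule inner_summable)
    then show "(\<lambda>(k, l). cnj (s k) * (cnj (t l) * z (k, l))) summable_on UNIV \<times> UNIV"
      by (simp add: case_prod_unfold mult.assoc)
  qed
  also have "\<dots> = (\<Sum>\<^sub>\<infinity>l. cnj (t l) * (\<Sum>\<^sub>\<infinity>k. cnj (s k) * z (k, l)))"
    by (simp add: infsum_cmult_right' mult.left_commute[of "cnj (s _)"])
  also have "\<dots> = amp2 T (amp1 S z) (i, j)"
  proof -
    have "amp2 T (amp1 S z) (i, j) = ell2_inner t (\<lambda>l. amp1 S z (i, l))"
      unfolding amp2_def t_def using op_coord[OF T ell2_rows(1)[OF amp1_ell2(1)[OF S z]]] by simp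
    also have "(\<lambda>l. amp1 S z (i, l)) = (\<lambda>l. ell2_inner s (\<lambda>k. z (k, l)))"
      unfolding amp1_def s_def using op_coord[OF S cols[OF z]] by simp
    finally show ?thesis by (simp add: ell2_inner_def)
  qed
  finally show "amp1 S (amp2 T z) (i, j) = amp2 T (amp1 S z) (i, j)" .
qed

lemma op_tensor_amp: "op_tensor S T = (\<lambda>z\<in>ell2. amp1 S (amp2 T z))"
  by (auto simp: op_tensor_def amp1_def amp2_def restrict_def fun_eq_iff)

lemma ell2_cols: "z \<in> ell2 \<Longrightarrow> (\<lambda>k. z (k, l)) \<in> ell2"
  using ell2_rows(1)[OF ell2_swap(1)] by fastforce

lemma op_tensor_in:
  assumes S: "S \<in> bounded_ops" and T: "T \<in> bounded_ops"
  shows "op_tensor S T \<in> bounded_ops" "opn (op_tensor S T) \<le> opn S * opn T"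
proof -
  have le: "ell2_norm (amp1 S (amp2 T z)) \<le> (opn S * opn T) * ell2_norm z" if z: "z \<in> ell2" for z
    using amp1_ell2(2)[OF S amp2_ell2(1)[OF T z]] mult_left_mono[OF amp2_ell2(2)[OF T z] opn_bound(2)[OF S]]
    by (simp add: mult.assoc)
  show "op_tensor S T \<in> bounded_ops"
  proof (rule bounded_opsI)
    fix x y :: "'a \<times> 'b \<Rightarrow> complex" and i assume xy: "x \<in> ell2" "y \<in> ell2"
    have "amp2 T (\<lambda>i. x i + y i) = (\<lambda>i. amp2 T x i + amp2 T y i)"
      using bounded_opsD(3)[OF T ell2_rows(1)[OF xy(1)] ell2_rows(1)[OF xy(2)]] by (auto simp: amp2_def)
    moreover have "amp1 S (\<lambda>i. u i + v i) = (\<lambda>i. amp1 S u i + amp1 S v i)" if "u \<in> ell2" "v \<in> ell2" for u v :: "'a \<times> 'b \<Rightarrow> complex"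
      using bounded_opsD(3)[OF S ell2_cols[OF that(1)] ell2_cols[OF that(2)]] by (auto simp: amp1_def)
    ultimately show "op_tensor S T (\<lambda>i. x i + y i) i = op_tensor S T x i + op_tensor S T y i"
      using xy T by (simp add: op_tensor_amp ell2_add amp2_ell2)
  next
    fix x :: "'a \<times> 'b \<Rightarrow> complex" and c i assume x: "x \<in> ell2"
    have "amp2 T (\<lambda>i. c * x i) = (\<lambda>i. c * amp2 T x i)"
      using bounded_opsD(4)[OF T ell2_rows(1)[OF x]] by (auto simp: amp2_def)
    moreover have "amp1 S (\<lambda>i. c * u i) = (\<lambda>i. c * amp1 S u i)" if "u \<in> ell2" for u :: "'a \<times> 'b \<Rightarrow> complex"
      using bounded_opsD(4)[OF S ell2_cols[OF that]] by (auto simp: amp1_def)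
    ultimately show "op_tensor S T (\<lambda>i. c * x i) i = c * op_tensor S T x i"
      using x T by (simp add: op_tensor_amp amp2_ell2)
  qed (use le S T in \<open>auto simp: op_tensor_amp amp1_ell2 amp2_ell2\<close>)
  show "opn (op_tensor S T) \<le> opn S * opn T"
    using le opn_bound(2)[OF S] opn_bound(2)[OF T] by (intro opn_le) (auto simp: op_tensor_amp)
qed

text \<open>The product is (S \<otimes> 1)(1 \<otimes> T)(S' \<otimes> 1)(1 \<otimes> T'); commuting
  the two middle factors groups the legs.\<close>

lemma op_tensor_mult:
  assumes S: "S \<in> bounded_ops" "S' \<in> bounded_ops" and T: "T \<in> bounded_ops" "T' \<in> bounded_ops"
  shows "compose ell2 (op_tensor S T) (op_tensor S' T') = op_tensor (compose ell2 S S') (compose ell2 T T')"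
proof -
  have "amp1 S (amp2 T (amp1 S' (amp2 T' z))) = amp1 (compose ell2 S S') (amp2 (compose ell2 T T') z)" if z: "z \<in> ell2" for z :: "'a \<times> 'b \<Rightarrow> complex"
  proof -
    have "amp2 T (amp1 S' (amp2 T' z)) = amp1 S' (amp2 T (amp2 T' z))"
      using amp_commute[OF S(2) T(1) amp2_ell2(1)[OF T(2) z]] by simp
    moreover have "amp2 T (amp2 T' z) = amp2 (compose ell2 T T') z"
      using ell2_rows(1)[OF z] by (auto simp: amp2_def compose_def)
    moreover have "amp1 S (amp1 S' w) = amp1 (compose ell2 S S') w" if "w \<in> ell2" for w :: "'a \<times> 'b \<Rightarrow> complex"
      using ell2_cols[OF that] by (auto simp: amp1_def compose_def)
    ultimately show ?thesis using amp2_ell2(1)[OF op_mult_in(1)[OF T] z] by simp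
  qed
  then show ?thesis using S T by (auto simp: op_tensor_amp compose_def restrict_def amp1_ell2 amp2_ell2)
qed

lemma op_tensor_adj:
  assumes S: "S \<in> bounded_ops" and T: "T \<in> bounded_ops"
  shows "op_adj (op_tensor S T) = op_tensor (op_adj S) (op_adj T)"
proof (rule op_adj_unique[symmetric])
  fix x y :: "'a \<times> 'b \<Rightarrow> complex" assume "x \<in> ell2" "y \<in> ell2"
  then show "ell2_inner (op_tensor (op_adj S) (op_adj T) x) y = ell2_inner x (op_tensor S T y)"
    using S T by (simp add: op_tensor_amp amp1_inner amp2_inner amp1_ell2 amp2_ell2 op_adj(1) amp_commute)
qed (use S T in \<open>simp_all add: op_tensor_in op_adj\<close>)

lemma op_tensor_one: "op_tensor (\<lambda>x\<in>ell2. x) (\<lambda>x\<in>ell2. x) = (\<lambda>z\<in>ell2. z)"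
  by (auto simp: op_tensor_def restrict_def ell2_rows ell2_cols fun_eq_iff)

lemma op_tensor_add:
  assumes "S \<in> bounded_ops" "T \<in> bounded_ops" "S' \<in> bounded_ops" "T' \<in> bounded_ops"
  shows "op_tensor (\<lambda>x\<in>ell2. \<lambda>i. S x i + S' x i) T = (\<lambda>z\<in>ell2. \<lambda>i. op_tensor S T z i + op_tensor S' T z i)"
    "op_tensor S (\<lambda>x\<in>ell2. \<lambda>i. T x i + T' x i) = (\<lambda>z\<in>ell2. \<lambda>i. op_tensor S T z i + op_tensor S T' z i)"
proof -
  have c: "(\<lambda>k. U (\<lambda>l. z (k, l)) j) \<in> ell2" if "U \<in> bounded_ops" "z \<in> ell2" for U and z :: "'a \<times> 'b \<Rightarrow> complex" and j
    using ell2_cols[OF amp2_ell2(1)[OF that]] by (simp add: amp2_def)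
  show "op_tensor (\<lambda>x\<in>ell2. \<lambda>i. S x i + S' x i) T = (\<lambda>z\<in>ell2. \<lambda>i. op_tensor S T z i + op_tensor S' T z i)"
    using assms c by (auto simp: op_tensor_def restrict_def fun_eq_iff)
  show "op_tensor S (\<lambda>x\<in>ell2. \<lambda>i. T x i + T' x i) = (\<lambda>z\<in>ell2. \<lambda>i. op_tensor S T z i + op_tensor S T' z i)"
    using assms c bounded_opsD(3)[OF assms(1)] by (auto simp: op_tensor_def restrict_def fun_eq_iff ell2_rows)
qed

lemma op_tensor_scale:
  assumes "S \<in> bounded_ops" "T \<in> bounded_ops"
  shows "op_tensor (\<lambda>x\<in>ell2. \<lambda>i. c * S x i) T = (\<lambda>z\<in>ell2. \<lambda>i. c * op_tensor S T z i)"
    "op_tensor S (\<lambda>x\<in>ell2. \<lambda>i. c * T x i) = (\<lambda>z\<in>ell2. \<lambda>i. c * op_tensor S T z i)"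
proof -
  have c: "(\<lambda>k. U (\<lambda>l. z (k, l)) j) \<in> ell2" if "U \<in> bounded_ops" "z \<in> ell2" for U and z :: "'a \<times> 'b \<Rightarrow> complex" and j
    using ell2_cols[OF amp2_ell2(1)[OF that]] by (simp add: amp2_def)
  show "op_tensor (\<lambda>x\<in>ell2. \<lambda>i. c * S x i) T = (\<lambda>z\<in>ell2. \<lambda>i. c * op_tensor S T z i)"
    using assms c by (auto simp: op_tensor_def restrict_def fun_eq_iff)
  show "op_tensor S (\<lambda>x\<in>ell2. \<lambda>i. c * T x i) = (\<lambda>z\<in>ell2. \<lambda>i. c * op_tensor S T z i)"
    using assms c bounded_opsD(4)[OF assms(1)] by (auto simp: op_tensor_def restrict_def fun_eq_iff ell2_rows)
qed

section \<open>Bounded families and closed subalgebras\<close>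

text \<open>Fixes the record type to \<open>'a cstar\<close> without extension fields, the type that
  \<open>bounded_families\<close> takes.\<close>

locale cstar_families = cstar_algebra A for A :: "'a cstar" (structure)

lemma bounded_families_simps [simp]:
  "mult (bounded_families I B) = (\<lambda>S T. \<lambda>i\<in>I. S i \<otimes>\<^bsub>B\<^esub> T i)" "one (bounded_families I B) = (\<lambda>i\<in>I. \<one>\<^bsub>B\<^esub>)"
  "zero (bounded_families I B) = (\<lambda>i\<in>I. \<zero>\<^bsub>B\<^esub>)" "add (bounded_families I B) = (\<lambda>S T. \<lambda>i\<in>I. S i \<oplus>\<^bsub>B\<^esub> T i)"
  "smult (bounded_families I B) = (\<lambda>c T. \<lambda>i\<in>I. c \<odot>\<^bsub>B\<^esub> T i)" "adj (bounded_families I B) = (\<lambda>T. \<lambda>i\<in>I. adj B (T i))"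
  by (simp_all add: bounded_families_def)

lemma (in cstar_families) bounded_families_carrier:
  "T \<in> carrier (bounded_families I A) \<longleftrightarrow> T \<in> I \<rightarrow>\<^sub>E carrier A \<and> (\<exists>K. \<forall>i\<in>I. cnorm A (T i) \<le> K)"
  by (simp add: bounded_families_def)

lemma (in cstar_families) families_inI:
  "\<lbrakk>\<And>i. i \<in> I \<Longrightarrow> f i \<in> carrier A; \<And>i. i \<in> I \<Longrightarrow> cnorm A (f i) \<le> K\<rbrakk> \<Longrightarrow> (\<lambda>i\<in>I. f i) \<in> carrier (bounded_families I A)"
  by (auto simp: bounded_families_carrier)

lemma (in cstar_families) families_inD:
  assumes "T \<in> carrier (bounded_families I A)"
  shows "i \<in> I \<Longrightarrow> T i \<in> carrier A" "i \<in> I \<Longrightarrow> cnorm A (T i) \<le> cnorm (bounded_families I A) T"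
    "0 \<le> cnorm (bounded_families I A) T" "restrict T I = T"
proof -
  obtain K where K: "\<And>i. i \<in> I \<Longrightarrow> cnorm A (T i) \<le> K" using assms unfolding bounded_families_carrier by blast
  have bdd: "bdd_above (insert 0 ((\<lambda>i. cnorm A (T i)) ` I))"
    using K by (intro bdd_aboveI[of _ "max K 0"]) (auto simp: le_max_iff_disj)
  show "i \<in> I \<Longrightarrow> T i \<in> carrier A" "restrict T I = T"
    using assms by (auto simp: bounded_families_carrier PiE_iff extensional_restrict)
  show "i \<in> I \<Longrightarrow> cnorm A (T i) \<le> cnorm (bounded_families I A) T" "0 \<le> cnorm (bounded_families I A) T"
    using bdd by (auto simp: bounded_families_def intro!: cSup_upper)
qed

text \<open>The condition \<open>0 \<le> K\<close> reflects the 0 inserted into the supremum, which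
  gives norm 0 over an empty index set. Such index sets do occur: the zero algebra has no unital
  representation.\<close>

lemma (in cstar_families) families_norm_le:
  "\<lbrakk>\<And>i. i \<in> I \<Longrightarrow> cnorm A (T i) \<le> K; 0 \<le> K\<rbrakk> \<Longrightarrow> cnorm (bounded_families I A) T \<le> K"
  by (auto simp: bounded_families_def intro!: cSup_least)

lemma (in cstar_families) families_eqI:
  "\<lbrakk>T \<in> carrier (bounded_families I A); \<And>i. i \<in> I \<Longrightarrow> f i = T i\<rbrakk> \<Longrightarrow> restrict f I = T"
  by (metis families_inD(4) restrict_ext)

text \<open>Limits are taken entry by entry; the Cauchy estimate is uniform in the index, so the
  limit family is bounded and the convergence holds in the supremum norm.\<close>

lemma (in cstar_families) families_complete:
  fixes s :: "nat \<Rightarrow> 'i \<Rightarrow> 'a" and I :: "'i set"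
  defines "P \<equiv> bounded_families I A"
  assumes s: "\<And>n. s n \<in> carrier P"
    and c: "\<forall>e>0. \<exists>M. \<forall>m\<ge>M. \<forall>n\<ge>M. cnorm P (s m \<oplus>\<^bsub>P\<^esub> (-1) \<odot>\<^bsub>P\<^esub> s n) < e"
  shows "\<exists>a\<in>carrier P. (\<lambda>n. cnorm P (s n \<oplus>\<^bsub>P\<^esub> (-1) \<odot>\<^bsub>P\<^esub> a)) \<longlonglongrightarrow> 0"
proof -
  note sD = families_inD[OF s[unfolded P_def]]
  have diff: "(S \<oplus>\<^bsub>P\<^esub> (-1) \<odot>\<^bsub>P\<^esub> T) i = S i \<ominus> T i" if "S i \<in> carrier A" "T i \<in> carrier A" "i \<in> I" for S T i
    using that by (simp add: P_def diff_eq_smult)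
  have le: "cnorm A (s m i \<ominus> s n i) \<le> cnorm P (s m \<oplus>\<^bsub>P\<^esub> (-1) \<odot>\<^bsub>P\<^esub> s n)" if i: "i \<in> I" for m n i
  proof -
    have "s m \<oplus>\<^bsub>P\<^esub> (-1) \<odot>\<^bsub>P\<^esub> s n \<in> carrier P"
      unfolding P_def bounded_families_simps
    proof (rule families_inI[where K = "cnorm P (s m) + cnorm P (s n)"])
      fix j assume "j \<in> I"
      then show "s m j \<oplus> (\<lambda>i\<in>I. - 1 \<odot> s n i) j \<in> carrier A"
        "cnorm A (s m j \<oplus> (\<lambda>i\<in>I. - 1 \<odot> s n i) j) \<le> cnorm P (s m) + cnorm P (s n)"
        using sD(1)[of j] sD(2)[of j m] sD(2)[of j n] norm_add[of "s m j" "(-1) \<odot> s n j"] by (auto simp: P_def)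
    qed
    from families_inD(2)[OF this[unfolded P_def] i] show ?thesis
      using diff[where S = "s m" and T = "s n" and i = i] sD(1)[OF i] i by (simp add: P_def)
  qed
  have "\<exists>l. conv (\<lambda>n. s n i) l" if i: "i \<in> I" for i
  proof (rule cauchy_conv)
    show "\<forall>e>0. \<exists>M. \<forall>m\<ge>M. \<forall>n\<ge>M. cnorm A (s m i \<ominus> s n i) < e"
      using c le[OF i] by (meson le_less_trans)
  qed (use sD i in blast)
  then obtain l where l: "\<And>i. i \<in> I \<Longrightarrow> conv (\<lambda>n. s n i) (l i)" by metis
  have lc: "l i \<in> carrier A" if "i \<in> I" for i using l[OF that] by (simp add: conv_def)
  have close: "cnorm A (s n i \<ominus> l i) \<le> e"
    if M: "\<And>m. m \<ge> M \<Longrightarrow> cnorm P (s n \<oplus>\<^bsub>P\<^esub> (-1) \<odot>\<^bsub>P\<^esub> s m) < e" and i: "i \<in> I" for n e M i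
  proof (rule LIMSEQ_le_const2)
    have "conv (\<lambda>m. s n i \<oplus> (-1) \<odot> s m i) (s n i \<oplus> (-1) \<odot> l i)"
      by (intro conv_add conv_smult conv_const l i sD)
    from conv_norm[OF this] show "(\<lambda>m. cnorm A (s n i \<ominus> s m i)) \<longlonglongrightarrow> cnorm A (s n i \<ominus> l i)"
      using i sD(1) lc by (simp add: diff_eq_smult)
    show "\<exists>N. \<forall>m\<ge>N. cnorm A (s n i \<ominus> s m i) \<le> e"
      using le[OF i] M by (meson less_imp_le order_trans)
  qed
  obtain M where M: "\<And>m n. m \<ge> M \<Longrightarrow> n \<ge> M \<Longrightarrow> cnorm P (s m \<oplus>\<^bsub>P\<^esub> (-1) \<odot>\<^bsub>P\<^esub> s n) < 1"
    using c zero_less_one by blast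
  define L where "L = restrict l I"
  have L: "L \<in> carrier P"
    unfolding L_def P_def
  proof (rule families_inI[where K = "cnorm P (s M) + 1"])
    fix i assume i: "i \<in> I"
    show "cnorm A (l i) \<le> cnorm P (s M) + 1"
      using close[of M M 1 i] M i norm_triangle2[of "l i" "s M i"] lc[OF i] sD(1)[OF i, of M] sD(2)[OF i, of M]
        norm_diff_commute[of "l i" "s M i"] by (simp add: P_def)
  qed (rule lc)
  have "(\<lambda>n. cnorm P (s n \<oplus>\<^bsub>P\<^esub> (-1) \<odot>\<^bsub>P\<^esub> L)) \<longlonglongrightarrow> 0"
  proof (rule LIMSEQ_I)
    fix e :: real assume "e > 0"
    then have "e / 2 > 0" by simp
    then obtain M where M: "\<And>m n. m \<ge> M \<Longrightarrow> n \<ge> M \<Longrightarrow> cnorm P (s m \<oplus>\<^bsub>P\<^esub> (-1) \<odot>\<^bsub>P\<^esub> s n) < e / 2" using c by blast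
    have "norm (cnorm P (s n \<oplus>\<^bsub>P\<^esub> (-1) \<odot>\<^bsub>P\<^esub> L) - 0) < e" if n: "n \<ge> M" for n
    proof -
      have b: "cnorm A ((s n \<oplus>\<^bsub>P\<^esub> (-1) \<odot>\<^bsub>P\<^esub> L) i) \<le> e / 2" if i: "i \<in> I" for i
        using close[of M n "e / 2" i] M[OF n] i sD(1)[OF i, of n] lc[OF i] by (subst diff) (auto simp: L_def)
      have "cnorm P (s n \<oplus>\<^bsub>P\<^esub> (-1) \<odot>\<^bsub>P\<^esub> L) \<le> e / 2"
        using b \<open>e > 0\<close> unfolding P_def by (intro families_norm_le) auto
      moreover have "0 \<le> cnorm P (s n \<oplus>\<^bsub>P\<^esub> (-1) \<odot>\<^bsub>P\<^esub> L)"
      proof -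
        have "s n \<oplus>\<^bsub>P\<^esub> (-1) \<odot>\<^bsub>P\<^esub> L \<in> carrier P"
          unfolding P_def bounded_families_simps
          using b sD(1) lc by (intro families_inI[where K = "e / 2"]) (auto simp: P_def L_def)
        then show ?thesis unfolding P_def by (rule families_inD(3))
      qed
      ultimately show ?thesis using \<open>e > 0\<close> by simp
    qed
    then show "\<exists>no. \<forall>n\<ge>no. norm (cnorm P (s n \<oplus>\<^bsub>P\<^esub> (-1) \<odot>\<^bsub>P\<^esub> L) - 0) < e" by blast
  qed
  with L show ?thesis by blast
qed

lemma (in cstar_families) cstar_algebra_families: "cstar_algebra (bounded_families I A)"
proof (rule cstar_algebraI)
  let ?P = "bounded_families I A"
  fix S T assume "S \<in> carrier ?P" "T \<in> carrier ?P"
  note S = families_inD[OF this(1)] and T = families_inD[OF this(2)]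
  have add: "cnorm A (S i \<oplus> T i) \<le> cnorm ?P S + cnorm ?P T" if "i \<in> I" for i
    using norm_add[of "S i" "T i"] S(1,2)[of i] T(1,2)[of i] that by simp
  have mult: "cnorm A (S i \<otimes> T i) \<le> cnorm ?P S * cnorm ?P T" if "i \<in> I" for i
    using norm_mult[of "S i" "T i"] mult_mono[OF S(2)[OF that] T(2)[OF that]] S(1)[of i] S(3) T(1)[of i] that by simp
  show "S \<oplus>\<^bsub>?P\<^esub> T \<in> carrier ?P" "S \<otimes>\<^bsub>?P\<^esub> T \<in> carrier ?P"
    unfolding bounded_families_simps using S(1) T(1) add mult by (auto intro!: families_inI)
  show "cnorm ?P (S \<oplus>\<^bsub>?P\<^esub> T) \<le> cnorm ?P S + cnorm ?P T"
    by (rule families_norm_le) (use add S(3) T(3) in auto)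
  show "cnorm ?P (S \<otimes>\<^bsub>?P\<^esub> T) \<le> cnorm ?P S * cnorm ?P T"
    by (rule families_norm_le) (use mult S(3) T(3) in auto)
  show "S \<oplus>\<^bsub>?P\<^esub> T = T \<oplus>\<^bsub>?P\<^esub> S" "adj ?P (S \<oplus>\<^bsub>?P\<^esub> T) = adj ?P S \<oplus>\<^bsub>?P\<^esub> adj ?P T"
    "adj ?P (S \<otimes>\<^bsub>?P\<^esub> T) = adj ?P T \<otimes>\<^bsub>?P\<^esub> adj ?P S"
    "c \<odot>\<^bsub>?P\<^esub> (S \<oplus>\<^bsub>?P\<^esub> T) = c \<odot>\<^bsub>?P\<^esub> S \<oplus>\<^bsub>?P\<^esub> c \<odot>\<^bsub>?P\<^esub> T"
    "(c \<odot>\<^bsub>?P\<^esub> S) \<otimes>\<^bsub>?P\<^esub> T = c \<odot>\<^bsub>?P\<^esub> (S \<otimes>\<^bsub>?P\<^esub> T)" "S \<otimes>\<^bsub>?P\<^esub> (c \<odot>\<^bsub>?P\<^esub> T) = c \<odot>\<^bsub>?P\<^esub> (S \<otimes>\<^bsub>?P\<^esub> T)" for c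
    unfolding bounded_families_simps using S(1) T(1) by (auto intro!: restrict_ext simp: a_comm smult_add_right)
next
  let ?P = "bounded_families I A"
  fix T assume Tc: "T \<in> carrier ?P"
  note T = families_inD[OF this]
  show "\<zero>\<^bsub>?P\<^esub> \<oplus>\<^bsub>?P\<^esub> T = T" "\<one>\<^bsub>?P\<^esub> \<otimes>\<^bsub>?P\<^esub> T = T" "T \<otimes>\<^bsub>?P\<^esub> \<one>\<^bsub>?P\<^esub> = T" "1 \<odot>\<^bsub>?P\<^esub> T = T" "adj ?P (adj ?P T) = T"
    unfolding bounded_families_simps using T(1) by (auto intro!: families_eqI[OF Tc])
  show "(c + d) \<odot>\<^bsub>?P\<^esub> T = c \<odot>\<^bsub>?P\<^esub> T \<oplus>\<^bsub>?P\<^esub> d \<odot>\<^bsub>?P\<^esub> T" "0 \<odot>\<^bsub>?P\<^esub> T = \<zero>\<^bsub>?P\<^esub>"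
    "c \<odot>\<^bsub>?P\<^esub> (d \<odot>\<^bsub>?P\<^esub> T) = (c * d) \<odot>\<^bsub>?P\<^esub> T" "adj ?P (c \<odot>\<^bsub>?P\<^esub> T) = cnj c \<odot>\<^bsub>?P\<^esub> adj ?P T" for c d
    unfolding bounded_families_simps using T(1) by (auto intro!: restrict_ext simp: smult_add_left)
  show sm: "c \<odot>\<^bsub>?P\<^esub> T \<in> carrier ?P" for c
    unfolding bounded_families_simps using T(1,2)
    by (intro families_inI[where K = "cmod c * cnorm ?P T"]) (auto simp: mult_left_mono)
  show ad: "adj ?P T \<in> carrier ?P"
    unfolding bounded_families_simps using T(1,2) by (intro families_inI[where K = "cnorm ?P T"]) auto
  show "cnorm ?P (c \<odot>\<^bsub>?P\<^esub> T) = cmod c * cnorm ?P T" for c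
  proof (rule antisym)
    have le: "cnorm ?P (c \<odot>\<^bsub>?P\<^esub> S) \<le> cmod c * cnorm ?P S" if "S \<in> carrier ?P" for c S
      using families_inD[OF that] by (intro families_norm_le) (auto simp: mult_left_mono)
    show "cnorm ?P (c \<odot>\<^bsub>?P\<^esub> T) \<le> cmod c * cnorm ?P T" using Tc by (rule le)
    show "cmod c * cnorm ?P T \<le> cnorm ?P (c \<odot>\<^bsub>?P\<^esub> T)"
    proof (cases "c = 0")
      case True
      then show ?thesis using families_inD(3)[OF sm[of c]] by simp
    next
      case False
      have "(1 / c) \<odot>\<^bsub>?P\<^esub> (c \<odot>\<^bsub>?P\<^esub> T) = T"
        unfolding bounded_families_simps using T(1) False by (auto intro!: families_eqI[OF Tc])
      then show ?thesis using le[OF sm, of "1 / c" c] False by (simp add: norm_divide field_simps)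
    qed
  qed
  show "cnorm ?P (adj ?P T \<otimes>\<^bsub>?P\<^esub> T) = (cnorm ?P T)\<^sup>2"
  proof (rule antisym)
    let ?a = "adj ?P T \<otimes>\<^bsub>?P\<^esub> T"
    have i: "cnorm A (?a i) = (cnorm A (T i))\<^sup>2" if "i \<in> I" for i using that T(1)[OF that] by (simp add: norm_cstar)
    then show "cnorm ?P ?a \<le> (cnorm ?P T)\<^sup>2"
      using T by (intro families_norm_le) (auto simp: power_mono simp del: bounded_families_simps)
    have a: "?a \<in> carrier ?P"
      unfolding bounded_families_simps using T(1,2) norm_cstar
      by (intro families_inI[where K = "(cnorm ?P T)\<^sup>2"]) (auto simp: power_mono)
    have "cnorm ?P T \<le> sqrt (cnorm ?P ?a)"
    proof (rule families_norm_le)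
      fix j assume j: "j \<in> I"
      have "(cnorm A (T j))\<^sup>2 \<le> cnorm ?P ?a" using families_inD(2)[OF a j] i[OF j] by simp
      then show "cnorm A (T j) \<le> sqrt (cnorm ?P ?a)" by (rule real_le_rsqrt)
    qed (use families_inD(3)[OF a] in simp)
    then have "(cnorm ?P T)\<^sup>2 \<le> (sqrt (cnorm ?P ?a))\<^sup>2" using T(3) by (rule power_mono)
    then show "(cnorm ?P T)\<^sup>2 \<le> cnorm ?P ?a" using families_inD(3)[OF a] by simp
  qed
  show "T = \<zero>\<^bsub>?P\<^esub>" if "cnorm ?P T = 0"
    unfolding bounded_families_simps
    using T(1,2) that norm_nonneg by (intro families_eqI[OF Tc, symmetric]) (metis norm_eq_zero order_antisym)
next
  let ?P = "bounded_families I A"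
  show "\<zero>\<^bsub>?P\<^esub> \<in> carrier ?P" "\<one>\<^bsub>?P\<^esub> \<in> carrier ?P"
    unfolding bounded_families_simps using norm_one_le by (auto intro!: families_inI)
next
  let ?P = "bounded_families I A"
  fix S T U assume "S \<in> carrier ?P" "T \<in> carrier ?P" "U \<in> carrier ?P"
  note S = families_inD(1)[OF this(1)] and T = families_inD(1)[OF this(2)] and U = families_inD(1)[OF this(3)]
  show "(S \<oplus>\<^bsub>?P\<^esub> T) \<oplus>\<^bsub>?P\<^esub> U = S \<oplus>\<^bsub>?P\<^esub> (T \<oplus>\<^bsub>?P\<^esub> U)" "(S \<otimes>\<^bsub>?P\<^esub> T) \<otimes>\<^bsub>?P\<^esub> U = S \<otimes>\<^bsub>?P\<^esub> (T \<otimes>\<^bsub>?P\<^esub> U)"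
    "(S \<oplus>\<^bsub>?P\<^esub> T) \<otimes>\<^bsub>?P\<^esub> U = S \<otimes>\<^bsub>?P\<^esub> U \<oplus>\<^bsub>?P\<^esub> T \<otimes>\<^bsub>?P\<^esub> U" "U \<otimes>\<^bsub>?P\<^esub> (S \<oplus>\<^bsub>?P\<^esub> T) = U \<otimes>\<^bsub>?P\<^esub> S \<oplus>\<^bsub>?P\<^esub> U \<otimes>\<^bsub>?P\<^esub> T"
    unfolding bounded_families_simps using S T U by (auto intro!: restrict_ext simp: a_assoc m_assoc l_distr r_distr)
qed (fact families_complete)

text \<open>\<open>min_tensor\<close> only replaces the carrier of an ambient algebra, so all
  identities are inherited, and stability under the operations and limits is all that
  remains.\<close>

lemma cstar_closed_subalgebra:
  assumes P: "cstar_algebra P" and S: "S \<subseteq> carrier P" "\<one>\<^bsub>P\<^esub> \<in> S" "\<zero>\<^bsub>P\<^esub> \<in> S"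
    and add: "\<And>a b. a \<in> S \<Longrightarrow> b \<in> S \<Longrightarrow> a \<oplus>\<^bsub>P\<^esub> b \<in> S"
    and mult: "\<And>a b. a \<in> S \<Longrightarrow> b \<in> S \<Longrightarrow> a \<otimes>\<^bsub>P\<^esub> b \<in> S"
    and smult: "\<And>a c. a \<in> S \<Longrightarrow> c \<odot>\<^bsub>P\<^esub> a \<in> S"
    and adj: "\<And>a. a \<in> S \<Longrightarrow> adj P a \<in> S"
    and lim: "\<And>s a. \<lbrakk>\<And>n. s n \<in> S; cstar_algebra.conv P s a\<rbrakk> \<Longrightarrow> a \<in> S"
  shows "cstar_algebra (P\<lparr>carrier := S\<rparr>)"
proof -
  interpret P: cstar_algebra P by fact
  have c: "a \<in> carrier P" if "a \<in> S" for a using that S by blast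
  show ?thesis
  proof (rule cstar_algebraI, goal_cases)
    case (6 a b)
    then show ?case by (simp add: c P.a_comm)
  next
    \<comment> \<open>The completeness axiom: the limit exists in the ambient algebra and is brought
      back by closedness.\<close>
    case (31 s)
    then have s: "\<And>n. s n \<in> S" by simp
    obtain a where a: "a \<in> carrier P" "(\<lambda>n. cnorm P (s n \<oplus>\<^bsub>P\<^esub> (-1) \<odot>\<^bsub>P\<^esub> a)) \<longlonglongrightarrow> 0"
      using P.complete[of s] 31 c by auto
    then have "P.conv s a" using s c by (simp add: P.conv_def P.diff_eq_smult)
    with lim[of s a] s have "a \<in> S" by blast
    with a show ?case by auto
  qed (use S add mult smult adj in \<open>auto simp: c P.a_assoc P.m_assoc P.l_distr P.r_distr P.smult_add_left
      P.smult_add_right P.norm_add P.norm_mult P.norm_cstar P.norm_eq_zero\<close>)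
qed

section \<open>The minimal tensor product\<close>

declare bounded_families_simps [simp del] B_ell2_simps [simp del] B_ell2_simps(1,7) [simp]

lemma op_tensor_B:
  assumes "S \<in> bounded_ops" "T \<in> bounded_ops"
  shows "S' \<in> bounded_ops \<Longrightarrow> op_tensor (S \<oplus>\<^bsub>B_ell2\<^esub> S') T = op_tensor S T \<oplus>\<^bsub>B_ell2\<^esub> op_tensor S' T"
    "T' \<in> bounded_ops \<Longrightarrow> op_tensor S (T \<oplus>\<^bsub>B_ell2\<^esub> T') = op_tensor S T \<oplus>\<^bsub>B_ell2\<^esub> op_tensor S T'"
    "op_tensor (c \<odot>\<^bsub>B_ell2\<^esub> S) T = c \<odot>\<^bsub>B_ell2\<^esub> op_tensor S T"
    "op_tensor S (c \<odot>\<^bsub>B_ell2\<^esub> T) = c \<odot>\<^bsub>B_ell2\<^esub> op_tensor S T"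
    "\<lbrakk>S' \<in> bounded_ops; T' \<in> bounded_ops\<rbrakk> \<Longrightarrow>
      op_tensor S T \<otimes>\<^bsub>B_ell2\<^esub> op_tensor S' T' = op_tensor (S \<otimes>\<^bsub>B_ell2\<^esub> S') (T \<otimes>\<^bsub>B_ell2\<^esub> T')"
    "adj B_ell2 (op_tensor S T) = op_tensor (adj B_ell2 S) (adj B_ell2 T)"
    "op_tensor \<one>\<^bsub>B_ell2\<^esub> \<one>\<^bsub>B_ell2\<^esub> = \<one>\<^bsub>B_ell2\<^esub>"
  using assms
  by (simp_all only: B_ell2_simps op_tensor_add op_tensor_scale op_tensor_mult op_tensor_adj op_tensor_one adj_B_ell2 op_tensor_in)

lemmas reps_hom = star_homD[where B = "B_ell2 :: nat operator cstar", folded reps_def]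

locale tensor_pair = A: cstar_algebra A + B: cstar_algebra B
  for A :: "('a, 'm) cstar_scheme" and B :: "('b, 'n) cstar_scheme"
begin

abbreviation "P \<equiv> bounded_families (reps A \<times> reps B) (B_ell2 :: (nat \<times> nat) operator cstar)"
abbreviation "T \<equiv> min_tensor A B"

sublocale BE: cstar_families "B_ell2 :: (nat \<times> nat) operator cstar"
  by (intro cstar_families.intro cstar_algebra_B_ell2)

sublocale P: cstar_algebra P
  by (rule BE.cstar_algebra_families)

lemma rep: assumes "\<pi> \<in> reps A" "a \<in> carrier A" shows "\<pi> a \<in> bounded_ops" "opn (\<pi> a) \<le> cnorm A a"
  using star_homD(2,8)[OF assms(1)[unfolded reps_def] assms(2)] by simp_all

lemma rep': assumes "\<pi> \<in> reps B" "a \<in> carrier B" shows "\<pi> a \<in> bounded_ops" "opn (\<pi> a) \<le> cnorm B a"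
  using star_homD(2,8)[OF assms(1)[unfolded reps_def] assms(2)] by simp_all

lemma tensor_P: assumes "a \<in> carrier A" "b \<in> carrier B" shows "tensor A B a b \<in> carrier P"
  unfolding tensor_def
proof (rule BE.families_inI[where K = "cnorm A a * cnorm B b"])
  fix p assume "p \<in> reps A \<times> reps B"
  then obtain \<pi> \<rho> where p: "p = (\<pi>, \<rho>)" "\<pi> \<in> reps A" "\<rho> \<in> reps B" by blast
  note r = rep[OF p(2) assms(1)] rep'[OF p(3) assms(2)]
  show "(case p of (\<pi>, \<rho>) \<Rightarrow> op_tensor (\<pi> a) (\<rho> b)) \<in> carrier B_ell2"
    using r by (simp add: p op_tensor_in)
  have "opn (op_tensor (\<pi> a) (\<rho> b)) \<le> opn (\<pi> a) * opn (\<rho> b)" using r by (intro op_tensor_in)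
  also have "\<dots> \<le> cnorm A a * cnorm B b" using r opn_bound(2) assms by (intro mult_mono) auto
  finally show "cnorm B_ell2 (case p of (\<pi>, \<rho>) \<Rightarrow> op_tensor (\<pi> a) (\<rho> b)) \<le> cnorm A a * cnorm B b"
    by (simp add: p)
qed

lemma P_tensor_mult: assumes "a \<in> carrier A" "b \<in> carrier B" "a' \<in> carrier A" "b' \<in> carrier B"
  shows "tensor A B a b \<otimes>\<^bsub>P\<^esub> tensor A B a' b' = tensor A B (a \<otimes>\<^bsub>A\<^esub> a') (b \<otimes>\<^bsub>B\<^esub> b')"
  unfolding tensor_def bounded_families_simps
  by (rule restrict_ext) (use assms in \<open>auto simp: rep rep' op_tensor_B reps_hom\<close>)

lemma P_tensor_adj: assumes "a \<in> carrier A" "b \<in> carrier B"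
  shows "adj P (tensor A B a b) = tensor A B (adj A a) (adj B b)"
  unfolding tensor_def bounded_families_simps
  by (rule restrict_ext) (use assms in \<open>auto simp: rep rep' op_tensor_B reps_hom\<close>)

lemma P_tensor_add_left: assumes "a \<in> carrier A" "a' \<in> carrier A" "b \<in> carrier B"
  shows "tensor A B (a \<oplus>\<^bsub>A\<^esub> a') b = tensor A B a b \<oplus>\<^bsub>P\<^esub> tensor A B a' b"
  unfolding tensor_def bounded_families_simps
  by (rule restrict_ext) (use assms in \<open>auto simp: rep rep' op_tensor_B reps_hom\<close>)

lemma P_tensor_add_right: assumes "a \<in> carrier A" "b \<in> carrier B" "b' \<in> carrier B"
  shows "tensor A B a (b \<oplus>\<^bsub>B\<^esub> b') = tensor A B a b \<oplus>\<^bsub>P\<^esub> tensor A B a b'"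
  unfolding tensor_def bounded_families_simps
  by (rule restrict_ext) (use assms in \<open>auto simp: rep rep' op_tensor_B reps_hom\<close>)

lemma P_tensor_smult_left: assumes "a \<in> carrier A" "b \<in> carrier B"
  shows "tensor A B (c \<odot>\<^bsub>A\<^esub> a) b = c \<odot>\<^bsub>P\<^esub> tensor A B a b"
  unfolding tensor_def bounded_families_simps
  by (rule restrict_ext) (use assms in \<open>auto simp: rep rep' op_tensor_B reps_hom\<close>)

lemma P_tensor_smult_right: assumes "a \<in> carrier A" "b \<in> carrier B"
  shows "tensor A B a (c \<odot>\<^bsub>B\<^esub> b) = c \<odot>\<^bsub>P\<^esub> tensor A B a b"
  unfolding tensor_def bounded_families_simps
  by (rule restrict_ext) (use assms in \<open>auto simp: rep rep' op_tensor_B reps_hom\<close>)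

lemma P_tensor_one: "tensor A B \<one>\<^bsub>A\<^esub> \<one>\<^bsub>B\<^esub> = \<one>\<^bsub>P\<^esub>"
  unfolding tensor_def bounded_families_simps
  by (rule restrict_ext) (auto simp: op_tensor_B(7)[OF op_one_in op_one_in] reps_hom)

text \<open>The image of the algebraic tensor product among the bounded families; the minimal tensor
  product is its norm closure.\<close>

definition D :: "('a, 'b) tensor_elem set" where
  "D = {\<Oplus>\<^bsub>P\<^esub>i\<in>{..<m}. tensor A B (a i) (b i) | (m :: nat) a b. a \<in> {..<m} \<rightarrow> carrier A \<and> b \<in> {..<m} \<rightarrow> carrier B}"

lemma D_P: "D \<subseteq> carrier P"
  by (auto simp: D_def intro!: P.finsum_in tensor_P)

lemma D_zero: "\<zero>\<^bsub>P\<^esub> \<in> D"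
  unfolding D_def by (rule CollectI, rule exI[of _ 0]) auto

lemma D_add_tensor: assumes "d \<in> D" "a' \<in> carrier A" "b' \<in> carrier B" shows "tensor A B a' b' \<oplus>\<^bsub>P\<^esub> d \<in> D"
proof -
  obtain m a b where d: "a \<in> {..<m::nat} \<rightarrow> carrier A" "b \<in> {..<m} \<rightarrow> carrier B" "d = (\<Oplus>\<^bsub>P\<^esub>i\<in>{..<m}. tensor A B (a i) (b i))"
    using assms(1) unfolding D_def by blast
  have "(\<Oplus>\<^bsub>P\<^esub>i\<in>{..<Suc m}. tensor A B ((a(m := a')) i) ((b(m := b')) i))
      = tensor A B a' b' \<oplus>\<^bsub>P\<^esub> (\<Oplus>\<^bsub>P\<^esub>i\<in>{..<m}. tensor A B ((a(m := a')) i) ((b(m := b')) i))"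
    unfolding lessThan_Suc using d assms by (subst P.finsum_insert) (auto intro!: tensor_P)
  also have "(\<Oplus>\<^bsub>P\<^esub>i\<in>{..<m}. tensor A B ((a(m := a')) i) ((b(m := b')) i)) = d"
    unfolding d(3) using d by (intro P.finsum_eq) (auto intro!: tensor_P)
  finally show ?thesis
    unfolding D_def using d assms
    by (intro CollectI exI[of _ "Suc m"] exI[of _ "a(m := a')"] exI[of _ "b(m := b')"]) (auto simp: less_Suc_eq)
qed

lemma D_tensor: "\<lbrakk>a \<in> carrier A; b \<in> carrier B\<rbrakk> \<Longrightarrow> tensor A B a b \<in> D"
  using D_add_tensor[OF D_zero, of a b] P.r_zero[OF tensor_P] by (simp)

lemma D_induct [consumes 1, case_names zero add]:
  assumes "d \<in> D" "Q \<zero>\<^bsub>P\<^esub>"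
    "\<And>a b d. \<lbrakk>a \<in> carrier A; b \<in> carrier B; d \<in> D; Q d\<rbrakk> \<Longrightarrow> Q (tensor A B a b \<oplus>\<^bsub>P\<^esub> d)"
  shows "Q d"
proof -
  have "(\<Oplus>\<^bsub>P\<^esub>i\<in>{..<m}. tensor A B (a i) (b i)) \<in> D \<and> Q (\<Oplus>\<^bsub>P\<^esub>i\<in>{..<m}. tensor A B (a i) (b i))"
    if "a \<in> {..<m::nat} \<rightarrow> carrier A" "b \<in> {..<m} \<rightarrow> carrier B" for m a b
    using that
  proof (induct m)
    case 0
    then show ?case using D_zero assms(2) by (simp)
  next
    case (Suc m)
    have c: "a i \<in> carrier A" "b i \<in> carrier B" if "i < Suc m" for i using Suc(2,3) that by auto
    have "(\<Oplus>\<^bsub>P\<^esub>i\<in>{..<Suc m}. tensor A B (a i) (b i)) = tensor A B (a m) (b m) \<oplus>\<^bsub>P\<^esub> (\<Oplus>\<^bsub>P\<^esub>i\<in>{..<m}. tensor A B (a i) (b i))"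
      unfolding lessThan_Suc using c by (subst P.finsum_insert) (auto intro!: tensor_P)
    then show ?case using Suc c by (auto intro!: D_add_tensor assms(3))
  qed
  then show ?thesis using assms(1) unfolding D_def by blast
qed

lemma D_add: "d \<in> D \<Longrightarrow> e \<in> D \<Longrightarrow> d \<oplus>\<^bsub>P\<^esub> e \<in> D"
proof (induct d rule: D_induct)
  case zero
  then show ?case using D_P by (auto)
next
  case (add a b d)
  have "d \<in> carrier P" "e \<in> carrier P" using add D_P by auto
  then have "tensor A B a b \<oplus>\<^bsub>P\<^esub> d \<oplus>\<^bsub>P\<^esub> e = tensor A B a b \<oplus>\<^bsub>P\<^esub> (d \<oplus>\<^bsub>P\<^esub> e)"
    using P.a_assoc tensor_P[OF add(1,2)] by blast
  then show ?case using add D_add_tensor[of "d \<oplus>\<^bsub>P\<^esub> e" a b] by simp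
qed

lemma D_smult: "d \<in> D \<Longrightarrow> c \<odot>\<^bsub>P\<^esub> d \<in> D"
proof (induct d rule: D_induct)
  case zero
  then show ?case using D_zero P.smult_zero_right by (simp)
next
  case (add a b d)
  have "c \<odot>\<^bsub>P\<^esub> (tensor A B a b \<oplus>\<^bsub>P\<^esub> d) = tensor A B (c \<odot>\<^bsub>A\<^esub> a) b \<oplus>\<^bsub>P\<^esub> c \<odot>\<^bsub>P\<^esub> d"
    using add D_P tensor_P by (subst P.smult_add_right) (auto simp: P_tensor_smult_left)
  then show ?case using add by (simp add: D_add_tensor)
qed

lemma D_adj: "d \<in> D \<Longrightarrow> adj P d \<in> D"
proof (induct d rule: D_induct)
  case zero
  then show ?case using D_zero P.adj_zero by (simp)
next
  case (add a b d)
  have "adj P (tensor A B a b \<oplus>\<^bsub>P\<^esub> d) = tensor A B (adj A a) (adj B b) \<oplus>\<^bsub>P\<^esub> adj P d"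
    using add D_P tensor_P by (subst P.adj_add) (auto simp: P_tensor_adj)
  then show ?case using add by (simp add: D_add_tensor)
qed

lemma D_mult: "d \<in> D \<Longrightarrow> e \<in> D \<Longrightarrow> d \<otimes>\<^bsub>P\<^esub> e \<in> D"
proof (induct d rule: D_induct)
  case zero
  then show ?case using D_P P.l_null[of e] D_zero by (auto)
next
  case (add a b d)
  have "tensor A B a b \<otimes>\<^bsub>P\<^esub> e \<in> D" using \<open>e \<in> D\<close>
  proof (induct e rule: D_induct)
    case zero
    then show ?case using P.r_null[OF tensor_P[OF add(1,2)]] D_zero by (simp)
  next
    case (add a' b' e)
    have "tensor A B a b \<otimes>\<^bsub>P\<^esub> (tensor A B a' b' \<oplus>\<^bsub>P\<^esub> e) = tensor A B (a \<otimes>\<^bsub>A\<^esub> a') (b \<otimes>\<^bsub>B\<^esub> b') \<oplus>\<^bsub>P\<^esub> tensor A B a b \<otimes>\<^bsub>P\<^esub> e"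
      using add \<open>a \<in> carrier A\<close> \<open>b \<in> carrier B\<close> D_P tensor_P
      by (subst P.r_distr) (auto simp: P_tensor_mult)
    then show ?case using add \<open>a \<in> carrier A\<close> \<open>b \<in> carrier B\<close> by (simp add: D_add_tensor)
  qed
  moreover have "(tensor A B a b \<oplus>\<^bsub>P\<^esub> d) \<otimes>\<^bsub>P\<^esub> e = tensor A B a b \<otimes>\<^bsub>P\<^esub> e \<oplus>\<^bsub>P\<^esub> d \<otimes>\<^bsub>P\<^esub> e"
    using add D_P tensor_P by (intro P.l_distr) auto
  ultimately show ?case using add by (simp add: D_add)
qed

lemma carrier_T: "x \<in> carrier T \<longleftrightarrow> x \<in> carrier P \<and> (\<forall>e>0. \<exists>d\<in>D. cnorm P (x \<ominus>\<^bsub>P\<^esub> d) < e)"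
proof -
  have eq: "(\<exists>d\<in>D. cnorm P (x \<ominus>\<^bsub>P\<^esub> d) < e) \<longleftrightarrow> (\<exists>(m::nat) a b. a \<in> {..<m} \<rightarrow> carrier A \<and> b \<in> {..<m} \<rightarrow> carrier B \<and>
      cnorm P (x \<ominus>\<^bsub>P\<^esub> (\<Oplus>\<^bsub>P\<^esub>i\<in>{..<m}. tensor A B (a i) (b i))) < e)" for e
    unfolding D_def by blast
  show ?thesis unfolding eq by (simp add: min_tensor_def Let_def)
qed

lemma T_update: "T = P\<lparr>carrier := carrier T\<rparr>"
  by (simp add: min_tensor_def Let_def)

lemma T_simps: "mult T = mult P" "one T = one P" "zero T = zero P" "add T = add P"
    "smult T = smult P" "adj T = adj P" "cnorm T = cnorm P"
  by (simp_all add: min_tensor_def Let_def)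

lemma T_P: "carrier T \<subseteq> carrier P"
  using carrier_T by blast

text \<open>Sequences replace the approximation condition of the definition, so that closure under
  the operations follows from their continuity and from the stability of \<open>D\<close>.\<close>

lemma T_conv: "x \<in> carrier T \<longleftrightarrow> (\<exists>s. (\<forall>n. s n \<in> D) \<and> P.conv s x)"
proof
  assume "x \<in> carrier T"
  then show "\<exists>s. (\<forall>n. s n \<in> D) \<and> P.conv s x" using D_P by (intro P.approx_conv) (auto simp: carrier_T)
next
  assume "\<exists>s. (\<forall>n. s n \<in> D) \<and> P.conv s x"
  then obtain s where s: "\<And>n. s n \<in> D" "P.conv s x" by blast
  have "\<exists>d\<in>D. cnorm P (x \<ominus>\<^bsub>P\<^esub> d) < e" if "e > 0" for e
  proof -
    have "\<forall>\<^sub>F n in sequentially. cnorm P (s n \<ominus>\<^bsub>P\<^esub> x) < e"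
      using s(2) that by (intro order_tendstoD(2)[of _ 0]) (auto simp: P.conv_def)
    then obtain n where "cnorm P (s n \<ominus>\<^bsub>P\<^esub> x) < e" by (auto simp: eventually_sequentially)
    then show ?thesis using s P.norm_diff_commute[of x "s n"] by (metis P.conv_def)
  qed
  then show "x \<in> carrier T" using s by (auto simp: carrier_T P.conv_def)
qed

lemma T_convI: "\<lbrakk>P.conv s x; \<And>n. s n \<in> D\<rbrakk> \<Longrightarrow> x \<in> carrier T"
  unfolding T_conv by (intro exI[of _ s]) simp

lemma T_lim: assumes s: "\<And>n. s n \<in> carrier T" "P.conv s x" shows "x \<in> carrier T"
  unfolding carrier_T
proof (intro conjI allI impI)
  show x: "x \<in> carrier P" using s(2) by (simp add: P.conv_def)
  fix e :: real assume "e > 0"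
  then have e: "e / 2 > 0" by simp
  then have "\<forall>\<^sub>F n in sequentially. cnorm P (s n \<ominus>\<^bsub>P\<^esub> x) < e / 2"
    using s(2) by (intro order_tendstoD(2)[of _ 0]) (auto simp: P.conv_def)
  then obtain n where n: "cnorm P (s n \<ominus>\<^bsub>P\<^esub> x) < e / 2" by (auto simp: eventually_sequentially)
  obtain d where d: "d \<in> D" "cnorm P (s n \<ominus>\<^bsub>P\<^esub> d) < e / 2" using s(1)[of n] e unfolding carrier_T by blast
  have "cnorm P (x \<ominus>\<^bsub>P\<^esub> d) \<le> cnorm P (x \<ominus>\<^bsub>P\<^esub> s n) + cnorm P (s n \<ominus>\<^bsub>P\<^esub> d)"
    using x d(1) D_P s(1)[of n] T_P by (intro P.norm_triangle) auto
  then have "cnorm P (x \<ominus>\<^bsub>P\<^esub> d) < e"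
    using n d(2) P.norm_diff_commute[of x "s n"] x s(1)[of n] T_P by auto
  with d(1) show "\<exists>d\<in>D. cnorm P (x \<ominus>\<^bsub>P\<^esub> d) < e" by blast
qed

lemma D_T: "D \<subseteq> carrier T"
proof
  fix d assume "d \<in> D"
  then show "d \<in> carrier T" unfolding T_conv using D_P P.conv_const[of d] by (intro exI[of _ "\<lambda>_. d"]) auto
qed

lemma cstar_algebra_T: "cstar_algebra T"
proof (subst T_update, rule cstar_closed_subalgebra[OF P.cstar_algebra_axioms T_P])
  show "\<one>\<^bsub>P\<^esub> \<in> carrier T" using D_tensor[of "\<one>\<^bsub>A\<^esub>" "\<one>\<^bsub>B\<^esub>"] D_T P_tensor_one by auto
  show "\<zero>\<^bsub>P\<^esub> \<in> carrier T" using D_zero D_T by blast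
next
  fix x y assume xy: "x \<in> carrier T" "y \<in> carrier T"
  obtain s where s: "\<And>n. s n \<in> D" "P.conv s x" using T_conv[THEN iffD1, OF xy(1)] by blast
  obtain t where t: "\<And>n. t n \<in> D" "P.conv t y" using T_conv[THEN iffD1, OF xy(2)] by blast
  show "x \<oplus>\<^bsub>P\<^esub> y \<in> carrier T" by (rule T_convI[OF P.conv_add[OF s(2) t(2)] D_add[OF s(1) t(1)]])
  show "x \<otimes>\<^bsub>P\<^esub> y \<in> carrier T" by (rule T_convI[OF P.conv_mult[OF s(2) t(2)] D_mult[OF s(1) t(1)]])
next
  fix x assume x: "x \<in> carrier T"
  obtain s where s: "\<And>n. s n \<in> D" "P.conv s x" using T_conv[THEN iffD1, OF x] by blast
  show "c \<odot>\<^bsub>P\<^esub> x \<in> carrier T" for c by (rule T_convI[OF P.conv_smult[OF s(2), of c] D_smult[OF s(1)]])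
  show "adj P x \<in> carrier T" by (rule T_convI[OF P.conv_adj[OF s(2)] D_adj[OF s(1)]])
qed (rule T_lim)

sublocale T: cstar_algebra T
  by (rule cstar_algebra_T)

lemma tensor_T [simp, intro]: "\<lbrakk>a \<in> carrier A; b \<in> carrier B\<rbrakk> \<Longrightarrow> tensor A B a b \<in> carrier T"
  using D_tensor D_T by blast

lemma tensor_mult [simp]: "\<lbrakk>a \<in> carrier A; b \<in> carrier B; a' \<in> carrier A; b' \<in> carrier B\<rbrakk>
    \<Longrightarrow> tensor A B a b \<otimes>\<^bsub>T\<^esub> tensor A B a' b' = tensor A B (a \<otimes>\<^bsub>A\<^esub> a') (b \<otimes>\<^bsub>B\<^esub> b')"
  using P_tensor_mult by (simp add: T_simps)

lemma tensor_adj [simp]: "\<lbrakk>a \<in> carrier A; b \<in> carrier B\<rbrakk> \<Longrightarrow> adj T (tensor A B a b) = tensor A B (adj A a) (adj B b)"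
  using P_tensor_adj by (simp add: T_simps)

lemma tensor_add_left: "\<lbrakk>a \<in> carrier A; a' \<in> carrier A; b \<in> carrier B\<rbrakk>
    \<Longrightarrow> tensor A B (a \<oplus>\<^bsub>A\<^esub> a') b = tensor A B a b \<oplus>\<^bsub>T\<^esub> tensor A B a' b"
  using P_tensor_add_left by (simp add: T_simps)

lemma tensor_add_right: "\<lbrakk>a \<in> carrier A; b \<in> carrier B; b' \<in> carrier B\<rbrakk>
    \<Longrightarrow> tensor A B a (b \<oplus>\<^bsub>B\<^esub> b') = tensor A B a b \<oplus>\<^bsub>T\<^esub> tensor A B a b'"
  using P_tensor_add_right by (simp add: T_simps)

lemma tensor_smult: "\<lbrakk>a \<in> carrier A; b \<in> carrier B\<rbrakk> \<Longrightarrow> tensor A B (c \<odot>\<^bsub>A\<^esub> a) b = c \<odot>\<^bsub>T\<^esub> tensor A B a b"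
    "\<lbrakk>a \<in> carrier A; b \<in> carrier B\<rbrakk> \<Longrightarrow> tensor A B a (c \<odot>\<^bsub>B\<^esub> b) = c \<odot>\<^bsub>T\<^esub> tensor A B a b"
  using P_tensor_smult_left P_tensor_smult_right by (simp_all add: T_simps)

lemma tensor_one [simp]: "tensor A B \<one>\<^bsub>A\<^esub> \<one>\<^bsub>B\<^esub> = \<one>\<^bsub>T\<^esub>"
  using P_tensor_one by (simp add: T_simps)

lemma tensor_zero [simp]: "b \<in> carrier B \<Longrightarrow> tensor A B \<zero>\<^bsub>A\<^esub> b = \<zero>\<^bsub>T\<^esub>" "a \<in> carrier A \<Longrightarrow> tensor A B a \<zero>\<^bsub>B\<^esub> = \<zero>\<^bsub>T\<^esub>"
  using tensor_smult(1)[of "\<zero>\<^bsub>A\<^esub>" b 0] tensor_smult(2)[of a "\<zero>\<^bsub>B\<^esub>" 0] by simp_all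

lemma tensor_finsum_left: "\<lbrakk>b \<in> carrier B; \<And>i. i \<in> J \<Longrightarrow> f i \<in> carrier A\<rbrakk>
    \<Longrightarrow> tensor A B (finsum A f J) b = (\<Oplus>\<^bsub>T\<^esub>i\<in>J. tensor A B (f i) b)"
  by (induct J rule: infinite_finite_induct) (auto simp: Pi_def tensor_add_left)

lemma tensor_finsum_right: "\<lbrakk>a \<in> carrier A; \<And>i. i \<in> J \<Longrightarrow> f i \<in> carrier B\<rbrakk>
    \<Longrightarrow> tensor A B a (finsum B f J) = (\<Oplus>\<^bsub>T\<^esub>i\<in>J. tensor A B a (f i))"
  by (induct J rule: infinite_finite_induct) (auto simp: Pi_def tensor_add_right)

end

text \<open>Pulling representations back along \<phi> and \<psi> reindexes families, so the
  pointwise operations are preserved, and the norm cannot grow because the supremum runs over a part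
  of the former values. Elementary tensors go to elementary tensors, so the algebraic part is mapped
  to the algebraic part, and contractivity brings its closure along.\<close>

lemma tensor_map_star_hom:
  assumes A: "cstar_algebra A" and B: "cstar_algebra B" and C: "cstar_algebra C" and D: "cstar_algebra D"
    and \<phi>: "\<phi> \<in> star_hom A C" and \<psi>: "\<psi> \<in> star_hom B D"
  shows "restrict (tensor_map A B C D \<phi> \<psi>) (carrier (min_tensor A B)) \<in> star_hom (min_tensor A B) (min_tensor C D)"
    and "\<And>a b. \<lbrakk>a \<in> carrier A; b \<in> carrier B\<rbrakk> \<Longrightarrow> tensor_map A B C D \<phi> \<psi> (tensor A B a b) = tensor C D (\<phi> a) (\<psi> b)"
proof -
  interpret AB: tensor_pair A B by (intro tensor_pair.intro A B)
  interpret CD: tensor_pair C D by (intro tensor_pair.intro C D)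
  let ?r = "\<lambda>(\<pi>, \<rho>). (compose (carrier A) \<pi> \<phi>, compose (carrier B) \<rho> \<psi>)"
  let ?t = "tensor_map A B C D \<phi> \<psi>"
  have r: "?r p \<in> reps A \<times> reps B" if "p \<in> reps C \<times> reps D" for p
    using that star_hom_compose[OF A \<phi>] star_hom_compose[OF B \<psi>] by (auto simp: reps_def)
  have t: "?t x = (\<lambda>p\<in>reps C \<times> reps D. x (?r p))" for x
    by (auto simp: tensor_map_def restrict_def)
  show tt: "?t (tensor A B a b) = tensor C D (\<phi> a) (\<psi> b)" if "a \<in> carrier A" "b \<in> carrier B" for a b
    unfolding t unfolding tensor_def
    by (rule restrict_ext) (use that star_hom_compose[OF A \<phi>] star_hom_compose[OF B \<psi>] in \<open>auto simp: reps_def compose_def\<close>)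
  have tP: "?t x \<in> carrier CD.P" "cnorm CD.P (?t x) \<le> cnorm AB.P x" if "x \<in> carrier AB.P" for x
  proof -
    note x = AB.BE.families_inD[OF that]
    show "?t x \<in> carrier CD.P"
      unfolding t using x(1,2) r by (intro AB.BE.families_inI[where K = "cnorm AB.P x"]) auto
    show "cnorm CD.P (?t x) \<le> cnorm AB.P x"
      using x(2,3) r by (intro AB.BE.families_norm_le) (auto simp: t)
  qed
  have t_add: "?t (x \<oplus>\<^bsub>AB.P\<^esub> y) = ?t x \<oplus>\<^bsub>CD.P\<^esub> ?t y" "?t (x \<otimes>\<^bsub>AB.P\<^esub> y) = ?t x \<otimes>\<^bsub>CD.P\<^esub> ?t y"
    "?t (c \<odot>\<^bsub>AB.P\<^esub> x) = c \<odot>\<^bsub>CD.P\<^esub> ?t x" "?t (adj AB.P x) = adj CD.P (?t x)"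
    "?t \<one>\<^bsub>AB.P\<^esub> = \<one>\<^bsub>CD.P\<^esub>" "?t \<zero>\<^bsub>AB.P\<^esub> = \<zero>\<^bsub>CD.P\<^esub>" for x y c
    unfolding t bounded_families_simps by (rule restrict_ext; use r in fastforce)+
  have tD: "?t d \<in> CD.D" if "d \<in> AB.D" for d
    using that
  proof (induct d rule: AB.D_induct)
    case zero
    then show ?case using CD.D_zero t_add(6) by simp
  next
    case (add a b d)
    then show ?case unfolding t_add tt[OF add(1,2)]
      using star_homD(2)[OF \<phi>] star_homD(2)[OF \<psi>] by (intro CD.D_add_tensor) auto
  qed
  have tT: "?t x \<in> carrier (min_tensor C D)" if x: "x \<in> carrier (min_tensor A B)" for x
    unfolding CD.carrier_T
  proof (intro conjI allI impI)
    show "?t x \<in> carrier CD.P" using x AB.T_P tP by blast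
    fix e :: real assume "e > 0"
    then obtain d where d: "d \<in> AB.D" "cnorm AB.P (x \<ominus>\<^bsub>AB.P\<^esub> d) < e" using x by (auto simp: AB.carrier_T)
    have xd: "x \<in> carrier AB.P" "d \<in> carrier AB.P" using x d AB.T_P AB.D_P by auto
    have "cnorm CD.P (?t x \<ominus>\<^bsub>CD.P\<^esub> ?t d) = cnorm CD.P (?t (x \<ominus>\<^bsub>AB.P\<^esub> d))"
      unfolding AB.P.diff_eq_smult[OF xd] CD.P.diff_eq_smult[OF tP(1)[OF xd(1)] tP(1)[OF xd(2)]] t_add ..
    also have "\<dots> < e" using tP(2)[of "x \<ominus>\<^bsub>AB.P\<^esub> d"] xd d(2) by (intro le_less_trans[OF tP(2)]) auto
    finally show "\<exists>d\<in>CD.D. cnorm CD.P (?t x \<ominus>\<^bsub>CD.P\<^esub> d) < e" using tD[OF d(1)] by blast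
  qed
  show "restrict ?t (carrier (min_tensor A B)) \<in> star_hom (min_tensor A B) (min_tensor C D)"
  proof (rule star_homI)
    fix x assume x: "x \<in> carrier (min_tensor A B)"
    then show "cnorm (min_tensor C D) (restrict ?t (carrier (min_tensor A B)) x) \<le> cnorm (min_tensor A B) x"
      using tP(2) AB.T_P by (auto simp: AB.T_simps CD.T_simps)
    show "restrict ?t (carrier (min_tensor A B)) (adj (min_tensor A B) x) = adj (min_tensor C D) (restrict ?t (carrier (min_tensor A B)) x)"
      using x t_add(4)[of x] AB.T.adj_closed[OF x] by (simp add: AB.T_simps CD.T_simps)
    show "restrict ?t (carrier (min_tensor A B)) (c \<odot>\<^bsub>min_tensor A B\<^esub> x) = c \<odot>\<^bsub>min_tensor C D\<^esub> restrict ?t (carrier (min_tensor A B)) x" for c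
      using x t_add(3)[of c x] AB.T.smult_closed[OF x, of c] by (simp add: AB.T_simps CD.T_simps)
  next
    fix x y assume x: "x \<in> carrier (min_tensor A B)" and y: "y \<in> carrier (min_tensor A B)"
    show "restrict ?t (carrier (min_tensor A B)) (x \<oplus>\<^bsub>min_tensor A B\<^esub> y)
        = restrict ?t (carrier (min_tensor A B)) x \<oplus>\<^bsub>min_tensor C D\<^esub> restrict ?t (carrier (min_tensor A B)) y"
      using x y t_add(1)[of x y] AB.T.a_closed[OF x y] by (simp add: AB.T_simps CD.T_simps)
    show "restrict ?t (carrier (min_tensor A B)) (x \<otimes>\<^bsub>min_tensor A B\<^esub> y)
        = restrict ?t (carrier (min_tensor A B)) x \<otimes>\<^bsub>min_tensor C D\<^esub> restrict ?t (carrier (min_tensor A B)) y"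
      using x y t_add(2)[of x y] AB.T.m_closed[OF x y] by (simp add: AB.T_simps CD.T_simps)
  next
    show "restrict ?t (carrier (min_tensor A B)) \<one>\<^bsub>min_tensor A B\<^esub> = \<one>\<^bsub>min_tensor C D\<^esub>"
      using t_add(5) AB.T.one_closed by (simp add: AB.T_simps CD.T_simps)
  qed (use tT in auto)
qed

section \<open>Magic unitaries\<close>

context cstar_algebra
begin

definition magic :: "'v set \<Rightarrow> ('v \<Rightarrow> 'v \<Rightarrow> 'a) \<Rightarrow> bool" where
  "magic V u \<longleftrightarrow> (\<forall>i\<in>V. \<forall>j\<in>V. projection (u i j)) \<and> (\<forall>i\<in>V. (\<Oplus>j\<in>V. u i j) = \<one>) \<and> (\<forall>j\<in>V. (\<Oplus>i\<in>V. u i j) = \<one>)"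

lemma magicD:
  assumes "magic V u"
  shows "\<lbrakk>i \<in> V; j \<in> V\<rbrakk> \<Longrightarrow> u i j \<in> carrier A" "\<lbrakk>i \<in> V; j \<in> V\<rbrakk> \<Longrightarrow> adj A (u i j) = u i j"
    "\<lbrakk>i \<in> V; j \<in> V\<rbrakk> \<Longrightarrow> u i j \<otimes> u i j = u i j"
    "i \<in> V \<Longrightarrow> (\<Oplus>j\<in>V. u i j) = \<one>" "j \<in> V \<Longrightarrow> (\<Oplus>i\<in>V. u i j) = \<one>"
  using assms by (auto simp: magic_def projection_def)

lemma magic_row: assumes "magic V u" "finite V" "i \<in> V" "j \<in> V" "k \<in> V" "j \<noteq> k" shows "u i j \<otimes> u i k = \<zero>"
  using assms projections_sum_one_orthogonal[of V "\<lambda>j. u i j" k j] by (auto simp: magic_def)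

lemma magic_col: assumes "magic V u" "finite V" "i \<in> V" "j \<in> V" "k \<in> V" "i \<noteq> j" shows "u i k \<otimes> u j k = \<zero>"
  using assms projections_sum_one_orthogonal[of V "\<lambda>i. u i k" j i] by (auto simp: magic_def)

definition intertwines :: "'v set \<Rightarrow> ('v \<Rightarrow> 'v \<Rightarrow> nat) \<Rightarrow> ('v \<Rightarrow> 'v \<Rightarrow> 'a) \<Rightarrow> bool" where
  "intertwines V M u \<longleftrightarrow> (\<forall>i\<in>V. \<forall>j\<in>V. (\<Oplus>k\<in>V. of_nat (M k j) \<odot> u i k) = (\<Oplus>k\<in>V. of_nat (M i k) \<odot> u k j))"

text \<open>The (i', j) entry of u M = M u is sandwiched between \<open>u i j\<close> and
  \<open>u i' j'\<close>. Row orthogonality leaves M_j'j times the product on one side, column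
  orthogonality leaves M_i'i times it on the other, and the two coefficients differ.\<close>

lemma intertwines_orthogonal:
  assumes u: "magic V u" and V: "finite V" and M: "intertwines V M u"
    and ij: "i \<in> V" "j \<in> V" "i' \<in> V" "j' \<in> V" and ne: "M i' i \<noteq> M j' j"
  shows "u i j \<otimes> u i' j' = \<zero>"
proof -
  note c = magicD(1)[OF u]
  define w where "w = u i j \<otimes> u i' j'"
  have w: "w \<in> carrier A" using c ij by (simp add: w_def)
  have "u i j \<otimes> (\<Oplus>k\<in>V. of_nat (M k j) \<odot> u i' k) \<otimes> u i' j' = (\<Oplus>k\<in>V. of_nat (M k j) \<odot> (u i j \<otimes> u i' k \<otimes> u i' j'))"
    using c ij by (subst finsum_mult_left) (auto simp: finsum_mult_right intro!: finsum_eq)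
  also have "\<dots> = of_nat (M j' j) \<odot> (u i j \<otimes> u i' j' \<otimes> u i' j')"
    using c ij V magic_row[OF u V ij(3) _ ij(4)] by (intro finsum_single) (auto simp: m_assoc)
  finally have 1: "u i j \<otimes> (\<Oplus>k\<in>V. of_nat (M k j) \<odot> u i' k) \<otimes> u i' j' = of_nat (M j' j) \<odot> w"
    using c ij magicD(3)[OF u] by (simp add: w_def m_assoc)
  have "u i j \<otimes> (\<Oplus>k\<in>V. of_nat (M i' k) \<odot> u k j) = (\<Oplus>k\<in>V. of_nat (M i' k) \<odot> (u i j \<otimes> u k j))"
    using c ij by (subst finsum_mult_left) (auto intro!: finsum_eq)
  also have "\<dots> = of_nat (M i' i) \<odot> (u i j \<otimes> u i j)"
    using c ij V magic_col[OF u V ij(1) _ ij(2)] by (intro finsum_single) auto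
  finally have 2: "u i j \<otimes> (\<Oplus>k\<in>V. of_nat (M i' k) \<odot> u k j) \<otimes> u i' j' = of_nat (M i' i) \<odot> w"
    using c ij magicD(3)[OF u] by (simp add: w_def)
  have "of_nat (M j' j) \<odot> w = of_nat (M i' i) \<odot> w"
    using 1 2 M ij by (simp add: intertwines_def)
  then have "(of_nat (M j' j) + - of_nat (M i' i)) \<odot> w = \<zero>"
    using w smult_add_left[OF w, of "of_nat (M j' j)" "- of_nat (M i' i)"]
      smult_add_left[OF w, of "of_nat (M i' i)" "- of_nat (M i' i)"] by simp
  then have "(1 / (of_nat (M j' j) - of_nat (M i' i))) \<odot> ((of_nat (M j' j) - of_nat (M i' i)) \<odot> w) = \<zero>"
    by simp
  moreover have "(of_nat (M j' j) :: complex) - of_nat (M i' i) \<noteq> 0" using ne by simp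
  ultimately have "w = \<zero>" using w by simp
  then show ?thesis by (simp add: w_def)
qed

lemma finsum_mult_triple:
  assumes "finite V" "\<And>k. k \<in> V \<Longrightarrow> f k \<in> carrier A" "\<And>k. k \<in> V \<Longrightarrow> g k \<in> carrier A" "\<And>k. k \<in> V \<Longrightarrow> h k \<in> carrier A"
  shows "finsum A f V \<otimes> finsum A g V \<otimes> finsum A h V = (\<Oplus>p\<in>V \<times> V \<times> V. f (fst p) \<otimes> g (fst (snd p)) \<otimes> h (snd (snd p)))"
proof -
  have "finsum A f V \<otimes> finsum A g V \<otimes> finsum A h V = (\<Oplus>i\<in>V. f i \<otimes> (finsum A g V \<otimes> finsum A h V))"
  proof -
    have "finsum A f V \<otimes> (finsum A g V \<otimes> finsum A h V) = (\<Oplus>i\<in>V. f i \<otimes> (finsum A g V \<otimes> finsum A h V))"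
      using assms by (intro finsum_mult_right) auto
    then show ?thesis using assms by (simp add: m_assoc)
  qed
  also have "\<dots> = (\<Oplus>i\<in>V. \<Oplus>p\<in>V \<times> V. f i \<otimes> g (fst p) \<otimes> h (snd p))"
  proof (intro finsum_eq refl)
    fix i assume i: "i \<in> V"
    have "finsum A g V \<otimes> finsum A h V = (\<Oplus>j\<in>V. \<Oplus>k\<in>V. g j \<otimes> h k)"
      using assms by (simp add: finsum_mult_right) (auto intro!: finsum_eq simp: finsum_mult_left)
    also have "\<dots> = (\<Oplus>p\<in>V \<times> V. g (fst p) \<otimes> h (snd p))" using assms by (intro finsum_pairs) auto
    finally have gh: "finsum A g V \<otimes> finsum A h V = (\<Oplus>p\<in>V \<times> V. g (fst p) \<otimes> h (snd p))" .
    show "f i \<otimes> (finsum A g V \<otimes> finsum A h V) = (\<Oplus>p\<in>V \<times> V. f i \<otimes> g (fst p) \<otimes> h (snd p))"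
      unfolding gh using assms i by (subst finsum_mult_left) (auto intro!: finsum_eq simp: m_assoc)
  qed (use assms in \<open>auto intro!: finsum_in\<close>)
  also have "\<dots> = (\<Oplus>p\<in>V \<times> V \<times> V. f (fst p) \<otimes> g (fst (snd p)) \<otimes> h (snd (snd p)))"
    using assms by (subst finsum_pairs) auto
  finally show ?thesis .
qed

text \<open>This lemma and its analogues for the other relations form the dictionary between
  vanishing of the presenting polynomials and identities in a C*-algebra. It is read one way for the
  generators and the other way to invoke universality.\<close>

lemma ev_magic_relations:
  assumes c: "\<And>i j. \<lbrakk>i \<in> V; j \<in> V\<rbrakk> \<Longrightarrow> u i j \<in> carrier A" and V: "finite V"
  shows "(\<forall>r\<in>magic_relations V. ev A (\<lambda>(i, j). u i j) r = \<zero>) \<longleftrightarrow> magic V u"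
proof -
  interpret cstar_eval A "V \<times> V" "\<lambda>(i, j). u i j" by unfold_locales (use c in auto)
  have 1: "ev A (\<lambda>(i, j). u i j) (free_adj (free_gen (i, j)) - free_gen (i, j)) = adj A (u i j) \<ominus> u i j"
    "ev A (\<lambda>(i, j). u i j) (free_gen (i, j) * free_gen (i, j) - free_gen (i, j)) = u i j \<otimes> u i j \<ominus> u i j"
    if "i \<in> V" "j \<in> V" for i j
    using that by simp_all
  have 2: "ev A (\<lambda>(i, j). u i j) ((\<Sum>j\<in>V. free_gen (i, j)) - 1) = (\<Oplus>j\<in>V. u i j) \<ominus> \<one>"
    "ev A (\<lambda>(i, j). u i j) ((\<Sum>j\<in>V. free_gen (j, i)) - 1) = (\<Oplus>j\<in>V. u j i) \<ominus> \<one>" if "i \<in> V" for i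
    using that c by (auto intro!: arg_cong[where f = "\<lambda>a. a \<ominus> \<one>"] finsum_eq)
  define Z where "Z r \<longleftrightarrow> ev A (\<lambda>(i, j). u i j) r = \<zero>" for r
  have "(\<forall>r\<in>magic_relations V. Z r) \<longleftrightarrow>
      (\<forall>i\<in>V. \<forall>j\<in>V. Z (free_adj (free_gen (i, j)) - free_gen (i, j)) \<and> Z (free_gen (i, j) * free_gen (i, j) - free_gen (i, j)))
      \<and> (\<forall>i\<in>V. Z ((\<Sum>j\<in>V. free_gen (i, j)) - 1)) \<and> (\<forall>j\<in>V. Z ((\<Sum>i\<in>V. free_gen (i, j)) - 1))"
    unfolding magic_relations_def by blast
  also have "\<dots> \<longleftrightarrow>
      (\<forall>i\<in>V. \<forall>j\<in>V. adj A (u i j) \<ominus> u i j = \<zero> \<and> u i j \<otimes> u i j \<ominus> u i j = \<zero>)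
      \<and> (\<forall>i\<in>V. (\<Oplus>j\<in>V. u i j) \<ominus> \<one> = \<zero>) \<and> (\<forall>j\<in>V. (\<Oplus>i\<in>V. u i j) \<ominus> \<one> = \<zero>)"
    unfolding Z_def by (simp only: 1 2 cong: ball_cong)
  also have "\<dots> \<longleftrightarrow> magic V u"
    using c by (auto simp: magic_def projection_def diff_eq_zero_iff finsum_in)
  finally show ?thesis by (simp add: Z_def)
qed

lemma ev_intertwining_relations:
  assumes c: "\<And>i j. \<lbrakk>i \<in> verts G; j \<in> verts G\<rbrakk> \<Longrightarrow> u i j \<in> carrier A"
  shows "(\<forall>r\<in>intertwining_relations G. ev A (\<lambda>(i, j). u i j) r = \<zero>) \<longleftrightarrow> intertwines (verts G) (vertex_matrix G) u"
proof -
  interpret cstar_eval A "verts G \<times> verts G" "\<lambda>(i, j). u i j" by unfold_locales (use c in auto)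
  have 1: "ev A (\<lambda>(i, j). u i j) ((\<Sum>k\<in>verts G. free_scale (of_nat (vertex_matrix G k j)) (free_gen (i, k)))
        - (\<Sum>k\<in>verts G. free_scale (of_nat (vertex_matrix G i k)) (free_gen (k, j))))
      = (\<Oplus>k\<in>verts G. of_nat (vertex_matrix G k j) \<odot> u i k) \<ominus> (\<Oplus>k\<in>verts G. of_nat (vertex_matrix G i k) \<odot> u k j)"
    if "i \<in> verts G" "j \<in> verts G" for i j
    using that c by (auto intro!: arg_cong2[where f = "\<lambda>a b. a \<ominus> b"] finsum_eq)
  show ?thesis
    unfolding intertwining_relations_def intertwines_def
  proof (intro iffI ballI)
    fix i j assume ij: "i \<in> verts G" "j \<in> verts G"
    assume *: "\<forall>r\<in>{(\<Sum>k\<in>verts G. free_scale (of_nat (vertex_matrix G k j)) (free_gen (i, k)))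
        - (\<Sum>k\<in>verts G. free_scale (of_nat (vertex_matrix G i k)) (free_gen (k, j))) | i j. i \<in> verts G \<and> j \<in> verts G}.
        ev A (\<lambda>(i, j). u i j) r = \<zero>"
    have "ev A (\<lambda>(i, j). u i j) ((\<Sum>k\<in>verts G. free_scale (of_nat (vertex_matrix G k j)) (free_gen (i, k)))
        - (\<Sum>k\<in>verts G. free_scale (of_nat (vertex_matrix G i k)) (free_gen (k, j)))) = \<zero>"
      using ij by (intro bspec[OF *]) blast
    then show "(\<Oplus>k\<in>verts G. of_nat (vertex_matrix G k j) \<odot> u i k) = (\<Oplus>k\<in>verts G. of_nat (vertex_matrix G i k) \<odot> u k j)"
      using ij c unfolding 1[OF ij] by (subst (asm) diff_eq_zero_iff) (auto intro!: finsum_in)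
  next
    fix r assume *: "\<forall>i\<in>verts G. \<forall>j\<in>verts G. (\<Oplus>k\<in>verts G. of_nat (vertex_matrix G k j) \<odot> u i k) = (\<Oplus>k\<in>verts G. of_nat (vertex_matrix G i k) \<odot> u k j)"
      and "r \<in> {(\<Sum>k\<in>verts G. free_scale (of_nat (vertex_matrix G k j)) (free_gen (i, k)))
        - (\<Sum>k\<in>verts G. free_scale (of_nat (vertex_matrix G i k)) (free_gen (k, j))) | i j. i \<in> verts G \<and> j \<in> verts G}"
    then obtain i j where ij: "i \<in> verts G" "j \<in> verts G" and r: "r = (\<Sum>k\<in>verts G. free_scale (of_nat (vertex_matrix G k j)) (free_gen (i, k)))
        - (\<Sum>k\<in>verts G. free_scale (of_nat (vertex_matrix G i k)) (free_gen (k, j)))" by blast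
    have "(\<Oplus>k\<in>verts G. of_nat (vertex_matrix G i k) \<odot> u k j) \<in> carrier A" using c ij by (intro finsum_in) auto
    then show "ev A (\<lambda>(i, j). u i j) r = \<zero>" unfolding r 1[OF ij] using * ij by (simp add: diff_eq_zero_iff)
  qed
qed

definition theta_compatible :: "('v, 'e) pre_digraph \<Rightarrow> ('v, 'f) pre_digraph \<Rightarrow> ('e \<times> 'f \<Rightarrow> 'f \<times> 'e) \<Rightarrow> ('v \<Rightarrow> 'v \<Rightarrow> 'a) \<Rightarrow> bool" where
  "theta_compatible G1 G2 \<theta> u \<longleftrightarrow> (\<forall>a b c d a' b' c' d'.
        (a, b) \<in> star_pairs G1 G2 \<and> (a', b') \<in> star_pairs G1 G2 \<and> \<theta> (a, b) = (c, d) \<and> \<theta> (a', b') = (c', d') \<longrightarrow>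
      u (head G2 c') (head G2 c) \<otimes> u (tail G2 c') (tail G2 c) \<otimes> u (tail G1 d') (tail G1 d)
      = u (head G1 a') (head G1 a) \<otimes> u (tail G1 a') (tail G1 a) \<otimes> u (tail G2 b') (tail G2 b))"

end

section \<open>Triples and their defining relations\<close>

text \<open>Both the given triple and its disjoint copies are instances, so the theory of
  \<open>quantum_aut\<close> is developed once for the two sides of the isomorphism.\<close>

locale triple_core = G1: fin_digraph G1 + G2: fin_digraph G2 + G1: nomulti_digraph G1 + G2: nomulti_digraph G2
  for G1 :: "('v, 'e) pre_digraph" and G2 :: "('v, 'f) pre_digraph" +
  fixes \<theta> :: "'e \<times> 'f \<Rightarrow> 'f \<times> 'e"
  assumes verts_eq: "verts G2 = verts G1"
    and theta_bij: "bij_betw \<theta> (star_pairs G1 G2) (star_pairs G2 G1)"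
begin

abbreviation "V \<equiv> verts G1"

lemma finV: "finite V" by simp

lemma theta_in: "\<lbrakk>(a, b) \<in> star_pairs G1 G2; \<theta> (a, b) = (c, d)\<rbrakk> \<Longrightarrow> (c, d) \<in> star_pairs G2 G1"
  using theta_bij by (metis bij_betwE)

lemma star_pairs_ends:
  "(a, b) \<in> star_pairs G1 G2 \<Longrightarrow> head G1 a \<in> V \<and> tail G1 a \<in> V \<and> tail G2 b \<in> V \<and> head G2 b \<in> V"
  "(c, d) \<in> star_pairs G2 G1 \<Longrightarrow> head G2 c \<in> V \<and> tail G2 c \<in> V \<and> tail G1 d \<in> V \<and> head G1 d \<in> V"
  using G1.head_in_verts G1.tail_in_verts G2.head_in_verts G2.tail_in_verts by (auto simp: star_pairs_def verts_eq)

definition "aut_relations = intertwining_relations G1 \<union> intertwining_relations G2 \<union> theta_relations G1 G2 \<theta>"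

end

context cstar_algebra
begin

definition aut_family :: "('v, 'e) pre_digraph \<Rightarrow> ('v, 'f) pre_digraph \<Rightarrow> ('e \<times> 'f \<Rightarrow> 'f \<times> 'e) \<Rightarrow> ('v \<Rightarrow> 'v \<Rightarrow> 'a) \<Rightarrow> bool" where
  "aut_family G1 G2 \<theta> u \<longleftrightarrow> magic (verts G1) u \<and> intertwines (verts G1) (vertex_matrix G1) u
     \<and> intertwines (verts G1) (vertex_matrix G2) u \<and> theta_compatible G1 G2 \<theta> u"

lemma ev_theta_relations:
  assumes "triple_core G1 G2 \<theta>" and c: "\<And>i j. \<lbrakk>i \<in> verts G1; j \<in> verts G1\<rbrakk> \<Longrightarrow> u i j \<in> carrier A"
  shows "(\<forall>r\<in>theta_relations G1 G2 \<theta>. ev A (\<lambda>(i, j). u i j) r = \<zero>) \<longleftrightarrow> theta_compatible G1 G2 \<theta> u"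
proof -
  interpret triple_core G1 G2 \<theta> by fact
  interpret cstar_eval A "V \<times> V" "\<lambda>(i, j). u i j" by unfold_locales (use c in auto)
  define r where "r a b c d a' b' c' d' = free_gen (head G2 c', head G2 c) * free_gen (tail G2 c', tail G2 c)
          * free_gen (tail G1 d', tail G1 d)
        - free_gen (head G1 a', head G1 a) * free_gen (tail G1 a', tail G1 a)
          * free_gen (tail G2 b', tail G2 b)" for a b c d a' b' c' d'
  have ev: "ev A (\<lambda>(i, j). u i j) (r a b c d a' b' c' d') = \<zero> \<longleftrightarrow>
      u (head G2 c') (head G2 c) \<otimes> u (tail G2 c') (tail G2 c) \<otimes> u (tail G1 d') (tail G1 d)
      = u (head G1 a') (head G1 a) \<otimes> u (tail G1 a') (tail G1 a) \<otimes> u (tail G2 b') (tail G2 b)"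
    if "(a, b) \<in> star_pairs G1 G2 \<and> (a', b') \<in> star_pairs G1 G2 \<and> \<theta> (a, b) = (c, d) \<and> \<theta> (a', b') = (c', d')"
    for a b c d a' b' c' d'
    using that star_pairs_ends(1)[of a b] star_pairs_ends(1)[of a' b'] star_pairs_ends(2)[OF theta_in, of a b c d] star_pairs_ends(2)[OF theta_in, of a' b' c' d']
    by (simp add: r_def c diff_eq_zero_iff)
  have "theta_relations G1 G2 \<theta> = {r a b c d a' b' c' d' | a b c d a' b' c' d'.
      (a, b) \<in> star_pairs G1 G2 \<and> (a', b') \<in> star_pairs G1 G2 \<and> \<theta> (a, b) = (c, d) \<and> \<theta> (a', b') = (c', d')}"
    unfolding theta_relations_def r_def ..
  note eq = this
  show ?thesis
    unfolding theta_compatible_def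
  proof (intro iffI allI impI ballI)
    fix a b c d a' b' c' d'
    assume *: "\<forall>r\<in>theta_relations G1 G2 \<theta>. ev A (\<lambda>(i, j). u i j) r = \<zero>"
      and H: "(a, b) \<in> star_pairs G1 G2 \<and> (a', b') \<in> star_pairs G1 G2 \<and> \<theta> (a, b) = (c, d) \<and> \<theta> (a', b') = (c', d')"
    have "r a b c d a' b' c' d' \<in> theta_relations G1 G2 \<theta>" unfolding eq using H by blast
    then show "u (head G2 c') (head G2 c) \<otimes> u (tail G2 c') (tail G2 c) \<otimes> u (tail G1 d') (tail G1 d)
      = u (head G1 a') (head G1 a) \<otimes> u (tail G1 a') (tail G1 a) \<otimes> u (tail G2 b') (tail G2 b)"
      using * ev[OF H] by simp
  next
    fix x assume *: "\<forall>a b c d a' b' c' d'.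
        (a, b) \<in> star_pairs G1 G2 \<and> (a', b') \<in> star_pairs G1 G2 \<and> \<theta> (a, b) = (c, d) \<and> \<theta> (a', b') = (c', d') \<longrightarrow>
      u (head G2 c') (head G2 c) \<otimes> u (tail G2 c') (tail G2 c) \<otimes> u (tail G1 d') (tail G1 d)
      = u (head G1 a') (head G1 a) \<otimes> u (tail G1 a') (tail G1 a) \<otimes> u (tail G2 b') (tail G2 b)"
      and "x \<in> theta_relations G1 G2 \<theta>"
    then obtain a b c d a' b' c' d' where x: "x = r a b c d a' b' c' d'" and
      H: "(a, b) \<in> star_pairs G1 G2 \<and> (a', b') \<in> star_pairs G1 G2 \<and> \<theta> (a, b) = (c, d) \<and> \<theta> (a', b') = (c', d')"
      unfolding eq by blast
    show "ev A (\<lambda>(i, j). u i j) x = \<zero>" unfolding x ev[OF H] by (rule *[rule_format, OF H])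
  qed
qed

lemma ev_aut_relations:
  assumes "triple_core G1 G2 \<theta>" and c: "\<And>i j. \<lbrakk>i \<in> verts G1; j \<in> verts G1\<rbrakk> \<Longrightarrow> u i j \<in> carrier A"
  shows "(\<forall>r\<in>magic_relations (verts G1) \<union> triple_core.aut_relations G1 G2 \<theta>. ev A (\<lambda>(i, j). u i j) r = \<zero>) \<longleftrightarrow> aut_family G1 G2 \<theta> u"
proof -
  interpret triple_core G1 G2 \<theta> by fact
  show ?thesis
    using ev_magic_relations[OF c finV] ev_intertwining_relations[of G1 u] ev_intertwining_relations[of G2 u]
      ev_theta_relations[OF assms] c
    unfolding aut_relations_def aut_family_def by (simp add: ball_Un verts_eq)
qed

end

section \<open>Universal magic unitaries and their comultiplication\<close>

locale magic_presentation =
  fixes V :: "'v set" and R :: "('v \<times> 'v) free_star set"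
  assumes finite_V: "finite V" and R_free: "R \<subseteq> free_on (V \<times> V)"
begin

abbreviation "rels \<equiv> algebraic (magic_relations V \<union> R)"

lemma magic_free: "magic_relations V \<subseteq> free_on (V \<times> V)"
  by (auto simp: magic_relations_def)

sublocale cstar_presentation "V \<times> V" rels
proof
  show "r \<in> free_on (V \<times> V) \<and> 0 \<le> \<eta>" if "(r, \<eta>) \<in> rels" for r \<eta>
    using that magic_free R_free by (auto simp: algebraic_def)
  fix g assume g: "g \<in> V \<times> V"
  then obtain i j where ij: "g = (i, j)" "i \<in> V" "j \<in> V" by blast
  have "N (free_gen g) \<le> 1" if N: "admissible (V \<times> V) rels N" for N
  proof -
    interpret seminormed "V \<times> V" N using N by (simp add: admissible_def seminormed_def)
    let ?x = "free_gen g"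
    have le: "N r \<le> 0" if "r \<in> magic_relations V" for r
      using N that by (force simp: admissible_def algebraic_def)
    have "free_adj ?x - ?x \<in> magic_relations V" "?x * ?x - ?x \<in> magic_relations V"
      using ij unfolding magic_relations_def by blast+
    then have 0: "N (free_adj ?x - ?x) \<le> 0" "N (?x * ?x - ?x) \<le> 0" using le by blast+
    have x: "?x \<in> free_on (V \<times> V)" using g by simp
    \<comment> \<open>The polynomial form of "a projection has norm at most 1": the correction terms
      are relations, on which the seminorm vanishes, so the square of the norm is at most the
      norm.\<close>
    have "free_adj ?x * ?x = (free_adj ?x - ?x) * ?x + ((?x * ?x - ?x) + ?x)" by (simp add: algebra_simps)
    then have "(N ?x)\<^sup>2 = N ((free_adj ?x - ?x) * ?x + ((?x * ?x - ?x) + ?x))" using N_cstar[OF x] by simp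
    also have "\<dots> \<le> N (free_adj ?x - ?x) * N ?x + (N (?x * ?x - ?x) + N ?x)"
      using x by (intro order_trans[OF N_add] add_mono N_mult N_add) auto
    also have "\<dots> \<le> N ?x" using 0 mult_nonpos_nonneg[OF 0(1) N_nonneg[OF x]] by simp
    finally show ?thesis using N_nonneg[OF x] by (cases "N ?x = 0") (auto simp: power2_eq_square)
  qed
  then show "\<exists>K. \<forall>N. admissible (V \<times> V) rels N \<longrightarrow> N (free_gen g) \<le> K" by blast
qed

abbreviation "q \<equiv> magic_gen V R"

lemma q_gen: "q i j = gen (i, j)"
  by (simp add: magic_gen_def)

lemma alg: "cqg_alg (magic_cqg V R) = W"
  by (simp add: magic_cqg_def Let_def)

lemma q_closed [simp]: "\<lbrakk>i \<in> V; j \<in> V\<rbrakk> \<Longrightarrow> q i j \<in> carrier W"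
  by (simp add: q_gen)

lemma gen_q: "gen = (\<lambda>(i, j). q i j)"
  by (auto simp: q_gen)

lemma relations_hold: assumes "r \<in> magic_relations V \<union> R" shows "ev W (\<lambda>(i, j). q i j) r = \<zero>\<^bsub>W\<^esub>"
proof -
  have "(r, 0) \<in> rels" using assms unfolding algebraic_def by (rule imageI)
  from relation_zero[OF this] show ?thesis by (simp only: gen_q)
qed

lemma magic_q: "W.magic V q"
  using relations_hold W.ev_magic_relations[of V q] finite_V by auto

lemma universal_magic:
  assumes B: "cstar_algebra B" and u: "\<And>i j. \<lbrakk>i \<in> V; j \<in> V\<rbrakk> \<Longrightarrow> u i j \<in> carrier B"
    and R: "\<forall>r\<in>magic_relations V \<union> R. ev B (\<lambda>(i, j). u i j) r = \<zero>\<^bsub>B\<^esub>"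
  shows "\<exists>\<phi>\<in>star_hom W B. \<forall>i\<in>V. \<forall>j\<in>V. \<phi> (q i j) = u i j"
proof -
  interpret B: cstar_algebra B by fact
  have "\<exists>\<phi>\<in>star_hom W B. \<forall>g\<in>V \<times> V. \<phi> (gen g) = (\<lambda>(i, j). u i j) g"
    by (rule universal[OF B]) (use u R in \<open>auto simp: algebraic_def\<close>)
  then show ?thesis by (auto simp: q_gen)
qed

lemma star_hom_magic_eqI:
  assumes "cstar_algebra B" "f \<in> star_hom W B" "h \<in> star_hom W B" "\<And>i j. \<lbrakk>i \<in> V; j \<in> V\<rbrakk> \<Longrightarrow> f (q i j) = h (q i j)"
  shows "f = h"
  using assms by (intro star_hom_eqI) (auto simp: q_gen)

sublocale WW: tensor_pair W W
  by unfold_locales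

abbreviation "TT \<equiv> min_tensor W W"

definition "qq i j = (\<Oplus>\<^bsub>TT\<^esub>k\<in>V. tensor W W (q i k) (q k j))"

lemma qq_closed [simp]: "\<lbrakk>i \<in> V; j \<in> V\<rbrakk> \<Longrightarrow> qq i j \<in> carrier TT"
  unfolding qq_def by (intro WW.T.finsum_in) auto

text \<open>In the square of an entry the cross terms vanish by orthogonality within row i of
  \<open>q\<close>. The row sums use up the second leg and then the first, the column sums the other
  way round.\<close>

lemma magic_qq: "WW.T.magic V qq"
  unfolding WW.T.magic_def
proof (intro conjI ballI)
  note qD = W.magicD[OF magic_q]
  have t: "tensor W W (q i k) (q k j) \<in> carrier TT" if "i \<in> V" "j \<in> V" "k \<in> V" for i j k using that by simp
  show "WW.T.projection (qq i j)" if ij: "i \<in> V" "j \<in> V" for i j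
    unfolding WW.T.projection_def
  proof (intro conjI)
    show "adj TT (qq i j) = qq i j"
      unfolding qq_def using ij qD t by (subst WW.T.adj_finsum) (auto intro!: WW.T.finsum_eq)
    have "qq i j \<otimes>\<^bsub>TT\<^esub> qq i j = (\<Oplus>\<^bsub>TT\<^esub>k\<in>V. tensor W W (q i k) (q k j) \<otimes>\<^bsub>TT\<^esub> qq i j)"
      using ij by (subst qq_def) (simp add: WW.T.finsum_mult_right)
    also have "\<dots> = qq i j"
      unfolding qq_def
    proof (intro WW.T.finsum_eq refl)
      fix k assume k: "k \<in> V"
      have "tensor W W (q i k) (q k j) \<otimes>\<^bsub>TT\<^esub> (\<Oplus>\<^bsub>TT\<^esub>l\<in>V. tensor W W (q i l) (q l j))
          = (\<Oplus>\<^bsub>TT\<^esub>l\<in>V. tensor W W (q i k \<otimes>\<^bsub>W\<^esub> q i l) (q k j \<otimes>\<^bsub>W\<^esub> q l j))"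
        using ij k by (simp add: WW.T.finsum_mult_left) (auto intro!: WW.T.finsum_eq)
      also have "\<dots> = tensor W W (q i k \<otimes>\<^bsub>W\<^esub> q i k) (q k j \<otimes>\<^bsub>W\<^esub> q k j)"
        using ij k finite_V W.magic_row[OF magic_q finite_V ij(1) k]
        by (intro WW.T.finsum_single[where f = "\<lambda>l. tensor W W (q i k \<otimes>\<^bsub>W\<^esub> q i l) (q k j \<otimes>\<^bsub>W\<^esub> q l j)"]) auto
      finally show "tensor W W (q i k) (q k j) \<otimes>\<^bsub>TT\<^esub> (\<Oplus>\<^bsub>TT\<^esub>l\<in>V. tensor W W (q i l) (q l j)) = tensor W W (q i k) (q k j)"
        using ij k qD by simp
    qed (use ij t in auto)
    finally show "qq i j \<otimes>\<^bsub>TT\<^esub> qq i j = qq i j" .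
  qed (use ij in simp)
  show "(\<Oplus>\<^bsub>TT\<^esub>j\<in>V. qq i j) = \<one>\<^bsub>TT\<^esub>" if i: "i \<in> V" for i
  proof -
    have "(\<Oplus>\<^bsub>TT\<^esub>j\<in>V. qq i j) = (\<Oplus>\<^bsub>TT\<^esub>k\<in>V. \<Oplus>\<^bsub>TT\<^esub>j\<in>V. tensor W W (q i k) (q k j))"
      unfolding qq_def using i finite_V by (intro WW.T.finsum_swap) auto
    also have "\<dots> = (\<Oplus>\<^bsub>TT\<^esub>k\<in>V. tensor W W (q i k) \<one>\<^bsub>W\<^esub>)"
      using i qD(4) by (intro WW.T.finsum_eq) (auto simp flip: WW.tensor_finsum_right)
    also have "\<dots> = tensor W W (\<Oplus>\<^bsub>W\<^esub>k\<in>V. q i k) \<one>\<^bsub>W\<^esub>"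
      using i by (subst WW.tensor_finsum_left) auto
    finally show ?thesis using qD(4)[OF i] by simp
  qed
  show "(\<Oplus>\<^bsub>TT\<^esub>i\<in>V. qq i j) = \<one>\<^bsub>TT\<^esub>" if j: "j \<in> V" for j
  proof -
    have "(\<Oplus>\<^bsub>TT\<^esub>i\<in>V. qq i j) = (\<Oplus>\<^bsub>TT\<^esub>k\<in>V. \<Oplus>\<^bsub>TT\<^esub>i\<in>V. tensor W W (q i k) (q k j))"
      unfolding qq_def using j finite_V by (intro WW.T.finsum_swap) auto
    also have "\<dots> = (\<Oplus>\<^bsub>TT\<^esub>k\<in>V. tensor W W \<one>\<^bsub>W\<^esub> (q k j))"
      using j qD(5) by (intro WW.T.finsum_eq) (auto simp flip: WW.tensor_finsum_left)
    also have "\<dots> = tensor W W \<one>\<^bsub>W\<^esub> (\<Oplus>\<^bsub>W\<^esub>k\<in>V. q k j)"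
      using j by (subst WW.tensor_finsum_right) auto
    finally show ?thesis using qD(5)[OF j] by simp
  qed
qed

text \<open>The definite description denotes as soon as \<open>R\<close> holds for
  \<open>qq\<close>: the universal property gives existence, and the values at the generators give
  uniqueness.\<close>

lemma comult_magic:
  assumes R: "\<forall>r\<in>R. ev TT (\<lambda>(i, j). qq i j) r = \<zero>\<^bsub>TT\<^esub>"
  shows "comult (magic_cqg V R) \<in> star_hom W TT" "\<And>i j. \<lbrakk>i \<in> V; j \<in> V\<rbrakk> \<Longrightarrow> comult (magic_cqg V R) (q i j) = qq i j"
proof -
  have "\<forall>r\<in>magic_relations V. ev TT (\<lambda>(i, j). qq i j) r = \<zero>\<^bsub>TT\<^esub>"
    using WW.T.ev_magic_relations[of V qq] magic_qq finite_V by simp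
  with R obtain \<Delta> where \<Delta>: "\<Delta> \<in> star_hom W TT" "\<forall>i\<in>V. \<forall>j\<in>V. \<Delta> (q i j) = qq i j"
    using universal_magic[OF WW.T.cstar_algebra_axioms, of qq] by auto
  have "comult (magic_cqg V R) = (THE \<Delta>. \<Delta> \<in> star_hom W TT \<and> (\<forall>i\<in>V. \<forall>j\<in>V. \<Delta> (q i j) = qq i j))"
    by (simp add: magic_cqg_def Let_def qq_def)
  also have "\<dots> = \<Delta>"
    using \<Delta> by (intro the_equality star_hom_magic_eqI[OF WW.T.cstar_algebra_axioms]) auto
  finally show "comult (magic_cqg V R) \<in> star_hom W TT" "\<And>i j. \<lbrakk>i \<in> V; j \<in> V\<rbrakk> \<Longrightarrow> comult (magic_cqg V R) (q i j) = qq i j"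
    using \<Delta> by auto
qed

end

section \<open>The quantum automorphism group of a triple\<close>

context triple_core
begin

lemma aut_relations_free: "aut_relations \<subseteq> free_on (V \<times> V)"
proof -
  have "intertwining_relations G1 \<subseteq> free_on (V \<times> V)" "intertwining_relations G2 \<subseteq> free_on (V \<times> V)"
    by (auto simp: intertwining_relations_def verts_eq)
  moreover have "theta_relations G1 G2 \<theta> \<subseteq> free_on (V \<times> V)"
  proof
    fix r assume "r \<in> theta_relations G1 G2 \<theta>"
    then obtain a b c d a' b' c' d' where
      r: "r = free_gen (head G2 c', head G2 c) * free_gen (tail G2 c', tail G2 c) * free_gen (tail G1 d', tail G1 d)
        - free_gen (head G1 a', head G1 a) * free_gen (tail G1 a', tail G1 a) * free_gen (tail G2 b', tail G2 b)"
      and "(a, b) \<in> star_pairs G1 G2" "(a', b') \<in> star_pairs G1 G2" "\<theta> (a, b) = (c, d)" "\<theta> (a', b') = (c', d')"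
      unfolding theta_relations_def by blast
    then show "r \<in> free_on (V \<times> V)"
      using star_pairs_ends(1)[of a b] star_pairs_ends(1)[of a' b'] star_pairs_ends(2)[OF theta_in, of a b c d]
        star_pairs_ends(2)[OF theta_in, of a' b' c' d'] by simp
  qed
  ultimately show ?thesis by (simp add: aut_relations_def)
qed

sublocale magic_presentation V aut_relations
  by unfold_locales (simp_all add: aut_relations_free)

lemma quantum_aut_magic: "quantum_aut G1 G2 \<theta> = magic_cqg V aut_relations"
  by (simp add: quantum_aut_def aut_relations_def)

lemma aut_family_q: "W.aut_family G1 G2 \<theta> q"
  using relations_hold W.ev_aut_relations[OF triple_core_axioms, of q] by auto

lemma universal_aut:
  assumes B: "cstar_algebra B" and u: "cstar_algebra.aut_family B G1 G2 \<theta> u"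
  shows "\<exists>\<phi>\<in>star_hom W B. \<forall>i\<in>V. \<forall>j\<in>V. \<phi> (q i j) = u i j"
proof -
  interpret B: cstar_algebra B by fact
  have c: "u i j \<in> carrier B" if "i \<in> V" "j \<in> V" for i j
    using u that B.magicD(1)[of V u] by (auto simp: B.aut_family_def)
  show ?thesis using universal_magic[OF B c] B.ev_aut_relations[OF triple_core_axioms c] u by auto
qed

text \<open>The matrix M passes first through the second leg and then through the first: (q
  \<otimes> q) M = q \<otimes> M q = q M \<otimes> q = M (q \<otimes> q), written entrywise.\<close>

lemma intertwines_qq:
  assumes M: "W.intertwines V M q"
  shows "WW.T.intertwines V M qq"
  unfolding WW.T.intertwines_def
proof (intro ballI)
  fix i j assume ij: "i \<in> V" "j \<in> V"
  have "(\<Oplus>\<^bsub>TT\<^esub>k\<in>V. of_nat (M k j) \<odot>\<^bsub>TT\<^esub> qq i k) = (\<Oplus>\<^bsub>TT\<^esub>k\<in>V. \<Oplus>\<^bsub>TT\<^esub>m\<in>V. tensor W W (q i m) (of_nat (M k j) \<odot>\<^bsub>W\<^esub> q m k))"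
    using ij by (intro WW.T.finsum_eq) (auto simp: qq_def WW.T.smult_finsum WW.tensor_smult intro!: WW.T.finsum_eq)
  also have "\<dots> = (\<Oplus>\<^bsub>TT\<^esub>m\<in>V. \<Oplus>\<^bsub>TT\<^esub>k\<in>V. tensor W W (q i m) (of_nat (M k j) \<odot>\<^bsub>W\<^esub> q m k))"
    using ij by (intro WW.T.finsum_swap) auto
  also have "\<dots> = (\<Oplus>\<^bsub>TT\<^esub>m\<in>V. tensor W W (q i m) (\<Oplus>\<^bsub>W\<^esub>k\<in>V. of_nat (M m k) \<odot>\<^bsub>W\<^esub> q k j))"
    using ij M by (intro WW.T.finsum_eq) (auto simp: W.intertwines_def simp flip: WW.tensor_finsum_right)
  also have "\<dots> = (\<Oplus>\<^bsub>TT\<^esub>m\<in>V. \<Oplus>\<^bsub>TT\<^esub>k\<in>V. tensor W W (of_nat (M m k) \<odot>\<^bsub>W\<^esub> q i m) (q k j))"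
    using ij by (intro WW.T.finsum_eq) (auto simp: WW.tensor_finsum_right WW.tensor_smult intro!: WW.T.finsum_eq)
  also have "\<dots> = (\<Oplus>\<^bsub>TT\<^esub>k\<in>V. \<Oplus>\<^bsub>TT\<^esub>m\<in>V. tensor W W (of_nat (M m k) \<odot>\<^bsub>W\<^esub> q i m) (q k j))"
    using ij by (intro WW.T.finsum_swap) auto
  also have "\<dots> = (\<Oplus>\<^bsub>TT\<^esub>k\<in>V. tensor W W (\<Oplus>\<^bsub>W\<^esub>m\<in>V. of_nat (M i m) \<odot>\<^bsub>W\<^esub> q m k) (q k j))"
    using ij M by (intro WW.T.finsum_eq) (auto simp: W.intertwines_def simp flip: WW.tensor_finsum_left)
  also have "\<dots> = (\<Oplus>\<^bsub>TT\<^esub>k\<in>V. \<Oplus>\<^bsub>TT\<^esub>m\<in>V. of_nat (M i m) \<odot>\<^bsub>TT\<^esub> tensor W W (q m k) (q k j))"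
    using ij by (intro WW.T.finsum_eq) (auto simp: WW.tensor_finsum_left WW.tensor_smult intro!: WW.T.finsum_eq)
  also have "\<dots> = (\<Oplus>\<^bsub>TT\<^esub>m\<in>V. \<Oplus>\<^bsub>TT\<^esub>k\<in>V. of_nat (M i m) \<odot>\<^bsub>TT\<^esub> tensor W W (q m k) (q k j))"
    using ij by (intro WW.T.finsum_swap) auto
  also have "\<dots> = (\<Oplus>\<^bsub>TT\<^esub>m\<in>V. of_nat (M i m) \<odot>\<^bsub>TT\<^esub> qq m j)"
    using ij by (intro WW.T.finsum_eq) (auto simp: qq_def WW.T.smult_finsum intro!: WW.T.finsum_eq)
  finally show "(\<Oplus>\<^bsub>TT\<^esub>k\<in>V. of_nat (M k j) \<odot>\<^bsub>TT\<^esub> qq i k) = (\<Oplus>\<^bsub>TT\<^esub>k\<in>V. of_nat (M i k) \<odot>\<^bsub>TT\<^esub> qq k j)" .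
qed

text \<open>A composable pair is a path through three vertices, and this is the product of the
  entries of \<open>q\<close> that match the path \<open>p'\<close> with the path \<open>p\<close>.
  The middle vertex is taken as the source of the first edge, which for a composable pair is also
  the target of the second.\<close>

definition "q3 H K p' p = q (head H (fst p')) (head H (fst p)) \<otimes>\<^bsub>W\<^esub> q (tail H (fst p')) (tail H (fst p)) \<otimes>\<^bsub>W\<^esub> q (tail K (snd p')) (tail K (snd p))"

text \<open>Expanding a product of three entries of \<open>qq\<close> gives a sum over all triples of vertices; by
  orthogonality only the triples along composable pairs of edges survive.\<close>

lemma qq_path:
  fixes H :: "('v, 'x) pre_digraph" and K :: "('v, 'y) pre_digraph"
  assumes H: "fin_digraph H" "nomulti_digraph H" "verts H = V" and K: "fin_digraph K" "nomulti_digraph K" "verts K = V"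
    and MH: "W.intertwines V (vertex_matrix H) q" and MK: "W.intertwines V (vertex_matrix K) q"
    and p': "p' \<in> star_pairs H K" and p: "p \<in> star_pairs H K"
  shows "qq (head H (fst p')) (head H (fst p)) \<otimes>\<^bsub>TT\<^esub> qq (tail H (fst p')) (tail H (fst p)) \<otimes>\<^bsub>TT\<^esub> qq (tail K (snd p')) (tail K (snd p))
    = (\<Oplus>\<^bsub>TT\<^esub>s\<in>star_pairs H K. tensor W W (q3 H K p' s) (q3 H K s p))"
proof -
  interpret H: fin_digraph H by fact
  interpret K: fin_digraph K by fact
  have ends: "head H (fst s) \<in> V" "tail H (fst s) \<in> V" "tail K (snd s) \<in> V" "tail H (fst s) = head K (snd s)"
    "fst s \<in> arcs H" "snd s \<in> arcs K" if "s \<in> star_pairs H K" for s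
    using that H.head_in_verts H.tail_in_verts K.tail_in_verts H(3) K(3) by (auto simp: star_pairs_def)
  define i1 i2 i3 j1 j2 j3 where "i1 = head H (fst p')" "i2 = tail H (fst p')" "i3 = tail K (snd p')"
    "j1 = head H (fst p)" "j2 = tail H (fst p)" "j3 = tail K (snd p)"
  note ijd = this
  have ij: "i1 \<in> V" "i2 \<in> V" "i3 \<in> V" "j1 \<in> V" "j2 \<in> V" "j3 \<in> V" using ends p p' by (auto simp: ijd)
  have pos: "vertex_matrix G v w \<noteq> 0 \<longleftrightarrow> (\<exists>e\<in>arcs G. tail G e = v \<and> head G e = w)" if "fin_digraph G" for G :: "('v, 'z) pre_digraph" and v w
    using fin_digraph.finite_arcs[OF that] by (auto simp: vertex_matrix_def card_eq_0_iff)
  define F where "F k = tensor W W (q i1 (fst k) \<otimes>\<^bsub>W\<^esub> q i2 (fst (snd k)) \<otimes>\<^bsub>W\<^esub> q i3 (snd (snd k)))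
      (q (fst k) j1 \<otimes>\<^bsub>W\<^esub> q (fst (snd k)) j2 \<otimes>\<^bsub>W\<^esub> q (snd (snd k)) j3)" for k
  define m where "m s = (head H (fst s), tail H (fst s), tail K (snd s))" for s
  have F: "F k \<in> carrier TT" if "k \<in> V \<times> V \<times> V" for k using that ij by (auto simp: F_def)
  have "qq i1 j1 \<otimes>\<^bsub>TT\<^esub> qq i2 j2 \<otimes>\<^bsub>TT\<^esub> qq i3 j3 = (\<Oplus>\<^bsub>TT\<^esub>k\<in>V \<times> V \<times> V. F k)"
    unfolding qq_def using ij by (subst WW.T.finsum_mult_triple) (auto intro!: WW.T.finsum_eq simp: F_def)
  also have "\<dots> = (\<Oplus>\<^bsub>TT\<^esub>k\<in>m ` star_pairs H K. F k)"
  proof (rule WW.T.finsum_subset)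
    show sub: "m ` star_pairs H K \<subseteq> V \<times> V \<times> V" using ends by (auto simp: m_def)
    show "F k \<in> carrier TT" if "k \<in> m ` star_pairs H K" for k using F sub that by blast
    fix k assume k: "k \<in> V \<times> V \<times> V - m ` star_pairs H K"
    then obtain k1 k2 k3 where k123: "k = (k1, k2, k3)" "k1 \<in> V" "k2 \<in> V" "k3 \<in> V" by auto
    have "vertex_matrix H k2 k1 = 0 \<or> vertex_matrix K k3 k2 = 0"
    proof (rule ccontr)
      assume "\<not> ?thesis"
      then obtain c d where "c \<in> arcs H" "tail H c = k2" "head H c = k1" "d \<in> arcs K" "tail K d = k3" "head K d = k2"
        using pos[OF H(1)] pos[OF K(1)] by blast
      then have "(c, d) \<in> star_pairs H K" "m (c, d) = k" by (auto simp: star_pairs_def m_def k123)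
      then show False using k by blast
    qed
    moreover have "vertex_matrix H i2 i1 \<noteq> 0" "vertex_matrix K i3 i2 \<noteq> 0"
      unfolding pos[OF H(1)] pos[OF K(1)] using ends[OF p'] by (auto simp: ijd)
    \<comment> \<open>The indices i run along edges of H and K, so their matrix entries are nonzero;
      a vanishing entry for the k is then a mismatch, and \<open>intertwines_orthogonal\<close>
      kills two neighbouring factors.\<close>
    ultimately have "q i1 k1 \<otimes>\<^bsub>W\<^esub> q i2 k2 = \<zero>\<^bsub>W\<^esub> \<or> q i2 k2 \<otimes>\<^bsub>W\<^esub> q i3 k3 = \<zero>\<^bsub>W\<^esub>"
      using W.intertwines_orthogonal[OF magic_q finV MH ij(1) k123(2) ij(2) k123(3)]
        W.intertwines_orthogonal[OF magic_q finV MK ij(2) k123(3) ij(3) k123(4)] by force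
    then have "q i1 k1 \<otimes>\<^bsub>W\<^esub> q i2 k2 \<otimes>\<^bsub>W\<^esub> q i3 k3 = \<zero>\<^bsub>W\<^esub>"
    proof
      assume "q i1 k1 \<otimes>\<^bsub>W\<^esub> q i2 k2 = \<zero>\<^bsub>W\<^esub>"
      then show ?thesis using ij k123 by simp
    next
      assume "q i2 k2 \<otimes>\<^bsub>W\<^esub> q i3 k3 = \<zero>\<^bsub>W\<^esub>"
      then show ?thesis using ij k123 W.m_assoc[of "q i1 k1" "q i2 k2" "q i3 k3"] by simp
    qed
    then show "F k = \<zero>\<^bsub>TT\<^esub>" using ij k123 by (simp add: F_def)
  qed simp
  also have "\<dots> = (\<Oplus>\<^bsub>TT\<^esub>s\<in>star_pairs H K. F (m s))"
  proof (rule WW.T.finsum_reindex)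
    show "F \<in> m ` star_pairs H K \<rightarrow> carrier TT" using F ends by (auto simp: m_def)
    \<comment> \<open>Without multiple edges a composable pair is determined by its three
      vertices.\<close>
    show "inj_on m (star_pairs H K)"
    proof (rule inj_onI)
      fix s t assume st: "s \<in> star_pairs H K" "t \<in> star_pairs H K" "m s = m t"
      then have "fst s = fst t"
        using ends[OF st(1)] ends[OF st(2)] nomulti_digraph.no_multi_arcs[OF H(2)] by (auto simp: m_def arc_to_ends_def)
      moreover have "snd s = snd t"
        using st ends[OF st(1)] ends[OF st(2)] nomulti_digraph.no_multi_arcs[OF K(2), of "snd s" "snd t"] by (auto simp: m_def arc_to_ends_def)
      ultimately show "s = t" by (rule prod_eqI)
    qed
  qed
  finally show ?thesis by (simp add: F_def m_def q3_def ijd)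
qed

lemma q3_closed: "\<lbrakk>s \<in> star_pairs G1 G2; t \<in> star_pairs G1 G2\<rbrakk> \<Longrightarrow> q3 G1 G2 s t \<in> carrier W"
  "\<lbrakk>s' \<in> star_pairs G2 G1; t' \<in> star_pairs G2 G1\<rbrakk> \<Longrightarrow> q3 G2 G1 s' t' \<in> carrier W"
  using star_pairs_ends(1)[of "fst s" "snd s"] star_pairs_ends(1)[of "fst t" "snd t"]
    star_pairs_ends(2)[of "fst s'" "snd s'"] star_pairs_ends(2)[of "fst t'" "snd t'"]
  by (auto simp: q3_def)

lemma q3_theta: assumes "s \<in> star_pairs G1 G2" "t \<in> star_pairs G1 G2"
  shows "q3 G2 G1 (\<theta> s) (\<theta> t) = q3 G1 G2 s t"
proof -
  have "W.theta_compatible G1 G2 \<theta> q" using aut_family_q by (simp add: W.aut_family_def)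
  then show ?thesis
    using assms unfolding W.theta_compatible_def q3_def
    by (cases s; cases t; cases "\<theta> s"; cases "\<theta> t") auto
qed

text \<open>By \<open>qq_path\<close> each side is a sum over composable pairs of \<open>q3\<close>
  \<otimes> \<open>q3\<close>. The bijection \<theta> matches the two index sets, and the
  \<theta>-relations for \<open>q\<close> say exactly that \<open>q3\<close> takes the same values
  on matched pairs.\<close>

lemma theta_compatible_qq: "WW.T.theta_compatible G1 G2 \<theta> qq"
  unfolding WW.T.theta_compatible_def
proof (intro allI impI, elim conjE)
  fix a b c d a' b' c' d'
  assume *: "(a, b) \<in> star_pairs G1 G2" "(a', b') \<in> star_pairs G1 G2" "\<theta> (a, b) = (c, d)" "\<theta> (a', b') = (c', d')"
  have M: "W.intertwines V (vertex_matrix G1) q" "W.intertwines V (vertex_matrix G2) q"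
    using aut_family_q by (auto simp: W.aut_family_def)
  have inj: "inj_on \<theta> (star_pairs G1 G2)" and img: "\<theta> ` star_pairs G1 G2 = star_pairs G2 G1"
    using theta_bij by (auto simp: bij_betw_def)
  have cd: "(c, d) \<in> star_pairs G2 G1" "(c', d') \<in> star_pairs G2 G1" using * theta_in by auto
  have "(\<Oplus>\<^bsub>TT\<^esub>s\<in>star_pairs G2 G1. tensor W W (q3 G2 G1 (c', d') s) (q3 G2 G1 s (c, d)))
      = (\<Oplus>\<^bsub>TT\<^esub>s\<in>star_pairs G1 G2. tensor W W (q3 G2 G1 (c', d') (\<theta> s)) (q3 G2 G1 (\<theta> s) (c, d)))"
    unfolding img[symmetric] using inj cd q3_closed img by (intro WW.T.finsum_reindex) auto
  also have "\<dots> = (\<Oplus>\<^bsub>TT\<^esub>s\<in>star_pairs G1 G2. tensor W W (q3 G1 G2 (a', b') s) (q3 G1 G2 s (a, b)))"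
    using * q3_theta q3_closed by (intro WW.T.finsum_eq) (auto simp flip: *(3,4))
  finally show "qq (head G2 c') (head G2 c) \<otimes>\<^bsub>TT\<^esub> qq (tail G2 c') (tail G2 c) \<otimes>\<^bsub>TT\<^esub> qq (tail G1 d') (tail G1 d)
      = qq (head G1 a') (head G1 a) \<otimes>\<^bsub>TT\<^esub> qq (tail G1 a') (tail G1 a) \<otimes>\<^bsub>TT\<^esub> qq (tail G2 b') (tail G2 b)"
    using qq_path[of G2 G1 "(c', d')" "(c, d)"] qq_path[of G1 G2 "(a', b')" "(a, b)"] cd * M
      G1.fin_digraph_axioms G2.fin_digraph_axioms G1.nomulti_digraph_axioms G2.nomulti_digraph_axioms verts_eq by simp
qed

lemma aut_family_qq: "WW.T.aut_family G1 G2 \<theta> qq"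
  unfolding WW.T.aut_family_def
  using magic_qq intertwines_qq theta_compatible_qq aut_family_q by (auto simp: W.aut_family_def)

abbreviation "\<Delta> \<equiv> comult (quantum_aut G1 G2 \<theta>)"

lemma comult_aut: "\<Delta> \<in> star_hom W TT" "\<And>i j. \<lbrakk>i \<in> V; j \<in> V\<rbrakk> \<Longrightarrow> \<Delta> (q i j) = qq i j"
proof -
  have "\<forall>r\<in>aut_relations. ev TT (\<lambda>(i, j). qq i j) r = \<zero>\<^bsub>TT\<^esub>"
    using aut_family_qq WW.T.ev_aut_relations[OF triple_core_axioms, of qq] by auto
  from comult_magic[OF this] show "\<Delta> \<in> star_hom W TT" "\<And>i j. \<lbrakk>i \<in> V; j \<in> V\<rbrakk> \<Longrightarrow> \<Delta> (q i j) = qq i j"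
    by (simp_all add: quantum_aut_magic)
qed

end

section \<open>Disjoint copies\<close>

lemma copies_simps [simp]:
  "verts (copies n G) = {..<n} \<times> verts G" "arcs (copies n G) = {..<n} \<times> arcs G"
  "tail (copies n G) = (\<lambda>(k, e). (k, tail G e))" "head (copies n G) = (\<lambda>(k, e). (k, head G e))"
  by (simp_all add: copies_def)

lemma star_pairs_copiesI: "\<lbrakk>k < n; (a, b) \<in> star_pairs G H\<rbrakk> \<Longrightarrow> ((k, a), (k, b)) \<in> star_pairs (copies n G) (copies n H)"
  by (auto simp: star_pairs_def)

lemma star_pairs_copiesE:
  assumes "p \<in> star_pairs (copies n G) (copies n H)"
  obtains k a b where "p = ((k, a), (k, b))" "k < n" "(a, b) \<in> star_pairs G H"
  using assms by (auto simp: star_pairs_def)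

lemma vertex_matrix_copies:
  "vertex_matrix (copies n G) (k, v) (l, w) = (if k = l \<and> k < n then vertex_matrix G v w else 0)"
proof (cases "k = l \<and> k < n")
  case True
  then have "{e \<in> arcs (copies n G). tail (copies n G) e = (k, v) \<and> head (copies n G) e = (l, w)}
      = Pair k ` {e \<in> arcs G. tail G e = v \<and> head G e = w}" by auto
  then show ?thesis using True by (simp add: vertex_matrix_def card_image inj_on_def)
next
  case False
  then have "{e \<in> arcs (copies n G). tail (copies n G) e = (k, v) \<and> head (copies n G) e = (l, w)} = {}" by auto
  then have "vertex_matrix (copies n G) (k, v) (l, w) = 0" unfolding vertex_matrix_def by (simp only: card.empty)
  then show ?thesis by (simp only: False if_False)
qed

lemma triple_core_copies: assumes "triple_core G1 G2 \<theta>"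
  shows "triple_core (copies n G1) (copies n G2) (theta_copies \<theta>)"
proof -
  interpret triple_core G1 G2 \<theta> by fact
  have fin: "fin_digraph (copies n G)" if "fin_digraph G" for G :: "('v, 'z) pre_digraph"
  proof -
    interpret fin_digraph G by fact
    show ?thesis by unfold_locales auto
  qed
  have nomulti: "nomulti_digraph (copies n G)" if "nomulti_digraph G" for G :: "('v, 'z) pre_digraph"
  proof -
    interpret nomulti_digraph G by fact
    show ?thesis by unfold_locales (auto simp: arc_to_ends_def intro: no_multi_arcs)
  qed
  have eq: "theta_copies \<theta> ((k, a), (k, b)) = ((k, fst (\<theta> (a, b))), (k, snd (\<theta> (a, b))))" for k :: nat and a b
    by (simp add: theta_copies_def case_prod_unfold)
  have "bij_betw (theta_copies \<theta>) (star_pairs (copies n G1) (copies n G2)) (star_pairs (copies n G2) (copies n G1))"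
  proof (rule bij_betw_imageI)
    have inj: "inj_on \<theta> (star_pairs G1 G2)" and img: "\<theta> ` star_pairs G1 G2 = star_pairs G2 G1"
      using theta_bij by (auto simp: bij_betw_def)
    show "inj_on (theta_copies \<theta>) (star_pairs (copies n G1) (copies n G2))"
    proof (rule inj_onI)
      fix p r assume pr: "p \<in> star_pairs (copies n G1) (copies n G2)" "r \<in> star_pairs (copies n G1) (copies n G2)"
        and *: "theta_copies \<theta> p = theta_copies \<theta> r"
      obtain k a b where p: "p = ((k, a), (k, b))" "(a, b) \<in> star_pairs G1 G2" using pr(1) by (rule star_pairs_copiesE)
      obtain l a' b' where r: "r = ((l, a'), (l, b'))" "(a', b') \<in> star_pairs G1 G2" using pr(2) by (rule star_pairs_copiesE)
      from * have "k = l" "\<theta> (a, b) = \<theta> (a', b')" unfolding p r eq by (auto simp: prod_eq_iff)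
      with inj p r show "p = r" by (auto dest: inj_onD)
    qed
    show "theta_copies \<theta> ` star_pairs (copies n G1) (copies n G2) = star_pairs (copies n G2) (copies n G1)"
    proof (intro equalityI subsetI)
      fix s assume "s \<in> theta_copies \<theta> ` star_pairs (copies n G1) (copies n G2)"
      then obtain p where p: "p \<in> star_pairs (copies n G1) (copies n G2)" "s = theta_copies \<theta> p" by blast
      obtain k a b where k: "p = ((k, a), (k, b))" "k < n" "(a, b) \<in> star_pairs G1 G2" using p(1) by (rule star_pairs_copiesE)
      have "\<theta> (a, b) \<in> star_pairs G2 G1" using k img by blast
      then show "s \<in> star_pairs (copies n G2) (copies n G1)" unfolding p k eq using k(2) by (intro star_pairs_copiesI) auto
    next
      fix s assume "s \<in> star_pairs (copies n G2) (copies n G1)"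
      then obtain k c d where k: "s = ((k, c), (k, d))" "k < n" "(c, d) \<in> star_pairs G2 G1" by (rule star_pairs_copiesE)
      obtain a b where ab: "(a, b) \<in> star_pairs G1 G2" "\<theta> (a, b) = (c, d)" using k(3) unfolding img[symmetric] by auto
      then have "s = theta_copies \<theta> ((k, a), (k, b))" by (simp add: eq k)
      then show "s \<in> theta_copies \<theta> ` star_pairs (copies n G1) (copies n G2)" using star_pairs_copiesI[OF k(2) ab(1)] by blast
    qed
  qed
  then show ?thesis
    using fin[OF G1.fin_digraph_axioms] fin[OF G2.fin_digraph_axioms] nomulti[OF G1.nomulti_digraph_axioms]
      nomulti[OF G2.nomulti_digraph_axioms] verts_eq
    by (simp add: triple_core_def triple_core_axioms_def fin_digraph_def nomulti_digraph_def)
qed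

section \<open>Solutions for the copies from solutions for one triple\<close>

context cstar_algebra
begin

text \<open>Multiplying \<open>P l\<close> by the second sum, or \<open>P' l\<close> by the first,
  leaves only the product of \<open>P l\<close> and \<open>P' l\<close> in both cases.\<close>

lemma partition_eq:
  assumes N: "finite N" and P: "\<And>l. l \<in> N \<Longrightarrow> P l \<in> carrier A" "\<And>l. l \<in> N \<Longrightarrow> P' l \<in> carrier A"
    and one: "(\<Oplus>l\<in>N. P l) = \<one>" "(\<Oplus>l\<in>N. P' l) = \<one>"
    and orth: "\<And>l l'. \<lbrakk>l \<in> N; l' \<in> N; l \<noteq> l'\<rbrakk> \<Longrightarrow> P l \<otimes> P' l' = \<zero>"
    and l: "l \<in> N"
  shows "P l = P' l"
proof -
  have "P l = P l \<otimes> (\<Oplus>l\<in>N. P' l)" using one P l by simp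
  also have "\<dots> = (\<Oplus>l'\<in>N. P l \<otimes> P' l')" using P l by (intro finsum_mult_left)
  also have "\<dots> = P l \<otimes> P' l" using P l N orth by (intro finsum_single) auto
  also have "\<dots> = (\<Oplus>l'\<in>N. P l' \<otimes> P' l)" using P l N orth by (intro finsum_single[symmetric]) auto
  also have "\<dots> = (\<Oplus>l'\<in>N. P l') \<otimes> P' l" using P l by (intro finsum_mult_right[symmetric])
  also have "\<dots> = P' l" using one P l by simp
  finally show ?thesis .
qed

lemma finsum_orthogonal:
  assumes "\<And>i. i \<in> I \<Longrightarrow> f i \<in> carrier A" "\<And>j. j \<in> J \<Longrightarrow> g j \<in> carrier A"
    "\<And>i j. \<lbrakk>i \<in> I; j \<in> J\<rbrakk> \<Longrightarrow> f i \<otimes> g j = \<zero>"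
  shows "finsum A f I \<otimes> finsum A g J = \<zero>"
  using assms by (subst finsum_mult_right) (auto simp: finsum_mult_left intro!: finsum_all_zero)

text \<open>The vertex matrix of the union is block diagonal, so the sum over all vertices shrinks
  to the block l of the column index on one side and to the block k of the row index on the other.
  Both involve entries of the (k, l) block of u only.\<close>

lemma intertwines_copies:
  assumes V: "finite V" and u: "\<And>p r. \<lbrakk>p \<in> {..<n} \<times> V; r \<in> {..<n} \<times> V\<rbrakk> \<Longrightarrow> u p r \<in> carrier A"
  shows "intertwines ({..<n} \<times> V) (vertex_matrix (copies n G)) u \<longleftrightarrow>
    (\<forall>k<n. \<forall>l<n. \<forall>i\<in>V. \<forall>j\<in>V. (\<Oplus>v\<in>V. of_nat (vertex_matrix G v j) \<odot> u (k, i) (l, v)) = (\<Oplus>v\<in>V. of_nat (vertex_matrix G i v) \<odot> u (k, v) (l, j)))"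
proof -
  let ?M = "vertex_matrix (copies n G)"
  have 1: "(\<Oplus>p\<in>{..<n} \<times> V. of_nat (?M p (l, j)) \<odot> u (k, i) p) = (\<Oplus>v\<in>V. of_nat (vertex_matrix G v j) \<odot> u (k, i) (l, v))"
    if "k < n" "l < n" "i \<in> V" "j \<in> V" for k l i j
  proof -
    have "(\<Oplus>p\<in>{..<n} \<times> V. of_nat (?M p (l, j)) \<odot> u (k, i) p) = (\<Oplus>p\<in>Pair l ` V. of_nat (?M p (l, j)) \<odot> u (k, i) p)"
      using that V u by (intro finsum_subset) (auto simp: vertex_matrix_copies)
    also have "\<dots> = (\<Oplus>v\<in>V. of_nat (?M (l, v) (l, j)) \<odot> u (k, i) (l, v))"
      using that u by (intro finsum_reindex) (auto simp: inj_on_def)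
    finally show ?thesis using that by (simp add: vertex_matrix_copies)
  qed
  have 2: "(\<Oplus>p\<in>{..<n} \<times> V. of_nat (?M (k, i) p) \<odot> u p (l, j)) = (\<Oplus>v\<in>V. of_nat (vertex_matrix G i v) \<odot> u (k, v) (l, j))"
    if "k < n" "l < n" "i \<in> V" "j \<in> V" for k l i j
  proof -
    have "(\<Oplus>p\<in>{..<n} \<times> V. of_nat (?M (k, i) p) \<odot> u p (l, j)) = (\<Oplus>p\<in>Pair k ` V. of_nat (?M (k, i) p) \<odot> u p (l, j))"
      using that V u by (intro finsum_subset) (auto simp: vertex_matrix_copies)
    also have "\<dots> = (\<Oplus>v\<in>V. of_nat (?M (k, i) (k, v)) \<odot> u (k, v) (l, j))"
      using that u by (intro finsum_reindex) (auto simp: inj_on_def)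
    finally show ?thesis using that by (simp add: vertex_matrix_copies)
  qed
  show ?thesis unfolding intertwines_def using 1 2 by (auto simp: Ball_def)
qed

text \<open>A composable pair of the union lies in one copy, so a relation between two pairs
  involves only the entries of one block (k', k).\<close>

lemma theta_compatible_copies:
  "theta_compatible (copies n G1) (copies n G2) (theta_copies \<theta>) u \<longleftrightarrow>
    (\<forall>k<n. \<forall>k'<n. \<forall>a b c d a' b' c' d'.
        (a, b) \<in> star_pairs G1 G2 \<and> (a', b') \<in> star_pairs G1 G2 \<and> \<theta> (a, b) = (c, d) \<and> \<theta> (a', b') = (c', d') \<longrightarrow>
      u (k', head G2 c') (k, head G2 c) \<otimes> u (k', tail G2 c') (k, tail G2 c) \<otimes> u (k', tail G1 d') (k, tail G1 d)
      = u (k', head G1 a') (k, head G1 a) \<otimes> u (k', tail G1 a') (k, tail G1 a) \<otimes> u (k', tail G2 b') (k, tail G2 b))"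
  (is "?L \<longleftrightarrow> ?R")
proof
  assume L: ?L
  show ?R
  proof (intro allI impI)
    fix k k' a b c d a' b' c' d'
    assume k: "k < n" "k' < n" and
      H: "(a, b) \<in> star_pairs G1 G2 \<and> (a', b') \<in> star_pairs G1 G2 \<and> \<theta> (a, b) = (c, d) \<and> \<theta> (a', b') = (c', d')"
    have "((k, a), (k, b)) \<in> star_pairs (copies n G1) (copies n G2)" "((k', a'), (k', b')) \<in> star_pairs (copies n G1) (copies n G2)"
      using H k by (auto intro: star_pairs_copiesI)
    moreover have "theta_copies \<theta> ((k, a), (k, b)) = ((k, c), (k, d))" "theta_copies \<theta> ((k', a'), (k', b')) = ((k', c'), (k', d'))"
      using H by (auto simp: theta_copies_def)
    ultimately show "u (k', head G2 c') (k, head G2 c) \<otimes> u (k', tail G2 c') (k, tail G2 c) \<otimes> u (k', tail G1 d') (k, tail G1 d)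
      = u (k', head G1 a') (k, head G1 a) \<otimes> u (k', tail G1 a') (k, tail G1 a) \<otimes> u (k', tail G2 b') (k, tail G2 b)"
      using L unfolding theta_compatible_def copies_simps by fastforce
  qed
next
  assume R: ?R
  show ?L
    unfolding theta_compatible_def
  proof (intro allI impI, elim conjE)
    fix a b c d a' b' c' d'
    assume "(a, b) \<in> star_pairs (copies n G1) (copies n G2)" "(a', b') \<in> star_pairs (copies n G1) (copies n G2)"
      and t: "theta_copies \<theta> (a, b) = (c, d)" "theta_copies \<theta> (a', b') = (c', d')"
    then obtain k a0 b0 k' a0' b0' where e: "a = (k, a0)" "b = (k, b0)" "a' = (k', a0')" "b' = (k', b0')"
      and m: "k < n" "k' < n" "(a0, b0) \<in> star_pairs G1 G2" "(a0', b0') \<in> star_pairs G1 G2"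
      by (elim star_pairs_copiesE) auto
    obtain c0 d0 where cd: "\<theta> (a0, b0) = (c0, d0)" by force
    obtain c0' d0' where cd': "\<theta> (a0', b0') = (c0', d0')" by force
    have e2: "c = (k, c0)" "d = (k, d0)" "c' = (k', c0')" "d' = (k', d0')"
      using t cd cd' by (auto simp: e theta_copies_def)
    show "u (head (copies n G2) c') (head (copies n G2) c) \<otimes> u (tail (copies n G2) c') (tail (copies n G2) c) \<otimes> u (tail (copies n G1) d') (tail (copies n G1) d)
      = u (head (copies n G1) a') (head (copies n G1) a) \<otimes> u (tail (copies n G1) a') (tail (copies n G1) a) \<otimes> u (tail (copies n G2) b') (tail (copies n G2) b)"
      unfolding copies_simps e e2 split_conv by (rule R[rule_format, OF m(1,2)]) (use m cd cd' in blast)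
  qed
qed

text \<open>Within a block (k, l) the factor \<open>x k l\<close> commutes with the entries of
  \<open>v k\<close>, so products of entries carry it along as a single central idempotent of the
  block. Row and column sums are computed first inside a block, where \<open>v k\<close> sums to 1,
  and then over the blocks, where \<open>x\<close> does.\<close>

lemma aut_family_copies:
  fixes G1 :: "('v, 'e) pre_digraph" and G2 :: "('v, 'f) pre_digraph"
  assumes tc: "triple_core G1 G2 \<theta>"
    and v: "\<And>k. k < n \<Longrightarrow> aut_family G1 G2 \<theta> (v k)" and x: "magic {..<n} x"
    and comm: "\<And>k l i j. \<lbrakk>k < n; l < n; i \<in> verts G1; j \<in> verts G1\<rbrakk> \<Longrightarrow> v k i j \<otimes> x k l = x k l \<otimes> v k i j"
  shows "aut_family (copies n G1) (copies n G2) (theta_copies \<theta>) (\<lambda>(k, i) (l, j). v k i j \<otimes> x k l)"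
    (is "aut_family _ _ _ ?u")
proof -
  interpret triple_core G1 G2 \<theta> by fact
  have vm: "magic V (v k)" "intertwines V (vertex_matrix G1) (v k)" "intertwines V (vertex_matrix G2) (v k)"
    "theta_compatible G1 G2 \<theta> (v k)" if "k < n" for k
    using v[OF that] by (auto simp: aut_family_def)
  note vD = magicD[OF vm(1)] and xD = magicD[OF x]
  have xc: "x k l \<in> carrier A" "adj A (x k l) = x k l" "x k l \<otimes> x k l = x k l" if "k < n" "l < n" for k l using xD that by auto
  have c: "?u p r \<in> carrier A" if "p \<in> {..<n} \<times> V" "r \<in> {..<n} \<times> V" for p r
    using that vD(1) xc by (auto simp: case_prod_unfold)
  have inter: "intertwines ({..<n} \<times> V) (vertex_matrix (copies n G)) ?u"
    if M: "\<And>k. k < n \<Longrightarrow> intertwines V (vertex_matrix G) (v k)" for G :: "('v, 'z) pre_digraph"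
  proof -
    have "\<forall>k<n. \<forall>l<n. \<forall>i\<in>V. \<forall>j\<in>V. (\<Oplus>w\<in>V. of_nat (vertex_matrix G w j) \<odot> (v k i w \<otimes> x k l))
        = (\<Oplus>w\<in>V. of_nat (vertex_matrix G i w) \<odot> (v k w j \<otimes> x k l))"
  proof (intro allI impI ballI)
    fix k l i j assume k: "k < n" "l < n" "i \<in> V" "j \<in> V"
    have "(\<Oplus>w\<in>V. of_nat (vertex_matrix G w j) \<odot> (v k i w \<otimes> x k l)) = (\<Oplus>w\<in>V. of_nat (vertex_matrix G w j) \<odot> v k i w) \<otimes> x k l"
      using k vD xc by (subst finsum_mult_right) (auto intro!: finsum_eq)
    also have "\<dots> = (\<Oplus>w\<in>V. of_nat (vertex_matrix G i w) \<odot> v k w j) \<otimes> x k l"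
      using M[OF k(1)] k by (simp add: intertwines_def)
    also have "\<dots> = (\<Oplus>w\<in>V. of_nat (vertex_matrix G i w) \<odot> (v k w j \<otimes> x k l))"
      using k vD xc by (subst finsum_mult_right) (auto intro!: finsum_eq)
    finally show "(\<Oplus>w\<in>V. of_nat (vertex_matrix G w j) \<odot> (v k i w \<otimes> x k l)) = (\<Oplus>w\<in>V. of_nat (vertex_matrix G i w) \<odot> (v k w j \<otimes> x k l))" .
  qed
    then show ?thesis using intertwines_copies[of V n ?u G, OF finV c] by simp
  qed
  have "magic ({..<n} \<times> V) ?u"
    unfolding magic_def
  proof (intro conjI ballI)
    fix p r assume "p \<in> {..<n} \<times> V" "r \<in> {..<n} \<times> V"
    then obtain k i l j where k: "p = (k, i)" "r = (l, j)" "k < n" "l < n" "i \<in> V" "j \<in> V" by auto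
    have "v k i j \<otimes> x k l \<otimes> (v k i j \<otimes> x k l) = v k i j \<otimes> (x k l \<otimes> v k i j) \<otimes> x k l"
      using k vD(1) xc by (simp add: m_assoc)
    also have "\<dots> = (v k i j \<otimes> v k i j) \<otimes> (x k l \<otimes> x k l)"
      using k vD(1) xc(1) by (simp add: m_assoc flip: comm)
    also have "\<dots> = v k i j \<otimes> x k l" using k vD(1,3) xc by simp
    finally show "projection (?u p r)"
      using k vD(1,2) xc by (simp add: projection_def comm)
  next
    fix p assume "p \<in> {..<n} \<times> V"
    then obtain k i where k: "p = (k, i)" "k < n" "i \<in> V" by auto
    have "(\<Oplus>r\<in>{..<n} \<times> V. ?u p r) = (\<Oplus>l\<in>{..<n}. \<Oplus>j\<in>V. v k i j \<otimes> x k l)"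
      using k vD(1) xc(1) by (subst finsum_pairs) (auto simp: case_prod_unfold intro!: finsum_eq)
    also have "\<dots> = (\<Oplus>l\<in>{..<n}. x k l)"
      using k vD(1,4) xc(1) by (intro finsum_eq) (auto simp flip: finsum_mult_right)
    finally show "(\<Oplus>r\<in>{..<n} \<times> V. ?u p r) = \<one>" using xD(4) k by simp
  next
    fix r assume "r \<in> {..<n} \<times> V"
    then obtain l j where l: "r = (l, j)" "l < n" "j \<in> V" by auto
    have "(\<Oplus>p\<in>{..<n} \<times> V. ?u p r) = (\<Oplus>k\<in>{..<n}. \<Oplus>i\<in>V. v k i j \<otimes> x k l)"
      using l vD(1) xc(1) by (subst finsum_pairs) (auto simp: case_prod_unfold intro!: finsum_eq)
    also have "\<dots> = (\<Oplus>k\<in>{..<n}. x k l)"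
      using l vD(1,5) xc(1) by (intro finsum_eq) (auto simp flip: finsum_mult_right)
    finally show "(\<Oplus>p\<in>{..<n} \<times> V. ?u p r) = \<one>" using xD(5) l by simp
  qed
  moreover have "theta_compatible (copies n G1) (copies n G2) (theta_copies \<theta>) ?u"
    unfolding theta_compatible_copies split_conv
  proof (intro allI impI)
    fix k k' a b c d a' b' c' d'
    assume k: "k < n" "k' < n" and
      H: "(a, b) \<in> star_pairs G1 G2 \<and> (a', b') \<in> star_pairs G1 G2 \<and> \<theta> (a, b) = (c, d) \<and> \<theta> (a', b') = (c', d')"
    \<comment> \<open>All three factors lie in block (k', k), so the projections gather at the right
      and merge into one, the same for both sides of the relation.\<close>
    have tri: "(v k' i1 j1 \<otimes> x k' k) \<otimes> (v k' i2 j2 \<otimes> x k' k) \<otimes> (v k' i3 j3 \<otimes> x k' k) = v k' i1 j1 \<otimes> v k' i2 j2 \<otimes> v k' i3 j3 \<otimes> x k' k"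
      if "i1 \<in> V" "j1 \<in> V" "i2 \<in> V" "j2 \<in> V" "i3 \<in> V" "j3 \<in> V" for i1 j1 i2 j2 i3 j3
    proof -
      have pair: "(a \<otimes> x k' k) \<otimes> (v k' i j \<otimes> x k' k) = (a \<otimes> v k' i j) \<otimes> x k' k" if "a \<in> carrier A" "i \<in> V" "j \<in> V" for a i j
      proof -
        have "(a \<otimes> x k' k) \<otimes> (v k' i j \<otimes> x k' k) = a \<otimes> (x k' k \<otimes> v k' i j) \<otimes> x k' k"
          using that k vD(1) xc by (simp add: m_assoc)
        also have "\<dots> = a \<otimes> (v k' i j \<otimes> x k' k) \<otimes> x k' k" using that k by (simp add: comm)
        also have "\<dots> = (a \<otimes> v k' i j) \<otimes> (x k' k \<otimes> x k' k)" using that k vD(1) xc(1) by (simp add: m_assoc)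
        finally show ?thesis using k xc by simp
      qed
      show ?thesis using that k vD(1) by (simp add: pair)
    qed
    have "v k' (head G2 c') (head G2 c) \<otimes> v k' (tail G2 c') (tail G2 c) \<otimes> v k' (tail G1 d') (tail G1 d)
      = v k' (head G1 a') (head G1 a) \<otimes> v k' (tail G1 a') (tail G1 a) \<otimes> v k' (tail G2 b') (tail G2 b)"
      using vm(4)[OF k(2)] H unfolding theta_compatible_def by blast
    then show "(v k' (head G2 c') (head G2 c) \<otimes> x k' k) \<otimes> (v k' (tail G2 c') (tail G2 c) \<otimes> x k' k) \<otimes> (v k' (tail G1 d') (tail G1 d) \<otimes> x k' k)
      = (v k' (head G1 a') (head G1 a) \<otimes> x k' k) \<otimes> (v k' (tail G1 a') (tail G1 a) \<otimes> x k' k) \<otimes> (v k' (tail G2 b') (tail G2 b) \<otimes> x k' k)"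
      using H star_pairs_ends(1)[of a b] star_pairs_ends(1)[of a' b'] star_pairs_ends(2)[OF theta_in, of a b c d]
        star_pairs_ends(2)[OF theta_in, of a' b' c' d'] by (simp add: tri)
  qed
  ultimately show ?thesis
    using inter[of G1] inter[of G2] vm by (simp add: aut_family_def)
qed

end

section \<open>Splitting a solution for the copies into wreath data\<close>

locale copies_family = cstar_algebra A + triple_core G1 G2 \<theta>
  for A :: "('a, 'm) cstar_scheme" (structure) and G1 :: "('v, 'e) pre_digraph" and G2 :: "('v, 'f) pre_digraph" and \<theta> +
  fixes n :: nat and U :: "nat \<times> 'v \<Rightarrow> nat \<times> 'v \<Rightarrow> 'a"
  assumes U: "aut_family (copies n G1) (copies n G2) (theta_copies \<theta>) U"
    and conn: "\<lbrakk>v \<in> V; w \<in> V\<rbrakk> \<Longrightarrow> (v, w) \<in> (arcs_ends G1)\<^sup>*"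
    and nonempty: "V \<noteq> {}"
begin

lemma U_magic: "magic ({..<n} \<times> V) U"
  and U_int: "intertwines ({..<n} \<times> V) (vertex_matrix (copies n G1)) U" "intertwines ({..<n} \<times> V) (vertex_matrix (copies n G2)) U"
  and U_theta: "theta_compatible (copies n G1) (copies n G2) (theta_copies \<theta>) U"
  using U by (simp_all add: aut_family_def)

lemma finNV: "finite ({..<n} \<times> V)" by simp

lemma U_closed [simp]: "\<lbrakk>k < n; l < n; i \<in> V; j \<in> V\<rbrakk> \<Longrightarrow> U (k, i) (l, j) \<in> carrier A"
  using magicD(1)[OF U_magic] by simp

lemma U_adj [simp]: "\<lbrakk>k < n; l < n; i \<in> V; j \<in> V\<rbrakk> \<Longrightarrow> adj A (U (k, i) (l, j)) = U (k, i) (l, j)"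
  using magicD(2)[OF U_magic] by simp

lemma U_idem [simp]: "\<lbrakk>k < n; l < n; i \<in> V; j \<in> V\<rbrakk> \<Longrightarrow> U (k, i) (l, j) \<otimes> U (k, i) (l, j) = U (k, i) (l, j)"
  using magicD(3)[OF U_magic] by simp

lemma U_row: "\<lbrakk>k < n; l < n; l' < n; i \<in> V; j \<in> V; j' \<in> V; (l, j) \<noteq> (l', j')\<rbrakk> \<Longrightarrow> U (k, i) (l, j) \<otimes> U (k, i) (l', j') = \<zero>"
  using magic_row[OF U_magic finNV] by simp

text \<open>The arguments are ordered so that the last one enumerates a partition of unity:
  \<open>r k i\<close> is indexed by the copy l of the column, and \<open>cc l j\<close> by the copy
  k of the row.\<close>

definition "r k i l = (\<Oplus>j\<in>V. U (k, i) (l, j))"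
definition "cc l j k = (\<Oplus>i\<in>V. U (k, i) (l, j))"

lemma rc_closed [simp]: "\<lbrakk>k < n; l < n; i \<in> V\<rbrakk> \<Longrightarrow> r k i l \<in> carrier A" "\<lbrakk>k < n; l < n; i \<in> V\<rbrakk> \<Longrightarrow> cc l i k \<in> carrier A"
  by (auto simp: r_def cc_def)

lemma sum_r: "\<lbrakk>k < n; i \<in> V\<rbrakk> \<Longrightarrow> (\<Oplus>l\<in>{..<n}. r k i l) = \<one>"
  using magicD(4)[OF U_magic, of "(k, i)"] finsum_pairs[of "{..<n}" V "\<lambda>l j. U (k, i) (l, j)"] by (simp add: r_def)

lemma sum_cc: "\<lbrakk>l < n; j \<in> V\<rbrakk> \<Longrightarrow> (\<Oplus>k\<in>{..<n}. cc l j k) = \<one>"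
  using magicD(5)[OF U_magic, of "(l, j)"] finsum_pairs[of "{..<n}" V "\<lambda>k i. U (k, i) (l, j)"] by (simp add: cc_def)

lemma edge_pos: "e \<in> arcs G1 \<Longrightarrow> vertex_matrix G1 (tail G1 e) (head G1 e) \<noteq> 0"
  by (auto simp: vertex_matrix_def card_eq_0_iff)

text \<open>The two ends of an edge give two partitions of unity over the copies. Their members for
  different copies are orthogonal term by term, because the row indices are joined by an edge while
  vertices of different copies are not; \<open>partition_eq\<close> then identifies the
  partitions.\<close>

lemma edge_r: assumes e: "e \<in> arcs G1" and k: "k < n" "l < n"
  shows "r k (head G1 e) l = r k (tail G1 e) l"
proof (rule partition_eq[of "{..<n}"])
  have V: "tail G1 e \<in> V" "head G1 e \<in> V" using e by auto
  fix m m' assume m: "m \<in> {..<n}" "m' \<in> {..<n}" "m \<noteq> m'"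
  show "r k (head G1 e) m \<otimes> r k (tail G1 e) m' = \<zero>"
    unfolding r_def
  proof (rule finsum_orthogonal)
    fix j j' assume j: "j \<in> V" "j' \<in> V"
    show "U (k, head G1 e) (m, j) \<otimes> U (k, tail G1 e) (m', j') = \<zero>"
      using m k V j edge_pos[OF e]
      by (intro intertwines_orthogonal[OF U_magic finNV U_int(1)]) (auto simp: vertex_matrix_copies)
  qed (use k m V in auto)
qed (use k e sum_r in auto)

lemma edge_cc: assumes e: "e \<in> arcs G1" and k: "k < n" "l < n"
  shows "cc l (head G1 e) k = cc l (tail G1 e) k"
proof (rule partition_eq[of "{..<n}"])
  have V: "tail G1 e \<in> V" "head G1 e \<in> V" using e by auto
  fix m m' assume m: "m \<in> {..<n}" "m' \<in> {..<n}" "m \<noteq> m'"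
  show "cc l (head G1 e) m \<otimes> cc l (tail G1 e) m' = \<zero>"
    unfolding cc_def
  proof (rule finsum_orthogonal)
    fix i i' assume i: "i \<in> V" "i' \<in> V"
    show "U (m, i) (l, head G1 e) \<otimes> U (m', i') (l, tail G1 e) = \<zero>"
      using m k V i edge_pos[OF e]
      by (intro intertwines_orthogonal[OF U_magic finNV U_int(1)]) (auto simp: vertex_matrix_copies)
  qed (use k m V in auto)
qed (use k e sum_cc in auto)

lemma rc_const: assumes "v \<in> V" "w \<in> V" and k: "k < n" "l < n"
  shows "r k v l = r k w l" "cc l v k = cc l w k"
proof -
  have "(v, w) \<in> (arcs_ends G1)\<^sup>*" using assms conn by blast
  then have "r k v l = r k w l \<and> cc l v k = cc l w k"
    by (induct rule: rtrancl_induct) (use edge_r edge_cc k in \<open>auto simp: arcs_ends_conv\<close>)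
  then show "r k v l = r k w l" "cc l v k = cc l w k" by auto
qed

text \<open>An arbitrary base vertex; by \<open>rc_const\<close> the sums \<open>X\<close> do not
  depend on it.\<close>

definition "i0 = (SOME i. i \<in> V)"
definition "X k l = r k i0 l"

lemma i0: "i0 \<in> V" using nonempty by (simp add: i0_def some_in_eq)

lemma X_closed [simp]: "\<lbrakk>k < n; l < n\<rbrakk> \<Longrightarrow> X k l \<in> carrier A"
  by (simp add: X_def i0)

lemma X_r: "\<lbrakk>k < n; l < n; i \<in> V\<rbrakk> \<Longrightarrow> r k i l = X k l"
  using rc_const(1)[of i i0 k l] i0 by (simp add: X_def)

text \<open>Double counting: the entries of the block (k, l) add up to card V times the common row
  sum and also to card V times the common column sum.\<close>

lemma X_cc: assumes k: "k < n" "l < n" and j: "j \<in> V" shows "cc l j k = X k l"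
proof -
  have "(\<Oplus>i\<in>V. r k i l) = (\<Oplus>j\<in>V. cc l j k)"
    unfolding r_def cc_def using k by (intro finsum_swap) auto
  moreover have "(\<Oplus>i\<in>V. r k i l) = of_nat (card V) \<odot> X k l"
    using k finV by (subst finsum_const_smult[symmetric]) (auto intro!: finsum_eq simp: X_r)
  moreover have "(\<Oplus>j\<in>V. cc l j k) = of_nat (card V) \<odot> cc l j k"
  proof -
    have "(\<Oplus>j'\<in>V. cc l j' k) = (\<Oplus>j'\<in>V. cc l j k)"
      using rc_const(2)[OF _ j k] rc_closed(2)[OF k j] by (intro finsum_eq refl) blast+
    then show ?thesis using k j finV by (simp add: finsum_const_smult)
  qed
  ultimately have "(1 / of_nat (card V)) \<odot> (of_nat (card V) \<odot> X k l) = (1 / of_nat (card V)) \<odot> (of_nat (card V) \<odot> cc l j k)" by simp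
  moreover have "complex_of_nat (card V) \<noteq> 0" using nonempty finV by (simp add: card_eq_0_iff)
  ultimately show ?thesis using k j by simp
qed

lemma U_X: assumes "k < n" "l < n" "i \<in> V" "j \<in> V"
  shows "U (k, i) (l, j) \<otimes> X k l = U (k, i) (l, j)" "X k l \<otimes> U (k, i) (l, j) = U (k, i) (l, j)"
proof -
  have "U (k, i) (l, j) \<otimes> r k i l = (\<Oplus>j'\<in>V. U (k, i) (l, j) \<otimes> U (k, i) (l, j'))"
    unfolding r_def using assms by (intro finsum_mult_left) auto
  also have "\<dots> = U (k, i) (l, j) \<otimes> U (k, i) (l, j)"
    using assms finV U_row by (intro finsum_single) auto
  finally show "U (k, i) (l, j) \<otimes> X k l = U (k, i) (l, j)" using assms by (simp add: X_r)
  have "r k i l \<otimes> U (k, i) (l, j) = (\<Oplus>j'\<in>V. U (k, i) (l, j') \<otimes> U (k, i) (l, j))"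
    unfolding r_def using assms by (intro finsum_mult_right) auto
  also have "\<dots> = U (k, i) (l, j) \<otimes> U (k, i) (l, j)"
    using assms finV U_row by (intro finsum_single[where f = "\<lambda>j'. U (k, i) (l, j') \<otimes> U (k, i) (l, j)"]) auto
  finally show "X k l \<otimes> U (k, i) (l, j) = U (k, i) (l, j)" using assms by (simp add: X_r)
qed

lemma X_U_zero: assumes "k < n" "l < n" "l' < n" "l \<noteq> l'" "i \<in> V" "j \<in> V" shows "X k l \<otimes> U (k, i) (l', j) = \<zero>"
proof -
  have "r k i l \<otimes> U (k, i) (l', j) = (\<Oplus>j'\<in>V. U (k, i) (l, j') \<otimes> U (k, i) (l', j))"
    unfolding r_def using assms by (intro finsum_mult_right) auto
  also have "\<dots> = \<zero>" using assms U_row by (intro finsum_all_zero) auto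
  finally show ?thesis using assms by (simp add: X_r)
qed

lemma U_X_zero: assumes "k < n" "l < n" "l' < n" "l \<noteq> l'" "i \<in> V" "j \<in> V" shows "U (k, i) (l', j) \<otimes> X k l = \<zero>"
proof -
  have "U (k, i) (l', j) \<otimes> r k i l = (\<Oplus>j'\<in>V. U (k, i) (l', j) \<otimes> U (k, i) (l, j'))"
    unfolding r_def using assms by (intro finsum_mult_left) auto
  also have "\<dots> = \<zero>" using assms U_row by (intro finsum_all_zero) auto
  finally show ?thesis using assms by (simp add: X_r)
qed

text \<open>\<open>X k l\<close> is a unit for the block (k, l) and annihilates the block (k, l'),
  so the two blocks are orthogonal even at different vertices i and i', where the rows of
  \<open>U\<close> alone give nothing.\<close>

lemma U_U_zero: assumes "k < n" "l < n" "l' < n" "l \<noteq> l'" "i \<in> V" "j \<in> V" "i' \<in> V" "j' \<in> V"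
  shows "U (k, i) (l, j) \<otimes> U (k, i') (l', j') = \<zero>"
proof -
  have "U (k, i) (l, j) \<otimes> U (k, i') (l', j') = U (k, i) (l, j) \<otimes> (X k l \<otimes> U (k, i') (l', j'))"
    using assms U_X(1)[of k l i j] by (simp flip: m_assoc)
  then show ?thesis using assms by (simp add: X_U_zero)
qed

lemma X_magic: "magic {..<n} X"
  unfolding magic_def
proof (intro conjI ballI)
  fix k l assume kl: "k \<in> {..<n}" "l \<in> {..<n}"
  have "X k l \<otimes> X k l = (\<Oplus>j\<in>V. X k l \<otimes> U (k, i0) (l, j))"
    using kl i0 by (subst (2) X_def) (simp add: r_def finsum_mult_left)
  also have "\<dots> = (\<Oplus>j\<in>V. U (k, i0) (l, j))" using kl i0 U_X by (intro finsum_eq) auto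
  finally have "X k l \<otimes> X k l = X k l" by (simp add: X_def r_def)
  moreover have "adj A (X k l) = X k l"
    using kl i0 by (auto simp: X_def r_def intro!: finsum_eq)
  ultimately show "projection (X k l)" using kl by (simp add: projection_def)
next
  fix k assume "k \<in> {..<n}"
  then show "(\<Oplus>l\<in>{..<n}. X k l) = \<one>" using sum_r[of k i0] i0 by (simp add: X_def)
next
  fix l assume "l \<in> {..<n}"
  then have "(\<Oplus>k\<in>{..<n}. X k l) = (\<Oplus>k\<in>{..<n}. cc l i0 k)" using i0 by (intro finsum_eq) (auto simp: X_cc)
  then show "(\<Oplus>k\<in>{..<n}. X k l) = \<one>" using sum_cc[of l i0] i0 \<open>l \<in> {..<n}\<close> by simp
qed

definition "nu k i j = (\<Oplus>l\<in>{..<n}. U (k, i) (l, j))"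

lemma nu_closed [simp]: "\<lbrakk>k < n; i \<in> V; j \<in> V\<rbrakk> \<Longrightarrow> nu k i j \<in> carrier A"
  by (auto simp: nu_def)

lemma nu_X: assumes "k < n" "l < n" "i \<in> V" "j \<in> V"
  shows "nu k i j \<otimes> X k l = U (k, i) (l, j)" "X k l \<otimes> nu k i j = U (k, i) (l, j)"
proof -
  have "nu k i j \<otimes> X k l = (\<Oplus>l'\<in>{..<n}. U (k, i) (l', j) \<otimes> X k l)"
    unfolding nu_def using assms by (intro finsum_mult_right) auto
  also have "\<dots> = U (k, i) (l, j) \<otimes> X k l"
    using assms U_X_zero by (intro finsum_single[where f = "\<lambda>l'. U (k, i) (l', j) \<otimes> X k l"]) auto
  finally show "nu k i j \<otimes> X k l = U (k, i) (l, j)" using assms by (simp add: U_X)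
  have "X k l \<otimes> nu k i j = (\<Oplus>l'\<in>{..<n}. X k l \<otimes> U (k, i) (l', j))"
    unfolding nu_def using assms by (intro finsum_mult_left) auto
  also have "\<dots> = X k l \<otimes> U (k, i) (l, j)"
    using assms X_U_zero by (intro finsum_single[where f = "\<lambda>l'. X k l \<otimes> U (k, i) (l', j)"]) auto
  finally show "X k l \<otimes> nu k i j = U (k, i) (l, j)" using assms by (simp add: U_X)
qed

text \<open>Mixed terms vanish by \<open>U_U_zero\<close>. The diagonal sum that remains lets the
  \<theta>-relations be transferred block by block.\<close>

lemma nu_triple: assumes "k < n" "i1 \<in> V" "j1 \<in> V" "i2 \<in> V" "j2 \<in> V" "i3 \<in> V" "j3 \<in> V"
  shows "nu k i1 j1 \<otimes> nu k i2 j2 \<otimes> nu k i3 j3 = (\<Oplus>l\<in>{..<n}. U (k, i1) (l, j1) \<otimes> U (k, i2) (l, j2) \<otimes> U (k, i3) (l, j3))"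
proof -
  let ?F = "\<lambda>p. U (k, i1) (fst p, j1) \<otimes> U (k, i2) (fst (snd p), j2) \<otimes> U (k, i3) (snd (snd p), j3)"
  let ?d = "\<lambda>l. (l, l, l)"
  have "nu k i1 j1 \<otimes> nu k i2 j2 \<otimes> nu k i3 j3 = (\<Oplus>p\<in>{..<n} \<times> {..<n} \<times> {..<n}. ?F p)"
    unfolding nu_def using assms by (intro finsum_mult_triple) auto
  also have "\<dots> = (\<Oplus>p\<in>?d ` {..<n}. ?F p)"
  proof (rule finsum_subset)
    fix p assume "p \<in> {..<n} \<times> {..<n} \<times> {..<n} - ?d ` {..<n}"
    then obtain l1 l2 l3 where p: "p = (l1, l2, l3)" "l1 < n" "l2 < n" "l3 < n" "l1 \<noteq> l2 \<or> l2 \<noteq> l3" by (cases p) auto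
    from p(5) show "?F p = \<zero>"
    proof
      assume "l1 \<noteq> l2"
      then show ?thesis using p assms by (simp add: U_U_zero)
    next
      assume "l2 \<noteq> l3"
      then show ?thesis using p assms by (simp add: m_assoc U_U_zero)
    qed
  qed (use assms in auto)
  also have "\<dots> = (\<Oplus>l\<in>{..<n}. ?F (?d l))"
    using assms by (intro finsum_reindex) (auto simp: inj_on_def)
  finally show ?thesis by simp
qed

text \<open>The linear relations and row sums are inherited by summing over the blocks in block row
  k. The column sums are less direct: they are sums of the block column sums over l, and only the
  identification of these with \<open>X k l\<close> turns them into a row sum of
  \<open>X\<close>.\<close>

lemma nu_aut_family: assumes k: "k < n" shows "aut_family G1 G2 \<theta> (nu k)"
proof -
  have int: "intertwines V (vertex_matrix G) (nu k)"
    if "intertwines ({..<n} \<times> V) (vertex_matrix (copies n G)) U" for G :: "('v, 'z) pre_digraph"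
    unfolding intertwines_def
  proof (intro ballI)
    fix i j assume ij: "i \<in> V" "j \<in> V"
    have eq: "(\<Oplus>v\<in>V. of_nat (vertex_matrix G v j) \<odot> U (k, i) (l, v)) = (\<Oplus>v\<in>V. of_nat (vertex_matrix G i v) \<odot> U (k, v) (l, j))" if "l < n" for l
      using intertwines_copies[of V n U G, OF finV] magicD(1)[OF U_magic] \<open>intertwines ({..<n} \<times> V) (vertex_matrix (copies n G)) U\<close> k that ij by blast
    have "(\<Oplus>v\<in>V. of_nat (vertex_matrix G v j) \<odot> nu k i v) = (\<Oplus>v\<in>V. \<Oplus>l\<in>{..<n}. of_nat (vertex_matrix G v j) \<odot> U (k, i) (l, v))"
      using k ij unfolding nu_def by (intro finsum_eq refl smult_finsum finsum_in smult_closed U_closed) auto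
    also have "\<dots> = (\<Oplus>l\<in>{..<n}. \<Oplus>v\<in>V. of_nat (vertex_matrix G v j) \<odot> U (k, i) (l, v))"
      using k ij by (intro finsum_swap) auto
    also have "\<dots> = (\<Oplus>l\<in>{..<n}. \<Oplus>v\<in>V. of_nat (vertex_matrix G i v) \<odot> U (k, v) (l, j))"
      by (rule finsum_eq[OF refl]) (use k ij in \<open>auto simp: eq\<close>)
    also have "\<dots> = (\<Oplus>v\<in>V. \<Oplus>l\<in>{..<n}. of_nat (vertex_matrix G i v) \<odot> U (k, v) (l, j))"
      using k ij by (intro finsum_swap) auto
    also have "\<dots> = (\<Oplus>v\<in>V. of_nat (vertex_matrix G i v) \<odot> nu k v j)"
      using k ij unfolding nu_def by (intro finsum_eq refl smult_finsum[symmetric] finsum_in smult_closed U_closed) auto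
    finally show "(\<Oplus>v\<in>V. of_nat (vertex_matrix G v j) \<odot> nu k i v) = (\<Oplus>v\<in>V. of_nat (vertex_matrix G i v) \<odot> nu k v j)" .
  qed
  have "magic V (nu k)"
    unfolding magic_def
  proof (intro conjI ballI)
    fix i j assume ij: "i \<in> V" "j \<in> V"
    have "nu k i j \<otimes> nu k i j = (\<Oplus>l\<in>{..<n}. nu k i j \<otimes> U (k, i) (l, j))"
      using k ij by (subst (2) nu_def) (rule finsum_mult_left, auto)
    also have "\<dots> = (\<Oplus>l\<in>{..<n}. U (k, i) (l, j))"
    proof (intro finsum_eq refl)
      fix l assume l: "l \<in> {..<n}"
      have "nu k i j \<otimes> U (k, i) (l, j) = (\<Oplus>l'\<in>{..<n}. U (k, i) (l', j) \<otimes> U (k, i) (l, j))"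
        unfolding nu_def using k ij l by (intro finsum_mult_right) auto
      also have "\<dots> = U (k, i) (l, j) \<otimes> U (k, i) (l, j)"
        using k ij l U_row by (intro finsum_single[where f = "\<lambda>l'. U (k, i) (l', j) \<otimes> U (k, i) (l, j)"]) auto
      finally show "nu k i j \<otimes> U (k, i) (l, j) = U (k, i) (l, j)" using k ij l by simp
    qed (use k ij in auto)
    finally have "nu k i j \<otimes> nu k i j = nu k i j" by (simp add: nu_def)
    moreover have "adj A (nu k i j) = nu k i j" unfolding nu_def using k ij by (subst adj_finsum) (auto intro!: finsum_eq)
    ultimately show "projection (nu k i j)" using k ij by (simp add: projection_def)
  next
    fix i assume i: "i \<in> V"
    have "(\<Oplus>j\<in>V. nu k i j) = (\<Oplus>l\<in>{..<n}. r k i l)"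
      unfolding nu_def r_def using k i by (intro finsum_swap) auto
    then show "(\<Oplus>j\<in>V. nu k i j) = \<one>" using sum_r[OF k i] by simp
  next
    fix j assume j: "j \<in> V"
    have "(\<Oplus>i\<in>V. nu k i j) = (\<Oplus>l\<in>{..<n}. cc l j k)"
      unfolding nu_def cc_def using k j by (intro finsum_swap) auto
    also have "\<dots> = (\<Oplus>l\<in>{..<n}. X k l)" using k j by (intro finsum_eq) (auto simp: X_cc)
    finally show "(\<Oplus>i\<in>V. nu k i j) = \<one>" using magicD(4)[OF X_magic] k by simp
  qed
  moreover have "theta_compatible G1 G2 \<theta> (nu k)"
    unfolding theta_compatible_def
  proof (intro allI impI)
    fix a b c d a' b' c' d'
    assume H: "(a, b) \<in> star_pairs G1 G2 \<and> (a', b') \<in> star_pairs G1 G2 \<and> \<theta> (a, b) = (c, d) \<and> \<theta> (a', b') = (c', d')"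
    note ends = star_pairs_ends(1)[of a b] star_pairs_ends(1)[of a' b'] star_pairs_ends(2)[OF theta_in, of a b c d]
        star_pairs_ends(2)[OF theta_in, of a' b' c' d']
    have eq: "U (k, head G2 c') (l, head G2 c) \<otimes> U (k, tail G2 c') (l, tail G2 c) \<otimes> U (k, tail G1 d') (l, tail G1 d)
      = U (k, head G1 a') (l, head G1 a) \<otimes> U (k, tail G1 a') (l, tail G1 a) \<otimes> U (k, tail G2 b') (l, tail G2 b)" if "l < n" for l
      using U_theta[unfolded theta_compatible_copies] k that H by blast
    show "nu k (head G2 c') (head G2 c) \<otimes> nu k (tail G2 c') (tail G2 c) \<otimes> nu k (tail G1 d') (tail G1 d)
      = nu k (head G1 a') (head G1 a) \<otimes> nu k (tail G1 a') (tail G1 a) \<otimes> nu k (tail G2 b') (tail G2 b)"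
      using H ends k by (auto simp: nu_triple eq intro!: finsum_eq)
  qed
  ultimately show ?thesis using int[OF U_int(1)] int[OF U_int(2)] by (simp add: aut_family_def)
qed

end

section \<open>The free wreath product\<close>

text \<open>The predicate \<open>Z\<close> is left open because two readings are needed:
  well-formedness of the relations and their truth under an evaluation.\<close>

lemma ball_hom_relations:
  fixes A :: "('a, 'm) cstar_scheme" and \<iota> :: "'a \<Rightarrow> 'c"
  shows
  "(\<forall>(r, \<eta>)\<in>hom_relations A \<iota>. Z r \<eta>) \<longleftrightarrow>
    (\<forall>a\<in>carrier A. \<forall>b\<in>carrier A. Z (free_gen (\<iota> (a \<oplus>\<^bsub>A\<^esub> b)) - (free_gen (\<iota> a) + free_gen (\<iota> b))) 0
      \<and> Z (free_gen (\<iota> (a \<otimes>\<^bsub>A\<^esub> b)) - free_gen (\<iota> a) * free_gen (\<iota> b)) 0)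
    \<and> (\<forall>c. \<forall>a\<in>carrier A. Z (free_gen (\<iota> (c \<odot>\<^bsub>A\<^esub> a)) - free_scale c (free_gen (\<iota> a))) 0)
    \<and> (\<forall>a\<in>carrier A. Z (free_gen (\<iota> (adj A a)) - free_adj (free_gen (\<iota> a))) 0)
    \<and> Z (free_gen (\<iota> \<one>\<^bsub>A\<^esub>) - 1) 0
    \<and> (\<forall>a\<in>carrier A. Z (free_gen (\<iota> a)) (cnorm A a))"
proof -
  have "(\<forall>(r, \<eta>)\<in>algebraic (\<Union>a\<in>C. \<Union>b\<in>C. {f a b, g a b}). Z r \<eta>) \<longleftrightarrow> (\<forall>a\<in>C. \<forall>b\<in>C. Z (f a b) 0 \<and> Z (g a b) 0)"
    "(\<forall>(r, \<eta>)\<in>algebraic {h c a | c a. a \<in> C}. Z r \<eta>) \<longleftrightarrow> (\<forall>c. \<forall>a\<in>C. Z (h c a) 0)"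
    "(\<forall>(r, \<eta>)\<in>algebraic {u a | a. a \<in> C}. Z r \<eta>) \<longleftrightarrow> (\<forall>a\<in>C. Z (u a) 0)"
    "(\<forall>(r, \<eta>)\<in>algebraic {w}. Z r \<eta>) \<longleftrightarrow> Z w 0"
    "(\<forall>(r, \<eta>)\<in>{(v a, t a) | a. a \<in> C}. Z r \<eta>) \<longleftrightarrow> (\<forall>a\<in>C. Z (v a) (t a))"
    for C and f g :: "'a \<Rightarrow> 'a \<Rightarrow> 'c free_star" and h :: "complex \<Rightarrow> 'a \<Rightarrow> 'c free_star" and u v w t
    by (auto simp: algebraic_def)
  then show ?thesis unfolding hom_relations_def Let_def ball_Un by simp
qed

lemma hom_relations_wf:
  assumes A: "cstar_algebra A" and \<iota>: "\<And>a. a \<in> carrier A \<Longrightarrow> \<iota> a \<in> X" and r: "(r, \<eta>) \<in> hom_relations A \<iota>"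
  shows "r \<in> free_on X \<and> 0 \<le> \<eta>"
proof -
  interpret cstar_algebra A by fact
  have "\<forall>(r, \<eta>)\<in>hom_relations A \<iota>. r \<in> free_on X \<and> 0 \<le> \<eta>"
    unfolding ball_hom_relations using \<iota> by auto
  with r show ?thesis by blast
qed

text \<open>The bound 0 makes a relation an equation, and the remaining norm relations are precisely
  the contractivity clause of \<open>star_hom\<close>. Maps out of the free product are thereby
  given by homomorphisms on its factors.\<close>

lemma (in cstar_eval) hom_relations_ev:
  fixes B :: "('b, 'n) cstar_scheme"
  assumes B: "cstar_algebra B" and \<iota>: "\<And>b. b \<in> carrier B \<Longrightarrow> \<iota> b \<in> X"
  shows "(\<forall>(r, \<eta>)\<in>hom_relations B \<iota>. cnorm A (ev A x r) \<le> \<eta>) \<longleftrightarrow> (\<lambda>b\<in>carrier B. x (\<iota> b)) \<in> star_hom B A"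
proof -
  interpret B: cstar_algebra B by fact
  have le0: "cnorm A (a \<ominus> b) \<le> 0 \<longleftrightarrow> a = b" if "a \<in> carrier A" "b \<in> carrier A" for a b
    using that by (metis antisym diff_eq_zero_iff eq_if_norm_diff minus_closed norm_nonneg norm_zero order_refl)
  have eqs: "\<forall>a\<in>carrier B. \<forall>b\<in>carrier B. cnorm A (ev A x (free_gen (\<iota> (a \<oplus>\<^bsub>B\<^esub> b)) - (free_gen (\<iota> a) + free_gen (\<iota> b)))) \<le> 0
      \<longleftrightarrow> x (\<iota> (a \<oplus>\<^bsub>B\<^esub> b)) = x (\<iota> a) \<oplus> x (\<iota> b)"
    "\<forall>a\<in>carrier B. \<forall>b\<in>carrier B. cnorm A (ev A x (free_gen (\<iota> (a \<otimes>\<^bsub>B\<^esub> b)) - free_gen (\<iota> a) * free_gen (\<iota> b))) \<le> 0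
      \<longleftrightarrow> x (\<iota> (a \<otimes>\<^bsub>B\<^esub> b)) = x (\<iota> a) \<otimes> x (\<iota> b)"
    "\<forall>a\<in>carrier B. \<forall>c. cnorm A (ev A x (free_gen (\<iota> (c \<odot>\<^bsub>B\<^esub> a)) - free_scale c (free_gen (\<iota> a)))) \<le> 0
      \<longleftrightarrow> x (\<iota> (c \<odot>\<^bsub>B\<^esub> a)) = c \<odot> x (\<iota> a)"
    "\<forall>a\<in>carrier B. cnorm A (ev A x (free_gen (\<iota> (adj B a)) - free_adj (free_gen (\<iota> a)))) \<le> 0
      \<longleftrightarrow> x (\<iota> (adj B a)) = adj A (x (\<iota> a))"
    "cnorm A (ev A x (free_gen (\<iota> \<one>\<^bsub>B\<^esub>) - 1)) \<le> 0 \<longleftrightarrow> x (\<iota> \<one>\<^bsub>B\<^esub>) = \<one>"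
    "\<forall>a\<in>carrier B. ev A x (free_gen (\<iota> a)) = x (\<iota> a)"
    using \<iota> by (simp_all add: le0)
  show ?thesis
    unfolding ball_hom_relations star_hom_def ring_hom_def using eqs \<iota> by auto
qed

section \<open>The algebra of the free wreath product\<close>

text \<open>The algebra of the free wreath product depends on the quantum group only through its
  C*-algebra \<open>A\<close>; the comultiplication enters later, in
  \<open>comult_free_wreath\<close>.\<close>

locale wreath_product = A: cstar_algebra A for A :: "'a cstar" +
  fixes n :: nat
begin

interpretation S: magic_presentation "{..<n}" "{}"
  by unfold_locales auto

abbreviation "P \<equiv> cqg_alg (quantum_perm n)"
abbreviation "s \<equiv> magic_gen {..<n} {}"

lemma P_eq: "P = S.W"
  by (simp only: quantum_perm_def S.alg)

sublocale P: cstar_algebra P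
  unfolding P_eq by (rule S.W.cstar_algebra_axioms)

lemmas magic_s = S.magic_q[folded P_eq]
  and s_closed [simp] = S.q_closed[folded P_eq]
  and universal_s = S.universal_magic[folded P_eq]
  and s_eqI = S.star_hom_magic_eqI[folded P_eq]

definition "gens = free_product_gens n A P"

abbreviation "commutations \<equiv> {free_gen (Inl (k, a)) * free_gen (Inr (s k l))
                   - free_gen (Inr (s k l)) * free_gen (Inl (k, a)) | a k l.
                 a \<in> carrier A \<and> k < n \<and> l < n}"

definition "wreath_rels = free_product_relations n A P \<union> algebraic commutations"

lemma gens_in [simp]: "Inl (k, a) \<in> gens \<longleftrightarrow> k < n \<and> a \<in> carrier A" "Inr b \<in> gens \<longleftrightarrow> b \<in> carrier P"
  by (auto simp: gens_def free_product_gens_def)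

lemma gens_cases: "g \<in> gens \<Longrightarrow> (\<exists>k<n. \<exists>a\<in>carrier A. g = Inl (k, a)) \<or> (\<exists>b\<in>carrier P. g = Inr b)"
  by (auto simp: gens_def free_product_gens_def)

lemma wreath_rels_cases:
  assumes "(r, \<eta>) \<in> wreath_rels"
  obtains k where "k < n" "(r, \<eta>) \<in> hom_relations A (\<lambda>a. Inl (k, a))" | "(r, \<eta>) \<in> hom_relations P Inr"
    | a k l where "a \<in> carrier A" "k < n" "l < n" "\<eta> = 0"
        "r = free_gen (Inl (k, a)) * free_gen (Inr (s k l)) - free_gen (Inr (s k l)) * free_gen (Inl (k, a))"
  using assms unfolding wreath_rels_def free_product_relations_def algebraic_def by blast

sublocale cstar_presentation gens wreath_rels
proof
  fix r \<eta> assume "(r, \<eta>) \<in> wreath_rels"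
  then show "r \<in> free_on gens \<and> 0 \<le> \<eta>"
  proof (cases rule: wreath_rels_cases)
    case (1 k)
    then show ?thesis by (intro hom_relations_wf[OF A.cstar_algebra_axioms _ 1(2)]) auto
  next
    case 2
    then show ?thesis by (intro hom_relations_wf[OF P.cstar_algebra_axioms _ 2]) auto
  qed simp
next
  fix g assume "g \<in> gens"
  \<comment> \<open>The norm clause of \<open>hom_relations\<close> is itself a bound for every
    generator.\<close>
  then have "\<exists>K. (free_gen g, K) \<in> wreath_rels"
    using gens_cases[of g] by (auto simp: wreath_rels_def free_product_relations_def hom_relations_def)
  then show "\<exists>K. \<forall>N. admissible gens wreath_rels N \<longrightarrow> N (free_gen g) \<le> K"
    by (auto simp: admissible_def)
qed

lemma wreath_universal:
  assumes B: "cstar_algebra B" and f: "\<And>k. k < n \<Longrightarrow> f k \<in> star_hom A B" and g: "g \<in> star_hom P B"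
    and comm: "\<And>k l a. \<lbrakk>k < n; l < n; a \<in> carrier A\<rbrakk> \<Longrightarrow> f k a \<otimes>\<^bsub>B\<^esub> g (s k l) = g (s k l) \<otimes>\<^bsub>B\<^esub> f k a"
  shows "\<exists>\<phi>\<in>star_hom W B. (\<forall>k<n. \<forall>a\<in>carrier A. \<phi> (gen (Inl (k, a))) = f k a) \<and> (\<forall>b\<in>carrier P. \<phi> (gen (Inr b)) = g b)"
proof -
  define y where "y = case_sum (\<lambda>(k, a). f k a) g"
  have y: "y h \<in> carrier B" if "h \<in> gens" for h
    using gens_cases[OF that] star_homD(2)[OF f] star_homD(2)[OF g] by (auto simp: y_def)
  have yl: "y (Inl (k, a)) = f k a" and yr: "y (Inr b) = g b" for k a b by (simp_all add: y_def)
  interpret B: cstar_eval B gens y by (intro cstar_eval.intro B cstar_eval_axioms.intro y)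
  have "\<exists>\<phi>\<in>star_hom W B. \<forall>h\<in>gens. \<phi> (gen h) = y h"
  proof (rule universal[OF B y])
    fix r \<eta> assume "(r, \<eta>) \<in> wreath_rels"
    then show "cnorm B (ev B y r) \<le> \<eta>"
    proof (cases rule: wreath_rels_cases)
      case (1 k)
      have "(\<lambda>a\<in>carrier A. y (Inl (k, a))) = f k"
        using f[OF 1(1)] by (auto simp: y_def star_hom_def intro: extensionalityI)
      then show ?thesis using B.hom_relations_ev[OF A.cstar_algebra_axioms, of "\<lambda>a. Inl (k, a)"] f 1 by fastforce
    next
      case 2
      have "(\<lambda>a\<in>carrier P. y (Inr a)) = g"
        using g by (auto simp: y_def star_hom_def intro: extensionalityI)
      then show ?thesis using B.hom_relations_ev[OF P.cstar_algebra_axioms, of Inr] g 2 by fastforce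
    next
      case (3 a k l)
      have "ev B y r = f k a \<otimes>\<^bsub>B\<^esub> g (s k l) \<ominus>\<^bsub>B\<^esub> g (s k l) \<otimes>\<^bsub>B\<^esub> f k a"
        unfolding 3(5) using 3(1-3) by (simp add: yl yr)
      also have "\<dots> = \<zero>\<^bsub>B\<^esub>"
        unfolding comm[OF 3(2,3,1)] using star_homD(2)[OF f[OF 3(2)] 3(1)] star_homD(2)[OF g, of "s k l"] 3
        by (simp add: B.diff_eq_zero_iff)
      finally have "ev B y r = \<zero>\<^bsub>B\<^esub>" .
      then show ?thesis using 3 by simp
    qed
  qed
  then obtain \<phi> where \<phi>: "\<phi> \<in> star_hom W B" "\<And>h. h \<in> gens \<Longrightarrow> \<phi> (gen h) = y h" by blast
  have "\<phi> (gen (Inl (k, a))) = f k a" if "k < n" "a \<in> carrier A" for k a using \<phi>(2) that by (simp add: yl)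
  moreover have "\<phi> (gen (Inr b)) = g b" if "b \<in> carrier P" for b using \<phi>(2) that by (simp add: yr)
  ultimately show ?thesis using \<phi>(1) by blast
qed

definition "\<nu> k = (\<lambda>a\<in>carrier A. gen (Inl (k, a)))"
text \<open>Every element of \<open>P\<close> is a generator of the presentation, not only the
  entries \<open>s k l\<close>. Reducing equality of two maps to the entries therefore needs this
  homomorphism and the universal property of \<open>P\<close>.\<close>

definition "\<sigma> = (\<lambda>b\<in>carrier P. gen (Inr b))"
definition "x k l = gen (Inr (s k l))"

lemma relations_W: "\<forall>(r, \<eta>)\<in>wreath_rels. cnorm W (ev W gen r) \<le> \<eta>"
  using relation_norm by blast

lemma nu_star_hom: assumes "k < n" shows "\<nu> k \<in> star_hom A W"
  unfolding \<nu>_def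
  using W.hom_relations_ev[OF A.cstar_algebra_axioms, of "\<lambda>a. Inl (k, a)"] relations_W assms
  unfolding wreath_rels_def free_product_relations_def by auto

lemma sigma_star_hom: "\<sigma> \<in> star_hom P W"
  unfolding \<sigma>_def
  using W.hom_relations_ev[OF P.cstar_algebra_axioms, of Inr] relations_W
  unfolding wreath_rels_def free_product_relations_def by auto

lemma sigma_q: "\<lbrakk>k < n; l < n\<rbrakk> \<Longrightarrow> \<sigma> (s k l) = x k l"
  by (simp add: \<sigma>_def x_def)

lemma nu_closed [simp]: "\<lbrakk>k < n; a \<in> carrier A\<rbrakk> \<Longrightarrow> \<nu> k a \<in> carrier W"
  using star_homD(2)[OF nu_star_hom] .

lemma x_closed [simp]: "\<lbrakk>k < n; l < n\<rbrakk> \<Longrightarrow> x k l \<in> carrier W"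
  by (simp add: x_def)

lemma nu_x_commute: assumes "k < n" "l < n" "a \<in> carrier A" shows "\<nu> k a \<otimes>\<^bsub>W\<^esub> x k l = x k l \<otimes>\<^bsub>W\<^esub> \<nu> k a"
proof -
  have "(free_gen (Inl (k, a)) * free_gen (Inr (s k l)) - free_gen (Inr (s k l)) * free_gen (Inl (k, a)), 0) \<in> wreath_rels"
    using assms unfolding wreath_rels_def algebraic_def by blast
  from relation_zero[OF this] show ?thesis using assms by (simp add: W.diff_eq_zero_iff \<nu>_def x_def)
qed

end

section \<open>Transport along homomorphisms, commutants and corners\<close>

lemma star_hom_id: "cstar_algebra A \<Longrightarrow> (\<lambda>a\<in>carrier A. a) \<in> star_hom A A"
proof -
  assume "cstar_algebra A"
  then interpret cstar_algebra A .
  show ?thesis by (rule star_homI) auto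
qed

lemma (in cstar_algebra) magic_cong:
  assumes "\<And>i j. \<lbrakk>i \<in> V; j \<in> V\<rbrakk> \<Longrightarrow> u i j = v i j" "\<And>i j. \<lbrakk>i \<in> V; j \<in> V\<rbrakk> \<Longrightarrow> v i j \<in> carrier A"
  shows "magic V u \<longleftrightarrow> magic V v"
proof -
  have "(\<Oplus>j\<in>V. u i j) = (\<Oplus>j\<in>V. v i j)" "(\<Oplus>j\<in>V. u j i) = (\<Oplus>j\<in>V. v j i)" if "i \<in> V" for i
    using assms that by (auto intro!: finsum_eq)
  then show ?thesis using assms by (simp add: magic_def)
qed

lemma star_hom_magic:
  assumes A: "cstar_algebra A" and B: "cstar_algebra B" and f: "f \<in> star_hom A B"
    and u: "cstar_algebra.magic A V u"
  shows "cstar_algebra.magic B V (\<lambda>i j. f (u i j))"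
proof -
  interpret A: cstar_algebra A by fact
  interpret B: cstar_algebra B by fact
  note uD = A.magicD[OF u] and fD = star_homD[OF f] and fs = star_hom_finsum[OF A B f, symmetric]
  show ?thesis
    unfolding B.magic_def B.projection_def using uD by (simp add: fs flip: fD(4,7)) (simp add: fD)
qed

lemma star_hom_aut_family:
  assumes tc: "triple_core G1 G2 \<theta>" and A: "cstar_algebra A" and B: "cstar_algebra B" and f: "f \<in> star_hom A B"
    and u: "cstar_algebra.aut_family A G1 G2 \<theta> u"
  shows "cstar_algebra.aut_family B G1 G2 \<theta> (\<lambda>i j. f (u i j))"
proof -
  interpret A: cstar_algebra A by fact
  interpret B: cstar_algebra B by fact
  interpret triple_core G1 G2 \<theta> by fact
  have m: "A.magic V u" and i: "A.intertwines V (vertex_matrix G1) u" "A.intertwines V (vertex_matrix G2) u"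
    and t: "A.theta_compatible G1 G2 \<theta> u"
    using u by (simp_all add: A.aut_family_def)
  note uD = A.magicD[OF m] and fD = star_homD[OF f] and fs = star_hom_finsum[OF A B f, symmetric]
  have int: "B.intertwines V M (\<lambda>i j. f (u i j))" if M: "A.intertwines V M u" for M
    unfolding B.intertwines_def
  proof (intro ballI)
    fix i j assume ij: "i \<in> V" "j \<in> V"
    have "(\<Oplus>\<^bsub>B\<^esub>k\<in>V. of_nat (M k j) \<odot>\<^bsub>B\<^esub> f (u i k)) = f (\<Oplus>\<^bsub>A\<^esub>k\<in>V. of_nat (M k j) \<odot>\<^bsub>A\<^esub> u i k)"
      using ij uD fD by (subst star_hom_finsum[OF A B f]) (auto intro!: B.finsum_eq)
    also have "\<dots> = f (\<Oplus>\<^bsub>A\<^esub>k\<in>V. of_nat (M i k) \<odot>\<^bsub>A\<^esub> u k j)"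
      using M ij by (simp add: A.intertwines_def)
    also have "\<dots> = (\<Oplus>\<^bsub>B\<^esub>k\<in>V. of_nat (M i k) \<odot>\<^bsub>B\<^esub> f (u k j))"
      using ij uD fD by (subst star_hom_finsum[OF A B f]) (auto intro!: B.finsum_eq)
    finally show "(\<Oplus>\<^bsub>B\<^esub>k\<in>V. of_nat (M k j) \<odot>\<^bsub>B\<^esub> f (u i k)) = (\<Oplus>\<^bsub>B\<^esub>k\<in>V. of_nat (M i k) \<odot>\<^bsub>B\<^esub> f (u k j))" .
  qed
  have f3: "f (u i j) \<otimes>\<^bsub>B\<^esub> f (u i' j') \<otimes>\<^bsub>B\<^esub> f (u i'' j'') = f (u i j \<otimes>\<^bsub>A\<^esub> u i' j' \<otimes>\<^bsub>A\<^esub> u i'' j'')"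
    if "i \<in> V" "j \<in> V" "i' \<in> V" "j' \<in> V" "i'' \<in> V" "j'' \<in> V" for i j i' j' i'' j''
    using that uD(1) fD by simp
  have "B.theta_compatible G1 G2 \<theta> (\<lambda>i j. f (u i j))"
    unfolding B.theta_compatible_def
  proof (intro allI impI)
    fix a b c d a' b' c' d'
    assume H: "(a, b) \<in> star_pairs G1 G2 \<and> (a', b') \<in> star_pairs G1 G2 \<and> \<theta> (a, b) = (c, d) \<and> \<theta> (a', b') = (c', d')"
    have "u (head G2 c') (head G2 c) \<otimes>\<^bsub>A\<^esub> u (tail G2 c') (tail G2 c) \<otimes>\<^bsub>A\<^esub> u (tail G1 d') (tail G1 d)
      = u (head G1 a') (head G1 a) \<otimes>\<^bsub>A\<^esub> u (tail G1 a') (tail G1 a) \<otimes>\<^bsub>A\<^esub> u (tail G2 b') (tail G2 b)"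
      using t H unfolding A.theta_compatible_def by blast
    then show "f (u (head G2 c') (head G2 c)) \<otimes>\<^bsub>B\<^esub> f (u (tail G2 c') (tail G2 c)) \<otimes>\<^bsub>B\<^esub> f (u (tail G1 d') (tail G1 d))
      = f (u (head G1 a') (head G1 a)) \<otimes>\<^bsub>B\<^esub> f (u (tail G1 a') (tail G1 a)) \<otimes>\<^bsub>B\<^esub> f (u (tail G2 b') (tail G2 b))"
      using H star_pairs_ends(1)[of a b] star_pairs_ends(1)[of a' b'] star_pairs_ends(2)[OF theta_in, of a b c d]
        star_pairs_ends(2)[OF theta_in, of a' b' c' d'] by (simp add: f3)
  qed
  then show ?thesis
    using star_hom_magic[OF A B f m] int[OF i(1)] int[OF i(2)] by (simp add: B.aut_family_def)
qed

context cstar_presentation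
begin

text \<open>The elements whose image commutes with c form a closed subalgebra; self-adjointness of c
  makes it stable under adjoints as well.\<close>

lemma star_hom_commuteI:
  assumes B: "cstar_algebra B" and f: "f \<in> star_hom W B" and c: "c \<in> carrier B" "adj B c = c"
    and gen: "\<And>g. g \<in> X \<Longrightarrow> f (gen g) \<otimes>\<^bsub>B\<^esub> c = c \<otimes>\<^bsub>B\<^esub> f (gen g)" and a: "a \<in> carrier W"
  shows "f a \<otimes>\<^bsub>B\<^esub> c = c \<otimes>\<^bsub>B\<^esub> f a"
proof -
  interpret B: cstar_algebra B by fact
  note f = star_homD[OF f] f
  show ?thesis
    using a
  proof (induct a rule: univ_induct)
    case (mult a b)
    then show ?case using f c by (metis B.m_assoc)
  next
    case (adj a)
    then have "adj B (c \<otimes>\<^bsub>B\<^esub> f a) = adj B (f a \<otimes>\<^bsub>B\<^esub> c)" by simp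
    then show ?case using adj(1) f c by simp
  next
    case (lim t a)
    then have conv: "B.conv (\<lambda>n. f (t n)) (f a)" using star_hom_conv[OF W.cstar_algebra_axioms B] f by blast
    show ?case
      using B.conv_mult[OF conv B.conv_const[OF c(1)]] B.conv_mult[OF B.conv_const[OF c(1)] conv] lim(2)
      by (intro B.conv_unique) auto
  qed (use f c gen in \<open>auto simp: B.l_distr B.r_distr\<close>)
qed

text \<open>Only h is known to commute with p. In a product, p is moved across h between the two
  applications of the induction hypothesis: f a f b p = f a h b p = f a p h b = h a p h b. The left
  and right versions are proved together because taking adjoints exchanges them.\<close>

lemma star_hom_corner_eqI:
  assumes B: "cstar_algebra B" and f: "f \<in> star_hom W B" and h: "h \<in> star_hom W B" and p: "p \<in> carrier B" "adj B p = p"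
    and comm: "\<And>a. a \<in> carrier W \<Longrightarrow> h a \<otimes>\<^bsub>B\<^esub> p = p \<otimes>\<^bsub>B\<^esub> h a"
    and gen: "\<And>g. g \<in> X \<Longrightarrow> f (gen g) \<otimes>\<^bsub>B\<^esub> p = h (gen g) \<otimes>\<^bsub>B\<^esub> p"
      "\<And>g. g \<in> X \<Longrightarrow> p \<otimes>\<^bsub>B\<^esub> f (gen g) = p \<otimes>\<^bsub>B\<^esub> h (gen g)"
    and a: "a \<in> carrier W"
  shows "f a \<otimes>\<^bsub>B\<^esub> p = h a \<otimes>\<^bsub>B\<^esub> p"
proof -
  interpret B: cstar_algebra B by fact
  note fc = star_homD[OF f] and hc = star_homD[OF h]
  have "f a \<otimes>\<^bsub>B\<^esub> p = h a \<otimes>\<^bsub>B\<^esub> p \<and> p \<otimes>\<^bsub>B\<^esub> f a = p \<otimes>\<^bsub>B\<^esub> h a"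
    using a
  proof (induct a rule: univ_induct)
    case (mult a b)
    have "f a \<otimes>\<^bsub>B\<^esub> f b \<otimes>\<^bsub>B\<^esub> p = f a \<otimes>\<^bsub>B\<^esub> (h b \<otimes>\<^bsub>B\<^esub> p)" using mult(1,2,4) fc(2) hc(2) p by (simp add: B.m_assoc)
    also have "\<dots> = f a \<otimes>\<^bsub>B\<^esub> (p \<otimes>\<^bsub>B\<^esub> h b)" using mult comm by simp
    also have "\<dots> = f a \<otimes>\<^bsub>B\<^esub> p \<otimes>\<^bsub>B\<^esub> h b" using mult(1,2) fc(2) hc(2) p by (simp add: B.m_assoc)
    also have "\<dots> = h a \<otimes>\<^bsub>B\<^esub> p \<otimes>\<^bsub>B\<^esub> h b" using mult by simp
    also have "\<dots> = h a \<otimes>\<^bsub>B\<^esub> (h b \<otimes>\<^bsub>B\<^esub> p)" using mult fc hc p comm[of b] by (simp add: B.m_assoc)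
    finally have 1: "f a \<otimes>\<^bsub>B\<^esub> f b \<otimes>\<^bsub>B\<^esub> p = h a \<otimes>\<^bsub>B\<^esub> h b \<otimes>\<^bsub>B\<^esub> p" using mult fc hc p by (simp add: B.m_assoc)
    have "p \<otimes>\<^bsub>B\<^esub> (f a \<otimes>\<^bsub>B\<^esub> f b) = p \<otimes>\<^bsub>B\<^esub> h a \<otimes>\<^bsub>B\<^esub> f b" using mult(1,2) fc(2) p mult(3) B.m_assoc[of p "f a" "f b"] by simp
    also have "\<dots> = h a \<otimes>\<^bsub>B\<^esub> p \<otimes>\<^bsub>B\<^esub> f b" using mult comm[of a] by simp
    also have "\<dots> = h a \<otimes>\<^bsub>B\<^esub> (p \<otimes>\<^bsub>B\<^esub> h b)" using mult fc hc p by (simp add: B.m_assoc)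
    also have "\<dots> = h a \<otimes>\<^bsub>B\<^esub> p \<otimes>\<^bsub>B\<^esub> h b" using mult fc hc p by (simp add: B.m_assoc)
    also have "\<dots> = p \<otimes>\<^bsub>B\<^esub> h a \<otimes>\<^bsub>B\<^esub> h b" using mult comm[of a] by simp
    finally have 2: "p \<otimes>\<^bsub>B\<^esub> (f a \<otimes>\<^bsub>B\<^esub> f b) = p \<otimes>\<^bsub>B\<^esub> (h a \<otimes>\<^bsub>B\<^esub> h b)" using mult fc hc p by (simp add: B.m_assoc)
    show ?case using 1 2 mult fc hc by simp
  next
    case (adj a)
    then have "adj B (p \<otimes>\<^bsub>B\<^esub> f a) = adj B (p \<otimes>\<^bsub>B\<^esub> h a)" "adj B (f a \<otimes>\<^bsub>B\<^esub> p) = adj B (h a \<otimes>\<^bsub>B\<^esub> p)" by simp_all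
    then show ?case using adj(1) fc hc p by simp
  next
    case (lim t a)
    have cf: "B.conv (\<lambda>n. f (t n)) (f a)" and ch: "B.conv (\<lambda>n. h (t n)) (h a)"
      using star_hom_conv[OF W.cstar_algebra_axioms B _ lim(1)] f h by blast+
    note cp = B.conv_const[OF p(1)]
    show ?case
      using B.conv_unique[OF B.conv_mult[OF cf cp]] B.conv_unique[OF B.conv_mult[OF cp cf]]
        B.conv_mult[OF ch cp] B.conv_mult[OF cp ch] lim(2) by simp
  qed (use fc hc p gen in \<open>auto simp: B.l_distr B.r_distr\<close>)
  then show ?thesis ..
qed

end

context wreath_product
begin

lemma wreath_eqI:
  assumes B: "cstar_algebra B" and f: "f \<in> star_hom W B" and h: "h \<in> star_hom W B"
    and nu: "\<And>k a. \<lbrakk>k < n; a \<in> carrier A\<rbrakk> \<Longrightarrow> f (\<nu> k a) = h (\<nu> k a)"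
    and x: "\<And>k l. \<lbrakk>k < n; l < n\<rbrakk> \<Longrightarrow> f (x k l) = h (x k l)"
  shows "f = h"
proof (rule star_hom_eqI[OF B f h])
  fix g assume "g \<in> gens"
  then consider k a where "k < n" "a \<in> carrier A" "g = Inl (k, a)" | b where "b \<in> carrier P" "g = Inr b"
    using gens_cases by blast
  then show "f (gen g) = h (gen g)"
  proof cases
    case 1
    then show ?thesis using nu[of k a] by (simp add: \<nu>_def)
  next
    case (2 b)
    have "compose (carrier P) f \<sigma> = compose (carrier P) h \<sigma>"
      by (intro s_eqI[OF B] star_hom_compose[OF P.cstar_algebra_axioms sigma_star_hom] f h)
        (simp_all add: compose_def sigma_q x)
    from fun_cong[OF this, of b] show ?thesis using 2 by (simp add: compose_def \<sigma>_def)
  qed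
qed

lemma magic_x: "W.magic {..<n} x"
  using star_hom_magic[OF P.cstar_algebra_axioms W.cstar_algebra_axioms sigma_star_hom magic_s]
    W.magic_cong[of "{..<n}" "\<lambda>k l. \<sigma> (s k l)" x] by (simp add: sigma_q)

lemma alg_free_wreath: "cqg_alg G = A \<Longrightarrow> cqg_alg (free_wreath G n) = W"
  by (simp add: free_wreath_def Let_def gens_def wreath_rels_def)

sublocale WW: tensor_pair W W
  by unfold_locales

abbreviation "TT \<equiv> min_tensor W W"

text \<open>Turns the definite description into a test: any homomorphism with the prescribed values
  is the comultiplication, since the elements \<nu> k a and \<open>x k l\<close> determine
  it.\<close>

lemma comult_free_wreath:
  assumes G: "cqg_alg G = A" and \<Delta>: "\<Delta> \<in> star_hom W TT"
    and x: "\<And>k l. \<lbrakk>k < n; l < n\<rbrakk> \<Longrightarrow> \<Delta> (x k l) = (\<Oplus>\<^bsub>TT\<^esub>r\<in>{..<n}. tensor W W (x k r) (x r l))"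
    and nu: "\<And>k a. \<lbrakk>k < n; a \<in> carrier A\<rbrakk> \<Longrightarrow> \<Delta> (\<nu> k a) =
        (\<Oplus>\<^bsub>TT\<^esub>l\<in>{..<n}. tensor_map A A W W (\<nu> k) (\<nu> l) (comult G a) \<otimes>\<^bsub>TT\<^esub> tensor W W (x k l) \<one>\<^bsub>W\<^esub>)"
  shows "comult (free_wreath G n) = \<Delta>"
proof -
  have "comult (free_wreath G n) = (THE \<Delta>. \<Delta> \<in> star_hom W TT \<and>
      (\<forall>k<n. \<forall>l<n. \<Delta> (x k l) = (\<Oplus>\<^bsub>TT\<^esub>r\<in>{..<n}. tensor W W (x k r) (x r l))) \<and>
      (\<forall>k<n. \<forall>a\<in>carrier A. \<Delta> (\<nu> k a) =
        (\<Oplus>\<^bsub>TT\<^esub>l\<in>{..<n}. tensor_map A A W W (\<nu> k) (\<nu> l) (comult G a) \<otimes>\<^bsub>TT\<^esub> tensor W W (x k l) \<one>\<^bsub>W\<^esub>)))"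
    unfolding free_wreath_def Let_def G \<nu>_def x_def gens_def wreath_rels_def by simp
  also have "\<dots> = \<Delta>"
    using \<Delta> x nu by (intro the_equality wreath_eqI[OF WW.T.cstar_algebra_axioms]) auto
  finally show ?thesis .
qed

end

section \<open>The isomorphism\<close>

declare copies_simps(1) [simp del]

lemma mem_verts_copies [simp]: "(k, i) \<in> verts (copies n G) \<longleftrightarrow> k < n \<and> i \<in> verts G"
  by (simp add: copies_simps(1))

text \<open>The unqualified names belong to the single triple, \<open>C\<close> to its disjoint
  copies and \<open>D\<close> to the wreath product over the algebra of the triple; \<open>K\<close>
  is the splitting of the universal solution \<open>C.q\<close> into wreath data.\<close>

locale wreath_triple = triple_core G1 G2 \<theta>
  for G1 :: "('v, 'e) pre_digraph" and G2 :: "('v, 'f) pre_digraph" and \<theta> +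
  fixes n :: nat
  assumes conn: "\<lbrakk>v \<in> V; w \<in> V\<rbrakk> \<Longrightarrow> (v, w) \<in> (arcs_ends G1)\<^sup>*"
    and nonempty: "V \<noteq> {}"
begin

sublocale C: triple_core "copies n G1" "copies n G2" "theta_copies \<theta>"
  by (rule triple_core_copies[OF triple_core_axioms])

sublocale D: wreath_product W n
  by unfold_locales

sublocale K: copies_family C.W G1 G2 \<theta> n C.q
  by unfold_locales (use C.aut_family_q conn nonempty in auto)

lemma ex_phi: "\<exists>\<phi>\<in>star_hom C.W D.W. \<forall>k<n. \<forall>l<n. \<forall>i\<in>V. \<forall>j\<in>V. \<phi> (C.q (k, i) (l, j)) = D.\<nu> k (q i j) \<otimes>\<^bsub>D.W\<^esub> D.x k l"
proof -
  have fam: "D.W.aut_family G1 G2 \<theta> (\<lambda>i j. D.\<nu> k (q i j))" if "k < n" for k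
    using star_hom_aut_family[OF triple_core_axioms W.cstar_algebra_axioms D.W.cstar_algebra_axioms D.nu_star_hom[OF that] aut_family_q] .
  have "D.W.aut_family (copies n G1) (copies n G2) (theta_copies \<theta>) (\<lambda>(k, i) (l, j). D.\<nu> k (q i j) \<otimes>\<^bsub>D.W\<^esub> D.x k l)"
    by (intro D.W.aut_family_copies triple_core_axioms fam D.magic_x D.nu_x_commute q_closed)
  from C.universal_aut[OF D.W.cstar_algebra_axioms this] obtain \<phi> where \<phi>: "\<phi> \<in> star_hom C.W D.W"
    "\<And>p p'. p \<in> verts (copies n G1) \<Longrightarrow> p' \<in> verts (copies n G1) \<Longrightarrow>
      \<phi> (C.q p p') = (case p of (k, i) \<Rightarrow> \<lambda>(l, j). D.\<nu> k (q i j) \<otimes>\<^bsub>D.W\<^esub> D.x k l) p'" by blast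
  have "\<phi> (C.q (k, i) (l, j)) = D.\<nu> k (q i j) \<otimes>\<^bsub>D.W\<^esub> D.x k l" if "k < n" "l < n" "i \<in> V" "j \<in> V" for k l i j
    using \<phi>(2)[of "(k, i)" "(l, j)"] that by simp
  with \<phi>(1) show ?thesis by blast
qed

text \<open>The wreath relations ask that all of \<open>W\<close>, embedded as the k-th copy,
  commute with \<open>K.X k l\<close>. This is known on the entries of \<open>q\<close> by
  \<open>K.nu_X\<close> and spreads to \<open>W\<close> because \<open>K.X k l\<close> is
  self-adjoint.\<close>

lemma ex_psi: "\<exists>\<psi>\<in>star_hom D.W C.W. (\<forall>k<n. \<forall>i\<in>V. \<forall>j\<in>V. \<psi> (D.\<nu> k (q i j)) = K.nu k i j) \<and> (\<forall>k<n. \<forall>l<n. \<psi> (D.x k l) = K.X k l)"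
proof -
  have "\<exists>f\<in>star_hom W C.W. \<forall>i\<in>V. \<forall>j\<in>V. f (q i j) = K.nu k i j" if "k < n" for k
    by (rule universal_aut[OF C.W.cstar_algebra_axioms K.nu_aut_family[OF that]])
  then obtain f where f: "\<And>k. k < n \<Longrightarrow> f k \<in> star_hom W C.W"
    "\<And>k i j. \<lbrakk>k < n; i \<in> V; j \<in> V\<rbrakk> \<Longrightarrow> f k (q i j) = K.nu k i j" by metis
  have "\<forall>r\<in>magic_relations {..<n} \<union> {}. ev C.W (\<lambda>(i, j). K.X i j) r = \<zero>\<^bsub>C.W\<^esub>"
    using C.W.ev_magic_relations[of "{..<n}" K.X] K.X_magic by simp
  then have "\<exists>g\<in>star_hom D.P C.W. \<forall>k\<in>{..<n}. \<forall>l\<in>{..<n}. g (D.s k l) = K.X k l"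
    by (intro D.universal_s C.W.cstar_algebra_axioms) auto
  then obtain g where g: "g \<in> star_hom D.P C.W" "\<And>k l. \<lbrakk>k < n; l < n\<rbrakk> \<Longrightarrow> g (D.s k l) = K.X k l" by blast
  have comm: "f k a \<otimes>\<^bsub>C.W\<^esub> g (D.s k l) = g (D.s k l) \<otimes>\<^bsub>C.W\<^esub> f k a" if kl: "k < n" "l < n" and a: "a \<in> carrier W" for k l a
    unfolding g(2)[OF kl]
  proof (rule star_hom_commuteI[OF C.W.cstar_algebra_axioms f(1)[OF kl(1)] _ _ _ a])
    show "K.X k l \<in> carrier C.W" "adj C.W (K.X k l) = K.X k l" using kl C.W.magicD(2)[OF K.X_magic, of k l] by auto
    fix p assume "p \<in> V \<times> V"
    then show "f k (gen p) \<otimes>\<^bsub>C.W\<^esub> K.X k l = K.X k l \<otimes>\<^bsub>C.W\<^esub> f k (gen p)"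
      using f(2) kl K.nu_X by (auto simp flip: q_gen)
  qed
  obtain \<psi> where \<psi>: "\<psi> \<in> star_hom D.W C.W" "\<And>k a. \<lbrakk>k < n; a \<in> carrier W\<rbrakk> \<Longrightarrow> \<psi> (D.gen (Inl (k, a))) = f k a"
    "\<And>b. b \<in> carrier D.P \<Longrightarrow> \<psi> (D.gen (Inr b)) = g b"
    using D.wreath_universal[of C.W f g, OF C.W.cstar_algebra_axioms f(1) g(1) comm] by blast
  have "\<psi> (D.\<nu> k (q i j)) = K.nu k i j" if "k < n" "i \<in> V" "j \<in> V" for k i j
    using that \<psi>(2) f(2) by (simp add: D.\<nu>_def)
  moreover have "\<psi> (D.x k l) = K.X k l" if "k < n" "l < n" for k l
    using that \<psi>(3)[of "D.s k l"] g(2) by (simp add: D.x_def)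
  ultimately show ?thesis by (intro bexI[OF _ \<psi>(1)]) simp
qed

lemma wreath_eqI:
  assumes B: "cstar_algebra B" and f: "f \<in> star_hom D.W B" and h: "h \<in> star_hom D.W B"
    and nu: "\<And>k i j. \<lbrakk>k < n; i \<in> V; j \<in> V\<rbrakk> \<Longrightarrow> f (D.\<nu> k (q i j)) = h (D.\<nu> k (q i j))"
    and x: "\<And>k l. \<lbrakk>k < n; l < n\<rbrakk> \<Longrightarrow> f (D.x k l) = h (D.x k l)"
  shows "f = h"
proof (rule D.wreath_eqI[OF B f h _ x])
  fix k a assume k: "k < n" and a: "a \<in> carrier W"
  have "compose (carrier W) f (D.\<nu> k) = compose (carrier W) h (D.\<nu> k)"
    by (intro star_hom_magic_eqI[OF B] star_hom_compose[OF W.cstar_algebra_axioms D.nu_star_hom[OF k]] f h)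
      (simp_all add: compose_def nu k)
  from fun_cong[OF this, of a] a show "f (D.\<nu> k a) = h (D.\<nu> k a)" by (simp add: compose_def)
qed

end

section \<open>The two homomorphisms are mutually inverse\<close>

locale wreath_maps = wreath_triple G1 G2 \<theta> n
  for G1 :: "('v, 'e) pre_digraph" and G2 :: "('v, 'f) pre_digraph" and \<theta> n +
  fixes \<phi> \<psi>
  assumes phi: "\<phi> \<in> star_hom C.W D.W"
    and phi_q: "\<lbrakk>k < n; l < n; i \<in> V; j \<in> V\<rbrakk> \<Longrightarrow> \<phi> (C.q (k, i) (l, j)) = D.\<nu> k (q i j) \<otimes>\<^bsub>D.W\<^esub> D.x k l"
    and psi: "\<psi> \<in> star_hom D.W C.W"
    and psi_nu: "\<lbrakk>k < n; i \<in> V; j \<in> V\<rbrakk> \<Longrightarrow> \<psi> (D.\<nu> k (q i j)) = K.nu k i j"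
    and psi_x: "\<lbrakk>k < n; l < n\<rbrakk> \<Longrightarrow> \<psi> (D.x k l) = K.X k l"
begin

lemmas phiD = star_homD[OF phi] and psiD = star_homD[OF psi]

lemma psi_phi: assumes a: "a \<in> carrier C.W" shows "\<psi> (\<phi> a) = a"
proof -
  have "compose (carrier C.W) \<psi> \<phi> = (\<lambda>a\<in>carrier C.W. a)"
  proof (rule C.star_hom_magic_eqI[OF C.W.cstar_algebra_axioms])
    show "compose (carrier C.W) \<psi> \<phi> \<in> star_hom C.W C.W" "(\<lambda>a\<in>carrier C.W. a) \<in> star_hom C.W C.W"
      by (rule star_hom_compose[OF C.W.cstar_algebra_axioms phi psi] star_hom_id[OF C.W.cstar_algebra_axioms])+
    fix p p' assume "p \<in> verts (copies n G1)" "p' \<in> verts (copies n G1)"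
    then obtain k i l j where p: "p = (k, i)" "p' = (l, j)" "k < n" "l < n" "i \<in> V" "j \<in> V" by (cases p; cases p') auto
    then show "compose (carrier C.W) \<psi> \<phi> (C.q p p') = (\<lambda>a\<in>carrier C.W. a) (C.q p p')"
      by (simp add: compose_def phi_q psiD psi_nu psi_x K.nu_X)
  qed
  from fun_cong[OF this, of a] a show ?thesis by (simp add: compose_def)
qed

text \<open>Together with \<open>x_sum\<close> this writes the generators of the wreath product
  through the range of \<phi>, both for surjectivity and for computing the transported
  comultiplication on them.\<close>

lemma nu_q_sum: assumes "k < n" "i \<in> V" "j \<in> V" shows "D.\<nu> k (q i j) = (\<Oplus>\<^bsub>D.W\<^esub>l\<in>{..<n}. \<phi> (C.q (k, i) (l, j)))"
proof -
  have "(\<Oplus>\<^bsub>D.W\<^esub>l\<in>{..<n}. \<phi> (C.q (k, i) (l, j))) = (\<Oplus>\<^bsub>D.W\<^esub>l\<in>{..<n}. D.\<nu> k (q i j) \<otimes>\<^bsub>D.W\<^esub> D.x k l)"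
    using assms by (intro D.W.finsum_eq) (auto simp: phi_q)
  also have "\<dots> = D.\<nu> k (q i j) \<otimes>\<^bsub>D.W\<^esub> (\<Oplus>\<^bsub>D.W\<^esub>l\<in>{..<n}. D.x k l)"
    using assms by (intro D.W.finsum_mult_left[symmetric]) auto
  also have "\<dots> = D.\<nu> k (q i j)"
    using assms D.W.magicD(4)[OF D.magic_x, of k] by simp
  finally show ?thesis ..
qed

lemma x_sum: assumes "k < n" "l < n" "i \<in> V" shows "D.x k l = (\<Oplus>\<^bsub>D.W\<^esub>j\<in>V. \<phi> (C.q (k, i) (l, j)))"
proof -
  have "(\<Oplus>\<^bsub>D.W\<^esub>j\<in>V. \<phi> (C.q (k, i) (l, j))) = (\<Oplus>\<^bsub>D.W\<^esub>j\<in>V. D.\<nu> k (q i j) \<otimes>\<^bsub>D.W\<^esub> D.x k l)"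
    using assms by (intro D.W.finsum_eq) (auto simp: phi_q)
  also have "\<dots> = (\<Oplus>\<^bsub>D.W\<^esub>j\<in>V. D.\<nu> k (q i j)) \<otimes>\<^bsub>D.W\<^esub> D.x k l"
    using assms by (intro D.W.finsum_mult_right[symmetric]) auto
  also have "(\<Oplus>\<^bsub>D.W\<^esub>j\<in>V. D.\<nu> k (q i j)) = D.\<nu> k (\<Oplus>\<^bsub>W\<^esub>j\<in>V. q i j)"
    using assms by (intro star_hom_finsum[OF W.cstar_algebra_axioms D.W.cstar_algebra_axioms D.nu_star_hom, symmetric]) auto
  also have "\<dots> = \<one>\<^bsub>D.W\<^esub>"
    using assms W.magicD(4)[OF magic_q, of i] star_homD(5)[OF D.nu_star_hom, of k] by simp
  finally show ?thesis using assms by simp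
qed

lemma phi_psi: assumes b: "b \<in> carrier D.W" shows "\<phi> (\<psi> b) = b"
proof -
  have "compose (carrier D.W) \<phi> \<psi> = (\<lambda>a\<in>carrier D.W. a)"
  proof (rule wreath_eqI[OF D.W.cstar_algebra_axioms])
    show "compose (carrier D.W) \<phi> \<psi> \<in> star_hom D.W D.W" "(\<lambda>a\<in>carrier D.W. a) \<in> star_hom D.W D.W"
      by (rule star_hom_compose[OF D.W.cstar_algebra_axioms psi phi] star_hom_id[OF D.W.cstar_algebra_axioms])+
    show "compose (carrier D.W) \<phi> \<psi> (D.\<nu> k (q i j)) = (\<lambda>a\<in>carrier D.W. a) (D.\<nu> k (q i j))" if "k < n" "i \<in> V" "j \<in> V" for k i j
    proof -
      have "\<phi> (K.nu k i j) = (\<Oplus>\<^bsub>D.W\<^esub>l\<in>{..<n}. \<phi> (C.q (k, i) (l, j)))"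
        unfolding K.nu_def using that
        by (intro star_hom_finsum[OF C.W.cstar_algebra_axioms D.W.cstar_algebra_axioms phi]) auto
      then show ?thesis using that nu_q_sum[OF that, symmetric] by (simp add: compose_def psi_nu)
    qed
    show "compose (carrier D.W) \<phi> \<psi> (D.x k l) = (\<lambda>a\<in>carrier D.W. a) (D.x k l)" if "k < n" "l < n" for k l
    proof -
      have "\<phi> (K.X k l) = (\<Oplus>\<^bsub>D.W\<^esub>j\<in>V. \<phi> (C.q (k, K.i0) (l, j)))"
        unfolding K.X_def K.r_def using that K.i0
        by (intro star_hom_finsum[OF C.W.cstar_algebra_axioms D.W.cstar_algebra_axioms phi]) auto
      then show ?thesis using that K.i0 x_sum[of k l K.i0, symmetric] by (simp add: compose_def psi_x)
    qed
  qed
  from fun_cong[OF this, of b] b show ?thesis by (simp add: compose_def)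
qed

lemma bij_phi: "bij_betw \<phi> (carrier C.W) (carrier D.W)"
  by (rule bij_betw_byWitness[where f' = \<psi>]) (use psi_phi phi_psi phiD psiD in auto)

end

section \<open>Transport of the comultiplication\<close>

context wreath_maps
begin

definition "\<phi>\<phi> = restrict (tensor_map C.W C.W D.W D.W \<phi> \<phi>) (carrier C.TT)"

lemma tensor_phi: "\<phi>\<phi> \<in> star_hom C.TT D.TT"
  "\<lbrakk>a \<in> carrier C.W; b \<in> carrier C.W\<rbrakk> \<Longrightarrow> \<phi>\<phi> (tensor C.W C.W a b) = tensor D.W D.W (\<phi> a) (\<phi> b)"
  using tensor_map_star_hom[OF C.W.cstar_algebra_axioms C.W.cstar_algebra_axioms D.W.cstar_algebra_axioms
      D.W.cstar_algebra_axioms phi phi] by (simp_all add: \<phi>\<phi>_def)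

text \<open>The composite of \<psi>, the comultiplication of the copies, and \<phi> \<otimes>
  \<phi>. With this choice \<phi> intertwines by construction, and the whole content lies in
  recognising \<Delta>' as the comultiplication of \<open>free_wreath\<close>.\<close>

definition "\<Delta>' = compose (carrier D.W) \<phi>\<phi> (compose (carrier D.W) C.\<Delta> \<psi>)"

lemma Delta_star_hom: "\<Delta>' \<in> star_hom D.W D.TT"
  unfolding \<Delta>'_def
  by (rule star_hom_compose[OF D.W.cstar_algebra_axioms
        star_hom_compose[OF D.W.cstar_algebra_axioms psi C.comult_aut(1)] tensor_phi(1)])

lemma Delta_phi: "a \<in> carrier C.W \<Longrightarrow> \<Delta>' (\<phi> a) = \<phi>\<phi> (C.\<Delta> a)"
  by (simp add: \<Delta>'_def compose_def phiD(2) psi_phi)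

lemma Delta_finsum: "(\<And>i. i \<in> I \<Longrightarrow> f i \<in> carrier D.W) \<Longrightarrow> \<Delta>' (finsum D.W f I) = (\<Oplus>\<^bsub>D.TT\<^esub>i\<in>I. \<Delta>' (f i))"
  by (rule star_hom_finsum[OF D.W.cstar_algebra_axioms D.WW.T.cstar_algebra_axioms Delta_star_hom])

abbreviation "t \<equiv> tensor D.W D.W"

lemma Delta_phi_q:
  assumes "k < n" "l < n" "i \<in> V" "j \<in> V"
  shows "\<Delta>' (\<phi> (C.q (k, i) (l, j))) = (\<Oplus>\<^bsub>D.TT\<^esub>r\<in>{..<n}. \<Oplus>\<^bsub>D.TT\<^esub>m\<in>V.
      t (D.\<nu> k (q i m) \<otimes>\<^bsub>D.W\<^esub> D.x k r) (D.\<nu> r (q m j) \<otimes>\<^bsub>D.W\<^esub> D.x r l))"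
proof -
  let ?F = "\<lambda>r m. t (D.\<nu> k (q i m) \<otimes>\<^bsub>D.W\<^esub> D.x k r) (D.\<nu> r (q m j) \<otimes>\<^bsub>D.W\<^esub> D.x r l)"
  have "\<Delta>' (\<phi> (C.q (k, i) (l, j))) = \<phi>\<phi> (C.qq (k, i) (l, j))"
    using assms C.comult_aut(2)[of "(k, i)" "(l, j)"] by (simp add: Delta_phi)
  also have "\<dots> = (\<Oplus>\<^bsub>D.TT\<^esub>p\<in>verts (copies n G1). \<phi>\<phi> (tensor C.W C.W (C.q (k, i) p) (C.q p (l, j))))"
    unfolding C.qq_def using assms
    by (intro star_hom_finsum[OF C.WW.T.cstar_algebra_axioms D.WW.T.cstar_algebra_axioms tensor_phi(1)] C.WW.tensor_T C.q_closed) auto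
  also have "\<dots> = (\<Oplus>\<^bsub>D.TT\<^esub>p\<in>{..<n} \<times> V. ?F (fst p) (snd p))"
  proof (rule D.WW.T.finsum_eq)
    show "verts (copies n G1) = {..<n} \<times> V" by (simp add: copies_simps(1))
    fix p assume "p \<in> {..<n} \<times> V"
    then obtain r m where p: "p = (r, m)" "r < n" "m \<in> V" by auto
    show "\<phi>\<phi> (tensor C.W C.W (C.q (k, i) p) (C.q p (l, j))) = ?F (fst p) (snd p)"
      using p assms by (simp add: tensor_phi(2) phi_q)
    show "?F (fst p) (snd p) \<in> carrier D.TT" using p assms by simp
  qed
  also have "\<dots> = (\<Oplus>\<^bsub>D.TT\<^esub>r\<in>{..<n}. \<Oplus>\<^bsub>D.TT\<^esub>m\<in>V. ?F r m)"
    using assms by (intro D.WW.T.finsum_pairs[symmetric]) auto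
  finally show ?thesis .
qed

text \<open>Summation over j removes the entry of \<open>q\<close> from the second leg and leaves
  \<open>D.x r l\<close>; summation over m then does the same in the first leg and leaves
  \<open>D.x k r\<close>.\<close>

lemma Delta_x:
  assumes k: "k < n" and l: "l < n"
  shows "\<Delta>' (D.x k l) = (\<Oplus>\<^bsub>D.TT\<^esub>r\<in>{..<n}. t (D.x k r) (D.x r l))"
proof -
  obtain i where i: "i \<in> V" using nonempty by blast
  let ?F = "\<lambda>j r m. t (D.\<nu> k (q i m) \<otimes>\<^bsub>D.W\<^esub> D.x k r) (D.\<nu> r (q m j) \<otimes>\<^bsub>D.W\<^esub> D.x r l)"
  have "\<Delta>' (D.x k l) = (\<Oplus>\<^bsub>D.TT\<^esub>j\<in>V. \<Oplus>\<^bsub>D.TT\<^esub>r\<in>{..<n}. \<Oplus>\<^bsub>D.TT\<^esub>m\<in>V. ?F j r m)"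
    unfolding x_sum[OF k l i] using k l i phiD(2)
    by (subst Delta_finsum) (auto intro!: D.WW.T.finsum_eq simp: Delta_phi_q)
  also have "\<dots> = (\<Oplus>\<^bsub>D.TT\<^esub>r\<in>{..<n}. \<Oplus>\<^bsub>D.TT\<^esub>j\<in>V. \<Oplus>\<^bsub>D.TT\<^esub>m\<in>V. ?F j r m)"
    using k l i by (intro D.WW.T.finsum_swap) auto
  also have "\<dots> = (\<Oplus>\<^bsub>D.TT\<^esub>r\<in>{..<n}. t (D.x k r) (D.x r l))"
  proof (rule D.WW.T.finsum_eq[OF refl])
    fix r assume "r \<in> {..<n}"
    then have r: "r < n" by simp
    have "(\<Oplus>\<^bsub>D.TT\<^esub>j\<in>V. \<Oplus>\<^bsub>D.TT\<^esub>m\<in>V. ?F j r m) = (\<Oplus>\<^bsub>D.TT\<^esub>m\<in>V. \<Oplus>\<^bsub>D.TT\<^esub>j\<in>V. ?F j r m)"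
      using k l i r by (intro D.WW.T.finsum_swap) auto
    also have "\<dots> = (\<Oplus>\<^bsub>D.TT\<^esub>m\<in>V. t (D.\<nu> k (q i m) \<otimes>\<^bsub>D.W\<^esub> D.x k r) (D.x r l))"
    proof (rule D.WW.T.finsum_eq[OF refl])
      fix m assume m: "m \<in> V"
      have "(\<Oplus>\<^bsub>D.TT\<^esub>j\<in>V. ?F j r m) = t (D.\<nu> k (q i m) \<otimes>\<^bsub>D.W\<^esub> D.x k r) (\<Oplus>\<^bsub>D.W\<^esub>j\<in>V. \<phi> (C.q (r, m) (l, j)))"
        using k l i r m phiD(2) by (subst D.WW.tensor_finsum_right) (auto intro!: D.WW.T.finsum_eq simp: phi_q)
      then show "(\<Oplus>\<^bsub>D.TT\<^esub>j\<in>V. ?F j r m) = t (D.\<nu> k (q i m) \<otimes>\<^bsub>D.W\<^esub> D.x k r) (D.x r l)"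
        unfolding x_sum[OF r l m] .
    qed (use k l i r in simp)
    also have "\<dots> = t (\<Oplus>\<^bsub>D.W\<^esub>m\<in>V. \<phi> (C.q (k, i) (r, m))) (D.x r l)"
      using k l i r phiD(2) by (subst D.WW.tensor_finsum_left) (auto intro!: D.WW.T.finsum_eq simp: phi_q)
    finally show "(\<Oplus>\<^bsub>D.TT\<^esub>j\<in>V. \<Oplus>\<^bsub>D.TT\<^esub>m\<in>V. ?F j r m) = t (D.x k r) (D.x r l)"
      unfolding x_sum[OF k r i] .
  qed (use k l in simp)
  finally show ?thesis .
qed

text \<open>\<open>E k r\<close> is (\<nu> k \<otimes> \<nu> r) \<circ> \<Delta> as a homomorphism;
  multiplied by \<open>p k r\<close> it is the r-th summand of Bichon's formula.\<close>

definition "E k r = compose (carrier W) (restrict (tensor_map W W D.W D.W (D.\<nu> k) (D.\<nu> r)) (carrier TT)) \<Delta>"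
definition "p k r = t (D.x k r) \<one>\<^bsub>D.W\<^esub>"

lemma E_star_hom: "\<lbrakk>k < n; r < n\<rbrakk> \<Longrightarrow> E k r \<in> star_hom W D.TT"
  unfolding E_def
  by (intro star_hom_compose[OF W.cstar_algebra_axioms comult_aut(1)] tensor_map_star_hom(1)
      W.cstar_algebra_axioms D.W.cstar_algebra_axioms D.nu_star_hom)

lemma E_eq: "a \<in> carrier W \<Longrightarrow> E k r a = tensor_map W W D.W D.W (D.\<nu> k) (D.\<nu> r) (\<Delta> a)"
  using star_homD(2)[OF comult_aut(1)] by (simp add: E_def compose_def)

lemma E_q:
  assumes k: "k < n" "r < n" and i: "i \<in> V" "j \<in> V"
  shows "E k r (q i j) = (\<Oplus>\<^bsub>D.TT\<^esub>m\<in>V. t (D.\<nu> k (q i m)) (D.\<nu> r (q m j)))"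
proof -
  let ?f = "restrict (tensor_map W W D.W D.W (D.\<nu> k) (D.\<nu> r)) (carrier TT)"
  note f = tensor_map_star_hom[OF W.cstar_algebra_axioms W.cstar_algebra_axioms D.W.cstar_algebra_axioms
      D.W.cstar_algebra_axioms D.nu_star_hom[OF k(1)] D.nu_star_hom[OF k(2)]]
  have "E k r (q i j) = ?f (qq i j)"
    using i by (simp add: E_def compose_def comult_aut(2))
  also have "\<dots> = (\<Oplus>\<^bsub>D.TT\<^esub>m\<in>V. ?f (tensor W W (q i m) (q m j)))"
    unfolding qq_def using i
    by (intro star_hom_finsum[OF WW.T.cstar_algebra_axioms D.WW.T.cstar_algebra_axioms f(1)] WW.tensor_T q_closed)
  also have "\<dots> = (\<Oplus>\<^bsub>D.TT\<^esub>m\<in>V. t (D.\<nu> k (q i m)) (D.\<nu> r (q m j)))"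
    using k i by (intro D.WW.T.finsum_eq) (auto simp: f(2))
  finally show ?thesis .
qed

lemma p_closed [simp]: "\<lbrakk>k < n; r < n\<rbrakk> \<Longrightarrow> p k r \<in> carrier D.TT"
  by (simp add: p_def)

lemma p_adj: "\<lbrakk>k < n; r < n\<rbrakk> \<Longrightarrow> adj D.TT (p k r) = p k r"
  using D.W.magicD(2)[OF D.magic_x] by (simp add: p_def)

lemma p_mult: "\<lbrakk>k < n; r < n; r' < n\<rbrakk> \<Longrightarrow> p k r \<otimes>\<^bsub>D.TT\<^esub> p k r' = (if r = r' then p k r else \<zero>\<^bsub>D.TT\<^esub>)"
  using D.W.magicD(3)[OF D.magic_x, of k r] D.W.magic_row[OF D.magic_x, of k r r']
  by (cases "r = r'") (simp_all add: p_def)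

lemma p_sum: assumes "k < n" shows "(\<Oplus>\<^bsub>D.TT\<^esub>r\<in>{..<n}. p k r) = \<one>\<^bsub>D.TT\<^esub>"
proof -
  have "(\<Oplus>\<^bsub>D.TT\<^esub>r\<in>{..<n}. p k r) = t (\<Oplus>\<^bsub>D.W\<^esub>r\<in>{..<n}. D.x k r) \<one>\<^bsub>D.W\<^esub>"
    unfolding p_def using assms by (intro D.WW.tensor_finsum_left[symmetric]) auto
  then show ?thesis using D.W.magicD(4)[OF D.magic_x, of k] assms by simp
qed

text \<open>Only the first legs meet, and there \<nu> k commutes with every \<open>D.x k r'\<close>;
  the index r of the second leg is unrelated to r'.\<close>

lemma E_p_commute:
  assumes k: "k < n" "r < n" "r' < n" and a: "a \<in> carrier W"
  shows "E k r a \<otimes>\<^bsub>D.TT\<^esub> p k r' = p k r' \<otimes>\<^bsub>D.TT\<^esub> E k r a"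
proof (rule star_hom_commuteI[OF D.WW.T.cstar_algebra_axioms E_star_hom[OF k(1,2)] p_closed[OF k(1,3)] p_adj[OF k(1,3)] _ a])
  fix g assume "g \<in> V \<times> V"
  then obtain i j where g: "g = (i, j)" "i \<in> V" "j \<in> V" by blast
  have "E k r (q i j) \<otimes>\<^bsub>D.TT\<^esub> p k r' = (\<Oplus>\<^bsub>D.TT\<^esub>m\<in>V. t (D.\<nu> k (q i m)) (D.\<nu> r (q m j)) \<otimes>\<^bsub>D.TT\<^esub> p k r')"
    unfolding E_q[OF k(1,2) g(2,3)] using k g by (intro D.WW.T.finsum_mult_right) auto
  also have "\<dots> = (\<Oplus>\<^bsub>D.TT\<^esub>m\<in>V. p k r' \<otimes>\<^bsub>D.TT\<^esub> t (D.\<nu> k (q i m)) (D.\<nu> r (q m j)))"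
    using k g by (intro D.WW.T.finsum_eq) (auto simp: p_def D.nu_x_commute)
  also have "\<dots> = p k r' \<otimes>\<^bsub>D.TT\<^esub> E k r (q i j)"
    unfolding E_q[OF k(1,2) g(2,3)] using k g by (intro D.WW.T.finsum_mult_left[symmetric]) auto
  finally show "E k r (gen g) \<otimes>\<^bsub>D.TT\<^esub> p k r' = p k r' \<otimes>\<^bsub>D.TT\<^esub> E k r (gen g)"
    unfolding g(1) q_gen .
qed

text \<open>Writing \<nu> k (q i j) as a sum over the target copy l, summation over l removes
  \<open>D.x r l\<close> from the second leg, while \<open>D.x k r\<close> stays in the first leg
  and becomes \<open>p k r\<close>.\<close>

lemma Delta_nu_q:
  assumes k: "k < n" and i: "i \<in> V" and j: "j \<in> V"
  shows "\<Delta>' (D.\<nu> k (q i j)) = (\<Oplus>\<^bsub>D.TT\<^esub>r\<in>{..<n}. E k r (q i j) \<otimes>\<^bsub>D.TT\<^esub> p k r)"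
proof -
  let ?F = "\<lambda>l r m. t (D.\<nu> k (q i m) \<otimes>\<^bsub>D.W\<^esub> D.x k r) (D.\<nu> r (q m j) \<otimes>\<^bsub>D.W\<^esub> D.x r l)"
  have "\<Delta>' (D.\<nu> k (q i j)) = (\<Oplus>\<^bsub>D.TT\<^esub>l\<in>{..<n}. \<Oplus>\<^bsub>D.TT\<^esub>r\<in>{..<n}. \<Oplus>\<^bsub>D.TT\<^esub>m\<in>V. ?F l r m)"
    unfolding nu_q_sum[OF k i j] using k i j phiD(2)
    by (subst Delta_finsum) (auto intro!: D.WW.T.finsum_eq simp: Delta_phi_q)
  also have "\<dots> = (\<Oplus>\<^bsub>D.TT\<^esub>r\<in>{..<n}. \<Oplus>\<^bsub>D.TT\<^esub>l\<in>{..<n}. \<Oplus>\<^bsub>D.TT\<^esub>m\<in>V. ?F l r m)"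
    using k i j by (intro D.WW.T.finsum_swap) auto
  also have "\<dots> = (\<Oplus>\<^bsub>D.TT\<^esub>r\<in>{..<n}. E k r (q i j) \<otimes>\<^bsub>D.TT\<^esub> p k r)"
  proof (rule D.WW.T.finsum_eq[OF refl])
    fix r assume "r \<in> {..<n}"
    then have r: "r < n" by simp
    have "(\<Oplus>\<^bsub>D.TT\<^esub>l\<in>{..<n}. \<Oplus>\<^bsub>D.TT\<^esub>m\<in>V. ?F l r m) = (\<Oplus>\<^bsub>D.TT\<^esub>m\<in>V. \<Oplus>\<^bsub>D.TT\<^esub>l\<in>{..<n}. ?F l r m)"
      using k i j r by (intro D.WW.T.finsum_swap) auto
    also have "\<dots> = (\<Oplus>\<^bsub>D.TT\<^esub>m\<in>V. t (D.\<nu> k (q i m)) (D.\<nu> r (q m j)) \<otimes>\<^bsub>D.TT\<^esub> p k r)"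
    proof (rule D.WW.T.finsum_eq[OF refl])
      fix m assume m: "m \<in> V"
      have "(\<Oplus>\<^bsub>D.TT\<^esub>l\<in>{..<n}. ?F l r m) = t (D.\<nu> k (q i m) \<otimes>\<^bsub>D.W\<^esub> D.x k r) (\<Oplus>\<^bsub>D.W\<^esub>l\<in>{..<n}. \<phi> (C.q (r, m) (l, j)))"
        using k i j r m phiD(2) by (subst D.WW.tensor_finsum_right) (auto intro!: D.WW.T.finsum_eq simp: phi_q)
      also have "\<dots> = t (D.\<nu> k (q i m)) (D.\<nu> r (q m j)) \<otimes>\<^bsub>D.TT\<^esub> p k r"
        unfolding nu_q_sum[OF r m j, symmetric] using k i j r m by (simp add: p_def)
      finally show "(\<Oplus>\<^bsub>D.TT\<^esub>l\<in>{..<n}. ?F l r m) = t (D.\<nu> k (q i m)) (D.\<nu> r (q m j)) \<otimes>\<^bsub>D.TT\<^esub> p k r" .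
    qed (use k i j r in simp)
    also have "\<dots> = E k r (q i j) \<otimes>\<^bsub>D.TT\<^esub> p k r"
      unfolding E_q[OF k r i j] using k r i j by (intro D.WW.T.finsum_mult_right[symmetric]) auto
    finally show "(\<Oplus>\<^bsub>D.TT\<^esub>l\<in>{..<n}. \<Oplus>\<^bsub>D.TT\<^esub>m\<in>V. ?F l r m) = E k r (q i j) \<otimes>\<^bsub>D.TT\<^esub> p k r" .
  qed (use k i j star_homD(2)[OF E_star_hom] in simp)
  finally show ?thesis .
qed

text \<open>The right-hand side is not evidently a homomorphism in a, so the formula for entries of
  \<open>q\<close> cannot be extended by uniqueness. In the corner of \<open>p k r\<close> it
  becomes the comparison of two genuine homomorphisms.\<close>

lemma Delta_nu:
  assumes k: "k < n" and a: "a \<in> carrier W"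
  shows "\<Delta>' (D.\<nu> k a) = (\<Oplus>\<^bsub>D.TT\<^esub>r\<in>{..<n}. E k r a \<otimes>\<^bsub>D.TT\<^esub> p k r)"
proof -
  let ?h = "compose (carrier W) \<Delta>' (D.\<nu> k)"
  have h: "?h \<in> star_hom W D.TT" by (rule star_hom_compose[OF W.cstar_algebra_axioms D.nu_star_hom[OF k] Delta_star_hom])
  have Ec: "E k r b \<in> carrier D.TT" if "r < n" "b \<in> carrier W" for r b
    using star_homD(2)[OF E_star_hom[OF k that(1)] that(2)] .
  have corner: "?h a \<otimes>\<^bsub>D.TT\<^esub> p k r = E k r a \<otimes>\<^bsub>D.TT\<^esub> p k r" if r: "r < n" for r
  proof (rule star_hom_corner_eqI[OF D.WW.T.cstar_algebra_axioms h E_star_hom[OF k r] p_closed[OF k r] p_adj[OF k r]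
        E_p_commute[OF k r r] _ _ a])
    fix g assume "g \<in> V \<times> V"
    then obtain i j where g: "g = (i, j)" "i \<in> V" "j \<in> V" by blast
    have hg: "?h (q i j) = (\<Oplus>\<^bsub>D.TT\<^esub>r\<in>{..<n}. E k r (q i j) \<otimes>\<^bsub>D.TT\<^esub> p k r)"
      using g by (simp add: compose_def Delta_nu_q[OF k])
    let ?e = "\<lambda>r'. E k r' (q i j) \<otimes>\<^bsub>D.TT\<^esub> p k r'"
    have e: "?e r' \<in> carrier D.TT" if "r' < n" for r' using that g k Ec by simp
    \<comment> \<open>Multiplication by \<open>p k r\<close> selects the summand r: from the right
      by orthogonality in row k of \<open>D.x\<close>, and from the left after \<open>p k r'\<close>
      has been moved past \<open>E k r'\<close>.\<close>
    have er: "?e r' \<otimes>\<^bsub>D.TT\<^esub> p k r = (if r' = r then ?e r else \<zero>\<^bsub>D.TT\<^esub>)"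
      "p k r \<otimes>\<^bsub>D.TT\<^esub> ?e r' = (if r' = r then p k r \<otimes>\<^bsub>D.TT\<^esub> E k r (q i j) else \<zero>\<^bsub>D.TT\<^esub>)" if r': "r' < n" for r'
    proof -
      have c: "E k r' (q i j) \<in> carrier D.TT" using r' g Ec by simp
      show "?e r' \<otimes>\<^bsub>D.TT\<^esub> p k r = (if r' = r then ?e r else \<zero>\<^bsub>D.TT\<^esub>)"
        using c k r r' by (simp add: D.WW.T.m_assoc p_mult)
      have "p k r \<otimes>\<^bsub>D.TT\<^esub> ?e r' = p k r \<otimes>\<^bsub>D.TT\<^esub> (p k r' \<otimes>\<^bsub>D.TT\<^esub> E k r' (q i j))"
        using E_p_commute[OF k r' r' q_closed[OF g(2,3)]] by simp
      also have "\<dots> = p k r \<otimes>\<^bsub>D.TT\<^esub> p k r' \<otimes>\<^bsub>D.TT\<^esub> E k r' (q i j)"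
        using c k r r' by (simp add: D.WW.T.m_assoc)
      also have "\<dots> = (if r' = r then p k r \<otimes>\<^bsub>D.TT\<^esub> E k r (q i j) else \<zero>\<^bsub>D.TT\<^esub>)"
        using c k r r' by (simp add: p_mult)
      finally show "p k r \<otimes>\<^bsub>D.TT\<^esub> ?e r' = (if r' = r then p k r \<otimes>\<^bsub>D.TT\<^esub> E k r (q i j) else \<zero>\<^bsub>D.TT\<^esub>)" .
    qed
    have "?h (q i j) \<otimes>\<^bsub>D.TT\<^esub> p k r = (\<Oplus>\<^bsub>D.TT\<^esub>r'\<in>{..<n}. ?e r' \<otimes>\<^bsub>D.TT\<^esub> p k r)"
      unfolding hg using e k r by (intro D.WW.T.finsum_mult_right) auto
    also have "\<dots> = ?e r \<otimes>\<^bsub>D.TT\<^esub> p k r"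
      using e er(1) k r by (intro D.WW.T.finsum_single[where f = "\<lambda>r'. ?e r' \<otimes>\<^bsub>D.TT\<^esub> p k r"]) auto
    finally show "?h (gen g) \<otimes>\<^bsub>D.TT\<^esub> p k r = E k r (gen g) \<otimes>\<^bsub>D.TT\<^esub> p k r"
      using er(1)[OF r] unfolding g(1) q_gen by simp
    have "p k r \<otimes>\<^bsub>D.TT\<^esub> ?h (q i j) = (\<Oplus>\<^bsub>D.TT\<^esub>r'\<in>{..<n}. p k r \<otimes>\<^bsub>D.TT\<^esub> ?e r')"
      unfolding hg using e k r by (intro D.WW.T.finsum_mult_left) auto
    also have "\<dots> = p k r \<otimes>\<^bsub>D.TT\<^esub> ?e r"
      using e er(2) k r Ec[OF r q_closed[OF g(2,3)]] by (intro D.WW.T.finsum_single[where f = "\<lambda>r'. p k r \<otimes>\<^bsub>D.TT\<^esub> ?e r'"]) auto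
    finally show "p k r \<otimes>\<^bsub>D.TT\<^esub> ?h (gen g) = p k r \<otimes>\<^bsub>D.TT\<^esub> E k r (gen g)"
      using er(2)[OF r] unfolding g(1) q_gen by simp
  qed
  have "?h a = ?h a \<otimes>\<^bsub>D.TT\<^esub> (\<Oplus>\<^bsub>D.TT\<^esub>r\<in>{..<n}. p k r)"
    using p_sum[OF k] star_homD(2)[OF h a] by simp
  also have "\<dots> = (\<Oplus>\<^bsub>D.TT\<^esub>r\<in>{..<n}. ?h a \<otimes>\<^bsub>D.TT\<^esub> p k r)"
    using k star_homD(2)[OF h a] by (intro D.WW.T.finsum_mult_left) auto
  also have "\<dots> = (\<Oplus>\<^bsub>D.TT\<^esub>r\<in>{..<n}. E k r a \<otimes>\<^bsub>D.TT\<^esub> p k r)"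
    using k a Ec by (intro D.WW.T.finsum_eq) (auto simp: corner simp del: compose_def)
  finally show ?thesis using a by (simp add: compose_def)
qed

lemma comult_wreath: "comult (free_wreath (quantum_aut G1 G2 \<theta>) n) = \<Delta>'"
proof (rule D.comult_free_wreath[OF _ Delta_star_hom Delta_x])
  show "cqg_alg (quantum_aut G1 G2 \<theta>) = W" by (simp only: quantum_aut_magic alg)
  show "\<Delta>' (D.\<nu> k a) = (\<Oplus>\<^bsub>D.TT\<^esub>l\<in>{..<n}. tensor_map W W D.W D.W (D.\<nu> k) (D.\<nu> l) (\<Delta> a) \<otimes>\<^bsub>D.TT\<^esub> t (D.x k l) \<one>\<^bsub>D.W\<^esub>)"
    if "k < n" "a \<in> carrier W" for k a
    using Delta_nu[OF that] E_eq[OF that(2)] by (simp add: p_def)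
qed

lemma isomorphic: "cqg_isomorphic (quantum_aut (copies n G1) (copies n G2) (theta_copies \<theta>)) (free_wreath (quantum_aut G1 G2 \<theta>) n)"
proof -
  have G: "cqg_alg (quantum_aut G1 G2 \<theta>) = W" by (simp only: quantum_aut_magic alg)
  have C: "cqg_alg (quantum_aut (copies n G1) (copies n G2) (theta_copies \<theta>)) = C.W" by (simp only: C.quantum_aut_magic C.alg)
  show ?thesis
    unfolding cqg_isomorphic_def Let_def C D.alg_free_wreath[OF G] comult_wreath
  proof (rule bexI[OF _ phi], intro conjI ballI bij_phi)
    fix a assume a: "a \<in> carrier C.W"
    have "C.\<Delta> a \<in> carrier C.TT" using star_homD(2)[OF C.comult_aut(1) a] .
    then show "\<Delta>' (\<phi> a) = tensor_map C.W C.W D.W D.W \<phi> \<phi> (C.\<Delta> a)"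
      using Delta_phi[OF a] by (simp add: \<phi>\<phi>_def)
  qed
qed

end

lemma (in wreath_triple) isomorphic:
  "cqg_isomorphic (quantum_aut (copies n G1) (copies n G2) (theta_copies \<theta>)) (free_wreath (quantum_aut G1 G2 \<theta>) n)"
proof -
  obtain \<phi> where phi: "\<phi> \<in> star_hom C.W D.W"
    "\<forall>k<n. \<forall>l<n. \<forall>i\<in>V. \<forall>j\<in>V. \<phi> (C.q (k, i) (l, j)) = D.\<nu> k (q i j) \<otimes>\<^bsub>D.W\<^esub> D.x k l"
    using ex_phi by (elim bexE)
  obtain \<psi> where psi: "\<psi> \<in> star_hom D.W C.W"
    "(\<forall>k<n. \<forall>i\<in>V. \<forall>j\<in>V. \<psi> (D.\<nu> k (q i j)) = K.nu k i j) \<and> (\<forall>k<n. \<forall>l<n. \<psi> (D.x k l) = K.X k l)"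
    using ex_psi by (elim bexE)
  show ?thesis
    by (rule wreath_maps.isomorphic[OF wreath_maps.intro[OF wreath_triple_axioms wreath_maps_axioms.intro[OF phi(1) _ psi(1)]]])
      (use phi(2) psi(2) in simp_all)
qed

theorem theorem5p12:
  fixes G1 :: "('v, 'e) pre_digraph" and G2 :: "('v, 'f) pre_digraph"
    and \<theta> :: "'e \<times> 'f \<Rightarrow> 'f \<times> 'e" and n :: nat
  assumes "graph_triple G1 G2 \<theta>"
    and "Digraph_Component.connected G1"
    and "Digraph_Component.connected G2"
    and "1 \<le> n"
  shows "cqg_isomorphic
    (quantum_aut (copies n G1) (copies n G2) (theta_copies \<theta>))
    (free_wreath (quantum_aut G1 G2 \<theta>) n)"
proof -
  interpret G: graph_triple G1 G2 \<theta> by fact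
  have core: "triple_core G1 G2 \<theta>"
    by unfold_locales (use G.same_verts G.theta_bij in auto)
  have sym: "symmetric G1" by (rule G.G1.sym_arcs)
  have "strongly_connected (with_proj (mk_symmetric G1))"
    using assms(2) by (simp add: connected_def)
  then have ne: "verts G1 \<noteq> {}" and sc: "\<And>u v. \<lbrakk>u \<in> verts G1; v \<in> verts G1\<rbrakk> \<Longrightarrow> u \<rightarrow>\<^sup>*\<^bsub>mk_symmetric G1\<^esub> v"
    unfolding strongly_connected_def by auto
  \<comment> \<open>Connectedness speaks of the symmetrised digraph; since every edge has a reverse,
    reachability there is reachability along the edges of \<open>G1\<close> itself.\<close>
  have conn: "(v, w) \<in> (arcs_ends G1)\<^sup>*" if "v \<in> verts G1" "w \<in> verts G1" for v w
    using sc[OF that] G.G1.reachable_mk_symmetric_eq[OF sym] by (auto intro: reachable_rtranclI)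
  interpret wreath_triple G1 G2 \<theta> n
    by (rule wreath_triple.intro[OF core]) (unfold_locales, use conn ne in auto)
  show ?thesis by (rule isomorphic)
qed

end
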